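(* Let $d=2$, let $p_0(e)=\frac14$ for all $e\in V$ be the jump probabilities of the simple symmetric random walk on $\mathbb Z^2$, and let $\eta>0$. Put $z_0=(0,0)$ and $z_1=(0,1)$. Then there are an $\epsilon_0>0$ and a constant $c_2'=c_2'(\eta)$, depending only on $\eta$, such that whenever $0<\epsilon\le\epsilon_0$ and $\mathbb P$ is an i.i.d. law on $\Omega$ satisfying the local drift condition (LD) with bound $\epsilon$, namely $$\mathbb P(\Omega_{p_0,\epsilon})=1\quad\text{and}\quad\mathbb E[d(0,\omega)]\cdot e_1\ge\epsilon,$$ the Radon–Nikodym derivative of the restriction $\mathbb Q_{z_0,z_1}$ to $\{z_0,z_1\}$ of the limiting invariant measure $\mathbb Q$ of the environmental process with respect to the restriction $\mathbb P_{z_0,z_1}$ of $\mathbb P$ to $\{z_0,z_1\}$ admits $\mathbb P$-a.s. the expansion $$\frac{d\mathbb Q_{z_0,z_1}}{d\mathbb P_{z_0,z_1}}=1-\frac4\pi\bigl(\bar\xi(z_1,e_1)+\bar\xi(z_1,-e_1)\bigr)\epsilon+\Bigl(\frac8\pi-4\Bigr)\bar\xi(z_1,e_2)\,\epsilon+O(\epsilon^{2-\eta}).$$ In particular, $\mathbb P$-a.s., the restrictions to the single sites $z_0$ and $z_1$ satisfy $$\frac{d\mathbb Q_{z_0}}{d\mathbb P_{z_0}}=1+O(\epsilon^{2-\eta}),\qquad \frac{d\mathbb Q_{z_1}}{d\mathbb P_{z_1}}=1-\frac4\pi\bigl(\bar\xi(z_1,e_1)+\bar\xi(z_1,-e_1)\bigr)\epsilon+\Bigl(\frac8\pi-4\Bigr)\bar\xi(z_1,e_2)\,\epsilon+O(\epsilon^{2-\eta}).$$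 In all these expansions $|O(\epsilon^{2-\eta})|\le c_2'\epsilon^{2-\eta}$.
   Context: Here $V=\{e\in\mathbb Z^2:|e|_1=1\}=\{\pm e_1,\pm e_2\}$ with $e_1=(1,0)$, $e_2=(0,1)$. $\mathcal P$ is the set of probability vectors $p=\{p(e):e\in V\}$. $\Omega=\mathcal P^{\mathbb Z^2}$ with its Borel $\sigma$-algebra; its elements $\omega=\{\omega(x):x\in\mathbb Z^2\}$, $\omega(x)=\{\omega(x,e):e\in V\}\in\mathcal P$, are called environments. The random walk in environment $\omega$ is the Markov chain $(X_n)_{n\ge0}$ on $\mathbb Z^2$ jumping from $x$ to $x+e$ with probability $\omega(x,e)$; $P_{x,\omega}$ is its law starting from $x$, and $P_x=\int P_{x,\omega}\,d\mathbb P$ is the averaged law, where $\mathbb P$ is a probability measure on $\Omega$ with expectation $\mathbb E$. "I.i.d. law" means $\{\omega(x):x\in\mathbb Z^2\}$ are i.i.d. under $\mathbb P$. For $\epsilon>0$, $\Omega_{p_0,\epsilon}=\{\omega\in\Omega:|\omega(x,e)-p_0(e)|\le\epsilon\text{ for all }x\in\mathbb Z^2,e\in V\}$. The local drift is $d(x,\omega)=\sum_{e\in V}\omega(x,e)e$. Set $\xi(x,e)=\epsilon^{-1}(\omega(x,e)-p_0(e))$ and $\bar\xi(x,e)=\xi(x,e)-\mathbb E[\xi(x,e)]$. Shifts: $\theta_x\omega(y)=\omega(x+y)$. The environmental process is $\bar\omega_n=\theta_{X_n}\omega$, $n\ge0$ (with $X_0=0$). Under (LD), the law of $\bar\omega_n$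 under $P_0$ converges in distribution as $n\to\infty$ to an invariant measure $\mathbb Q$ of the environmental process, called the limiting invariant measure. For a measure $\mu$ on $\Omega$ and $B\subset\mathbb Z^2$, the restriction of $\mu$ to $B$ is the marginal law of $\mu$ on $\mathcal P^B$. *)

theory Defs
  imports "HOL-Probability.Probability"
begin

type_synonym site = "int \<times> int"

text \<open>A vector indexed by the steps is a function on all of \<open>\<int>\<^sup>2\<close> that vanishes off the step set.
  The function types carry the product topology, so \<open>\<Omega>\<close> below has the product topology as a
  subspace.\<close>

type_synonym env = "site \<Rightarrow> site \<Rightarrow> real"

definition steps :: "site set" where
  "steps = {e. \<bar>fst e\<bar> + \<bar>snd e\<bar> = 1}"

abbreviation e\<^sub>1 :: site where "e\<^sub>1 \<equiv> (1, 0)"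
abbreviation e\<^sub>2 :: site where "e\<^sub>2 \<equiv> (0, 1)"

definition prob_vectors :: "(site \<Rightarrow> real) set" where
  "prob_vectors = {p. (\<forall>e. 0 \<le> p e) \<and> (\<forall>e. e \<notin> steps \<longrightarrow> p e = 0) \<and> (\<Sum>e\<in>steps. p e) = 1}"

definition srw :: "site \<Rightarrow> real" where
  "srw e = (if e \<in> steps then 1 / 4 else 0)"

definition environments :: "env set" where
  "environments = {\<omega>. \<forall>x. \<omega> x \<in> prob_vectors}"

definition P_space :: "(site \<Rightarrow> real) measure" where
  "P_space = restrict_space borel prob_vectors"

definition Omega :: "env measure" where
  "Omega = restrict_space borel environments"

definition environments_near :: "(site \<Rightarrow> real) \<Rightarrow> real \<Rightarrow> env set" where
  "environments_near p0 \<epsilon> = {\<omega> \<in> environments. \<forall>x. \<forall>e\<in>steps. \<bar>\<omega> x e - p0 e\<bar> \<le> \<epsilon>}"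

definition iid_law :: "env measure \<Rightarrow> bool" where
  "iid_law P \<longleftrightarrow> prob_space P \<and> sets P = sets Omega \<and>
     prob_space.indep_vars P (\<lambda>_. P_space) (\<lambda>x \<omega>. \<omega> x) UNIV \<and>
     (\<forall>x y. distr P P_space (\<lambda>\<omega>. \<omega> x) = distr P P_space (\<lambda>\<omega>. \<omega> y))"


definition to_plane :: "site \<Rightarrow> real \<times> real" where
  "to_plane x = (real_of_int (fst x), real_of_int (snd x))"

definition local_drift :: "site \<Rightarrow> env \<Rightarrow> real \<times> real" where
  "local_drift x \<omega> = (\<Sum>e\<in>steps. \<omega> x e *\<^sub>R to_plane e)"

definition LD :: "(site \<Rightarrow> real) \<Rightarrow> real \<Rightarrow> env measure \<Rightarrow> bool" where
  "LD p0 \<epsilon> P \<longleftrightarrow> measure P (environments_near p0 \<epsilon>) = 1 \<and>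
     (LINT \<omega>|P. local_drift 0 \<omega>) \<bullet> to_plane e\<^sub>1 \<ge> \<epsilon>"

definition xi :: "(site \<Rightarrow> real) \<Rightarrow> real \<Rightarrow> env \<Rightarrow> site \<Rightarrow> site \<Rightarrow> real" where
  "xi p0 \<epsilon> \<omega> x e = (\<omega> x e - p0 e) / \<epsilon>"

definition xi_bar :: "(site \<Rightarrow> real) \<Rightarrow> real \<Rightarrow> env measure \<Rightarrow> env \<Rightarrow> site \<Rightarrow> site \<Rightarrow> real" where
  "xi_bar p0 \<epsilon> P \<omega> x e = xi p0 \<epsilon> \<omega> x e - (LINT \<omega>'|P. xi p0 \<epsilon> \<omega>' x e)"


definition paths :: "(nat \<Rightarrow> site) measure" where
  "paths = (\<Pi>\<^sub>M n\<in>UNIV. count_space UNIV)"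

definition jump :: "env \<Rightarrow> site \<Rightarrow> site measure" where
  "jump \<omega> x = density (count_space UNIV) (\<lambda>y. ennreal (\<omega> x (y - x)))"

text \<open>The law of the position at time \<open>n\<close> given the path before time \<open>n\<close>.\<close>

definition walk_kernel :: "env \<Rightarrow> site \<Rightarrow> nat \<Rightarrow> (nat \<Rightarrow> site) \<Rightarrow> site measure" where
  "walk_kernel \<omega> x n X = (if n = 0 then return (count_space UNIV) x else jump \<omega> (X (n - 1)))"

text \<open>\<open>P\<^bsub>x,\<omega>\<^esub>\<close> is the law on path space given by the Ionescu-Tulcea theorem.\<close>

definition quenched_law :: "env \<Rightarrow> site \<Rightarrow> (nat \<Rightarrow> site) measure" where
  "quenched_law \<omega> x = projective_family.lim UNIV
     (Ionescu_Tulcea.CI (walk_kernel \<omega> x) (\<lambda>_. count_space UNIV)) (\<lambda>_. count_space UNIV)"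

text \<open>The averaged law is kept as a joint law of the environment and the path, because the
  environmental process is a function of both.\<close>

definition averaged_law :: "env measure \<Rightarrow> site \<Rightarrow> (env \<times> (nat \<Rightarrow> site)) measure" where
  "averaged_law P x =
     P \<bind> (\<lambda>\<omega>. distr (quenched_law \<omega> x) (Omega \<Otimes>\<^sub>M paths) (\<lambda>X. (\<omega>, X)))"

definition env_shift :: "site \<Rightarrow> env \<Rightarrow> env" where
  "env_shift x \<omega> = (\<lambda>y. \<omega> (x + y))"

definition env_process :: "nat \<Rightarrow> env \<times> (nat \<Rightarrow> site) \<Rightarrow> env" where
  "env_process n = (\<lambda>(\<omega>, X). env_shift (X n) \<omega>)"

definition env_process_law :: "env measure \<Rightarrow> nat \<Rightarrow> env measure" where
  "env_process_law P n = distr (averaged_law P 0) Omega (env_process n)"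

definition invariant_measure :: "env measure \<Rightarrow> bool" where
  "invariant_measure Q \<longleftrightarrow> prob_space Q \<and> sets Q = sets Omega \<and> env_process_law Q 1 = Q"

text \<open>The library's weak convergence is for measures on the reals only.\<close>

definition converges_in_distribution :: "(nat \<Rightarrow> env measure) \<Rightarrow> env measure \<Rightarrow> bool" where
  "converges_in_distribution \<mu> \<nu> \<longleftrightarrow>
     (\<forall>f :: env \<Rightarrow> real. continuous_on environments f \<and> bounded (f ` environments) \<longrightarrow>
        (\<lambda>n. LINT \<omega>|\<mu> n. f \<omega>) \<longlonglongrightarrow> (LINT \<omega>|\<nu>. f \<omega>))"

definition limiting_invariant_measure :: "env measure \<Rightarrow> env measure \<Rightarrow> bool" where
  "limiting_invariant_measure P Q \<longleftrightarrow>
     invariant_measure Q \<and> converges_in_distribution (env_process_law P) Q"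

definition marginal :: "site set \<Rightarrow> env measure \<Rightarrow> env measure" where
  "marginal B \<mu> = distr \<mu> (\<Pi>\<^sub>M x\<in>B. P_space) (\<lambda>\<omega>. restrict \<omega> B)"

text \<open>\<^const>\<open>RN_deriv\<close> is the Radon-Nikodym derivative only when the second marginal is
  absolutely continuous with respect to the first, so this has to be stated alongside. The density
  is evaluated at the restriction of the environment.\<close>

definition marginal_density :: "site set \<Rightarrow> env measure \<Rightarrow> env measure \<Rightarrow> env \<Rightarrow> real" where
  "marginal_density B P Q \<omega> =
     enn2real (RN_deriv (marginal B P) (marginal B Q) (restrict \<omega> B))"


subsection \<open>Well-definedness of the walk\<close>

lemma steps_eq: "steps = {e\<^sub>1, - e\<^sub>1, e\<^sub>2, - e\<^sub>2}"
  by (auto simp: steps_def)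

lemma finite_steps: "finite steps"
  by (simp add: steps_eq)

lemma prob_space_jump:
  assumes "\<omega> \<in> environments"
  shows "prob_space (jump \<omega> x)"
proof
  have p: "0 \<le> \<omega> x e" "e \<notin> steps \<Longrightarrow> \<omega> x e = 0" "(\<Sum>e\<in>steps. \<omega> x e) = 1" for e
    using assms unfolding environments_def prob_vectors_def by blast+
  have "emeasure (jump \<omega> x) (space (jump \<omega> x)) =
      (\<integral>\<^sup>+y. ennreal (\<omega> x (y - x)) \<partial>count_space UNIV)"
    by (simp add: jump_def emeasure_density)
  also have "\<dots> = (\<integral>\<^sup>+e. ennreal (\<omega> x e) \<partial>count_space UNIV)"
    by (rule nn_integral_bij_count_space)
       (auto intro!: bij_betw_byWitness[where f' = "\<lambda>e. e + x"])
  also have "\<dots> = (\<Sum>e\<in>steps. ennreal (\<omega> x e))"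
    using p by (intro nn_integral_count_space') (auto simp: finite_steps)
  also have "\<dots> = 1"
    using p by (simp add: sum_ennreal)
  finally show "emeasure (jump \<omega> x) (space (jump \<omega> x)) = 1" .
qed

lemma Ionescu_Tulcea_walk_kernel:
  assumes "\<omega> \<in> environments"
  shows "Ionescu_Tulcea (walk_kernel \<omega> x) (\<lambda>_. count_space UNIV)"
proof (rule Ionescu_Tulcea.intro)
  have J: "jump \<omega> y \<in> space (subprob_algebra (count_space UNIV))" for y
    using prob_space_jump[OF assms]
    by (auto simp: space_subprob_algebra jump_def prob_space_imp_subprob_space)
  show "walk_kernel \<omega> x i \<in> PiM {0..<i} (\<lambda>_. count_space UNIV) \<rightarrow>\<^sub>M subprob_algebra (count_space UNIV)"
    for i
  proof (cases i)
    case 0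
    then show ?thesis
      by (simp add: walk_kernel_def[abs_def] space_subprob_algebra
          prob_space_imp_subprob_space prob_space_return)
  next
    case (Suc n)
    have "(\<lambda>X. X n) \<in> PiM {0..<Suc n} (\<lambda>_. count_space UNIV) \<rightarrow>\<^sub>M (count_space UNIV :: site measure)"
      by (rule measurable_component_singleton) simp
    moreover have "jump \<omega> \<in> count_space UNIV \<rightarrow>\<^sub>M subprob_algebra (count_space UNIV)"
      using J by simp
    ultimately have "(\<lambda>X. jump \<omega> (X n)) \<in> PiM {0..<Suc n} (\<lambda>_. count_space UNIV) \<rightarrow>\<^sub>M
        subprob_algebra (count_space UNIV)"
      by (rule measurable_compose)
    then show ?thesis using Suc by (simp add: walk_kernel_def[abs_def])
  qed
  show "\<And>i X. X \<in> space (PiM {0..<i} (\<lambda>_. count_space UNIV)) \<Longrightarrow> prob_space (walk_kernel \<omega> x i X)"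
    using prob_space_jump[OF assms] by (simp add: walk_kernel_def prob_space_return)
qed

lemma prob_space_quenched_law:
  assumes "\<omega> \<in> environments"
  shows "prob_space (quenched_law \<omega> x)"
proof -
  interpret Ionescu_Tulcea "walk_kernel \<omega> x" "\<lambda>_. count_space UNIV"
    by (rule Ionescu_Tulcea_walk_kernel) fact
  have "distr PF.lim (PiM {} (\<lambda>_. count_space UNIV)) (\<lambda>x. restrict x {}) = CI {}"
    by (rule distr_lim) simp
  moreover have "prob_space (CI {})" by (rule PF.prob_space_P) simp_all
  moreover have "(\<lambda>x. restrict x {}) \<in> PF.lim \<rightarrow>\<^sub>M PiM {} (\<lambda>_. count_space UNIV)"
    by (simp add: measurable_cong_sets[OF PF.sets_lim refl])
  ultimately have "prob_space PF.lim"
    by (metis prob_space_distrD)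
  then show ?thesis by (simp add: quenched_law_def)
qed

lemma sets_quenched_law: 
  assumes "\<omega> \<in> environments"
  shows "sets (quenched_law \<omega> x) = sets paths"
proof -
  interpret Ionescu_Tulcea "walk_kernel \<omega> x" "\<lambda>_. count_space UNIV"
    by (rule Ionescu_Tulcea_walk_kernel) fact
  show ?thesis by (simp add: quenched_law_def paths_def PF.sets_lim)
qed

lemma space_paths [simp]: "space paths = UNIV"
  by (simp add: paths_def space_PiM)

lemma cylinder_sets: "{X. \<forall>i<n. X i = s i} \<in> sets paths"
proof -
  have "{X \<in> space paths. \<forall>i\<in>{..<n}. X i = s i} \<in> sets paths"
    unfolding paths_def by measurable
  then show ?thesis by (simp add: Ball_def)
qed

lemma quenched_law_cylinder:
  assumes \<omega>: "\<omega> \<in> environments"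
  shows "emeasure (quenched_law \<omega> x) {X. \<forall>i<Suc n. X i = s i} =
    (if s 0 = x then (\<Prod>i<n. ennreal (\<omega> (s i) (s (Suc i) - s i))) else 0)"
proof -
  let ?M = "\<lambda>_::nat. count_space UNIV :: site measure"
  interpret Ionescu_Tulcea "walk_kernel \<omega> x" ?M
    by (rule Ionescu_Tulcea_walk_kernel) fact
  define r where "r n = restrict s {0..<n}" for n
  have r_sets: "{r n} \<in> sets (PiM {0..<n} ?M)" for n
  proof -
    have "r n \<in> extensional {0..<n}" by (simp add: r_def)
    then have "{r n} = (\<Pi>\<^sub>E i\<in>{0..<n}. {s i})"
      using PiE_singleton[of "r n" "{0..<n}"] PiE_cong[of "{0..<n}" "\<lambda>i. {r n i}" "\<lambda>i. {s i}"]
      by (simp add: r_def)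
    then show ?thesis by (simp add: sets_PiM_I_finite)
  qed
  have step: "emeasure (C 0 (Suc m) (\<lambda>_. undefined)) {r (Suc m)} =
      emeasure (C 0 m (\<lambda>_. undefined)) {r m} * emeasure (walk_kernel \<omega> x m (r m)) {s m}" for m
  proof -
    have sp: "space (C 0 m (\<lambda>_. undefined)) = space (PiM {0..<m} ?M)"
      using space_C[of "\<lambda>_. undefined" 0 m] by (simp add: space_PiM)
    have "emeasure (C 0 (Suc m) (\<lambda>_. undefined)) {r (Suc m)} =
        (\<integral>\<^sup>+Y. emeasure (eP m Y) {r (Suc m)} \<partial>C 0 m (\<lambda>_. undefined))"
      using r_sets[of "Suc m"] sp
      by (simp, subst emeasure_bind[where N = "PiM {0..<Suc m} ?M"])
         (auto simp: space_PiM measurable_cong_sets[OF sets_C refl])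
    also have "\<dots> = (\<integral>\<^sup>+Y. emeasure (walk_kernel \<omega> x m (r m)) {s m} * indicator {r m} Y
        \<partial>C 0 m (\<lambda>_. undefined))"
    proof (rule nn_integral_cong)
      fix Y assume "Y \<in> space (C 0 m (\<lambda>_. undefined))"
      then have Y: "Y \<in> space (PiM {0..<m} ?M)" using sp by simp
      have eq: "Y(m := y) = r (Suc m) \<longleftrightarrow> Y = r m \<and> y = s m" for y
      proof
        assume a: "Y(m := y) = r (Suc m)"
        have "Y i = r m i" for i
          using fun_cong[OF a, of i] Y
          by (cases "i < m"; cases "i = m") (auto simp: r_def space_PiM PiE_def extensional_def)
        then show "Y = r m \<and> y = s m" using fun_cong[OF a, of m] by (auto simp: r_def)
      next
        assume "Y = r m \<and> y = s m"
        then show "Y(m := y) = r (Suc m)" by (auto simp: r_def fun_eq_iff)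
      qed
      have "emeasure (eP m Y) {r (Suc m)} =
          emeasure (walk_kernel \<omega> x m Y) ((\<lambda>y. Y(m := y)) -` {r (Suc m)} \<inter> UNIV)"
        using emeasure_eP[OF Y r_sets] by simp
      also have "(\<lambda>y. Y(m := y)) -` {r (Suc m)} \<inter> UNIV = (if Y = r m then {s m} else {})"
        using eq by (simp add: vimage_def)
      finally show "emeasure (eP m Y) {r (Suc m)} =
          emeasure (walk_kernel \<omega> x m (r m)) {s m} * indicator {r m} Y"
        by (auto split: split_indicator)
    qed
    also have "\<dots> = emeasure (C 0 m (\<lambda>_. undefined)) {r m} * emeasure (walk_kernel \<omega> x m (r m)) {s m}"
      using r_sets[of m] sets_C[of "\<lambda>_. undefined" 0 m]
      by (subst nn_integral_cmult_indicator) (auto simp: space_PiM mult.commute)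
    finally show ?thesis .
  qed
  have "emeasure (C 0 (Suc n) (\<lambda>_. undefined)) {r (Suc n)} =
      (if s 0 = x then (\<Prod>i<n. ennreal (\<omega> (s i) (s (Suc i) - s i))) else 0)"
  proof (induction n)
    case 0
    have "r 0 = (\<lambda>_. undefined)" by (auto simp: r_def)
    then have "emeasure (C 0 0 (\<lambda>_. undefined)) {r 0} = 1"
      using r_sets[of 0] by (simp add: emeasure_return)
    then show ?case
      unfolding step[of 0] by (simp add: walk_kernel_def indicator_def del: C.simps)
  next
    case (Suc n)
    have "emeasure (walk_kernel \<omega> x (Suc n) (r (Suc n))) {s (Suc n)} =
        ennreal (\<omega> (s n) (s (Suc n) - s n))"
      by (simp add: walk_kernel_def jump_def emeasure_density r_def nn_integral_indicator_singleton)
    then show ?case unfolding step[of "Suc n"] using Suc by (simp del: C.simps)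
  qed
  moreover have "emeasure (quenched_law \<omega> x) {X. \<forall>i<Suc n. X i = s i} =
      emeasure (C 0 (Suc n) (\<lambda>_. undefined)) {r (Suc n)}"
  proof -
    have "(\<forall>i<Suc n. X i = s i) \<longleftrightarrow> restrict X {0..<Suc n} = restrict s {0..<Suc n}" for X
      by (metis (no_types, lifting) atLeastLessThan_iff restrict_apply' restrict_ext zero_le)
    then have "{X. \<forall>i<Suc n. X i = s i} = PF.emb UNIV {0..<Suc n} {r (Suc n)}"
      by (simp add: prod_emb_def r_def vimage_def)
    then have "emeasure (quenched_law \<omega> x) {X. \<forall>i<Suc n. X i = s i} =
        emeasure (CI {0..<Suc n}) {r (Suc n)}"
      using lim[OF _ r_sets] by (simp add: quenched_law_def)
    also have "\<dots> = emeasure (C 0 (Suc n) (\<lambda>_. undefined)) {r (Suc n)}"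
      using emeasure_CI[OF subset_refl r_sets]
      by (subst emeasure_CI[OF subset_refl r_sets]) (auto simp: prod_emb_def space_PiM r_def
        intro!: arg_cong[where f = "emeasure _"])
    finally show ?thesis .
  qed
  ultimately show ?thesis by simp
qed

lemma measurable_coord: "(\<lambda>\<omega>. \<omega> x e) \<in> borel_measurable Omega"
proof -
  have "continuous_on UNIV (\<lambda>\<omega>::env. \<omega> x)" by (rule continuous_on_product_coordinates)
  moreover have "continuous_on UNIV (\<lambda>p::site \<Rightarrow> real. p e)" by (rule continuous_on_product_coordinates)
  ultimately have "continuous_on UNIV (\<lambda>\<omega>::env. \<omega> x e)"
    using continuous_on_compose2[of UNIV "\<lambda>p::site \<Rightarrow> real. p e" UNIV "\<lambda>\<omega>::env. \<omega> x"] by simp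
  then show ?thesis
    unfolding Omega_def by (intro measurable_restrict_space1 borel_measurable_continuous_onI)
qed

lemma measurable_quenched_law:
  "(\<lambda>\<omega>. quenched_law \<omega> x) \<in> Omega \<rightarrow>\<^sub>M prob_algebra paths"
proof -
  have sp: "space Omega = environments" by (simp add: Omega_def space_restrict_space)
  define cyl :: "site list \<Rightarrow> (nat \<Rightarrow> site) set" where
    "cyl l = {X. \<forall>i<length l. X i = l ! i}" for l
  have cyl_sets: "cyl l \<in> sets paths" for l
    unfolding cyl_def by (rule cylinder_sets)
  have cyl_meas: "(\<lambda>\<omega>. emeasure (quenched_law \<omega> x) (cyl l)) \<in> borel_measurable Omega" for l
  proof (cases "length l")
    case 0
    then have "emeasure (quenched_law \<omega> x) (cyl l) = 1" if "\<omega> \<in> space Omega" for \<omega>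
      using prob_space.emeasure_space_1[OF prob_space_quenched_law]
        sets_eq_imp_space_eq[OF sets_quenched_law] that
      by (simp add: cyl_def sp)
    then show ?thesis by (simp cong: measurable_cong)
  next
    case (Suc n)
    have "emeasure (quenched_law \<omega> x) (cyl l) =
        (if l ! 0 = x then (\<Prod>i<n. ennreal (\<omega> (l ! i) (l ! Suc i - l ! i))) else 0)"
      if "\<omega> \<in> space Omega" for \<omega>
      using quenched_law_cylinder[of \<omega> x n "\<lambda>i. l ! i"] that by (simp add: cyl_def Suc sp)
    moreover have "(\<lambda>\<omega>. if l ! 0 = x then (\<Prod>i<n. ennreal (\<omega> (l ! i) (l ! Suc i - l ! i))) else 0)
        \<in> borel_measurable Omega"
      by (cases "l ! 0 = x")
         (auto intro!: borel_measurable_prod_ennreal measurable_compose[OF measurable_coord measurable_ennreal])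
    ultimately show ?thesis by (simp cong: measurable_cong)
  qed
  let ?G = "prod_algebra UNIV (\<lambda>_::nat. count_space UNIV :: site measure)"
  show ?thesis
  proof (rule measurable_prob_algebra_generated)
    show "sets paths = sigma_sets UNIV ?G"
      by (simp add: paths_def sets_PiM)
    show "Int_stable ?G" by (rule Int_stable_prod_algebra)
    show "?G \<subseteq> Pow UNIV" by simp
    show "prob_space (quenched_law \<omega> x)" if "\<omega> \<in> space Omega" for \<omega>
      using that by (simp add: sp prob_space_quenched_law)
    show "sets (quenched_law \<omega> x) = sets paths" if "\<omega> \<in> space Omega" for \<omega>
      using that by (simp add: sp sets_quenched_law)
    fix A assume "A \<in> ?G"
    then obtain J E where A: "A = prod_emb UNIV (\<lambda>_. count_space UNIV) J (\<Pi>\<^sub>E j\<in>J. E j)"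
      and J: "finite J"
      by (auto elim!: prod_algebraE)
    obtain n where n: "J \<subseteq> {..<n}" using J finite_nat_iff_bounded by auto
    define T where "T = (\<lambda>X. map X [0..<n]) ` A"
    have A_iff: "X \<in> A \<longleftrightarrow> (\<forall>j\<in>J. X j \<in> E j)" for X
      by (auto simp: A prod_emb_def)
    have "A = (\<Union>l\<in>T. cyl l)"
    proof (intro set_eqI iffI)
      fix X assume "X \<in> A"
      then show "X \<in> (\<Union>l\<in>T. cyl l)"
        by (intro UN_I[of "map X [0..<n]"]) (auto simp: T_def cyl_def)
    next
      fix X assume "X \<in> (\<Union>l\<in>T. cyl l)"
      then obtain Y where Y: "Y \<in> A" "\<forall>i<n. X i = Y i"
        by (auto simp: T_def cyl_def)
      have "X j \<in> E j" if "j \<in> J" for j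
        using Y n that by (auto simp: A_iff subset_iff)
      then show "X \<in> A" by (simp add: A_iff)
    qed
    moreover have "disjoint_family_on cyl T"
      unfolding disjoint_family_on_def
    proof (intro ballI impI)
      fix l l' assume "l \<in> T" "l' \<in> T" "l \<noteq> l'"
      then have len: "length l = n" "length l' = n" by (auto simp: T_def)
      then obtain i where "i < n" "l ! i \<noteq> l' ! i"
        using nth_equalityI[of l l'] \<open>l \<noteq> l'\<close> by metis
      then show "cyl l \<inter> cyl l' = {}"
        using len by (force simp: cyl_def)
    qed
    ultimately have "emeasure (quenched_law \<omega> x) A =
        (\<integral>\<^sup>+l. emeasure (quenched_law \<omega> x) (cyl l) \<partial>count_space T)" if "\<omega> \<in> space Omega" for \<omega>
      using emeasure_UN_countable[of T cyl "quenched_law \<omega> x"] cyl_sets sets_quenched_law that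
      by (simp add: sp image_subset_iff)
    moreover have "(\<lambda>\<omega>. \<integral>\<^sup>+l. emeasure (quenched_law \<omega> x) (cyl l) \<partial>count_space T) \<in> borel_measurable Omega"
    proof -
      interpret sigma_finite_measure "count_space T"
        by (rule sigma_finite_measure_count_space_countable) simp
      have "(\<lambda>(l, \<omega>). emeasure (quenched_law \<omega> x) (cyl l)) \<in> borel_measurable (count_space T \<Otimes>\<^sub>M Omega)"
        by (rule measurable_pair_measure_countable1) (simp_all add: cyl_meas)
      from measurable_pair_swap[OF this] show ?thesis
        by (intro borel_measurable_nn_integral) (simp add: case_prod_beta)
    qed
    ultimately show "(\<lambda>\<omega>. emeasure (quenched_law \<omega> x) A) \<in> borel_measurable Omega"
      by (simp cong: measurable_cong)
  qed
qed

lemma measurable_env_shift: "env_shift x \<in> Omega \<rightarrow>\<^sub>M Omega"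
proof -
  have "continuous_on UNIV (env_shift x)"
    unfolding env_shift_def
    by (rule continuous_on_coordinatewise_then_product) (rule continuous_on_product_coordinates)
  then have "env_shift x \<in> Omega \<rightarrow>\<^sub>M borel"
    unfolding Omega_def by (intro measurable_restrict_space1 borel_measurable_continuous_onI)
  moreover have "env_shift x \<omega> \<in> environments" if "\<omega> \<in> environments" for \<omega>
    using that unfolding environments_def env_shift_def by blast
  ultimately show ?thesis
    by (auto simp: Omega_def space_restrict_space intro!: measurable_restrict_space2)
qed

lemma measurable_env_process: "env_process n \<in> Omega \<Otimes>\<^sub>M paths \<rightarrow>\<^sub>M Omega"
proof -
  have "(\<lambda>z. (\<lambda>x. env_shift x (fst z)) (snd z n)) \<in> Omega \<Otimes>\<^sub>M paths \<rightarrow>\<^sub>M Omega"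
  proof (rule measurable_compose_countable)
    show "(\<lambda>z. env_shift x (fst z)) \<in> Omega \<Otimes>\<^sub>M paths \<rightarrow>\<^sub>M Omega" for x
      by (rule measurable_compose[OF measurable_fst measurable_env_shift])
    have "(\<lambda>X. X n) \<in> paths \<rightarrow>\<^sub>M count_space UNIV"
      unfolding paths_def by (rule measurable_component_singleton) simp
    then show "(\<lambda>z. snd z n) \<in> Omega \<Otimes>\<^sub>M paths \<rightarrow>\<^sub>M count_space UNIV"
      by (rule measurable_compose[OF measurable_snd])
  qed
  then show ?thesis by (simp add: env_process_def case_prod_beta)
qed

lemma emeasure_env_process_law:
  assumes P: "prob_space P" "sets P = sets Omega" and A: "A \<in> sets Omega"
  shows "emeasure (env_process_law P n) A =
    (\<integral>\<^sup>+\<omega>. emeasure (quenched_law \<omega> 0) {X. env_shift (X n) \<omega> \<in> A} \<partial>P)"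
proof -
  have sp: "space Omega = environments" "space P = environments"
    using sets_eq_imp_space_eq[OF P(2)] by (simp_all add: Omega_def space_restrict_space)
  have Pair: "Pair \<omega> \<in> quenched_law \<omega> 0 \<rightarrow>\<^sub>M Omega \<Otimes>\<^sub>M paths" if "\<omega> \<in> environments" for \<omega>
    using that by (simp add: measurable_cong_sets[OF sets_quenched_law refl] sp)
  have K: "(\<lambda>\<omega>. distr (quenched_law \<omega> 0) (Omega \<Otimes>\<^sub>M paths) (Pair \<omega>))
      \<in> P \<rightarrow>\<^sub>M subprob_algebra (Omega \<Otimes>\<^sub>M paths)"
    unfolding measurable_cong_sets[OF P(2) refl]
    by (rule measurable_distr2[where M = paths])
       (simp_all add: measurable_quenched_law[THEN measurable_prob_algebraD])
  let ?B = "env_process n -` A \<inter> space (Omega \<Otimes>\<^sub>M paths)"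
  have B: "?B \<in> sets (Omega \<Otimes>\<^sub>M paths)"
    by (rule measurable_sets[OF measurable_env_process A])
  have S: "sets (averaged_law P 0) = sets (Omega \<Otimes>\<^sub>M paths)"
    unfolding averaged_law_def
    by (rule sets_bind) (simp_all add: sp P(1) prob_space.not_empty flip: sp(2))
  have "emeasure (env_process_law P n) A = emeasure (averaged_law P 0) ?B"
    unfolding env_process_law_def using measurable_env_process A
    by (subst emeasure_distr)
       (simp_all add: measurable_cong_sets[OF S refl] sets_eq_imp_space_eq[OF S])
  also have "\<dots> = (\<integral>\<^sup>+\<omega>. emeasure (distr (quenched_law \<omega> 0) (Omega \<Otimes>\<^sub>M paths) (Pair \<omega>)) ?B \<partial>P)"
    unfolding averaged_law_def using K B P(1) by (intro emeasure_bind) (auto simp: prob_space.not_empty)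
  also have "\<dots> = (\<integral>\<^sup>+\<omega>. emeasure (quenched_law \<omega> 0) {X. env_shift (X n) \<omega> \<in> A} \<partial>P)"
  proof (rule nn_integral_cong)
    fix \<omega> assume "\<omega> \<in> space P"
    then have \<omega>: "\<omega> \<in> environments" by (simp add: sp)
    have "Pair \<omega> -` ?B \<inter> space (quenched_law \<omega> 0) = {X. env_shift (X n) \<omega> \<in> A}"
      using \<omega> sets_eq_imp_space_eq[OF sets_quenched_law[OF \<omega>]]
      by (auto simp: env_process_def space_pair_measure sp)
    then show "emeasure (distr (quenched_law \<omega> 0) (Omega \<Otimes>\<^sub>M paths) (Pair \<omega>)) ?B =
        emeasure (quenched_law \<omega> 0) {X. env_shift (X n) \<omega> \<in> A}"
      by (simp add: emeasure_distr[OF Pair[OF \<omega>] B])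
  qed
  finally show ?thesis .
qed

lemma measurable_restrict_env:
  "(\<lambda>\<omega>. restrict \<omega> B) \<in> Omega \<rightarrow>\<^sub>M (\<Pi>\<^sub>M x\<in>B. P_space)"
proof (rule measurable_restrict)
  fix x
  have "(\<lambda>\<omega>. \<omega> x) \<in> Omega \<rightarrow>\<^sub>M borel"
    unfolding Omega_def
    by (intro measurable_restrict_space1 borel_measurable_continuous_onI
        continuous_on_product_coordinates)
  then show "(\<lambda>\<omega>. \<omega> x) \<in> Omega \<rightarrow>\<^sub>M P_space"
    unfolding P_space_def
    by (intro measurable_restrict_space2)
       (simp_all add: Omega_def space_restrict_space environments_def del: split_paired_All)
qed

end

theory Submission
  imports Defs "HOL-Real_Asymp.Real_Asymp"
begin

text \<open>The walk is killed at rate \<open>1 - \<delta>\<close> and \<open>\<delta>\<close> is sent to \<open>1\<close> at the end. Let \<open>m x \<omega>\<close> be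
  \<open>1 - \<delta>\<close> times the total Green function mass flowing into \<open>x\<close> from all sites. By translation
  invariance, \<open>\<integral> f m(0) dP\<close> is the Abel mean of the integrals of \<open>f\<close> against the laws of the
  environmental process, so its limit is \<open>\<integral> f dQ\<close>. For \<open>f\<close> depending on the two sites only,
  \<open>u x = \<integral> f m(x) dP - \<integral> f dP\<close> solves a Poisson equation for a homogeneous kernel whose source
  is the divergence of the correlations \<open>D x e\<close> of \<open>f m(x)\<close> with \<open>\<omega> x e\<close>. At the two sites these are
  explicit to leading order and produce values of the potential kernel of simple random walk; elsewhere
  they are of order \<open>\<epsilon>\<^sup>3\<close> times the probability of visiting one of the two sites, and the energy
  estimate for the gradient of the Green function, together with the transience produced by the drift,
  makes their total contribution \<open>O(\<epsilon>\<^sup>2 log (1 / \<epsilon>))\<close>.\<close>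

section \<open>Potential theory of sub-Markovian nearest-neighbour kernels\<close>

text \<open>In the plane the Green function on the diagonal grows like log (1 / \<epsilon>) and the
  drift is only of order \<epsilon>, so pointwise bounds would lose powers of 1 / \<epsilon>. Two
  devices prevent this. Resampling: exchanging one site of the environment for an independent copy
  turns a covariance with \<open>\<omega> x e\<close> into an oscillation, and masses, Green
  functions and escape probabilities change by a factor 1 + O(\<epsilon>) only. The influence of the
  two sites, its oscillation at x and the fluctuation of \<open>\<omega> x e\<close> contribute one
  power each, whence \<epsilon>^3. Square norms: upstream, the visit probabilities have squared norm
  O(1 / \<epsilon>^2) and are paired with a gradient in l^2; downstream, an exponential tilt makes
  the gradient itself summable at scale 1 / \<epsilon>. Either way \<epsilon>^3 loses just one
  power, up to a logarithm. Killing makes all series absolutely convergent, and the estimates are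
  uniform in 1 - \<epsilon>^2 / 4 \<le> \<delta> < 1. The origin drops out of the first order
  because all its neighbours have the same potential kernel value; this is why only (0, 1) appears
  in the expansion.\<close>

definition subkernel :: "real \<Rightarrow> env \<Rightarrow> bool" where
  "subkernel q w \<longleftrightarrow> 0 \<le> q \<and> q < 1 \<and> (\<forall>x e. 0 \<le> w x e) \<and> (\<forall>x. (\<Sum>e\<in>steps. w x e) \<le> q)"

definition step_op :: "env \<Rightarrow> (site \<Rightarrow> real) \<Rightarrow> site \<Rightarrow> real" where
  "step_op w f y = (\<Sum>e\<in>steps. w y e * f (y + e))"

text \<open>The Neumann series of I - \<open>step_op w\<close>: the expected sum of \<open>c\<close>
  along the killed walk from \<open>y\<close>. Markov properties appear below as resolvent
  identities, without path measures.\<close>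

definition pot :: "env \<Rightarrow> (site \<Rightarrow> real) \<Rightarrow> site \<Rightarrow> real" where
  "pot w c y = (\<Sum>n. (step_op w ^^ n) c y)"

definition unit_at :: "site \<Rightarrow> site \<Rightarrow> real" where
  "unit_at x y = of_bool (y = x)"

definition green :: "env \<Rightarrow> site \<Rightarrow> site \<Rightarrow> real" where
  "green w y x = pot w (unit_at x) y"

definition bdd :: "('a \<Rightarrow> real) \<Rightarrow> bool" where
  "bdd f \<longleftrightarrow> (\<exists>C. \<forall>y. \<bar>f y\<bar> \<le> C)"

lemma bddI: "(\<And>y. \<bar>f y\<bar> \<le> C) \<Longrightarrow> bdd f"
  unfolding bdd_def by blast

lemma bddE:
  assumes "bdd f"
  obtains C where "C \<ge> 0" "\<And>y. \<bar>f y\<bar> \<le> C"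
proof -
  obtain C where C: "\<And>y. \<bar>f y\<bar> \<le> C" using assms unfolding bdd_def by blast
  show thesis using that[of C] C order_trans[OF abs_ge_zero C] by blast
qed

lemma bdd_add: "bdd f \<Longrightarrow> bdd g \<Longrightarrow> bdd (\<lambda>x. f x + g x)"
  unfolding bdd_def by (meson abs_triangle_ineq add_mono order_trans)

lemma bdd_cmult: "bdd f \<Longrightarrow> bdd (\<lambda>x. c * f x)"
  unfolding bdd_def abs_mult by (meson mult_left_mono abs_ge_zero)

lemma bdd_diff: "bdd f \<Longrightarrow> bdd g \<Longrightarrow> bdd (\<lambda>x. f x - g x)"
  using bdd_add[of f "\<lambda>x. -1 * g x"] bdd_cmult[of g "-1"] by simp

lemma bdd_fun_upd:
  assumes "bdd f"
  shows "bdd (f(z := v))"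
proof -
  obtain C where "\<And>y. \<bar>f y\<bar> \<le> C" using assms unfolding bdd_def by blast
  then show ?thesis by (intro bddI[where C = "max \<bar>v\<bar> C"]) (simp add: le_max_iff_disj)
qed

lemma bdd_unit_at [simp]: "bdd (unit_at x)"
  by (rule bddI[where C = 1]) (simp add: unit_at_def)

lemma bdd_const [simp]: "bdd (\<lambda>x. c)"
  by (rule bddI[where C = "\<bar>c\<bar>"]) simp

lemma bdd_shift: "bdd f \<Longrightarrow> bdd (\<lambda>x. f (h x))"
  unfolding bdd_def by blast

lemma bdd_sum: "(\<And>i. i \<in> I \<Longrightarrow> bdd (f i)) \<Longrightarrow> bdd (\<lambda>x. \<Sum>i\<in>I. f i x)"
  by (induction I rule: infinite_finite_induct) (auto intro: bdd_add)

lemma kernelD: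
  assumes "subkernel q w"
  shows "0 \<le> q" "q < 1" "0 \<le> w x e" "(\<Sum>e\<in>steps. w x e) \<le> q"
  using assms unfolding subkernel_def by blast+

lemma sum_kernel_nonneg: "subkernel q w \<Longrightarrow> 0 \<le> (\<Sum>e\<in>steps. w x e)"
  by (simp add: kernelD sum_nonneg)

lemma step_op_le:
  assumes "subkernel q w" "\<And>y. \<bar>c y\<bar> \<le> C"
  shows "\<bar>step_op w c y\<bar> \<le> q * C"
proof -
  have "C \<ge> 0" using order_trans[OF abs_ge_zero assms(2)] .
  have "\<bar>step_op w c y\<bar> \<le> (\<Sum>e\<in>steps. w y e * C)"
    unfolding step_op_def using assms
    by (intro order_trans[OF sum_abs] sum_mono) (simp add: abs_mult kernelD mult_left_mono)
  also have "\<dots> \<le> q * C"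
    using \<open>C \<ge> 0\<close> kernelD(4)[OF assms(1), of y] by (simp add: mult_right_mono flip: sum_distrib_right)
  finally show ?thesis .
qed

lemma bdd_step_op: "subkernel q w \<Longrightarrow> bdd f \<Longrightarrow> bdd (step_op w f)"
  unfolding bdd_def using step_op_le by metis

lemma step_op_pow_le:
  assumes "subkernel q w" "\<And>y. \<bar>c y\<bar> \<le> C"
  shows "\<bar>(step_op w ^^ n) c y\<bar> \<le> q ^ n * C"
proof (induction n arbitrary: y)
  case 0
  then show ?case using assms(2) by simp
next
  case (Suc n)
  then show ?case using step_op_le[OF assms(1), of "(step_op w ^^ n) c"] by (simp add: mult.assoc)
qed

lemma pot_summable:
  assumes "subkernel q w" "bdd c"
  shows "summable (\<lambda>n. (step_op w ^^ n) c y)"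
proof -
  obtain C where C: "\<And>y. \<bar>c y\<bar> \<le> C" using assms(2) unfolding bdd_def by blast
  show ?thesis
  proof (rule summable_comparison_test')
    show "norm ((step_op w ^^ n) c y) \<le> q ^ n * C" for n
      using step_op_pow_le[OF assms(1) C] by simp
    show "summable (\<lambda>n. q ^ n * C)"
      using kernelD[OF assms(1)] by (intro summable_mult2 summable_geometric) simp
  qed
qed

lemma pot_le:
  assumes "subkernel q w" "\<And>y. \<bar>c y\<bar> \<le> C"
  shows "\<bar>pot w c y\<bar> \<le> C / (1 - q)"
proof -
  have q: "0 \<le> q" "q < 1" using kernelD[OF assms(1)] by auto
  have s: "summable (\<lambda>n. q ^ n * C)"
    using q by (intro summable_mult2 summable_geometric) simp
  have "norm (pot w c y) \<le> (\<Sum>n. q ^ n * C)"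
    unfolding pot_def using step_op_pow_le[OF assms] s
    by (intro norm_suminf_le) simp_all
  also have "\<dots> = C / (1 - q)"
    using q by (simp add: suminf_geometric suminf_mult2[symmetric] summable_geometric)
  finally show ?thesis by simp
qed

lemma bdd_pot: "subkernel q w \<Longrightarrow> bdd c \<Longrightarrow> bdd (pot w c)"
  by (erule bddE, rule bddI, rule pot_le) auto

lemma step_op_nonneg: "subkernel q w \<Longrightarrow> (\<And>y. 0 \<le> c y) \<Longrightarrow> 0 \<le> step_op w c y"
  by (simp add: step_op_def sum_nonneg kernelD)

lemma step_op_pow_nonneg: "subkernel q w \<Longrightarrow> (\<And>y. 0 \<le> c y) \<Longrightarrow> 0 \<le> (step_op w ^^ n) c y"
  by (induction n arbitrary: y) (auto intro: step_op_nonneg)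

lemma pot_nonneg:
  assumes "subkernel q w" "bdd c" "\<And>y. 0 \<le> c y"
  shows "0 \<le> pot w c y"
  unfolding pot_def by (intro suminf_nonneg pot_summable[OF assms(1,2)] step_op_pow_nonneg[OF assms(1,3)])

lemma pot_eq:
  assumes "subkernel q w" "bdd c"
  shows "pot w c y = c y + step_op w (pot w c) y"
proof -
  have "pot w c y = (\<Sum>n. (step_op w ^^ Suc n) c y) + c y"
    unfolding pot_def using suminf_split_head[OF pot_summable[OF assms, of y]] by simp
  also have "(\<Sum>n. (step_op w ^^ Suc n) c y) = (\<Sum>n. \<Sum>e\<in>steps. w y e * (step_op w ^^ n) c (y + e))"
    by (simp add: step_op_def)
  also have "\<dots> = (\<Sum>e\<in>steps. w y e * pot w c (y + e))"
    unfolding pot_def using pot_summable[OF assms]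
    by (simp add: suminf_sum summable_mult suminf_mult)
  finally show ?thesis by (simp add: step_op_def)
qed

text \<open>The difference of two bounded solutions is fixed by \<open>step_op w\<close>, hence at
  most \<open>q ^ n * C\<close> for every \<open>n\<close>. Most identities below follow by checking
  that a bounded function solves the equation.\<close>

lemma pot_unique:
  assumes "subkernel q w" "bdd c" "bdd T" "\<And>y. T y = c y + step_op w T y"
  shows "T y = pot w c y"
proof -
  define h where "h = (\<lambda>y. T y - pot w c y)"
  have "bdd h" unfolding h_def by (intro bdd_diff assms bdd_pot[OF assms(1)])
  then obtain C where C: "\<And>y. \<bar>h y\<bar> \<le> C" unfolding bdd_def by blast
  have "h y = step_op w h y" for y
    using assms(4)[of y] pot_eq[OF assms(1,2), of y]
    by (simp add: h_def step_op_def algebra_simps sum_subtractf)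
  then have "step_op w h = h" by auto
  then have "(step_op w ^^ n) h = h" for n by (induction n) auto
  then have b: "\<bar>h y\<bar> \<le> q ^ n * C" for n using step_op_pow_le[where c = h, OF assms(1) C, of n y] by simp
  have "(\<lambda>n. q ^ n * C) \<longlonglongrightarrow> 0 * C"
    using kernelD[OF assms(1)] by (intro tendsto_intros LIMSEQ_power_zero) auto
  then have "\<bar>h y\<bar> \<le> 0" using b by (intro LIMSEQ_le_const[of _ 0 "\<bar>h y\<bar>"]) auto
  then show ?thesis by (simp add: h_def)
qed

lemma step_op_add: "step_op w (\<lambda>x. f x + g x) y = step_op w f y + step_op w g y"
  by (simp add: step_op_def algebra_simps sum.distrib)

lemma step_op_cmult: "step_op w (\<lambda>x. c * f x) y = c * step_op w f y"
  by (simp add: step_op_def algebra_simps sum_distrib_left)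

lemma step_op_sum: "step_op w (\<lambda>x. \<Sum>i\<in>I. f i x) y = (\<Sum>i\<in>I. step_op w (f i) y)"
  by (simp add: step_op_def sum_distrib_left) (rule sum.swap)

lemma pot_add:
  assumes "subkernel q w" "bdd c" "bdd d"
  shows "pot w (\<lambda>x. c x + d x) y = pot w c y + pot w d y"
proof (rule pot_unique[symmetric, OF assms(1)])
  show "pot w c y + pot w d y = c y + d y + step_op w (\<lambda>y. pot w c y + pot w d y) y" for y
    unfolding step_op_add by (subst (1) pot_eq[OF assms(1,2)], subst (1) pot_eq[OF assms(1,3)]) simp
qed (intro bdd_add bdd_pot[OF assms(1)] assms)+

lemma pot_cmult:
  assumes "subkernel q w" "bdd c"
  shows "pot w (\<lambda>x. a * c x) y = a * pot w c y"
proof (rule pot_unique[symmetric, OF assms(1)])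
  show "a * pot w c y = a * c y + step_op w (\<lambda>y. a * pot w c y) y" for y
    by (subst pot_eq[OF assms]) (simp add: step_op_cmult algebra_simps)
qed (auto intro!: bdd_cmult bdd_pot[OF assms(1)] assms)

lemma pot_mono:
  assumes "subkernel q w" "bdd c" "bdd d" "\<And>x. c x \<le> d x"
  shows "pot w c y \<le> pot w d y"
proof -
  have "pot w d y = pot w (\<lambda>x. c x + (d x - c x)) y" by simp
  also have "\<dots> = pot w c y + pot w (\<lambda>x. d x - c x) y"
    using assms by (intro pot_add) (auto intro: bdd_diff)
  finally show ?thesis
    using pot_nonneg[OF assms(1), of "\<lambda>x. d x - c x" y] assms by (auto intro: bdd_diff)
qed

text \<open>A bounded \<open>T\<close> is the potential of its own defect
  \<open>T - step_op w T\<close>, and this defect dominates \<open>c\<close>.\<close>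

lemma pot_le_supersolution:
  assumes "subkernel q w" "bdd c" "bdd T" "\<And>y. c y + step_op w T y \<le> T y"
  shows "pot w c y \<le> T y"
proof -
  have b: "bdd (\<lambda>y. T y - step_op w T y)"
    using assms(3) by (intro bdd_diff bdd_step_op[OF assms(1)])
  have "T y = pot w (\<lambda>y. T y - step_op w T y) y"
    using assms b by (intro pot_unique) auto
  moreover have "pot w c y \<le> pot w (\<lambda>y. T y - step_op w T y) y"
    using assms b by (intro pot_mono) (simp_all add: le_diff_eq)
  ultimately show ?thesis by simp
qed

lemma green_eq: "subkernel q w \<Longrightarrow> green w y x = of_bool (y = x) + (\<Sum>e\<in>steps. w y e * green w (y + e) x)"
  using pot_eq[of q w "unit_at x" y] by (simp add: green_def step_op_def unit_at_def[of x y])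

lemma green_nonneg: "subkernel q w \<Longrightarrow> 0 \<le> green w y x"
  unfolding green_def by (rule pot_nonneg[OF _ bdd_unit_at]) (simp_all add: unit_at_def)

lemma green_diag_ge: "subkernel q w \<Longrightarrow> 1 \<le> green w z z"
  using green_eq[of q w z z] green_nonneg kernelD(3) by (simp add: sum_nonneg)

text \<open>As a function of the starting point \<open>y\<close>, the right-hand side solves the
  first-step equation that characterises the Green function of \<open>x\<close>.\<close>

lemma green_last_step:
  assumes "subkernel q w"
  shows "green w y x = of_bool (y = x) + (\<Sum>e\<in>steps. green w y (x - e) * w (x - e) e)"
proof -
  let ?T = "\<lambda>y. unit_at x y + (\<Sum>e\<in>steps. w (x - e) e * green w y (x - e))"
  have "?T y = pot w (unit_at x) y"
  proof (rule pot_unique[OF assms])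
    show "bdd ?T"
      unfolding green_def by (intro bdd_add bdd_sum bdd_cmult bdd_pot[OF assms]) auto
    fix y
    have "step_op w ?T y = step_op w (unit_at x) y + (\<Sum>e\<in>steps. w (x - e) e * step_op w (\<lambda>y. green w y (x - e)) y)"
      by (simp add: step_op_add step_op_sum step_op_cmult)
    moreover have "step_op w (\<lambda>y. green w y u) y = green w y u - unit_at u y" for u
      using green_eq[OF assms, of y u] by (simp add: step_op_def unit_at_def)
    moreover have "step_op w (unit_at x) y = (\<Sum>e\<in>steps. w (x - e) e * unit_at (x - e) y)"
      unfolding step_op_def by (intro sum.cong refl) (auto simp: unit_at_def)
    ultimately show "?T y = unit_at x y + step_op w ?T y"
      by (simp add: algebra_simps sum.distrib sum_subtractf)
  qed simp
  then show ?thesis by (simp add: green_def unit_at_def mult.commute)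
qed

text \<open>The \<open>w\<close>-walk killed on its first visit to \<open>z\<close>, where it is still counted: for \<open>x \<noteq> z\<close>,
  \<open>green (kill z w) y x\<close> counts the visits to \<open>x\<close> before \<open>z\<close>, while \<open>green (kill z w) y z\<close> is the
  probability of hitting \<open>z\<close>.\<close>

definition kill :: "site \<Rightarrow> env \<Rightarrow> env" where
  "kill z w = w(z := \<lambda>_. 0)"

lemma kernel_kill: "subkernel q w \<Longrightarrow> subkernel q (kill z w)"
  by (auto simp: subkernel_def kill_def)

lemma step_op_kill: "step_op (kill z w) f y = (if y = z then 0 else step_op w f y)"
  by (simp add: step_op_def kill_def)

text \<open>The Markov property at the first visit to \<open>z\<close>: the unkilled potential
  solves the killed equation once the source at \<open>z\<close> is replaced by the potential
  there.\<close>

lemma pot_kill: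
  assumes "subkernel q w" "bdd c"
  shows "pot w c y = pot (kill z w) (c(z := 0)) y + green (kill z w) y z * pot w c z"
proof -
  note K = kernel_kill[OF assms(1), of z]
  have "pot w c y = pot (kill z w) (c(z := pot w c z)) y"
  proof (rule pot_unique[OF K])
    show "pot w c y = (c(z := pot w c z)) y + step_op (kill z w) (pot w c) y" for y
      using pot_eq[OF assms, of y] by (cases "y = z") (simp_all add: step_op_kill)
  qed (intro bdd_fun_upd bdd_pot[OF assms(1)] assms)+
  also have "c(z := pot w c z) = (\<lambda>x. (c(z := 0)) x + pot w c z * unit_at z x)"
    by (auto simp: unit_at_def)
  also have "pot (kill z w) \<dots> y = pot (kill z w) (c(z := 0)) y + green (kill z w) y z * pot w c z"
    unfolding green_def mult.commute[of _ "pot w c z"] pot_cmult[OF K bdd_unit_at, symmetric]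
    by (rule pot_add[OF K bdd_fun_upd[OF assms(2)] bdd_cmult[OF bdd_unit_at]])
  finally show ?thesis .
qed

text \<open>The decomposition at \<open>z\<close> solved for the value at \<open>z\<close>; the
  factor on the left is one minus the return probability. The killed quantities do not depend on the
  row \<open>w z\<close>, so the dependence on that row becomes explicit.\<close>

lemma pot_kill_centre:
  assumes "subkernel q w" "bdd c"
  shows "pot w c z * (1 - (\<Sum>e\<in>steps. w z e * green (kill z w) (z + e) z)) =
    c z + (\<Sum>e\<in>steps. w z e * pot (kill z w) (c(z := 0)) (z + e))"
proof -
  have "pot w c z = c z + (\<Sum>e\<in>steps. w z e * pot w c (z + e))"
    using pot_eq[OF assms, of z] unfolding step_op_def .
  also have "(\<Sum>e\<in>steps. w z e * pot w c (z + e)) = (\<Sum>e\<in>steps. w z e *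
      (pot (kill z w) (c(z := 0)) (z + e) + green (kill z w) (z + e) z * pot w c z))"
    by (rule sum.cong, rule refl, rule arg_cong2[where f = "(*)"], rule refl, rule pot_kill[OF assms])
  also have "\<dots> = (\<Sum>e\<in>steps. w z e * pot (kill z w) (c(z := 0)) (z + e)) +
      pot w c z * (\<Sum>e\<in>steps. w z e * green (kill z w) (z + e) z)"
    by (simp add: distrib_left sum.distrib sum_distrib_left ac_simps)
  finally show ?thesis
    unfolding right_diff_distrib mult_1_right by linarith
qed

lemma green_kill:
  assumes "subkernel q w" "x \<noteq> z"
  shows "green w y x = green (kill z w) y x + green (kill z w) y z * green w z x"
proof -
  have "(unit_at x)(z := 0) = unit_at x" using assms(2) by (auto simp: unit_at_def)
  then show ?thesis using pot_kill[OF assms(1), of "unit_at x" y z] by (simp add: green_def)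
qed

lemma green_kill_self:
  assumes "subkernel q w"
  shows "green w y z = green (kill z w) y z * green w z z"
proof -
  have "(unit_at z)(z := 0) = (\<lambda>_. 0)" by (auto simp: unit_at_def)
  moreover have "pot (kill z w) (\<lambda>_. 0) y = 0"
    using pot_unique[OF kernel_kill[OF assms], of "\<lambda>_. 0" "\<lambda>_. 0"] by (simp add: step_op_def)
  ultimately show ?thesis using pot_kill[OF assms(1), of "unit_at z" y z] by (simp add: green_def)
qed

text \<open>Only the visits to \<open>x\<close> after the first visit to \<open>z\<close> are kept;
  the expected number of visits to \<open>z\<close> is the hitting probability times
  \<open>green w z z\<close>.\<close>

lemma green_product_le:
  assumes "subkernel q w" "x \<noteq> z"
  shows "green w y z * green w z x \<le> green w z z * green w y x"
proof -
  have "green w y z * green w z x = green w z z * (green (kill z w) y z * green w z x)"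
    by (subst green_kill_self[OF assms(1), of y]) simp
  also have "\<dots> \<le> green w z z * green w y x"
    using green_nonneg[OF kernel_kill[OF assms(1)]] green_nonneg[OF assms(1)] green_kill[OF assms, of y]
    by (intro mult_left_mono) auto
  finally show ?thesis .
qed

lemma green_kill_centre:
  assumes "subkernel q w"
  shows "green w z z * (1 - (\<Sum>e\<in>steps. w z e * green (kill z w) (z + e) z)) = 1"
proof -
  have "green w z z = 1 + (\<Sum>e\<in>steps. w z e * (green (kill z w) (z + e) z * green w z z))"
    unfolding green_kill_self[OF assms, symmetric] using green_eq[OF assms, of z z] by simp
  also have "(\<Sum>e\<in>steps. w z e * (green (kill z w) (z + e) z * green w z z)) =
      green w z z * (\<Sum>e\<in>steps. w z e * green (kill z w) (z + e) z)"
    by (simp add: sum_distrib_left ac_simps)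
  finally show ?thesis unfolding right_diff_distrib mult_1_right by linarith
qed

text \<open>The kernels differ in one row, so the old potential solves the new equation up to a
  source concentrated at \<open>z\<close>, which the new Green function carries to
  \<open>y\<close>.\<close>

lemma pot_perturb:
  assumes "subkernel q w" "subkernel q w'" "bdd c" "\<And>x. x \<noteq> z \<Longrightarrow> w' x = w x"
  shows "pot w' c y = pot w c y + green w' y z * (\<Sum>e\<in>steps. (w' z e - w z e) * pot w c (z + e))"
proof -
  define a where "a = (\<Sum>e\<in>steps. (w' z e - w z e) * pot w c (z + e))"
  have "step_op w' f y = step_op w f y + (\<Sum>e\<in>steps. (w' z e - w z e) * f (z + e)) * unit_at z y" for f y
    using assms(4)[of y] by (cases "y = z") (simp_all add: step_op_def unit_at_def algebra_simps sum_subtractf)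
  then have "pot w c y = (c y + (- a) * unit_at z y) + step_op w' (pot w c) y" for y
    using pot_eq[OF assms(1,3), of y] by (simp add: a_def)
  then have "pot w c y = pot w' (\<lambda>x. c x + (- a) * unit_at z x) y"
    by (rule pot_unique[OF assms(2) bdd_add[OF assms(3) bdd_cmult[OF bdd_unit_at]] bdd_pot[OF assms(1,3)]])
  also have "\<dots> = pot w' c y + (- a) * green w' y z"
    unfolding green_def pot_cmult[OF assms(2) bdd_unit_at, symmetric]
    by (rule pot_add[OF assms(2,3) bdd_cmult[OF bdd_unit_at]])
  finally show ?thesis by (simp add: a_def)
qed

lemma escape_source_bounds:
  assumes "subkernel q w"
  shows "0 \<le> (if y = z then 0 else 1 - (\<Sum>e\<in>steps. w y e))" "(if y = z then 0 else 1 - (\<Sum>e\<in>steps. w y e)) \<le> 1"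
  using kernelD(2)[OF assms] kernelD(4)[OF assms, of y] sum_kernel_nonneg[OF assms, of y] by auto

lemma bdd_escape_source:
  assumes "subkernel q w"
  shows "bdd (\<lambda>y. if y = z then 0 else 1 - (\<Sum>e\<in>steps. w y e))"
  using escape_source_bounds[OF assms] by (intro bddI[where C = 1]) (smt (verit))

text \<open>A walk that misses \<open>z\<close> is killed elsewhere. Being a potential of a
  nonnegative source, namely the killing rate, the escape probability falls under the oscillation
  bound below.\<close>

lemma escape_eq:
  assumes "subkernel q w"
  shows "1 - green (kill z w) y z = pot (kill z w) (\<lambda>y. if y = z then 0 else 1 - (\<Sum>e\<in>steps. w y e)) y"
proof (rule pot_unique[OF kernel_kill[OF assms]])
  note K = kernel_kill[OF assms, of z]
  show "bdd (\<lambda>y. if y = z then 0 else 1 - (\<Sum>e\<in>steps. w y e))"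
    by (rule bdd_escape_source[OF assms])
  show "bdd (\<lambda>y. 1 - green (kill z w) y z)"
    unfolding green_def by (intro bdd_diff bdd_pot[OF K]) auto
  fix y
  show "1 - green (kill z w) y z = (if y = z then 0 else 1 - (\<Sum>e\<in>steps. w y e)) +
      step_op (kill z w) (\<lambda>y. 1 - green (kill z w) y z) y"
    by (subst green_eq[OF K])
       (auto simp: step_op_def kill_def algebra_simps sum_subtractf)
qed

lemma green_kill_le_1:
  assumes "subkernel q w"
  shows "green (kill z w) y z \<le> 1"
proof -
  have "0 \<le> pot (kill z w) (\<lambda>y. if y = z then 0 else 1 - (\<Sum>e\<in>steps. w y e)) y"
    by (intro pot_nonneg[OF kernel_kill[OF assms]] bdd_escape_source[OF assms] escape_source_bounds[OF assms])
  then show ?thesis using escape_eq[OF assms, of z y] by simp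
qed

subsection \<open>Oscillation under a change of the kernel at one site\<close>

text \<open>Closeness is multiplicative because linear forms with nonnegative coefficients inherit
  it, whatever the coefficients.\<close>

definition close :: "real \<Rightarrow> (site \<Rightarrow> real) \<Rightarrow> (site \<Rightarrow> real) \<Rightarrow> bool" where
  "close \<rho> s t \<longleftrightarrow> (\<forall>e\<in>steps. 0 \<le> s e \<and> 0 \<le> t e \<and> s e \<le> \<rho> * t e \<and> t e \<le> \<rho> * s e) \<and>
     (\<Sum>e\<in>steps. s e) = 1 \<and> (\<Sum>e\<in>steps. t e) = 1"

text \<open>As a function of \<open>w z\<close>, a potential is a constant plus a ratio of two linear forms with
  nonnegative coefficients.\<close>

lemma pot_oscillation:
  assumes w: "subkernel q w" and w': "subkernel q w'" and off: "\<And>x. x \<noteq> z \<Longrightarrow> w' x = w x"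
    and s: "\<And>e. e \<in> steps \<Longrightarrow> w z e = q * s e" and t: "\<And>e. e \<in> steps \<Longrightarrow> w' z e = q * t e"
    and cl: "close \<rho> s t" and c: "bdd c" "\<And>x. 0 \<le> c x" and \<rho>: "1 \<le> \<rho>"
  shows "pot w' c y \<le> \<rho>\<^sup>2 * pot w c y"
proof -
  have k: "kill z w' = kill z w" using off by (auto simp: kill_def fun_eq_iff)
  note K = kernel_kill[OF w, of z]
  have q: "0 \<le> q" "q < 1" using kernelD[OF w] by auto
  \<comment> \<open>The rows \<open>s\<close> and \<open>t\<close> sum to 1, so the constants
    \<open>c z\<close> and 1 can be put inside the sums; \<open>N\<close> and \<open>D\<close>
    become homogeneous in the row at \<open>z\<close>.\<close>
  define N where "N u = (\<Sum>e\<in>steps. u e * (c z + q * pot (kill z w) (c(z := 0)) (z + e)))" for u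
  define D where "D u = (\<Sum>e\<in>steps. u e * (1 - q * green (kill z w) (z + e) z))" for u
  have c0: "bdd (c(z := 0))" "\<And>x. 0 \<le> (c(z := 0)) x" using c by (auto intro: bdd_fun_upd)
  have N0: "0 \<le> c z + q * pot (kill z w) (c(z := 0)) (z + e)" for e
    using pot_nonneg[OF K c0, of "z + e"] c(2)[of z] q by (simp del: fun_upd_apply)
  have D0: "1 - q \<le> 1 - q * green (kill z w) (z + e) z" for e
    using green_kill_le_1[OF w, of z "z + e"] q by (simp add: mult_left_le)
  have st: "0 \<le> s e" "0 \<le> t e" "t e \<le> \<rho> * s e" "s e \<le> \<rho> * t e" if "e \<in> steps" for e
    using cl that by (auto simp: close_def)
  have "N t \<le> \<rho> * N s"
    unfolding N_def sum_distrib_left using N0 st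
    by (intro sum_mono) (simp add: mult_right_mono flip: mult.assoc)
  have "D s \<le> \<rho> * D t"
    unfolding D_def sum_distrib_left mult.assoc[symmetric] using order_trans[OF _ D0, of 0] q st
    by (intro sum_mono mult_right_mono) auto
  have Dpos: "0 < D u" if "\<And>e. e \<in> steps \<Longrightarrow> 0 \<le> u e" "(\<Sum>e\<in>steps. u e) = 1" for u
  proof -
    have "1 - q = (\<Sum>e\<in>steps. u e * (1 - q))" using that(2) by (simp flip: sum_distrib_right)
    also have "\<dots> \<le> D u" unfolding D_def using D0 that(1) by (intro sum_mono mult_left_mono) auto
    finally show ?thesis using q by simp
  qed
  have eqs: "pot w c z * D s = N s" "pot w' c z * D t = N t"
    using pot_kill_centre[OF w c(1), of z] pot_kill_centre[OF w' c(1), of z] s t cl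
    by (simp_all add: N_def D_def k close_def algebra_simps sum.distrib sum_subtractf
        flip: sum_distrib_left)
  have Ds: "0 < D s" "0 < D t" using cl by (auto intro!: Dpos simp: close_def)
  have Ns: "0 \<le> N s" unfolding N_def using N0 st by (intro sum_nonneg mult_nonneg_nonneg) auto
  have z: "pot w' c z \<le> \<rho>\<^sup>2 * pot w c z"
  proof -
    have "pot w' c z = N t / D t" using eqs Ds by (simp add: field_simps)
    also have "\<dots> \<le> (\<rho> * N s) / (D s / \<rho>)"
      using \<open>N t \<le> \<rho> * N s\<close> \<open>D s \<le> \<rho> * D t\<close> Ds Ns \<rho>
      by (intro frac_le) (auto simp: field_simps)
    also have "\<dots> = \<rho>\<^sup>2 * pot w c z" using eqs Ds \<rho> by (simp add: field_simps power2_eq_square)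
    finally show ?thesis .
  qed
  have "pot w' c y = pot (kill z w) (c(z := 0)) y + green (kill z w) y z * pot w' c z"
    using pot_kill[OF w' c(1), of y z] k by simp
  also have "\<dots> \<le> \<rho>\<^sup>2 * pot (kill z w) (c(z := 0)) y + green (kill z w) y z * (\<rho>\<^sup>2 * pot w c z)"
    using mult_right_mono[OF one_le_power[OF \<rho>, of 2] pot_nonneg[OF K c0, of y]]
    by (intro add_mono mult_left_mono z green_nonneg[OF K]) (simp only: mult_1_left)
  also have "\<dots> = \<rho>\<^sup>2 * pot w c y"
    by (subst pot_kill[OF w c(1), of y z]) (simp add: algebra_simps)
  finally show ?thesis .
qed

subsection \<open>Decay and summation over sites\<close>

definition rad :: "site \<Rightarrow> nat" where
  "rad x = nat (\<bar>fst x\<bar> + \<bar>snd x\<bar>)"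

lemma rad_zero [simp]: "rad 0 = 0"
  by (simp add: rad_def)

lemma rad_step: "e \<in> steps \<Longrightarrow> rad x \<le> Suc (rad (x - e))"
  by (auto simp: rad_def steps_def)

lemma rad_eq_0: "rad x = 0 \<longleftrightarrow> x = 0"
  by (auto simp: rad_def prod_eq_iff)

lemma summable_on_geometric_int:
  fixes q :: real
  assumes "0 \<le> q" "q < 1"
  shows "(\<lambda>a::int. q ^ nat \<bar>a\<bar>) summable_on UNIV"
proof -
  have "(\<lambda>n. q ^ n) summable_on (UNIV :: nat set)"
    using assms by (intro summable_nonneg_imp_summable_on) (auto intro: summable_geometric)
  then have "((\<lambda>a::int. q ^ nat \<bar>a\<bar>) \<circ> int) summable_on UNIV" "((\<lambda>a::int. q ^ nat \<bar>a\<bar>) \<circ> (\<lambda>n. - int n)) summable_on UNIV"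
    by (simp_all add: o_def)
  then have "(\<lambda>a::int. q ^ nat \<bar>a\<bar>) summable_on range int" "(\<lambda>a::int. q ^ nat \<bar>a\<bar>) summable_on range (\<lambda>n. - int n)"
    by (subst summable_on_reindex; simp add: inj_on_def o_def)+
  moreover have "UNIV = range int \<union> range (\<lambda>n. - int n)"
    by (auto simp: image_iff) (metis int_cases2 add.inverse_inverse)
  ultimately show ?thesis using summable_on_union by metis
qed

lemma summable_on_geometric_rad:
  fixes q :: real
  assumes "0 \<le> q" "q < 1"
  shows "(\<lambda>x. q ^ rad x) summable_on UNIV"
proof -
  define S where "S = (\<Sum>\<^sub>\<infinity>a::int. q ^ nat \<bar>a\<bar>)"
  have h: "((\<lambda>a::int. q ^ nat \<bar>a\<bar>) has_sum S) UNIV"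
    unfolding S_def by (rule has_sum_infsum[OF summable_on_geometric_int[OF assms]])
  have "(\<lambda>x. q ^ rad x) summable_on (SIGMA a:UNIV. UNIV)"
  proof (rule summable_on_SigmaI)
    show "((\<lambda>b. q ^ rad (a, b)) has_sum (q ^ nat \<bar>a\<bar> * S)) UNIV" for a
      using has_sum_cmult_right[OF h, of "q ^ nat \<bar>a\<bar>"]
      by (simp add: rad_def nat_add_distrib power_add)
    show "(\<lambda>a. q ^ nat \<bar>a\<bar> * S) summable_on UNIV"
      using h by (intro summable_on_cmult_left) (auto simp: summable_on_def)
  qed (use assms in auto)
  then show ?thesis by simp
qed

lemma bij_translate: "bij (\<lambda>y::site. x - y)" "bij (\<lambda>y::site. y - x)" "bij (\<lambda>y::site. y + x)" "bij (\<lambda>y::site. x + y)"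
proof -
  show "bij (\<lambda>y::site. x - y)" by (rule bij_betw_byWitness[where f' = "\<lambda>y. x - y"]) auto
  show "bij (\<lambda>y::site. y - x)" by (rule bij_betw_byWitness[where f' = "\<lambda>y. y + x"]) auto
  show "bij (\<lambda>y::site. y + x)" by (rule bij_betw_byWitness[where f' = "\<lambda>y. y - x"]) auto
  show "bij (\<lambda>y::site. x + y)" by (rule bij_betw_byWitness[where f' = "\<lambda>y. y - x"]) auto
qed

lemmas summable_on_translate = bij_translate[THEN summable_on_reindex_bij_betw]
lemmas infsum_translate = bij_translate[THEN infsum_reindex_bij_betw]

lemma summable_on_abs_iff:
  fixes f :: "'a \<Rightarrow> real"
  shows "(\<lambda>x. \<bar>f x\<bar>) summable_on A \<longleftrightarrow> f summable_on A"
  unfolding real_norm_def[symmetric] by (rule summable_on_iff_abs_summable_on_real[symmetric])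

lemma summable_on_bdd_mult:
  fixes f :: "'a \<Rightarrow> real"
  assumes "f summable_on UNIV" "bdd g"
  shows "(\<lambda>x. f x * g x) summable_on UNIV"
proof -
  obtain C where C: "\<And>x. \<bar>g x\<bar> \<le> C" using assms(2) unfolding bdd_def by blast
  have "(\<lambda>x. \<bar>f x\<bar> * C) summable_on UNIV"
    using assms(1) by (intro summable_on_cmult_left) (simp add: summable_on_abs_iff)
  then have "(\<lambda>x. \<bar>f x * g x\<bar>) summable_on UNIV"
    by (rule summable_on_comparison_test) (auto simp: abs_mult C mult_left_mono simp del: split_paired_All)
  then show ?thesis by (simp add: summable_on_abs_iff)
qed

lemma summable_on_sum:
  fixes f :: "'b \<Rightarrow> 'a \<Rightarrow> real"
  shows "(\<And>i. i \<in> I \<Longrightarrow> f i summable_on A) \<Longrightarrow> (\<lambda>x. \<Sum>i\<in>I. f i x) summable_on A"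
  by (induction I rule: infinite_finite_induct) (auto intro: summable_on_add)

lemma infsum_sum:
  fixes f :: "'b \<Rightarrow> 'a \<Rightarrow> real"
  shows "(\<And>i. i \<in> I \<Longrightarrow> f i summable_on A) \<Longrightarrow> (\<Sum>\<^sub>\<infinity>x\<in>A. \<Sum>i\<in>I. f i x) = (\<Sum>i\<in>I. \<Sum>\<^sub>\<infinity>x\<in>A. f i x)"
  by (induction I rule: infinite_finite_induct) (auto simp: infsum_add summable_on_sum)

lemma bdd_summable:
  fixes f :: "'a \<Rightarrow> real"
  assumes "f summable_on UNIV"
  shows "bdd f"
proof (rule bddI)
  have s: "(\<lambda>x. \<bar>f x\<bar>) summable_on UNIV"
    using assms by (simp add: summable_on_abs_iff)
  show "\<bar>f x\<bar> \<le> (\<Sum>\<^sub>\<infinity>x. \<bar>f x\<bar>)" for x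
    using finite_sum_le_infsum[OF s, of "{x}"] by simp
qed

lemma infsum_unit_at: "(\<Sum>\<^sub>\<infinity>y. of_bool (y = x) * f y) = (f x :: real)" "(\<lambda>y. of_bool (y = x) * f y :: real) summable_on UNIV"
proof -
  have "((\<lambda>y. of_bool (y = x) * f y) has_sum f x) UNIV"
    by (rule has_sum_finite_neutralI[of "{x}"]) auto
  then show "(\<Sum>\<^sub>\<infinity>y. of_bool (y = x) * f y) = (f x :: real)" "(\<lambda>y. of_bool (y = x) * f y :: real) summable_on UNIV"
    by (auto simp: infsumI summable_on_def)
qed

text \<open>The right-hand side is a supersolution: a step changes the l^1 distance by at most 1 and
  costs a factor \<open>q\<close>. The rate degenerates as \<open>q\<close> tends to 1; the bound
  serves for summability.\<close>

lemma green_decay: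
  assumes "subkernel q w"
  shows "green w y x \<le> q ^ rad (x - y) / (1 - q)"
  unfolding green_def
proof (rule pot_le_supersolution[OF assms bdd_unit_at, where T = "\<lambda>y. q ^ rad (x - y) / (1 - q)"])
  have q: "0 \<le> q" "q < 1" using kernelD[OF assms] by auto
  show "bdd (\<lambda>y. q ^ rad (x - y) / (1 - q))"
    using q by (intro bddI[where C = "1 / (1 - q)"]) (auto simp: power_le_one divide_right_mono)
  fix y
  have W: "0 \<le> w y e" "(\<Sum>e\<in>steps. w y e) \<le> q" for e using kernelD[OF assms] by auto
  show "unit_at x y + step_op w (\<lambda>y. q ^ rad (x - y) / (1 - q)) y \<le> q ^ rad (x - y) / (1 - q)"
  proof (cases "y = x")
    case True
    have "step_op w (\<lambda>y. q ^ rad (x - y) / (1 - q)) y \<le> (\<Sum>e\<in>steps. w y e * (1 / (1 - q)))"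
      unfolding step_op_def using q W by (intro sum_mono mult_left_mono divide_right_mono) (auto simp: power_le_one)
    also have "\<dots> \<le> q * (1 / (1 - q))"
      unfolding sum_distrib_right[symmetric] using q W by (intro mult_right_mono) auto
    finally show ?thesis using True q by (simp add: unit_at_def field_simps)
  next
    case False
    then have "rad (x - y) \<noteq> 0" by (simp add: rad_eq_0)
    then obtain n where n: "rad (x - y) = Suc n" by (cases "rad (x - y)") auto
    have "n \<le> rad (x - (y + e))" if "e \<in> steps" for e
      using rad_step[OF that, of "x - y"] n by (simp add: algebra_simps)
    then have "step_op w (\<lambda>y. q ^ rad (x - y) / (1 - q)) y \<le> (\<Sum>e\<in>steps. w y e * (q ^ n / (1 - q)))"
      unfolding step_op_def using q W by (intro sum_mono mult_left_mono divide_right_mono power_decreasing) auto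
    also have "\<dots> \<le> q * (q ^ n / (1 - q))"
      unfolding sum_distrib_right[symmetric] using q W by (intro mult_right_mono) auto
    finally show ?thesis using False q by (simp add: unit_at_def n)
  qed
qed

lemma green_summable:
  assumes "subkernel q w"
  shows "(\<lambda>y. green w y x) summable_on UNIV" "(\<lambda>x. green w y x) summable_on UNIV"
proof -
  have q: "0 \<le> q" "q < 1" using kernelD[OF assms] by auto
  have "(\<lambda>x. q ^ rad x / (1 - q)) summable_on UNIV"
    unfolding divide_inverse by (intro summable_on_cmult_left summable_on_geometric_rad q)
  then have s: "(\<lambda>y. q ^ rad (x - y) / (1 - q)) summable_on UNIV" "(\<lambda>x. q ^ rad (x - y) / (1 - q)) summable_on UNIV"
    by (simp_all add: summable_on_translate[where f = "\<lambda>x. q ^ rad x / (1 - q)"])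
  show "(\<lambda>y. green w y x) summable_on UNIV" "(\<lambda>x. green w y x) summable_on UNIV"
    by (rule summable_on_comparison_test[OF s(1) green_decay[OF assms] green_nonneg[OF assms]])
       (rule summable_on_comparison_test[OF s(2) green_decay[OF assms] green_nonneg[OF assms]])
qed

lemma pot_eq_infsum:
  assumes "subkernel q w" "bdd c"
  shows "pot w c y = (\<Sum>\<^sub>\<infinity>x. green w y x * c x)"
proof (rule pot_unique[OF assms, symmetric])
  obtain C where C: "\<And>x. \<bar>c x\<bar> \<le> C" using assms(2) unfolding bdd_def by blast
  have s: "(\<lambda>x. green w y x * c x) summable_on UNIV" for y
    by (intro summable_on_bdd_mult green_summable[OF assms(1)] assms)
  have q: "0 \<le> q" "q < 1" using kernelD[OF assms(1)] by auto
  define h where "h x = C / (1 - q) * q ^ rad x" for x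
  have C0: "0 \<le> C" using order_trans[OF abs_ge_zero C] .
  have h: "h summable_on UNIV"
    unfolding h_def by (intro summable_on_cmult_right summable_on_geometric_rad q)
  have "\<bar>\<Sum>\<^sub>\<infinity>x. green w y x * c x\<bar> \<le> infsum h UNIV" for y
  proof -
    have s': "(\<lambda>x. h (x - y)) summable_on UNIV"
      using h by (simp only: summable_on_translate(2))
    have "norm (\<Sum>\<^sub>\<infinity>x. green w y x * c x) \<le> (\<Sum>\<^sub>\<infinity>x. h (x - y))"
    proof (rule norm_infsum_le[OF has_sum_infsum[OF s] has_sum_infsum[OF s']])
      fix x
      have "green w y x * \<bar>c x\<bar> \<le> (q ^ rad (x - y) / (1 - q)) * C"
        using q by (intro mult_mono green_decay[OF assms(1)] C) auto
      then show "norm (green w y x * c x) \<le> h (x - y)"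
        using green_nonneg[OF assms(1), of y x] by (simp add: abs_mult h_def mult.commute)
    qed
    then show ?thesis by (simp only: infsum_translate(2) real_norm_def)
  qed
  then show "bdd (\<lambda>y. \<Sum>\<^sub>\<infinity>x. green w y x * c x)" by (rule bddI)
  fix y
  have "(\<Sum>\<^sub>\<infinity>x. green w y x * c x) =
      (\<Sum>\<^sub>\<infinity>x. of_bool (x = y) * c x + (\<Sum>e\<in>steps. w y e * (green w (y + e) x * c x)))"
    by (intro infsum_cong, subst green_eq[OF assms(1)]) (auto simp: algebra_simps sum_distrib_left)
  also have "\<dots> = (\<Sum>\<^sub>\<infinity>x. of_bool (x = y) * c x) + (\<Sum>\<^sub>\<infinity>x. \<Sum>e\<in>steps. w y e * (green w (y + e) x * c x))"
    by (intro infsum_add infsum_unit_at summable_on_sum summable_on_cmult_right s)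
  also have "(\<Sum>\<^sub>\<infinity>x. \<Sum>e\<in>steps. w y e * (green w (y + e) x * c x)) =
      (\<Sum>e\<in>steps. w y e * (\<Sum>\<^sub>\<infinity>x. green w (y + e) x * c x))"
    unfolding infsum_cmult_right'[symmetric]
    by (rule infsum_sum) (intro summable_on_cmult_right s)
  finally show "(\<Sum>\<^sub>\<infinity>x. green w y x * c x) = c y + step_op w (\<lambda>y. \<Sum>\<^sub>\<infinity>x. green w y x * c x) y"
    by (simp add: step_op_def infsum_unit_at)
qed

section \<open>Total Green function mass arriving at a site\<close>

definition mass :: "env \<Rightarrow> site \<Rightarrow> real" where
  "mass w x = (\<Sum>\<^sub>\<infinity>y. green w y x)"

lemma mass_eq:
  assumes "subkernel q w"
  shows "mass w x = 1 + (\<Sum>e\<in>steps. mass w (x - e) * w (x - e) e)"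
proof -
  have "mass w x = (\<Sum>\<^sub>\<infinity>y. of_bool (y = x) * 1 + (\<Sum>e\<in>steps. green w y (x - e) * w (x - e) e))"
    unfolding mass_def by (intro infsum_cong, subst green_last_step[OF assms]) simp
  also have "\<dots> = (\<Sum>\<^sub>\<infinity>y. of_bool (y = x) * 1) + (\<Sum>\<^sub>\<infinity>y. \<Sum>e\<in>steps. green w y (x - e) * w (x - e) e)"
    by (intro infsum_add infsum_unit_at summable_on_sum summable_on_cmult_left green_summable(1)[OF assms])
  also have "(\<Sum>\<^sub>\<infinity>y. \<Sum>e\<in>steps. green w y (x - e) * w (x - e) e) = (\<Sum>e\<in>steps. mass w (x - e) * w (x - e) e)"
    unfolding mass_def infsum_cmult_left'[symmetric]
    by (rule infsum_sum) (intro summable_on_cmult_left green_summable(1)[OF assms])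
  finally show ?thesis unfolding infsum_unit_at(1)[of x "\<lambda>_. 1"] .
qed

lemma mass_nonneg: "subkernel q w \<Longrightarrow> 0 \<le> mass w x"
  unfolding mass_def by (intro infsum_nonneg green_nonneg)

lemma mass_le:
  assumes "subkernel q w"
  shows "mass w x \<le> (\<Sum>\<^sub>\<infinity>y. q ^ rad y / (1 - q))"
proof -
  have q: "0 \<le> q" "q < 1" using kernelD[OF assms] by auto
  have "(\<lambda>x. q ^ rad x / (1 - q)) summable_on UNIV"
    unfolding divide_inverse by (intro summable_on_cmult_left summable_on_geometric_rad q)
  then have "(\<lambda>y. q ^ rad (x - y) / (1 - q)) summable_on UNIV"
    by (simp add: summable_on_translate[where f = "\<lambda>x. q ^ rad x / (1 - q)"])
  then have "mass w x \<le> (\<Sum>\<^sub>\<infinity>y. q ^ rad (x - y) / (1 - q))"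
    unfolding mass_def by (intro infsum_mono green_summable[OF assms] green_decay[OF assms])
  then show ?thesis by (simp add: infsum_translate[where f = "\<lambda>x. q ^ rad x / (1 - q)"])
qed

lemma mass_perturb:
  assumes "subkernel q w" "subkernel q w'" "\<And>x. x \<noteq> z \<Longrightarrow> w' x = w x"
  shows "mass w' x = mass w x + mass w' z * (\<Sum>e\<in>steps. (w' z e - w z e) * green w (z + e) x)"
  unfolding mass_def infsum_cmult_left'[symmetric]
  by (subst infsum_add[symmetric])
     (auto intro!: infsum_cong green_summable[OF assms(1)] green_summable[OF assms(2)] summable_on_cmult_left
        pot_perturb[OF assms(1,2) bdd_unit_at assms(3), folded green_def])

lemma mass_green_le:
  assumes "subkernel q w" "x \<noteq> z"
  shows "mass w z * green w z x / green w z z \<le> mass w x"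
proof -
  have g: "0 < green w z z" using green_diag_ge[OF assms(1), of z] by simp
  have "mass w z * (green w z x / green w z z) \<le> mass w x"
    unfolding mass_def infsum_cmult_left'[symmetric]
  proof (intro infsum_mono summable_on_cmult_left green_summable[OF assms(1)])
    show "green w y z * (green w z x / green w z z) \<le> green w y x" for y
      using green_product_le[OF assms, of y] g by (simp add: divide_le_eq mult.commute)
  qed
  then show ?thesis by simp
qed

subsection \<open>The mass as a function of the environment at two sites\<close>

definition damped :: "real \<Rightarrow> env \<Rightarrow> env" where
  "damped \<delta> \<omega> = (\<lambda>x e. \<delta> * \<omega> x e)"

text \<open>A symmetric relative distance, chosen because products, sums, nonnegative multiples and
  reciprocals preserve it.\<close>

definition comparable :: "real \<Rightarrow> real \<Rightarrow> real \<Rightarrow> bool" where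
  "comparable c a b \<longleftrightarrow> 0 \<le> a \<and> 0 \<le> b \<and> a \<le> c * b \<and> b \<le> c * a"

lemma comparable_mult:
  assumes "comparable c a b" "comparable d a' b'" "0 \<le> c" "0 \<le> d"
  shows "comparable (c * d) (a * a') (b * b')"
  using assms mult_mono[of a "c * b" a' "d * b'"] mult_mono[of b "c * a" b' "d * a'"]
  by (auto simp: comparable_def mult_ac)

lemma comparable_cmult: "comparable c a b \<Longrightarrow> 0 \<le> k \<Longrightarrow> comparable c (k * a) (k * b)"
  using mult_left_mono[of a "c * b" k] mult_left_mono[of b "c * a" k]
  by (auto simp: comparable_def mult_ac)

lemma comparable_add_const: "comparable c a b \<Longrightarrow> 0 \<le> k \<Longrightarrow> 1 \<le> c \<Longrightarrow> comparable c (k + a) (k + b)"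
  using mult_right_mono[of 1 c k] by (auto simp: comparable_def algebra_simps)

lemma comparable_inverse:
  assumes "comparable c a b" "0 < a" "0 < b"
  shows "comparable c (1 / a) (1 / b)"
  using assms by (auto simp: comparable_def field_simps)

lemma comparable_weaken: "comparable c a b \<Longrightarrow> c \<le> d \<Longrightarrow> comparable d a b"
  by (auto simp: comparable_def intro: order_trans[OF _ mult_right_mono])

lemma comparable_abs_diff: "comparable (1 + k) a b \<Longrightarrow> 0 \<le> k \<Longrightarrow> \<bar>a - b\<bar> \<le> k * b"
proof -
  assume a: "comparable (1 + k) a b" "0 \<le> k"
  show ?thesis
  proof (cases "b \<le> a")
    case False
    then have "k * a \<le> k * b" using a by (intro mult_left_mono) auto
    then show ?thesis using a False by (auto simp: comparable_def algebra_simps)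
  qed (use a in \<open>auto simp: comparable_def algebra_simps\<close>)
qed

lemma environmentsD:
  assumes "\<omega> \<in> environments"
  shows "0 \<le> \<omega> x e" "e \<notin> steps \<Longrightarrow> \<omega> x e = 0" "(\<Sum>e\<in>steps. \<omega> x e) = 1"
  using assms unfolding environments_def prob_vectors_def by blast+

lemma environments_nearD:
  assumes "\<omega> \<in> environments_near srw \<epsilon>"
  shows "\<omega> \<in> environments" "e \<in> steps \<Longrightarrow> \<bar>\<omega> x e - 1 / 4\<bar> \<le> \<epsilon>"
proof -
  show "\<omega> \<in> environments" using assms by (simp add: environments_near_def)
  assume "e \<in> steps"
  then have "\<bar>\<omega> x e - srw e\<bar> \<le> \<epsilon>" using assms unfolding environments_near_def by blast
  then show "\<bar>\<omega> x e - 1 / 4\<bar> \<le> \<epsilon>" using \<open>e \<in> steps\<close> by (simp add: srw_def)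
qed

lemma subkernel_damped:
  assumes "\<omega> \<in> environments" "0 \<le> \<delta>" "\<delta> < 1"
  shows "subkernel \<delta> (damped \<delta> \<omega>)"
  using environmentsD[OF assms(1)] assms(2,3)
  by (auto simp: subkernel_def damped_def simp flip: sum_distrib_left)

text \<open>The extreme ratio (1/4 + \<epsilon>) / (1/4 - \<epsilon>) is 1 + 8\<epsilon> to first
  order; the factor 10 leaves room for \<epsilon> \<le> 1/1000.\<close>

lemma close_near:
  assumes "\<omega> \<in> environments_near srw \<epsilon>" "\<omega>' \<in> environments_near srw \<epsilon>" "0 < \<epsilon>" "\<epsilon> \<le> 1 / 1000"
  shows "close (1 + 10 * \<epsilon>) (\<omega> x) (\<omega>' x)"
proof -
  have r: "a \<le> (1 + 10 * \<epsilon>) * b" if "\<bar>a - 1 / 4\<bar> \<le> \<epsilon>" "\<bar>b - 1 / 4\<bar> \<le> \<epsilon>" for a b :: real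
  proof -
    have "10 * \<epsilon> * (1 / 4 - \<epsilon>) \<le> 10 * \<epsilon> * b" using that assms by (intro mult_left_mono) auto
    moreover have "\<epsilon> * \<epsilon> \<le> \<epsilon> * (1 / 1000)" using assms by (intro mult_left_mono) auto
    ultimately show ?thesis using that by (simp add: algebra_simps)
  qed
  show ?thesis
    using assms environments_nearD[OF assms(1)] environments_nearD[OF assms(2)]
    by (auto simp: close_def r environmentsD)
qed

lemma comparable_infsum:
  assumes "f summable_on UNIV" "g summable_on UNIV" "\<And>x. comparable c (f x) (g x)"
  shows "comparable c (\<Sum>\<^sub>\<infinity>x. f x) (\<Sum>\<^sub>\<infinity>x. g x)"
  unfolding comparable_def infsum_cmult_right'[symmetric]
  using assms(3) by (auto simp: comparable_def intro!: infsum_nonneg infsum_mono summable_on_cmult_right assms)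

locale site_change =
  fixes \<delta> \<epsilon> :: real and z :: site and \<omega> \<omega>' :: env
  assumes \<delta>: "0 \<le> \<delta>" "\<delta> < 1" and \<epsilon>: "0 < \<epsilon>" "\<epsilon> \<le> 1 / 1000"
    and near: "\<omega> \<in> environments_near srw \<epsilon>" "\<omega>' \<in> environments_near srw \<epsilon>"
    and off: "\<And>x. x \<noteq> z \<Longrightarrow> \<omega>' x = \<omega> x"
begin

abbreviation (input) "\<rho> \<equiv> 1 + 10 * \<epsilon>"
abbreviation "W \<equiv> damped \<delta> \<omega>"
abbreviation "W' \<equiv> damped \<delta> \<omega>'"

lemma env: "\<omega> \<in> environments" "\<omega>' \<in> environments"
  using near by (auto dest: environments_nearD)

lemma sub: "subkernel \<delta> W" "subkernel \<delta> W'"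
  using env \<delta> by (auto intro: subkernel_damped)

lemma sym: "site_change \<delta> \<epsilon> z \<omega>' \<omega>"
  using \<delta> \<epsilon> near off by unfold_locales auto

lemma pot_le: "bdd c \<Longrightarrow> (\<And>x. 0 \<le> c x) \<Longrightarrow> pot W' c y \<le> \<rho>\<^sup>2 * pot W c y"
  using off \<epsilon> by (intro pot_oscillation[OF sub, where z = z and s = "\<omega> z" and t = "\<omega>' z"])
    (auto simp: damped_def intro!: close_near near)

lemma pot_kill_le:
  assumes "x \<noteq> z" "bdd c" "\<And>x. 0 \<le> c x"
  shows "pot (kill x W') c y \<le> \<rho>\<^sup>2 * pot (kill x W) c y"
  using off \<epsilon> assms
  by (intro pot_oscillation[OF sub[THEN kernel_kill], where z = z and s = "\<omega> z" and t = "\<omega>' z"])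
    (auto simp: damped_def kill_def intro!: close_near near)

end

context site_change
begin

lemma pot_comparable: "bdd c \<Longrightarrow> (\<And>x. 0 \<le> c x) \<Longrightarrow> comparable (\<rho>\<^sup>2) (pot W' c y) (pot W c y)"
  using pot_le site_change.pot_le[OF sym] pot_nonneg[OF sub(1)] pot_nonneg[OF sub(2)]
  by (simp add: comparable_def)

lemma pot_kill_comparable:
  "x \<noteq> z \<Longrightarrow> bdd c \<Longrightarrow> (\<And>x. 0 \<le> c x) \<Longrightarrow> comparable (\<rho>\<^sup>2) (pot (kill x W') c y) (pot (kill x W) c y)"
  using pot_kill_le site_change.pot_kill_le[OF sym] pot_nonneg[OF sub(1)[THEN kernel_kill]]
    pot_nonneg[OF sub(2)[THEN kernel_kill]]
  by (simp add: comparable_def)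

lemma green_comparable: "comparable (\<rho>\<^sup>2) (green W' y x) (green W y x)"
  unfolding green_def by (rule pot_comparable) (auto simp: unit_at_def)

lemma green_kill_comparable: "x \<noteq> z \<Longrightarrow> comparable (\<rho>\<^sup>2) (green (kill x W') y u) (green (kill x W) y u)"
  unfolding green_def by (rule pot_kill_comparable) (auto simp: unit_at_def)

lemma mass_comparable: "comparable (\<rho>\<^sup>2) (mass W' x) (mass W x)"
  unfolding mass_def using sub by (intro comparable_infsum green_summable green_comparable) auto

lemma sum_W: "(\<Sum>e\<in>steps. W y e) = \<delta>" "(\<Sum>e\<in>steps. W' y e) = \<delta>"
  using env by (simp_all add: damped_def environmentsD flip: sum_distrib_left)

text \<open>Comparable hitting probabilities need not have comparable complements, which may be
  small. Written as \<open>1 - \<delta>\<close> plus \<open>\<delta>\<close> times a potential of a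
  nonnegative source, the complement inherits the relative bound directly.\<close>

lemma escape_comparable:
  assumes "x \<noteq> z"
  shows "comparable (\<rho>\<^sup>2) (1 - \<delta> * green (kill x W') y x) (1 - \<delta> * green (kill x W) y x)"
proof -
  let ?c = "\<lambda>y. if y = x then 0 else 1 - \<delta>"
  have e: "1 - \<delta> * green (kill x W) y x = (1 - \<delta>) + \<delta> * pot (kill x W) ?c y"
    "1 - \<delta> * green (kill x W') y x = (1 - \<delta>) + \<delta> * pot (kill x W') ?c y"
    unfolding escape_eq[OF sub(1), of x y, unfolded sum_W, symmetric]
      escape_eq[OF sub(2), of x y, unfolded sum_W, symmetric] by (simp_all add: algebra_simps)
  have "bdd ?c" by (rule bddI[where C = "1 - \<delta>"]) (use \<delta> in auto)
  then show ?thesis unfolding e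
    using \<delta> \<epsilon> by (intro comparable_add_const comparable_cmult pot_kill_comparable assms) auto
qed

end

text \<open>The expected discounted number of visits to \<open>z\<close> from which the walk goes on to reach \<open>x\<close>,
  each counted with the number of subsequent visits to \<open>x\<close> and divided by the number of returns to \<open>z\<close>.\<close>

definition through :: "real \<Rightarrow> env \<Rightarrow> site \<Rightarrow> site \<Rightarrow> real" where
  "through \<delta> \<omega> z x = mass (damped \<delta> \<omega>) z * green (damped \<delta> \<omega>) z x / green (damped \<delta> \<omega>) z z"

context site_change
begin

text \<open>Up to a summand independent of \<open>e\<close>, the mass difference at \<open>x\<close>
  has coefficients \<open>A - B\<close>: \<open>A\<close> counts arrivals at \<open>x\<close> from
  \<open>z + e\<close> before a return to \<open>z\<close>, \<open>B\<close> the visits to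
  \<open>x\<close> lost when the walk does not return.\<close>

definition A :: "site \<Rightarrow> site \<Rightarrow> real" where
  "A x e = mass W' z * (\<delta> * green (kill z W) (z + e) x)"

definition B :: "site \<Rightarrow> site \<Rightarrow> real" where
  "B x e = mass W' z * ((1 - \<delta> * green (kill z W) (z + e) z) * green W z x)"

text \<open>Both environments have total jump probability 1 at \<open>z\<close>, so the large common
  term \<open>mass W' z * green W z x\<close> cancels.\<close>

lemma mass_diff:
  assumes "x \<noteq> z"
  shows "mass W' x - mass W x = (\<Sum>e\<in>steps. (\<omega>' z e - \<omega> z e) * (A x e - B x e))"
proof -
  have z: "(\<Sum>e\<in>steps. \<omega>' z e - \<omega> z e) = 0"
    using env by (simp add: sum_subtractf environmentsD)
  have "mass W' x - mass W x = mass W' z * (\<Sum>e\<in>steps. (W' z e - W z e) * green W (z + e) x)"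
    using off by (subst mass_perturb[OF sub, of z]) (auto simp: damped_def)
  also have "\<dots> = (\<Sum>e\<in>steps. (\<omega>' z e - \<omega> z e) * (mass W' z * (\<delta> * green W (z + e) x)))"
    by (simp add: sum_distrib_left damped_def algebra_simps)
  also have "\<dots> = (\<Sum>e\<in>steps. (\<omega>' z e - \<omega> z e) * (A x e - B x e + mass W' z * green W z x))"
    by (intro sum.cong refl, subst green_kill[OF sub(1) assms]) (simp add: A_def B_def algebra_simps)
  also have "\<dots> = (\<Sum>e\<in>steps. (\<omega>' z e - \<omega> z e) * (A x e - B x e))"
    unfolding distrib_left[of _ "_ - _"] sum.distrib sum_distrib_right[symmetric] z by simp
  finally show ?thesis .
qed

lemma A_nonneg: "0 \<le> A x e"
  using \<delta> mass_nonneg[OF sub(2)] green_nonneg[OF kernel_kill[OF sub(1)]] by (simp add: A_def)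

lemma B_nonneg: "0 \<le> B x e"
proof -
  have "\<delta> * green (kill z W) (z + e) z \<le> 1 * 1"
    using \<delta> green_kill_le_1[OF sub(1)] green_nonneg[OF kernel_kill[OF sub(1)]]
    by (intro mult_mono) auto
  then show ?thesis
    using mass_nonneg[OF sub(2)] green_nonneg[OF sub(1)] by (simp add: B_def)
qed

text \<open>Both averages coincide: \<open>green W z x\<close> times the probability of not
  returning to \<open>z\<close> is the expected number of visits to \<open>x\<close> before a
  return, and that probability is \<open>1 / green W z z\<close>.\<close>

lemma sum_A_B:
  assumes "x \<noteq> z"
  shows "(\<Sum>e\<in>steps. \<omega> z e * (A x e + B x e)) = 2 * (mass W' z * green W z x / green W z z)"
proof -
  define h where "h = (\<Sum>e\<in>steps. W z e * green (kill z W) (z + e) z)"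
  define g where "g = (\<Sum>e\<in>steps. W z e * green (kill z W) (z + e) x)"
  have c: "green W z z * (1 - h) = 1"
    using green_kill_centre[OF sub(1), of z] by (simp add: h_def)
  have "(unit_at x)(z := 0) = unit_at x" using assms by (auto simp: unit_at_def)
  then have g: "green W z x * (1 - h) = g"
    using pot_kill_centre[OF sub(1) bdd_unit_at, of x z] assms by (simp add: g_def h_def green_def unit_at_def)
  have "(\<Sum>e\<in>steps. \<omega> z e * A x e) = mass W' z * g"
    by (simp add: A_def g_def sum_distrib_left damped_def mult_ac)
  moreover have "(\<Sum>e\<in>steps. \<omega> z e * B x e) = mass W' z * green W z x * ((\<Sum>e\<in>steps. \<omega> z e) - h)"
    unfolding B_def h_def sum_subtractf[symmetric] sum_distrib_left
    by (intro sum.cong refl) (simp add: damped_def algebra_simps)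
  moreover have "1 - h = 1 / green W z z"
    using c by (metis nonzero_mult_div_cancel_left mult_zero_left zero_neq_one)
  ultimately have "(\<Sum>e\<in>steps. \<omega> z e * A x e) = mass W' z * green W z x / green W z z"
    "(\<Sum>e\<in>steps. \<omega> z e * B x e) = mass W' z * green W z x / green W z z"
    using environmentsD(3)[OF env(1)] by (simp_all flip: g)
  then show ?thesis by (simp add: distrib_left sum.distrib)
qed

lemma sum_A_B_le:
  assumes "x \<noteq> z"
  shows "(\<Sum>e\<in>steps. A x e + B x e) \<le> (103 / 10) * through \<delta> \<omega> z x"
proof -
  have g: "1 \<le> green W z z" by (rule green_diag_ge[OF sub(1)])
  have t: "0 \<le> green W z x / green W z z" using green_nonneg[OF sub(1), of z] g by simp
  have m: "mass W' z \<le> \<rho>\<^sup>2 * mass W z" using mass_comparable by (simp add: comparable_def)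
  \<comment> \<open>Each \<open>\<omega> z e\<close> is at least 1/5, so the weighted identity
    controls the plain sum; 103/10 exceeds 10 times 1.01 squared.\<close>
  have "(\<Sum>e\<in>steps. 1 / 5 * (A x e + B x e)) \<le> (\<Sum>e\<in>steps. \<omega> z e * (A x e + B x e))"
  proof (intro sum_mono mult_right_mono add_nonneg_nonneg A_nonneg B_nonneg)
    show "1 / 5 \<le> \<omega> z e" if "e \<in> steps" for e
      using environments_nearD(2)[OF near(1) that, of z] \<epsilon> by (simp add: abs_le_iff)
  qed
  then have "(\<Sum>e\<in>steps. A x e + B x e) \<le> 10 * (mass W' z * (green W z x / green W z z))"
    unfolding sum_A_B[OF assms] by (simp flip: sum_divide_distrib)
  also have "\<dots> \<le> 10 * ((\<rho>\<^sup>2 * mass W z) * (green W z x / green W z z))"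
    by (intro mult_left_mono mult_right_mono m t) simp
  also have "\<dots> = 10 * \<rho>\<^sup>2 * through \<delta> \<omega> z x" by (simp add: through_def)
  also have "\<dots> \<le> (103 / 10) * through \<delta> \<omega> z x"
  proof (rule mult_right_mono)
    have "\<rho>\<^sup>2 \<le> (1 + 10 / 1000)\<^sup>2" using \<epsilon> by (intro power_mono) auto
    then show "10 * \<rho>\<^sup>2 \<le> 103 / 10" by (simp add: power2_eq_square)
    show "0 \<le> through \<delta> \<omega> z x"
      using t mass_nonneg[OF sub(1)] by (simp add: through_def flip: times_divide_eq_right)
  qed
  finally show ?thesis .
qed

lemma abs_diff_le: "e \<in> steps \<Longrightarrow> \<bar>\<omega>' z e - \<omega> z e\<bar> \<le> 2 * \<epsilon>"
  using environments_nearD(2)[OF near(1), of e z] environments_nearD(2)[OF near(2), of e z] by linarith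

lemma mass_diff_le:
  assumes "x \<noteq> z"
  shows "\<bar>mass W' x - mass W x\<bar> \<le> 21 * \<epsilon> * through \<delta> \<omega> z x"
proof -
  have "\<bar>mass W' x - mass W x\<bar> \<le> (\<Sum>e\<in>steps. 2 * \<epsilon> * (A x e + B x e))"
    unfolding mass_diff[OF assms]
    unfolding abs_mult[symmetric]
  proof (intro order_trans[OF sum_abs] sum_mono, unfold abs_mult, intro mult_mono abs_diff_le)
    show "\<bar>A x e - B x e\<bar> \<le> A x e + B x e" for e using A_nonneg[of x e] B_nonneg[of x e] by linarith
  qed (use \<epsilon> in auto)
  also have "\<dots> \<le> 2 * \<epsilon> * ((103 / 10) * through \<delta> \<omega> z x)"
    unfolding sum_distrib_left[symmetric] using \<epsilon> by (intro mult_left_mono sum_A_B_le assms) auto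
  also have "\<dots> \<le> 21 * \<epsilon> * through \<delta> \<omega> z x"
    using order_trans[OF sum_nonneg sum_A_B_le[OF assms]] A_nonneg B_nonneg \<epsilon>
    by (simp add: zero_le_mult_iff)
  finally show ?thesis .
qed

end

lemma (in site_change) \<rho>_pow:
  "\<rho>\<^sup>2 * \<rho>\<^sup>2 \<le> 1 + 70 * \<epsilon>" "\<rho>\<^sup>2 * (\<rho>\<^sup>2 * \<rho>\<^sup>2) \<le> 1 + 70 * \<epsilon>"
proof -
  have e: "\<epsilon> * \<epsilon> \<le> \<epsilon> * (1 / 1000)" using \<epsilon> by (intro mult_left_mono) auto
  have 2: "\<rho>\<^sup>2 \<le> 1 + 21 * \<epsilon>" using e \<epsilon> by (simp add: power2_eq_square algebra_simps)
  have "\<rho>\<^sup>2 * \<rho>\<^sup>2 \<le> (1 + 21 * \<epsilon>) * (1 + 21 * \<epsilon>)" using 2 \<epsilon> by (intro mult_mono) auto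
  also have "\<dots> \<le> 1 + 43 * \<epsilon>" using e \<epsilon> by (simp add: algebra_simps)
  finally have 4: "\<rho>\<^sup>2 * \<rho>\<^sup>2 \<le> 1 + 43 * \<epsilon>" .
  then show "\<rho>\<^sup>2 * \<rho>\<^sup>2 \<le> 1 + 70 * \<epsilon>" using \<epsilon> by simp
  have "\<rho>\<^sup>2 * (\<rho>\<^sup>2 * \<rho>\<^sup>2) \<le> (1 + 21 * \<epsilon>) * (1 + 43 * \<epsilon>)" using 2 4 \<epsilon> by (intro mult_mono) auto
  also have "\<dots> \<le> 1 + 70 * \<epsilon>" using e \<epsilon> by (simp add: algebra_simps)
  finally show "\<rho>\<^sup>2 * (\<rho>\<^sup>2 * \<rho>\<^sup>2) \<le> 1 + 70 * \<epsilon>" .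
qed

text \<open>Mixed second differences gain a further factor \<open>\<epsilon>\<close>, because \<open>A\<close> and \<open>B\<close> are
  products of potentials.\<close>

lemma mass_mixed_diff_le:
  assumes "site_change \<delta> \<epsilon> z \<omega> \<omega>'" "site_change \<delta> \<epsilon> x \<omega> \<sigma>" "x \<noteq> z"
  defines "\<sigma>' \<equiv> \<omega>'(x := \<sigma> x)"
  shows "\<bar>(mass (damped \<delta> \<sigma>') x - mass (damped \<delta> \<sigma>) x) - (mass (damped \<delta> \<omega>') x - mass (damped \<delta> \<omega>) x)\<bar>
    \<le> 1500 * \<epsilon>\<^sup>2 * through \<delta> \<omega> z x"
proof -
  interpret z: site_change \<delta> \<epsilon> z \<omega> \<omega>' by fact
  interpret x: site_change \<delta> \<epsilon> x \<omega> \<sigma> by fact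
  have \<sigma>': "\<sigma>' \<in> environments_near srw \<epsilon>"
    using z.near(2) x.near(2) by (auto simp: \<sigma>'_def environments_near_def environments_def simp del: split_paired_All)
  interpret z': site_change \<delta> \<epsilon> z \<sigma> \<sigma>'
    using z.\<delta> z.\<epsilon> z.off x.off \<sigma>' x.near by unfold_locales (auto simp: \<sigma>'_def)
  interpret x': site_change \<delta> \<epsilon> x \<omega>' \<sigma>'
    using z.\<delta> z.\<epsilon> z.off x.off \<sigma>' z.near by unfold_locales (auto simp: \<sigma>'_def)
  let ?\<rho> = "1 + 10 * \<epsilon>"
  \<comment> \<open>The coefficients at \<open>\<omega>\<close> and at \<open>\<sigma>\<close>
    differ by a change at \<open>x\<close> only. Their factors are masses, Green functions and
    escape probabilities, each moving by a relative O(\<epsilon>).\<close>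
  have A: "comparable (?\<rho>\<^sup>2 * ?\<rho>\<^sup>2) (z'.A x e) (z.A x e)" for e
    unfolding z.A_def z'.A_def
    using z.\<delta> assms(3)
    by (intro comparable_mult comparable_cmult x'.mass_comparable x.green_kill_comparable) auto
  have B: "comparable (?\<rho>\<^sup>2 * (?\<rho>\<^sup>2 * ?\<rho>\<^sup>2)) (z'.B x e) (z.B x e)" for e
    unfolding z.B_def z'.B_def
    using z.\<delta> assms(3)
    by (intro comparable_mult x'.mass_comparable x.green_comparable x.escape_comparable) auto
  have AB: "\<bar>(z'.A x e - z'.B x e) - (z.A x e - z.B x e)\<bar> \<le> 70 * \<epsilon> * (z.A x e + z.B x e)" for e
    using comparable_abs_diff[OF comparable_weaken[OF A[of e] z.\<rho>_pow(1)]]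
      comparable_abs_diff[OF comparable_weaken[OF B[of e] z.\<rho>_pow(2)]] z.\<epsilon>
    by (simp add: distrib_left)
  have d: "\<sigma>' z e - \<sigma> z e = \<omega>' z e - \<omega> z e" for e
    using assms(3) x.off[of z] by (simp add: \<sigma>'_def)
  have "\<bar>(mass (damped \<delta> \<sigma>') x - mass (damped \<delta> \<sigma>) x) - (mass (damped \<delta> \<omega>') x - mass (damped \<delta> \<omega>) x)\<bar> =
      \<bar>\<Sum>e\<in>steps. (\<omega>' z e - \<omega> z e) * ((z'.A x e - z'.B x e) - (z.A x e - z.B x e))\<bar>"
    unfolding z.mass_diff[OF assms(3)] z'.mass_diff[OF assms(3)] d
    by (simp add: right_diff_distrib sum_subtractf)
  also have "\<dots> \<le> (\<Sum>e\<in>steps. 2 * \<epsilon> * (70 * \<epsilon> * (z.A x e + z.B x e)))"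
    using AB z.\<epsilon> by (intro order_trans[OF sum_abs] sum_mono) (auto simp only: abs_mult intro!: mult_mono z.abs_diff_le)
  also have "\<dots> = 140 * \<epsilon>\<^sup>2 * (\<Sum>e\<in>steps. z.A x e + z.B x e)"
    by (simp add: sum_distrib_left power2_eq_square mult_ac)
  \<comment> \<open>140 is 2 from the change at \<open>z\<close> times 70 from the relative change
    of the coefficients; 140 times 10.3 is 1442.\<close>
  also have "\<dots> \<le> 140 * \<epsilon>\<^sup>2 * ((103 / 10) * through \<delta> \<omega> z x)"
    by (intro mult_left_mono z.sum_A_B_le assms) auto
  also have "\<dots> \<le> 1500 * \<epsilon>\<^sup>2 * through \<delta> \<omega> z x"
  proof -
    have "0 \<le> through \<delta> \<omega> z x"
      using order_trans[OF sum_nonneg z.sum_A_B_le[OF assms(3)]] z.A_nonneg z.B_nonneg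
      by (simp add: zero_le_mult_iff)
    then show ?thesis using z.\<epsilon> by (simp add: mult_left_mono mult_right_mono)
  qed
  finally show ?thesis .
qed

lemma through_bounds:
  assumes "\<omega> \<in> environments" "0 \<le> \<delta>" "\<delta> < 1"
  shows "0 \<le> through \<delta> \<omega> z x" "x \<noteq> z \<Longrightarrow> through \<delta> \<omega> z x \<le> mass (damped \<delta> \<omega>) x"
    "through \<delta> \<omega> z x \<le> mass (damped \<delta> \<omega>) z * green (damped \<delta> \<omega>) z x"
proof -
  note s = subkernel_damped[OF assms]
  have g: "1 \<le> green (damped \<delta> \<omega>) z z" by (rule green_diag_ge[OF s])
  have n: "0 \<le> mass (damped \<delta> \<omega>) z * green (damped \<delta> \<omega>) z x"
    using green_nonneg[OF s] mass_nonneg[OF s] by simp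
  show "0 \<le> through \<delta> \<omega> z x" unfolding through_def using g n by simp
  show "x \<noteq> z \<Longrightarrow> through \<delta> \<omega> z x \<le> mass (damped \<delta> \<omega>) x"
    unfolding through_def by (rule mass_green_le[OF s])
  show "through \<delta> \<omega> z x \<le> mass (damped \<delta> \<omega>) z * green (damped \<delta> \<omega>) z x"
    unfolding through_def using frac_le[OF n order_refl _ g] by simp
qed

lemma (in site_change) through_comparable: "comparable (1 + 70 * \<epsilon>) (through \<delta> \<omega>' u x) (through \<delta> \<omega> u x)"
proof -
  have g: "1 \<le> green W u u" "1 \<le> green W' u u" using sub by (auto intro: green_diag_ge)
  have "comparable (\<rho>\<^sup>2 * (\<rho>\<^sup>2 * \<rho>\<^sup>2)) (mass W' u * (green W' u x * (1 / green W' u u)))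
      (mass W u * (green W u x * (1 / green W u u)))"
    using g by (intro comparable_mult mass_comparable green_comparable comparable_inverse) auto
  from comparable_weaken[OF this \<rho>_pow(2)] show ?thesis by (simp add: through_def)
qed

section \<open>Green functions of translation-invariant kernels\<close>

text \<open>The argument is the starting point and the target is the origin. Under a drift to the
  right the values are therefore small where \<open>fst x\<close> is large and positive.\<close>

definition cgreen :: "(site \<Rightarrow> real) \<Rightarrow> site \<Rightarrow> real" where
  "cgreen k x = green (\<lambda>_. k) x 0"

definition cmass :: "(site \<Rightarrow> real) \<Rightarrow> real" where
  "cmass k = (\<Sum>e\<in>steps. k e)"

locale const_kernel =
  fixes k :: "site \<Rightarrow> real"
  assumes nonneg: "\<And>e. 0 \<le> k e" and mass_less: "cmass k < 1"
begin

lemma sub: "subkernel (cmass k) (\<lambda>_. k)"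
  using nonneg mass_less by (auto simp: subkernel_def cmass_def sum_nonneg)

lemma eq: "cgreen k x = of_bool (x = 0) + (\<Sum>e\<in>steps. k e * cgreen k (x + e))"
  unfolding cgreen_def by (rule green_eq[OF sub])

lemma green_translate: "green (\<lambda>_. k) y x = cgreen k (y - x)"
  unfolding green_def
proof (rule pot_unique[OF sub bdd_unit_at, symmetric])
  show "bdd (\<lambda>y. cgreen k (y - x))"
    unfolding cgreen_def green_def by (rule bdd_shift) (rule bdd_pot[OF sub bdd_unit_at])
  show "cgreen k (y - x) = unit_at x y + step_op (\<lambda>_. k) (\<lambda>y. cgreen k (y - x)) y" for y
    by (subst eq) (simp add: unit_at_def step_op_def algebra_simps)
qed

lemma cgreen_nonneg: "0 \<le> cgreen k x"
  unfolding cgreen_def by (rule green_nonneg[OF sub])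

lemma cgreen_summable: "cgreen k summable_on UNIV"
  using green_summable(1)[OF sub, of 0] by (simp add: cgreen_def[abs_def])

lemma cgreen_bdd: "bdd (cgreen k)"
  by (rule bdd_summable[OF cgreen_summable])

lemma cgreen_0_ge: "1 \<le> cgreen k 0"
  unfolding cgreen_def by (rule green_diag_ge[OF sub])

lemma shift_summable: "(\<lambda>x. cgreen k (x + e)) summable_on UNIV"
  using cgreen_summable by (simp only: summable_on_translate(3))

lemma product_summable: "(\<lambda>x. cgreen k (x + e) * cgreen k (x + e')) summable_on UNIV"
  by (intro summable_on_bdd_mult shift_summable bdd_shift[OF cgreen_bdd])

lemma sq_summable: "(\<lambda>x. (cgreen k x)\<^sup>2) summable_on UNIV"
  using product_summable[of 0 0] by (simp add: power2_eq_square)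

lemma grad_summable: "(\<lambda>x. cgreen k (x + e) - cgreen k x) summable_on UNIV"
  using summable_on_add[OF shift_summable[of e] summable_on_cmult_right[OF cgreen_summable, of "-1"]] by simp

lemma grad_sq_summable: "(\<lambda>x. (cgreen k (x + e) - cgreen k x)\<^sup>2) summable_on UNIV"
  unfolding power2_eq_square by (intro summable_on_bdd_mult grad_summable bdd_summable)

text \<open>Multiply the first-step equation by \<open>cgreen k\<close> and sum. Counting measure is
  translation invariant, so shifted square sums agree and each correlation is expressed by a squared
  gradient. The argument uses no symmetry of \<open>k\<close> and thus tolerates a drift.\<close>

theorem energy:
  "(\<Sum>e\<in>steps. k e * (\<Sum>\<^sub>\<infinity>x. (cgreen k (x + e) - cgreen k x)\<^sup>2)) +
    2 * (1 - cmass k) * (\<Sum>\<^sub>\<infinity>x. (cgreen k x)\<^sup>2) = 2 * cgreen k 0"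
proof -
  define S where "S = (\<Sum>\<^sub>\<infinity>x. (cgreen k x)\<^sup>2)"
  define C where "C e = (\<Sum>\<^sub>\<infinity>x. cgreen k (x + e) * cgreen k x)" for e
  have Ss: "(\<Sum>\<^sub>\<infinity>x. (cgreen k (x + e))\<^sup>2) = S" for e
    unfolding S_def by (rule infsum_translate(3)[where f = "\<lambda>x. (cgreen k x)\<^sup>2"])
  have sq: "(\<lambda>x. (cgreen k (x + e))\<^sup>2) summable_on UNIV" for e
    using product_summable[of e e] by (simp add: power2_eq_square)
  have pr: "(\<lambda>x. cgreen k (x + e) * cgreen k x) summable_on UNIV" for e
    using product_summable[of e 0] by simp
  have "S = (\<Sum>\<^sub>\<infinity>x. of_bool (x = 0) * cgreen k x + (\<Sum>e\<in>steps. k e * (cgreen k (x + e) * cgreen k x)))"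
    unfolding S_def power2_eq_square
    by (intro infsum_cong, subst (1) eq) (simp add: algebra_simps sum_distrib_left)
  also have "\<dots> = (\<Sum>\<^sub>\<infinity>x. of_bool (x = 0) * cgreen k x) + (\<Sum>\<^sub>\<infinity>x. \<Sum>e\<in>steps. k e * (cgreen k (x + e) * cgreen k x))"
    by (intro infsum_add infsum_unit_at summable_on_sum summable_on_cmult_right pr)
  also have "(\<Sum>\<^sub>\<infinity>x. \<Sum>e\<in>steps. k e * (cgreen k (x + e) * cgreen k x)) = (\<Sum>e\<in>steps. k e * C e)"
    unfolding C_def infsum_cmult_right'[symmetric] by (intro infsum_sum summable_on_cmult_right pr)
  finally have S: "S = cgreen k 0 + (\<Sum>e\<in>steps. k e * C e)" by (simp add: infsum_unit_at)
  have D: "(\<Sum>\<^sub>\<infinity>x. (cgreen k (x + e) - cgreen k x)\<^sup>2) = 2 * S - 2 * C e" for e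
  proof -
    have "(\<Sum>\<^sub>\<infinity>x. (cgreen k (x + e) - cgreen k x)\<^sup>2) =
        (\<Sum>\<^sub>\<infinity>x. ((cgreen k (x + e))\<^sup>2 + (cgreen k x)\<^sup>2) + (- 2) * (cgreen k (x + e) * cgreen k x))"
      by (intro infsum_cong) (simp add: power2_eq_square algebra_simps)
    also have "\<dots> = (\<Sum>\<^sub>\<infinity>x. (cgreen k (x + e))\<^sup>2 + (cgreen k x)\<^sup>2) + (\<Sum>\<^sub>\<infinity>x. (- 2) * (cgreen k (x + e) * cgreen k x))"
      by (intro infsum_add summable_on_add summable_on_cmult_right sq sq_summable pr)
    also have "(\<Sum>\<^sub>\<infinity>x. (cgreen k (x + e))\<^sup>2 + (cgreen k x)\<^sup>2) = S + S"
      by (subst infsum_add[OF sq sq_summable]) (simp add: Ss S_def[symmetric])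
    finally show ?thesis by (simp add: C_def infsum_cmult_right' infsum_uminus)
  qed
  have "(\<Sum>e\<in>steps. k e * (2 * S - 2 * C e)) = (\<Sum>e\<in>steps. 2 * S * k e - 2 * (k e * C e))"
    by (intro sum.cong) (simp_all add: algebra_simps)
  also have "\<dots> = 2 * S * cmass k - 2 * (\<Sum>e\<in>steps. k e * C e)"
    unfolding cmass_def sum_subtractf sum_distrib_left[symmetric] ..
  also have "\<dots> = 2 * S * cmass k - 2 * (S - cgreen k 0)" using S by simp
  finally show ?thesis unfolding D S_def[symmetric] by (simp add: algebra_simps)
qed

lemma sq_le: "(1 - cmass k) * (\<Sum>\<^sub>\<infinity>x. (cgreen k x)\<^sup>2) \<le> cgreen k 0"
proof -
  have "0 \<le> (\<Sum>e\<in>steps. k e * (\<Sum>\<^sub>\<infinity>x. (cgreen k (x + e) - cgreen k x)\<^sup>2))"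
    by (intro sum_nonneg mult_nonneg_nonneg nonneg infsum_nonneg) simp
  then show ?thesis using energy[unfolded mult.assoc] by linarith
qed

lemma grad_sq_le:
  shows "(\<Sum>e\<in>steps. k e * (\<Sum>\<^sub>\<infinity>x. (cgreen k (x + e) - cgreen k x)\<^sup>2)) \<le> 2 * cgreen k 0"
proof -
  have "0 \<le> (1 - cmass k) * (\<Sum>\<^sub>\<infinity>x. (cgreen k x)\<^sup>2)"
    using mass_less by (intro mult_nonneg_nonneg infsum_nonneg) auto
  then show ?thesis using energy[unfolded mult.assoc] by linarith
qed

end

lemma infsum_Cauchy_Schwarz:
  fixes f g :: "'a \<Rightarrow> real"
  assumes "(\<lambda>x. (f x)\<^sup>2) summable_on UNIV" "(\<lambda>x. (g x)\<^sup>2) summable_on UNIV"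
  shows "(\<lambda>x. \<bar>f x * g x\<bar>) summable_on UNIV"
    "(\<Sum>\<^sub>\<infinity>x. \<bar>f x * g x\<bar>) \<le> sqrt (\<Sum>\<^sub>\<infinity>x. (f x)\<^sup>2) * sqrt (\<Sum>\<^sub>\<infinity>x. (g x)\<^sup>2)"
proof -
  have "\<bar>f x * g x\<bar> \<le> (f x)\<^sup>2 + (g x)\<^sup>2" for x
    using sum_squares_bound[of "\<bar>f x\<bar>" "\<bar>g x\<bar>"] abs_ge_zero[of "f x * g x"] unfolding abs_mult power2_abs by linarith
  then show s: "(\<lambda>x. \<bar>f x * g x\<bar>) summable_on UNIV"
    by (intro summable_on_comparison_test[OF summable_on_add[OF assms]]) auto
  show "(\<Sum>\<^sub>\<infinity>x. \<bar>f x * g x\<bar>) \<le> sqrt (\<Sum>\<^sub>\<infinity>x. (f x)\<^sup>2) * sqrt (\<Sum>\<^sub>\<infinity>x. (g x)\<^sup>2)"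
  proof (rule infsum_le_finite_sums[OF s])
    fix F :: "'a set" assume F: "finite F"
    have "(\<Sum>x\<in>F. \<bar>f x * g x\<bar>) \<le> L2_set f F * L2_set g F"
      using L2_set_mult_ineq[of f g F] by (simp add: abs_mult)
    also have "\<dots> \<le> sqrt (\<Sum>\<^sub>\<infinity>x. (f x)\<^sup>2) * sqrt (\<Sum>\<^sub>\<infinity>x. (g x)\<^sup>2)"
      unfolding L2_set_def using F assms
      by (intro mult_mono real_sqrt_le_mono finite_sum_le_infsum) (auto intro: sum_nonneg infsum_nonneg)
    finally show "(\<Sum>x\<in>F. \<bar>f x * g x\<bar>) \<le> sqrt (\<Sum>\<^sub>\<infinity>x. (f x)\<^sup>2) * sqrt (\<Sum>\<^sub>\<infinity>x. (g x)\<^sup>2)" .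
  qed
qed

lemma infsum_Cauchy_Schwarz_abs:
  fixes f g :: "'a \<Rightarrow> real"
  assumes "(\<lambda>x. (f x)\<^sup>2) summable_on UNIV" "(\<lambda>x. (g x)\<^sup>2) summable_on UNIV"
    and "(\<Sum>\<^sub>\<infinity>x. (f x)\<^sup>2) \<le> a" "(\<Sum>\<^sub>\<infinity>x. (g x)\<^sup>2) \<le> b"
  shows "\<bar>\<Sum>\<^sub>\<infinity>x. f x * g x\<bar> \<le> sqrt (a * b)"
proof -
  note cs = infsum_Cauchy_Schwarz[OF assms(1,2)]
  have "\<bar>\<Sum>\<^sub>\<infinity>x. f x * g x\<bar> \<le> (\<Sum>\<^sub>\<infinity>x. \<bar>f x * g x\<bar>)"
    using norm_infsum_bound[of "\<lambda>x. f x * g x" UNIV] cs(1) by simp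
  also have "\<dots> \<le> sqrt a * sqrt b"
  proof (intro order_trans[OF cs(2)] mult_mono real_sqrt_le_mono assms(3,4))
    have "0 \<le> a" by (rule order_trans[OF infsum_nonneg assms(3)]) simp
    then show "0 \<le> sqrt a" by simp
    show "0 \<le> sqrt (\<Sum>\<^sub>\<infinity>x. (g x)\<^sup>2)" by (intro real_sqrt_ge_zero infsum_nonneg) simp
  qed
  finally show ?thesis by (simp add: real_sqrt_mult)
qed

subsection \<open>Comparison with killed simple random walk\<close>

text \<open>A drift of order \<epsilon> turns into killing of order \<epsilon>^2 under an
  exponential tilt; 1/25 is below the loss obtained in \<open>tilt_mass\<close> and has a convenient
  square root.\<close>

definition srw_rate :: "real \<Rightarrow> real" where
  "srw_rate \<epsilon> = \<epsilon>\<^sup>2 / 25"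

definition srw_killed :: "real \<Rightarrow> site \<Rightarrow> real" where
  "srw_killed \<kappa> e = (1 - \<kappa>) / 4"

lemma card_steps [simp]: "card steps = 4"
  by (simp add: steps_eq)

lemma srw_killed: "0 < \<kappa> \<Longrightarrow> \<kappa> \<le> 1 \<Longrightarrow> const_kernel (srw_killed \<kappa>)" "cmass (srw_killed \<kappa>) = 1 - \<kappa>"
  by (auto simp: const_kernel_def cmass_def srw_killed_def)

locale near_srw = const_kernel +
  fixes \<epsilon> :: real
  assumes \<epsilon>: "0 < \<epsilon>" "\<epsilon> \<le> 1 / 1000"
    and k_near: "\<And>e. e \<in> steps \<Longrightarrow> \<bar>k e - 1 / 4\<bar> \<le> 2 * \<epsilon>"
    and mass_near: "\<bar>cmass k - 1\<bar> \<le> \<epsilon>\<^sup>2"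
begin

abbreviation "\<kappa> \<equiv> srw_rate \<epsilon>"
abbreviation "k0 \<equiv> srw_killed (srw_rate \<epsilon>)"

lemma \<epsilon>2: "\<epsilon>\<^sup>2 \<le> \<epsilon> / 1000" "0 < \<epsilon>\<^sup>2"
  using \<epsilon> mult_left_mono[of \<epsilon> "1 / 1000" \<epsilon>] by (auto simp: power2_eq_square)

lemma \<kappa>: "0 < \<kappa>" "\<kappa> \<le> 1 / 1000"
  using \<epsilon> \<epsilon>2 by (auto simp: srw_rate_def)

sublocale k0: const_kernel k0
  using \<kappa> by (intro srw_killed) auto

lemma k0_sq_le: "\<epsilon>\<^sup>2 * (\<Sum>\<^sub>\<infinity>x. (cgreen k0 x)\<^sup>2) \<le> 25 * cgreen k0 0"
  using k0.sq_le by (simp add: srw_killed srw_rate_def)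

lemma k0_grad_sq_le: "(\<Sum>e\<in>steps. \<Sum>\<^sub>\<infinity>x. (cgreen k0 (x + e) - cgreen k0 x)\<^sup>2) \<le> 9 * cgreen k0 0"
proof -
  have "2 / 9 * (\<Sum>e\<in>steps. \<Sum>\<^sub>\<infinity>x. (cgreen k0 (x + e) - cgreen k0 x)\<^sup>2) \<le>
      (\<Sum>e\<in>steps. k0 e * (\<Sum>\<^sub>\<infinity>x. (cgreen k0 (x + e) - cgreen k0 x)\<^sup>2))"
    unfolding sum_distrib_left
    using \<kappa> by (intro sum_mono mult_right_mono infsum_nonneg) (auto simp: srw_killed_def)
  then show ?thesis using k0.grad_sq_le by linarith
qed

lemma grad_sq_le_each:
  assumes "e \<in> steps"
  shows "(\<Sum>\<^sub>\<infinity>x. (cgreen k (x + e) - cgreen k x)\<^sup>2) \<le> 9 * cgreen k 0"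
proof -
  have "2 / 9 * (\<Sum>\<^sub>\<infinity>x. (cgreen k (x + e) - cgreen k x)\<^sup>2) \<le> k e * (\<Sum>\<^sub>\<infinity>x. (cgreen k (x + e) - cgreen k x)\<^sup>2)"
    using k_near[OF assms] \<epsilon> by (intro mult_right_mono infsum_nonneg) (auto simp: abs_le_iff)
  also have "\<dots> \<le> (\<Sum>e\<in>steps. k e * (\<Sum>\<^sub>\<infinity>x. (cgreen k (x + e) - cgreen k x)\<^sup>2))"
    using assms nonneg by (intro member_le_sum mult_nonneg_nonneg infsum_nonneg) (auto simp: finite_steps)
  finally show ?thesis using grad_sq_le by simp
qed

text \<open>The defect of \<open>cgreen k0\<close> in the equation of \<open>k\<close>. As the two
  kernels have nearly equal mass, it is O(\<epsilon>) times gradients plus O(\<epsilon>^2) times the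
  function itself.\<close>

definition r :: "site \<Rightarrow> real" where
  "r x = (\<Sum>e\<in>steps. (k e - k0 e) * cgreen k0 (x + e))"

lemma r_summable: "r summable_on UNIV"
  unfolding r_def[abs_def] by (intro summable_on_sum summable_on_cmult_right k0.shift_summable)

lemma r_sq_summable: "(\<lambda>x. (r x)\<^sup>2) summable_on UNIV"
  unfolding power2_eq_square by (intro summable_on_bdd_mult r_summable bdd_summable)

text \<open>The energy identity bounds the gradients; the undifferentiated term is bounded through
  the killing of \<open>k0\<close>, which keeps \<epsilon>^2 times the square sum below 25 diagonal
  values. Altogether 72 * 9 + 8 * 25 = 848.\<close>

lemma r_sq_le: "(\<Sum>\<^sub>\<infinity>x. (r x)\<^sup>2) \<le> 1000 * \<epsilon>\<^sup>2 * cgreen k0 0"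
proof -
  define d where "d e x = cgreen k0 (x + e) - cgreen k0 x" for e x
  have k: "\<bar>k e - k0 e\<bar> \<le> 3 * \<epsilon>" if "e \<in> steps" for e
  proof -
    have "k0 e = 1 / 4 - \<epsilon>\<^sup>2 / 100" by (simp add: srw_killed_def srw_rate_def)
    then show ?thesis using k_near[OF that] \<epsilon> \<epsilon>2 by linarith
  qed
  have m: "\<bar>cmass k - cmass k0\<bar> \<le> 2 * \<epsilon>\<^sup>2"
    using mass_near \<epsilon>2 by (simp add: srw_killed srw_rate_def abs_le_iff)
  have b: "(r x)\<^sup>2 \<le> 72 * \<epsilon>\<^sup>2 * (\<Sum>e\<in>steps. (d e x)\<^sup>2) + 8 * \<epsilon>\<^sup>2 * (\<epsilon>\<^sup>2 * (cgreen k0 x)\<^sup>2)" for x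
  proof -
    define s where "s = (\<Sum>e\<in>steps. (k e - k0 e) * d e x)"
    have "r x = s + (cmass k - cmass k0) * cgreen k0 x"
      unfolding r_def s_def d_def cmass_def sum_subtractf[symmetric] sum_distrib_right sum.distrib[symmetric]
      by (intro sum.cong) (simp_all add: algebra_simps)
    then have "(r x)\<^sup>2 \<le> 2 * s\<^sup>2 + 2 * ((cmass k - cmass k0) * cgreen k0 x)\<^sup>2"
      using sum_squares_bound[of s "(cmass k - cmass k0) * cgreen k0 x"] by (simp add: power2_sum)
    moreover have "((cmass k - cmass k0) * cgreen k0 x)\<^sup>2 \<le> (2 * \<epsilon>\<^sup>2)\<^sup>2 * (cgreen k0 x)\<^sup>2"
      unfolding power_mult_distrib[of "cmass k - cmass k0"]
      using m power_mono[OF m, of 2] by (intro mult_right_mono) auto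
    moreover have "s\<^sup>2 \<le> 36 * \<epsilon>\<^sup>2 * (\<Sum>e\<in>steps. (d e x)\<^sup>2)"
    proof -
      have "s\<^sup>2 \<le> (\<Sum>e\<in>steps. (k e - k0 e)\<^sup>2) * (\<Sum>e\<in>steps. (d e x)\<^sup>2)"
        unfolding s_def by (rule Cauchy_Schwarz_ineq_sum)
      also have "(\<Sum>e\<in>steps. (k e - k0 e)\<^sup>2) \<le> (\<Sum>e\<in>steps. (3 * \<epsilon>)\<^sup>2)"
        using k \<epsilon> by (intro sum_mono) (metis abs_ge_zero power2_abs power_mono)
      finally show ?thesis by (simp add: power_mult_distrib mult_right_mono sum_nonneg)
    qed
    ultimately show ?thesis by (simp add: power_mult_distrib algebra_simps)
  qed
  have ds: "(\<lambda>x. (d e x)\<^sup>2) summable_on UNIV" for e unfolding d_def by (rule k0.grad_sq_summable)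
  have "(\<Sum>\<^sub>\<infinity>x. (r x)\<^sup>2) \<le> (\<Sum>\<^sub>\<infinity>x. 72 * \<epsilon>\<^sup>2 * (\<Sum>e\<in>steps. (d e x)\<^sup>2) + 8 * \<epsilon>\<^sup>2 * (\<epsilon>\<^sup>2 * (cgreen k0 x)\<^sup>2))"
    by (intro infsum_mono r_sq_summable summable_on_add summable_on_cmult_right summable_on_sum ds k0.sq_summable b)
  also have "\<dots> = (\<Sum>\<^sub>\<infinity>x. 72 * \<epsilon>\<^sup>2 * (\<Sum>e\<in>steps. (d e x)\<^sup>2)) + (\<Sum>\<^sub>\<infinity>x. 8 * \<epsilon>\<^sup>2 * (\<epsilon>\<^sup>2 * (cgreen k0 x)\<^sup>2))"
    by (intro infsum_add summable_on_cmult_right summable_on_sum ds k0.sq_summable)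
  also have "\<dots> = 72 * \<epsilon>\<^sup>2 * (\<Sum>e\<in>steps. \<Sum>\<^sub>\<infinity>x. (d e x)\<^sup>2) + 8 * \<epsilon>\<^sup>2 * (\<epsilon>\<^sup>2 * (\<Sum>\<^sub>\<infinity>x. (cgreen k0 x)\<^sup>2))"
    by (simp only: infsum_cmult_right' infsum_sum[OF ds])
  also have "\<dots> \<le> 72 * \<epsilon>\<^sup>2 * (9 * cgreen k0 0) + 8 * \<epsilon>\<^sup>2 * (25 * cgreen k0 0)"
    using k0_sq_le k0_grad_sq_le unfolding d_def by (intro add_mono mult_left_mono) auto
  also have "\<dots> \<le> 1000 * \<epsilon>\<^sup>2 * cgreen k0 0"
    using k0.cgreen_0_ge \<epsilon>2 by (simp add: mult_right_mono)
  finally show ?thesis .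
qed

text \<open>\<open>cgreen k0\<close> solves the equation of \<open>k\<close> with source
  \<open>unit_at 0\<close> minus \<open>r\<close>.\<close>

lemma cgreen_perturb: "cgreen k y = cgreen k0 y + (\<Sum>\<^sub>\<infinity>x. cgreen k (y - x) * r x)"
proof -
  have "cgreen k0 y = pot (\<lambda>_. k) (\<lambda>x. unit_at 0 x + (- 1) * r x) y"
  proof (rule pot_unique[OF sub])
    show "bdd (\<lambda>x. unit_at 0 x + - 1 * r x)"
      by (intro bdd_add bdd_cmult bdd_unit_at bdd_summable[OF r_summable])
    show "cgreen k0 y = unit_at 0 y + - 1 * r y + step_op (\<lambda>_. k) (cgreen k0) y" for y
      using k0.eq[of y] by (simp add: unit_at_def r_def step_op_def algebra_simps sum_subtractf)
  qed (rule k0.cgreen_bdd)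
  also have "\<dots> = pot (\<lambda>_. k) (unit_at 0) y + - 1 * pot (\<lambda>_. k) r y"
    unfolding pot_cmult[OF sub bdd_summable[OF r_summable], symmetric]
    by (intro pot_add[OF sub] bdd_cmult bdd_unit_at bdd_summable[OF r_summable])
  also have "pot (\<lambda>_. k) r y = (\<Sum>\<^sub>\<infinity>x. cgreen k (y - x) * r x)"
    unfolding pot_eq_infsum[OF sub bdd_summable[OF r_summable]] green_translate ..
  finally show ?thesis by (simp add: cgreen_def green_def)
qed

lemma cgreen_refl_summable: "(\<lambda>x. cgreen k (y - x) * r x) summable_on UNIV"
  by (intro summable_on_bdd_mult bdd_summable[OF r_summable])
     (simp only: summable_on_translate(1) cgreen_summable)

text \<open>The increment falls on the factor \<open>cgreen k\<close>, so Cauchy-Schwarz meets its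
  gradient, whose square sum is at most 9 diagonal values; sqrt 9000 is below 95.\<close>

lemma increment_diff_le:
  assumes "e \<in> steps"
  shows "\<bar>(cgreen k (y + e) - cgreen k0 (y + e)) - (cgreen k y - cgreen k0 y)\<bar> \<le> 95 * \<epsilon> * sqrt (cgreen k 0 * cgreen k0 0)"
proof -
  let ?d = "\<lambda>x. cgreen k (x + e) - cgreen k x"
  have p: "cgreen k u - cgreen k0 u = (\<Sum>\<^sub>\<infinity>x. cgreen k (u - x) * r x)" for u
    using cgreen_perturb[of u] by linarith
  have "(cgreen k (y + e) - cgreen k0 (y + e)) - (cgreen k y - cgreen k0 y) =
      (\<Sum>\<^sub>\<infinity>x. cgreen k (y + e - x) * r x + (- 1) * (cgreen k (y - x) * r x))"
    unfolding p infsum_add[OF cgreen_refl_summable summable_on_cmult_right[OF cgreen_refl_summable, of "- 1"]]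
    unfolding infsum_cmult_right' by simp
  also have "\<dots> = (\<Sum>\<^sub>\<infinity>x. ?d (y - x) * r x)"
    by (intro infsum_cong) (simp add: algebra_simps)
  also have "\<bar>\<dots>\<bar> \<le> sqrt (9 * cgreen k 0 * (1000 * \<epsilon>\<^sup>2 * cgreen k0 0))"
  proof (rule infsum_Cauchy_Schwarz_abs[OF _ r_sq_summable _ r_sq_le])
    show "(\<lambda>x. (?d (y - x))\<^sup>2) summable_on UNIV"
      using grad_sq_summable[of e] by (rule summable_on_translate(1)[THEN iffD2])
    show "(\<Sum>\<^sub>\<infinity>x. (?d (y - x))\<^sup>2) \<le> 9 * cgreen k 0"
      unfolding infsum_translate(1)[of "\<lambda>x. (?d x)\<^sup>2"] by (rule grad_sq_le_each[OF assms])
  qed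
  also have "\<dots> \<le> sqrt ((95 * \<epsilon>)\<^sup>2 * (cgreen k 0 * cgreen k0 0))"
    using cgreen_0_ge k0.cgreen_0_ge \<epsilon>2 by (intro real_sqrt_le_mono) (simp add: power_mult_distrib mult_right_mono)
  also have "\<dots> = 95 * \<epsilon> * sqrt (cgreen k 0 * cgreen k0 0)"
    using \<epsilon> by (simp add: real_sqrt_mult)
  finally show ?thesis .
qed

text \<open>Without an increment, Cauchy-Schwarz needs the square sum of \<open>cgreen k\<close>,
  which killing at rate \<open>\<kappa>\<close> bounds by the diagonal over \<epsilon>^2; the factor
  \<epsilon>^2 in \<open>r_sq_le\<close> compensates.\<close>

lemma diagonal_le:
  assumes "cmass k \<le> 1 - \<kappa>"
  shows "cgreen k 0 \<le> 25002 * cgreen k0 0"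
proof -
  define X where "X = cgreen k 0"
  define Y where "Y = cgreen k0 0"
  have XY: "1 \<le> X" "1 \<le> Y" unfolding X_def Y_def by (rule cgreen_0_ge k0.cgreen_0_ge)+
  have "\<kappa> * (\<Sum>\<^sub>\<infinity>x. (cgreen k x)\<^sup>2) \<le> X"
    using assms unfolding X_def by (intro order_trans[OF mult_right_mono sq_le] infsum_nonneg) auto
  then have s: "(\<Sum>\<^sub>\<infinity>x. (cgreen k x)\<^sup>2) \<le> 25 * X / \<epsilon>\<^sup>2"
    using \<epsilon>2 by (simp add: srw_rate_def field_simps)
  have "\<bar>\<Sum>\<^sub>\<infinity>x. cgreen k (0 - x) * r x\<bar> \<le> sqrt (25 * X / \<epsilon>\<^sup>2 * (1000 * \<epsilon>\<^sup>2 * Y))"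
    unfolding Y_def
  proof (rule infsum_Cauchy_Schwarz_abs[OF _ r_sq_summable _ r_sq_le])
    show "(\<lambda>x. (cgreen k (0 - x))\<^sup>2) summable_on UNIV"
      using sq_summable by (rule summable_on_translate(1)[THEN iffD2])
    show "(\<Sum>\<^sub>\<infinity>x. (cgreen k (0 - x))\<^sup>2) \<le> 25 * X / \<epsilon>\<^sup>2"
      unfolding infsum_translate(1)[of "\<lambda>x. (cgreen k x)\<^sup>2"] by (rule s)
  qed
  \<comment> \<open>The inequality of arithmetic and geometric means for 25000 * X * Y, weighted so
    that half of \<open>X\<close> can be absorbed on the left; this yields 2 * 12501.\<close>
  also have "\<dots> \<le> sqrt ((X / 2 + 12500 * Y)\<^sup>2)"
  proof (rule real_sqrt_le_mono)
    have "0 \<le> (X / 2 - 12500 * Y)\<^sup>2" by simp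
    then show "25 * X / \<epsilon>\<^sup>2 * (1000 * \<epsilon>\<^sup>2 * Y) \<le> (X / 2 + 12500 * Y)\<^sup>2"
      using \<epsilon>2 by (simp add: power2_eq_square algebra_simps)
  qed
  also have "\<dots> = X / 2 + 12500 * Y" using XY by simp
  finally have "X \<le> Y + (X / 2 + 12500 * Y)"
    using cgreen_perturb[of 0] unfolding X_def[symmetric] Y_def[symmetric] by linarith
  then show ?thesis unfolding X_def[symmetric] Y_def[symmetric] by linarith
qed

end

subsection \<open>Exponential tilting and kernels with drift\<close>

lemma sum_steps: "(\<Sum>e\<in>steps. f e) = f (1, 0) + f (- 1, 0) + f (0, 1) + f (0, - 1 :: int)"
  by (simp add: steps_eq add.assoc)

definition dotp :: "real \<times> real \<Rightarrow> site \<Rightarrow> real" where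
  "dotp a x = fst a * real_of_int (fst x) + snd a * real_of_int (snd x)"

lemma dotp_add: "dotp a (x + y) = dotp a x + dotp a y"
  by (simp add: dotp_def algebra_simps)

definition tilt :: "real \<times> real \<Rightarrow> (site \<Rightarrow> real) \<Rightarrow> site \<Rightarrow> real" where
  "tilt a k e = k e * exp (- dotp a e)"

text \<open>A path from \<open>x\<close> to the origin has total displacement \<open>- x\<close>, so
  the factors of the tilt always multiply to \<open>exp (dotp a x)\<close>. The diagonal value is
  unchanged.\<close>

lemma (in const_kernel) cgreen_tilt: "cgreen (tilt a k) x = exp (dotp a x) * cgreen k x"
proof -
  have "(step_op (\<lambda>_. tilt a k) ^^ n) (unit_at 0) x = exp (dotp a x) * (step_op (\<lambda>_. k) ^^ n) (unit_at 0) x" for n x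
  proof (induction n arbitrary: x)
    case 0
    then show ?case by (auto simp: unit_at_def dotp_def)
  next
    case (Suc n)
    have "tilt a k e * (step_op (\<lambda>_. tilt a k) ^^ n) (unit_at 0) (x + e) =
        exp (dotp a x) * (k e * (step_op (\<lambda>_. k) ^^ n) (unit_at 0) (x + e))" for e
      by (simp add: Suc tilt_def dotp_add exp_add exp_minus field_simps)
    then show ?case
      by (simp only: funpow.simps o_apply sum_distrib_left
          step_op_def[of _ "(step_op (\<lambda>_. tilt a k) ^^ n) (unit_at 0)"]
          step_op_def[of _ "(step_op (\<lambda>_. k) ^^ n) (unit_at 0)"])
  qed
  then show ?thesis
    unfolding cgreen_def green_def pot_def by (simp add: suminf_mult[OF pot_summable[OF sub bdd_unit_at]])
qed

lemma exp_minus_bounds: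
  fixes y :: real
  assumes "\<bar>y\<bar> \<le> 1 / 100"
  shows "1 - y \<le> exp (- y)" "exp (- y) \<le> 1 - y + 11 / 10 * y\<^sup>2"
proof -
  show "1 - y \<le> exp (- y)" using exp_ge_add_one_self[of "- y"] by simp
  have y: "0 < 1 + y" using assms by linarith
  have "exp (- y) = 1 / exp y" by (simp add: exp_minus inverse_eq_divide)
  also have "\<dots> \<le> 1 / (1 + y)" using y exp_ge_add_one_self[of y] by (intro divide_left_mono) auto
  also have "\<dots> \<le> 1 - y + 11 / 10 * y\<^sup>2"
  proof -
    have "0 \<le> y\<^sup>2 * (1 / 10 + 11 / 10 * y)" using assms by (intro mult_nonneg_nonneg) auto
    then have "1 \<le> (1 - y + 11 / 10 * y\<^sup>2) * (1 + y)" by (simp add: power2_eq_square algebra_simps)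
    then show ?thesis using y by (simp add: divide_le_eq)
  qed
  finally show "exp (- y) \<le> 1 - y + 11 / 10 * y\<^sup>2" .
qed

lemma exp_minus_abs_le:
  fixes y :: real
  assumes "\<bar>y\<bar> \<le> 1 / 100"
  shows "\<bar>exp (- y) - 1\<bar> \<le> 2 * \<bar>y\<bar>"
proof -
  have "y\<^sup>2 \<le> (1 / 100) * \<bar>y\<bar>"
    using mult_right_mono[OF assms, of "\<bar>y\<bar>"] by (simp add: power2_eq_square flip: abs_mult)
  then show ?thesis using exp_minus_bounds[OF assms] by linarith
qed

lemma infsum_geometric_int:
  fixes q :: real
  assumes "0 \<le> q" "q < 1"
  shows "(\<Sum>\<^sub>\<infinity>a::int. q ^ nat \<bar>a\<bar>) \<le> 2 / (1 - q)"
proof (rule infsum_le_finite_sums[OF summable_on_geometric_int[OF assms]])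
  fix F :: "int set" assume F: "finite F"
  define N where "N = Suc (nat (Max ((\<lambda>a. \<bar>a\<bar>) ` insert 0 F)))"
  have "\<bar>a\<bar> \<le> Max ((\<lambda>a. \<bar>a\<bar>) ` insert 0 F)" if "a \<in> F" for a
    using F that by (intro Max_ge) auto
  then have N: "nat \<bar>a\<bar> < N" if "a \<in> F" for a using that by (simp add: N_def less_Suc_eq_le nat_mono)
  have g: "(\<Sum>n<N. q ^ n) \<le> 1 / (1 - q)"
    using sum_le_suminf[of "\<lambda>n. q ^ n" "{..<N}"] assms by (simp add: suminf_geometric summable_geometric)
  have "(\<Sum>a\<in>F. q ^ nat \<bar>a\<bar>) \<le> (\<Sum>a\<in>int ` {..<N} \<union> (\<lambda>n. - int n) ` {..<N}. q ^ nat \<bar>a\<bar>)"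
  proof (rule sum_mono2)
    show "F \<subseteq> int ` {..<N} \<union> (\<lambda>n. - int n) ` {..<N}"
    proof
      fix a assume "a \<in> F"
      then have "nat \<bar>a\<bar> < N" by (rule N)
      moreover have "a = int (nat \<bar>a\<bar>) \<or> a = - int (nat \<bar>a\<bar>)" by linarith
      ultimately show "a \<in> int ` {..<N} \<union> (\<lambda>n. - int n) ` {..<N}" by blast
    qed
  qed (use assms in auto)
  also have "\<dots> \<le> (\<Sum>a\<in>int ` {..<N}. q ^ nat \<bar>a\<bar>) + (\<Sum>a\<in>(\<lambda>n. - int n) ` {..<N}. q ^ nat \<bar>a\<bar>)"
    using assms by (subst sum.union_inter[symmetric]) (auto intro: sum_nonneg)
  also have "\<dots> = (\<Sum>n<N. q ^ n) + (\<Sum>n<N. q ^ n)"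
    by (simp add: sum.reindex inj_on_def)
  also have "\<dots> \<le> 2 / (1 - q)" using g by simp
  finally show "(\<Sum>a\<in>F. q ^ nat \<bar>a\<bar>) \<le> 2 / (1 - q)" .
qed

lemma exp_abs_eq_power: "exp (- (t * \<bar>real_of_int a\<bar>)) = exp (- t) ^ nat \<bar>a\<bar>"
proof -
  have "real (nat \<bar>a\<bar>) = \<bar>real_of_int a\<bar>" by simp
  then show ?thesis unfolding exp_of_nat_mult[symmetric] by simp
qed

lemma infsum_exp_plane:
  fixes s t :: real
  assumes "0 < s" "s \<le> 1 / 100" "0 < t" "t \<le> 1 / 100"
  defines "E \<equiv> \<lambda>x::site. exp (- (s * \<bar>real_of_int (fst x)\<bar>)) * exp (- (t * \<bar>real_of_int (snd x)\<bar>))"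
  shows "E summable_on UNIV" "(\<Sum>\<^sub>\<infinity>x. E x) \<le> 5 / (s * t)"
proof -
  define S where "S u = (\<Sum>\<^sub>\<infinity>a::int. exp (- (u * \<bar>real_of_int a\<bar>)))" for u
  have s: "((\<lambda>a::int. exp (- (u * \<bar>real_of_int a\<bar>))) has_sum S u) UNIV" if "0 < u" for u
    unfolding S_def exp_abs_eq_power using that
    by (intro has_sum_infsum summable_on_geometric_int) auto
  have S: "0 \<le> S u" "S u \<le> 2 * (1 + u) / u" if "0 < u" "u \<le> 1 / 100" for u
  proof -
    show "0 \<le> S u" unfolding S_def by (rule infsum_nonneg) simp
    have "exp (- u) \<le> 1 / (1 + u)"
      using that exp_ge_add_one_self[of u] by (simp add: exp_minus inverse_eq_divide frac_le)
    then have e: "u / (1 + u) \<le> 1 - exp (- u)" using that by (simp add: field_simps)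
    have "S u \<le> 2 / (1 - exp (- u))"
      unfolding S_def exp_abs_eq_power using that by (intro infsum_geometric_int) auto
    also have "\<dots> \<le> 2 / (u / (1 + u))" using e that by (intro divide_left_mono) auto
    finally show "S u \<le> 2 * (1 + u) / u" using that by simp
  qed
  have i: "((\<lambda>b. E (a, b)) has_sum exp (- (s * \<bar>real_of_int a\<bar>)) * S t) UNIV" for a
    unfolding E_def using has_sum_cmult_right[OF s[of t]] assms by simp
  have o: "((\<lambda>a::int. exp (- (s * \<bar>real_of_int a\<bar>)) * S t) has_sum S s * S t) UNIV"
    using assms by (intro has_sum_cmult_left s)
  have "E summable_on (SIGMA a:UNIV. UNIV)"
    by (rule summable_on_SigmaI[OF i]) (use o in \<open>auto simp: summable_on_def E_def\<close>)
  then show sm: "E summable_on UNIV" by simp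
  have "(E has_sum S s * S t) (SIGMA a:UNIV. UNIV)"
    using sm by (intro has_sum_SigmaI[OF i o]) simp
  then have "(\<Sum>\<^sub>\<infinity>x. E x) = S s * S t" by (simp add: infsumI)
  also have "\<dots> \<le> (2 * (1 + s) / s) * (2 * (1 + t) / t)"
    using S assms by (intro mult_mono) (auto intro: order_trans[OF S(1)])
  also have "\<dots> = (4 * ((1 + s) * (1 + t))) / (s * t)" by (simp add: field_simps)
  also have "\<dots> \<le> 5 / (s * t)"
  proof (rule divide_right_mono)
    have "(1 + s) * (1 + t) \<le> (1 + 1 / 100) * (1 + 1 / 100)" using assms by (intro mult_mono) auto
    then show "4 * ((1 + s) * (1 + t)) \<le> 5" by simp
    show "0 \<le> s * t" using assms by simp
  qed
  finally show "(\<Sum>\<^sub>\<infinity>x. E x) \<le> 5 / (s * t)" .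
qed

text \<open>The total mass may be arbitrarily close to 1, so decay that is uniform in the killing
  can only come from the drift.\<close>

locale drift_kernel = const_kernel +
  fixes \<epsilon> :: real
  assumes \<epsilon>: "0 < \<epsilon>" "\<epsilon> \<le> 1 / 1000"
    and k_close: "\<And>e. e \<in> steps \<Longrightarrow> \<bar>k e - 1 / 4\<bar> \<le> 11 / 10 * \<epsilon>"
    and mass_ge: "1 - \<epsilon>\<^sup>2 / 4 \<le> cmass k"
    and drift: "9 / 10 * \<epsilon> \<le> k (1, 0) - k (- 1, 0)" "k (1, 0) - k (- 1, 0) \<le> 2 * \<epsilon>"
      "\<bar>k (0, 1) - k (0, - 1)\<bar> \<le> 2 * \<epsilon>"
begin

lemma near_srw: "near_srw k \<epsilon>"
proof unfold_locales
  show "\<bar>k e - 1 / 4\<bar> \<le> 2 * \<epsilon>" if "e \<in> steps" for e using k_close[OF that] \<epsilon> by linarith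
  show "\<bar>cmass k - 1\<bar> \<le> \<epsilon>\<^sup>2" using mass_less mass_ge zero_le_power2[of \<epsilon>] by linarith
qed (use \<epsilon> in auto)

sublocale near_srw k \<epsilon> by (rule near_srw)

text \<open>The tilt along the drift gains 9/50 * \<epsilon>^2 of killing, which outweighs the
  transversal loss of at most \<epsilon>^2 / 10 and the second-order terms. The sign
  \<open>\<sigma>\<close> selects the side of transversal decay.\<close>

definition slope :: "real \<Rightarrow> real \<times> real" where
  "slope \<sigma> = (\<epsilon> / 5, \<sigma> * \<epsilon> / 20)"

abbreviation "kt \<sigma> \<equiv> tilt (slope \<sigma>) k"

lemma dotp_slope_le:
  assumes "\<bar>\<sigma>\<bar> = 1" "e \<in> steps"
  shows "\<bar>dotp (slope \<sigma>) e\<bar> \<le> \<epsilon> / 5"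
proof -
  have "\<bar>\<sigma> * \<epsilon> / 20\<bar> = \<epsilon> / 20" using assms(1) \<epsilon> by (simp add: abs_mult)
  then show ?thesis using assms(2) \<epsilon> by (auto simp: steps_eq dotp_def slope_def)
qed

lemma exp_slope_le:
  assumes "\<bar>\<sigma>\<bar> = 1" "e \<in> steps"
  shows "\<bar>exp (- dotp (slope \<sigma>) e) - 1\<bar> \<le> 2 / 5 * \<epsilon>"
  using exp_minus_abs_le[of "dotp (slope \<sigma>) e"] dotp_slope_le[OF assms] \<epsilon> by linarith

lemma tilt_mass:
  assumes \<sigma>: "\<bar>\<sigma>\<bar> = 1"
  shows "cmass (kt \<sigma>) \<le> 1 - \<kappa>" "1 - \<epsilon>\<^sup>2 \<le> cmass (kt \<sigma>)"
proof -
  define t where "t = \<epsilon> / 5"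
  define s where "s = \<sigma> * \<epsilon> / 20"
  have s2: "s\<^sup>2 = \<epsilon>\<^sup>2 / 400"
  proof -
    have "\<sigma>\<^sup>2 = 1" using \<sigma> by (metis one_power2 power2_abs)
    then show ?thesis by (simp add: s_def power_mult_distrib power_divide)
  qed
  have ts: "\<bar>t\<bar> \<le> 1 / 100" "\<bar>s\<bar> = \<epsilon> / 20" "\<bar>s\<bar> \<le> 1 / 100"
    using \<epsilon> \<sigma> by (auto simp: t_def s_def abs_mult)
  have m: "cmass (kt \<sigma>) = k (1, 0) * exp (- t) + k (- 1, 0) * exp t + k (0, 1) * exp (- s) + k (0, - 1) * exp s"
    by (simp add: cmass_def sum_steps tilt_def dotp_def slope_def t_def s_def)
  have c: "cmass k = k (1, 0) + k (- 1, 0) + k (0, 1) + k (0, - 1)" by (simp add: cmass_def sum_steps)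
  define d where "d = t * (k (1, 0) - k (- 1, 0)) + s * (k (0, 1) - k (0, - 1))"
  have sd: "\<bar>s * (k (0, 1) - k (0, - 1))\<bar> \<le> \<epsilon>\<^sup>2 / 10"
    using mult_mono[OF eq_refl[OF ts(2)] drift(3)] \<epsilon> by (simp add: abs_mult power2_eq_square)
  have td: "t * (k (1, 0) - k (- 1, 0)) \<ge> 9 / 50 * \<epsilon>\<^sup>2" "t * (k (1, 0) - k (- 1, 0)) \<le> 2 / 5 * \<epsilon>\<^sup>2"
    using mult_left_mono[OF drift(1), of t] mult_left_mono[OF drift(2), of t] \<epsilon>
    by (auto simp: t_def power2_eq_square)
  have dl: "4 / 50 * \<epsilon>\<^sup>2 \<le> d" "d \<le> 1 / 2 * \<epsilon>\<^sup>2"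
  proof -
    define d1 where "d1 = t * (k (1, 0) - k (- 1, 0))"
    define d2 where "d2 = s * (k (0, 1) - k (0, - 1))"
    show "4 / 50 * \<epsilon>\<^sup>2 \<le> d" "d \<le> 1 / 2 * \<epsilon>\<^sup>2"
      using sd td unfolding d_def d1_def[symmetric] d2_def[symmetric] by linarith+
  qed
  define q where "q = k (1, 0) * t\<^sup>2 + k (- 1, 0) * t\<^sup>2 + k (0, 1) * s\<^sup>2 + k (0, - 1) * s\<^sup>2"
  have q: "q \<le> 11 / 500 * \<epsilon>\<^sup>2"
  proof -
    have kb: "k e \<le> 2511 / 10000" if "e \<in> steps" for e using k_close[OF that] \<epsilon> by linarith
    have kb': "k (1, 0) \<le> 2511 / 10000" "k (- 1, 0) \<le> 2511 / 10000" "k (0, 1) \<le> 2511 / 10000" "k (0, - 1) \<le> 2511 / 10000"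
      by (intro kb; simp add: steps_eq)+
    have "k (1, 0) * t\<^sup>2 + k (- 1, 0) * t\<^sup>2 + k (0, 1) * s\<^sup>2 + k (0, - 1) * s\<^sup>2 \<le>
        2511 / 10000 * t\<^sup>2 + 2511 / 10000 * t\<^sup>2 + 2511 / 10000 * s\<^sup>2 + 2511 / 10000 * s\<^sup>2"
      by (intro add_mono mult_right_mono kb') auto
    also have "\<dots> \<le> 11 / 500 * \<epsilon>\<^sup>2" unfolding s2 t_def power_divide using \<epsilon>2 by simp
    finally show ?thesis unfolding q_def .
  qed
  have up: "k e * exp (- y) \<le> k e - k e * y + 11 / 10 * (k e * y\<^sup>2)" if "\<bar>y\<bar> \<le> 1 / 100" for e y
    using mult_left_mono[OF exp_minus_bounds(2)[OF that] nonneg[of e]] by (simp add: algebra_simps)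
  have lo: "k e - k e * y \<le> k e * exp (- y)" if "\<bar>y\<bar> \<le> 1 / 100" for e y
    using mult_left_mono[OF exp_minus_bounds(1)[OF that] nonneg[of e]] by (simp add: algebra_simps)
  have "cmass (kt \<sigma>) \<le> cmass k - d + 11 / 10 * (k (1, 0) * t\<^sup>2 + k (- 1, 0) * t\<^sup>2 + k (0, 1) * s\<^sup>2 + k (0, - 1) * s\<^sup>2)"
    using up[of t "(1, 0)"] up[of "- t" "(- 1, 0)"] up[of s "(0, 1)"] up[of "- s" "(0, - 1)"] ts
    unfolding m c d_def by (simp add: algebra_simps)
  then show "cmass (kt \<sigma>) \<le> 1 - \<kappa>"
    using q dl(1) mass_less \<epsilon>2 unfolding srw_rate_def q_def[symmetric] by linarith
  have "cmass k - d \<le> cmass (kt \<sigma>)"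
    using lo[of t "(1, 0)"] lo[of "- t" "(- 1, 0)"] lo[of s "(0, 1)"] lo[of "- s" "(0, - 1)"] ts
    unfolding m c d_def by (simp add: algebra_simps)
  then show "1 - \<epsilon>\<^sup>2 \<le> cmass (kt \<sigma>)"
    using dl(2) mass_ge \<epsilon>2 by linarith
qed

lemma near_srw_tilt:
  assumes \<sigma>: "\<bar>\<sigma>\<bar> = 1"
  shows "near_srw (kt \<sigma>) \<epsilon>"
proof unfold_locales
  show "0 \<le> kt \<sigma> e" for e using nonneg by (simp add: tilt_def)
  show "cmass (kt \<sigma>) < 1" "\<bar>cmass (kt \<sigma>) - 1\<bar> \<le> \<epsilon>\<^sup>2" using tilt_mass[OF \<sigma>] \<kappa> by linarith+
  show "\<bar>kt \<sigma> e - 1 / 4\<bar> \<le> 2 * \<epsilon>" if "e \<in> steps" for e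
  proof -
    have "\<bar>k e * (exp (- dotp (slope \<sigma>) e) - 1)\<bar> \<le> 1 * (2 / 5 * \<epsilon>)"
      unfolding abs_mult using k_close[OF that] \<epsilon>
      by (intro mult_mono exp_slope_le \<sigma> that) (linarith, simp_all)
    moreover have "kt \<sigma> e = k e + k e * (exp (- dotp (slope \<sigma>) e) - 1)" by (simp add: tilt_def algebra_simps)
    ultimately show ?thesis using k_close[OF that] \<epsilon> by linarith
  qed
qed (use \<epsilon> in auto)

text \<open>\<open>diagonal_le\<close> needs killing of order \<epsilon>^2. The tilted kernel has it
  and shares its diagonal value with \<open>k\<close>.\<close>

lemma cgreen_0_le: "cgreen k 0 \<le> 25002 * cgreen k0 0"
proof -
  interpret t: near_srw "kt 1" \<epsilon> by (rule near_srw_tilt) simp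
  show ?thesis using t.diagonal_le[OF tilt_mass(1)] by (simp add: cgreen_tilt dotp_def)
qed

lemma increment_le:
  assumes "e \<in> steps"
  shows "\<bar>(cgreen k (y + e) - cgreen k0 (y + e)) - (cgreen k y - cgreen k0 y)\<bar> \<le> 16000 * \<epsilon> * cgreen k0 0"
proof -
  have g: "1 \<le> cgreen k0 0" by (rule k0.cgreen_0_ge)
  have "sqrt (cgreen k 0 * cgreen k0 0) \<le> 159 * cgreen k0 0"
  proof (rule real_le_lsqrt)
    have "cgreen k 0 * cgreen k0 0 \<le> (25002 * cgreen k0 0) * cgreen k0 0"
      using g by (intro mult_right_mono cgreen_0_le) auto
    also have "\<dots> \<le> (159 * cgreen k0 0)\<^sup>2" by (simp add: power2_eq_square)
    finally show "cgreen k 0 * cgreen k0 0 \<le> (159 * cgreen k0 0)\<^sup>2" .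
  qed (use g in simp)
  then have "95 * \<epsilon> * sqrt (cgreen k 0 * cgreen k0 0) \<le> 95 * \<epsilon> * (159 * cgreen k0 0)"
    using g \<epsilon> by (intro mult_left_mono) auto
  also have "\<dots> \<le> 16000 * \<epsilon> * cgreen k0 0" using g \<epsilon> by simp
  finally show ?thesis using increment_diff_le[OF assms, of y] by linarith
qed

text \<open>The increment of \<open>cgreen k\<close> with the exponential weight pulled out: nearly
  a gradient of the tilted Green function.\<close>

definition b :: "real \<Rightarrow> site \<Rightarrow> site \<Rightarrow> real" where
  "b \<sigma> e x = exp (- dotp (slope \<sigma>) e) * cgreen (kt \<sigma>) (x + e) - cgreen (kt \<sigma>) x"

lemma grad_eq_b: "cgreen k (x + e) - cgreen k x = exp (- dotp (slope \<sigma>) x) * b \<sigma> e x"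
  by (simp add: b_def cgreen_tilt dotp_add exp_add exp_minus field_simps)

text \<open>Besides the true gradient of the tilted Green function there is a term with a factor
  O(\<epsilon>), controlled by the killing of the tilted kernel: 2 * 9 + 2 * 25 = 68.\<close>

lemma b_sq:
  assumes \<sigma>: "\<bar>\<sigma>\<bar> = 1" and e: "e \<in> steps"
  shows "(\<lambda>x. (b \<sigma> e x)\<^sup>2) summable_on UNIV" "(\<Sum>\<^sub>\<infinity>x. (b \<sigma> e x)\<^sup>2) \<le> 68 * cgreen k 0"
proof -
  interpret t: near_srw "kt \<sigma>" \<epsilon> by (rule near_srw_tilt[OF \<sigma>])
  let ?g = "cgreen (kt \<sigma>)" and ?d = "exp (- dotp (slope \<sigma>) e) - 1"
  have g0: "?g 0 = cgreen k 0" by (simp add: cgreen_tilt dotp_def)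
  have d: "?d\<^sup>2 \<le> \<epsilon>\<^sup>2"
    using exp_slope_le[OF assms] \<epsilon> by (intro power2_le_iff_abs_le[THEN iffD2]) auto
  have le: "(b \<sigma> e x)\<^sup>2 \<le> 2 * (?g (x + e) - ?g x)\<^sup>2 + 2 * \<epsilon>\<^sup>2 * (?g (x + e))\<^sup>2" for x
  proof -
    have "b \<sigma> e x = (?g (x + e) - ?g x) + ?d * ?g (x + e)" by (simp add: b_def algebra_simps)
    then have "(b \<sigma> e x)\<^sup>2 \<le> 2 * (?g (x + e) - ?g x)\<^sup>2 + 2 * (?d * ?g (x + e))\<^sup>2"
      using sum_squares_bound[of "?g (x + e) - ?g x" "?d * ?g (x + e)"] by (simp add: power2_sum)
    also have "(?d * ?g (x + e))\<^sup>2 \<le> \<epsilon>\<^sup>2 * (?g (x + e))\<^sup>2"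
      unfolding power_mult_distrib by (intro mult_right_mono d) simp
    finally show ?thesis by simp
  qed
  have s1: "(\<lambda>x. (?g (x + e))\<^sup>2) summable_on UNIV"
    using t.sq_summable by (rule summable_on_translate(3)[THEN iffD2])
  have S: "(\<lambda>x. 2 * (?g (x + e) - ?g x)\<^sup>2 + 2 * \<epsilon>\<^sup>2 * (?g (x + e))\<^sup>2) summable_on UNIV"
    by (intro summable_on_add summable_on_cmult_right t.grad_sq_summable s1)
  show s: "(\<lambda>x. (b \<sigma> e x)\<^sup>2) summable_on UNIV"
    by (rule summable_on_comparison_test[OF S le]) simp
  have "\<epsilon>\<^sup>2 / 25 * (\<Sum>\<^sub>\<infinity>x. (?g x)\<^sup>2) \<le> (1 - cmass (kt \<sigma>)) * (\<Sum>\<^sub>\<infinity>x. (?g x)\<^sup>2)"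
    using tilt_mass(1)[OF \<sigma>] by (intro mult_right_mono infsum_nonneg) (auto simp: srw_rate_def)
  then have g: "\<epsilon>\<^sup>2 * (\<Sum>\<^sub>\<infinity>x. (?g x)\<^sup>2) \<le> 25 * ?g 0" using t.sq_le by linarith
  have "(\<Sum>\<^sub>\<infinity>x. (b \<sigma> e x)\<^sup>2) \<le> (\<Sum>\<^sub>\<infinity>x. 2 * (?g (x + e) - ?g x)\<^sup>2 + 2 * \<epsilon>\<^sup>2 * (?g (x + e))\<^sup>2)"
    by (rule infsum_mono[OF s S le])
  also have "\<dots> = (\<Sum>\<^sub>\<infinity>x. 2 * (?g (x + e) - ?g x)\<^sup>2) + (\<Sum>\<^sub>\<infinity>x. 2 * \<epsilon>\<^sup>2 * (?g (x + e))\<^sup>2)"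
    by (intro infsum_add summable_on_cmult_right t.grad_sq_summable s1)
  also have "\<dots> = 2 * (\<Sum>\<^sub>\<infinity>x. (?g (x + e) - ?g x)\<^sup>2) + 2 * (\<epsilon>\<^sup>2 * (\<Sum>\<^sub>\<infinity>x. (?g x)\<^sup>2))"
    unfolding infsum_cmult_right' infsum_translate(3)[of "\<lambda>x. (?g x)\<^sup>2"] by simp
  also have "\<dots> \<le> 68 * cgreen k 0"
    using t.grad_sq_le_each[OF e] g unfolding g0 by linarith
  finally show "(\<Sum>\<^sub>\<infinity>x. (b \<sigma> e x)\<^sup>2) \<le> 68 * cgreen k 0" .
qed

definition E :: "site \<Rightarrow> real" where
  "E x = exp (- (\<epsilon> / 5 * \<bar>real_of_int (fst x)\<bar>)) * exp (- (\<epsilon> / 20 * \<bar>real_of_int (snd x)\<bar>))"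

lemma E_sq: "(\<lambda>x. (E x)\<^sup>2) summable_on UNIV" "(\<Sum>\<^sub>\<infinity>x. (E x)\<^sup>2) \<le> 125 / \<epsilon>\<^sup>2"
proof -
  have "(E x)\<^sup>2 = exp (- (2 * \<epsilon> / 5 * \<bar>real_of_int (fst x)\<bar>)) * exp (- (2 * \<epsilon> / 20 * \<bar>real_of_int (snd x)\<bar>))" for x
    by (simp add: E_def power_mult_distrib exp_double[symmetric])
  then show "(\<lambda>x. (E x)\<^sup>2) summable_on UNIV" "(\<Sum>\<^sub>\<infinity>x. (E x)\<^sup>2) \<le> 125 / \<epsilon>\<^sup>2"
    using infsum_exp_plane[of "2 * \<epsilon> / 5" "2 * \<epsilon> / 20"] \<epsilon> by (simp_all add: power2_eq_square)
qed

text \<open>With \<open>\<sigma>\<close> the sign of \<open>snd x\<close> the tilting weight decays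
  in both coordinates and equals \<open>E\<close>. Adding both signs removes the case
  distinction.\<close>

lemma grad_le_downstream:
  assumes "0 \<le> fst x"
  shows "\<bar>cgreen k (x + e) - cgreen k x\<bar> \<le> \<bar>E x * b 1 e x\<bar> + \<bar>E x * b (- 1) e x\<bar>"
proof -
  define \<sigma> where "\<sigma> = (if 0 \<le> snd x then 1 else - 1 :: real)"
  have "exp (- dotp (slope \<sigma>) x) = E x"
    using assms unfolding E_def dotp_def slope_def exp_add[symmetric]
    by (intro arg_cong[where f = exp]) (auto simp: \<sigma>_def)
  then have "\<bar>cgreen k (x + e) - cgreen k x\<bar> = \<bar>E x * b \<sigma> e x\<bar>" by (simp add: grad_eq_b[of x e \<sigma>])
  then show ?thesis by (auto simp: \<sigma>_def)
qed

text \<open>Upstream the gradient is known to be square summable only, so \<open>D\<close> must be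
  square summable there. Downstream a bounded \<open>D\<close> suffices, because \<open>E\<close>
  has l^2 norm of order 1 / \<epsilon> and \<open>b\<close> is square summable.\<close>

theorem grad_pairing:
  assumes e: "e \<in> steps" and D: "\<And>x. 0 \<le> D x" "\<And>x. 0 < fst x \<Longrightarrow> D x \<le> \<beta>" and "0 \<le> \<beta>"
    and up: "(\<lambda>x. (if fst x \<le> 0 then D x else 0)\<^sup>2) summable_on UNIV"
      "(\<Sum>\<^sub>\<infinity>x. (if fst x \<le> 0 then D x else 0)\<^sup>2) \<le> \<alpha>\<^sup>2" and "0 \<le> \<alpha>"
  shows "(\<lambda>x. D x * \<bar>cgreen k (x + e) - cgreen k x\<bar>) summable_on UNIV"
    "(\<Sum>\<^sub>\<infinity>x. D x * \<bar>cgreen k (x + e) - cgreen k x\<bar>) \<le> (3 * \<alpha> + 200 * \<beta> / \<epsilon>) * sqrt (cgreen k 0)"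
proof -
  let ?g = "\<lambda>x. cgreen k (x + e) - cgreen k x"
  define D' where "D' x = (if fst x \<le> 0 then D x else 0)" for x
  have up': "(\<lambda>x. (D' x)\<^sup>2) summable_on UNIV" "(\<Sum>\<^sub>\<infinity>x. (D' x)\<^sup>2) \<le> \<alpha>\<^sup>2"
    using up by (simp_all only: D'_def)
  note cs1 = infsum_Cauchy_Schwarz[OF up'(1) grad_sq_summable[of e]]
  note cs2 = infsum_Cauchy_Schwarz[OF E_sq(1) b_sq(1)[OF _ e]]
  let ?h = "\<lambda>x. \<bar>D' x * ?g x\<bar> + \<beta> * (\<bar>E x * b 1 e x\<bar> + \<bar>E x * b (- 1) e x\<bar>)"
  have le: "D x * \<bar>?g x\<bar> \<le> ?h x" for x
  proof (cases "fst x \<le> 0")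
    case True
    have "0 \<le> \<beta> * (\<bar>E x * b 1 e x\<bar> + \<bar>E x * b (- 1) e x\<bar>)" using assms by simp
    then show ?thesis using True D by (simp add: D'_def abs_mult)
  next
    case False
    have "D x * \<bar>?g x\<bar> \<le> \<beta> * (\<bar>E x * b 1 e x\<bar> + \<bar>E x * b (- 1) e x\<bar>)"
      using False assms by (intro mult_mono grad_le_downstream D) auto
    then show ?thesis using False by (simp add: D'_def)
  qed
  have s: "?h summable_on UNIV"
    by (intro summable_on_add summable_on_cmult_right cs1 cs2) simp_all
  show sm: "(\<lambda>x. D x * \<bar>?g x\<bar>) summable_on UNIV"
    by (rule summable_on_comparison_test[OF s le]) (use D in simp)
  have I: "(\<Sum>\<^sub>\<infinity>x. \<bar>E x * b \<sigma> e x\<bar>) \<le> 100 / \<epsilon> * sqrt (cgreen k 0)" if "\<bar>\<sigma>\<bar> = 1" for \<sigma>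
  proof -
    have "(\<Sum>\<^sub>\<infinity>x. \<bar>E x * b \<sigma> e x\<bar>) \<le> sqrt (125 / \<epsilon>\<^sup>2) * sqrt (68 * cgreen k 0)"
      by (rule order_trans[OF cs2(2)[OF that]], intro mult_mono real_sqrt_le_mono E_sq b_sq that e)
         (auto intro!: infsum_nonneg real_sqrt_ge_zero)
    also have "\<dots> = sqrt 125 * sqrt 68 / \<epsilon> * sqrt (cgreen k 0)"
      using \<epsilon> by (simp add: real_sqrt_mult real_sqrt_divide)
    also have "\<dots> \<le> 100 / \<epsilon> * sqrt (cgreen k 0)"
    proof -
      have "sqrt 125 * sqrt 68 \<le> 12 * (33 / 4)"
        by (intro mult_mono real_le_lsqrt) (auto simp: power2_eq_square)
      then have "sqrt 125 * sqrt 68 \<le> 100" by simp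
      then show ?thesis using \<epsilon> cgreen_nonneg by (intro mult_right_mono divide_right_mono) auto
    qed
    finally show ?thesis .
  qed
  have "(\<Sum>\<^sub>\<infinity>x. D x * \<bar>?g x\<bar>) \<le> (\<Sum>\<^sub>\<infinity>x. ?h x)" by (rule infsum_mono[OF sm s le])
  also have "\<dots> = (\<Sum>\<^sub>\<infinity>x. \<bar>D' x * ?g x\<bar>) + \<beta> * ((\<Sum>\<^sub>\<infinity>x. \<bar>E x * b 1 e x\<bar>) + (\<Sum>\<^sub>\<infinity>x. \<bar>E x * b (- 1) e x\<bar>))"
    unfolding infsum_add[OF cs1(1) summable_on_cmult_right[OF summable_on_add[OF cs2(1) cs2(1)]], of 1 "- 1", simplified]
      infsum_cmult_right' infsum_add[OF cs2(1) cs2(1), of 1 "- 1", simplified] ..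
  also have "\<dots> \<le> \<alpha> * (3 * sqrt (cgreen k 0)) + \<beta> * (100 / \<epsilon> * sqrt (cgreen k 0) + 100 / \<epsilon> * sqrt (cgreen k 0))"
  proof (intro add_mono mult_left_mono I)
    have "(\<Sum>\<^sub>\<infinity>x. \<bar>D' x * ?g x\<bar>) \<le> sqrt (\<alpha>\<^sup>2) * sqrt (9 * cgreen k 0)"
      by (rule order_trans[OF cs1(2)], intro mult_mono real_sqrt_le_mono up' grad_sq_le_each e)
         (auto intro!: infsum_nonneg real_sqrt_ge_zero)
    then show "(\<Sum>\<^sub>\<infinity>x. \<bar>D' x * ?g x\<bar>) \<le> \<alpha> * (3 * sqrt (cgreen k 0))"
      using \<open>0 \<le> \<alpha>\<close> by (simp add: real_sqrt_mult)
  qed (use assms in auto)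
  also have "\<dots> = (3 * \<alpha> + 200 * \<beta> / \<epsilon>) * sqrt (cgreen k 0)" by (simp add: algebra_simps)
  finally show "(\<Sum>\<^sub>\<infinity>x. D x * \<bar>?g x\<bar>) \<le> (3 * \<alpha> + 200 * \<beta> / \<epsilon>) * sqrt (cgreen k 0)" .
qed

end

section \<open>Simple random walk\<close>

text \<open>In the coordinates \<open>fst x + snd x\<close> and \<open>fst x - snd x\<close> the walk is a pair of independent
  one-dimensional walks.\<close>

fun walk1 :: "nat \<Rightarrow> int \<Rightarrow> real" where
  "walk1 0 u = of_bool (u = 0)"
| "walk1 (Suc n) u = (walk1 n (u + 1) + walk1 n (u - 1)) / 2"

lemma srw_power:
  "(step_op (\<lambda>_. srw_killed \<kappa>) ^^ n) (unit_at 0) x = (1 - \<kappa>) ^ n * (walk1 n (fst x + snd x) * walk1 n (fst x - snd x))"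
proof (induction n arbitrary: x)
  case 0
  then show ?case by (auto simp: unit_at_def prod_eq_iff)
next
  case (Suc n)
  have "(step_op (\<lambda>_. srw_killed \<kappa>) ^^ Suc n) (unit_at 0) x =
      (\<Sum>e\<in>steps. srw_killed \<kappa> e * (step_op (\<lambda>_. srw_killed \<kappa>) ^^ n) (unit_at 0) (x + e))"
    by (simp only: funpow.simps o_apply step_op_def[of _ "(step_op (\<lambda>_. srw_killed \<kappa>) ^^ n) (unit_at 0)"])
  also have "\<dots> = (1 - \<kappa>) ^ Suc n * (walk1 (Suc n) (fst x + snd x) * walk1 (Suc n) (fst x - snd x))"
    unfolding Suc sum_steps srw_killed_def by (cases x) (simp add: field_simps)
  finally show ?case .
qed

lemma walk1_outside: "u < - int n \<Longrightarrow> walk1 n u = 0"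
  by (induction n arbitrary: u) auto

lemma walk1_binomial: "walk1 n (2 * int j - int n) = real (n choose j) / 2 ^ n"
proof (induction n arbitrary: j)
  case 0
  then show ?case by (cases j) auto
next
  case (Suc n)
  have e: "2 * int j - int (Suc n) + 1 = 2 * int j - int n" by simp
  show ?case
  proof (cases j)
    case 0
    then have e': "2 * int j - int (Suc n) - 1 = - int n - 2" by simp
    show ?thesis unfolding walk1.simps e e' Suc.IH by (simp add: walk1_outside 0)
  next
    case (Suc i)
    then have e': "2 * int j - int (Suc n) - 1 = 2 * int i - int n" by simp
    show ?thesis unfolding walk1.simps e e' Suc.IH unfolding Suc by (simp add: field_simps)
  qed
qed

lemma walk1_odd: "odd (u + int n) \<Longrightarrow> walk1 n u = 0"
  by (induction n arbitrary: u) (auto simp: algebra_simps)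

section \<open>Central binomial probabilities and the Wallis product\<close>

definition central :: "nat \<Rightarrow> real" where
  "central n = real (2 * n choose n) / 4 ^ n"

lemma walk1_0: "walk1 (2 * n) 0 = central n"
  using walk1_binomial[of "2 * n" n] by (simp add: central_def power_mult)

lemma walk1_2: "walk1 (2 * n) 2 = central n * (real n / (real n + 1))"
proof (cases n)
  case (Suc m)
  have "real (2 * n choose Suc n) = fact (2 * n) / (fact (Suc n) * fact m)"
    using binomial_fact[of "Suc n" "2 * n", where 'a = real] Suc by (simp del: fact_Suc)
  moreover have "real (2 * n choose n) = fact (2 * n) / (fact n * fact n)"
    using binomial_fact[of n "2 * n", where 'a = real] by (simp add: mult_2)
  moreover have "(fact n :: real) = real n * fact m" using Suc by simp
  moreover have "F / ((l * (k * f)) * f) = F / ((k * f) * (k * f)) * (k / l)"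
    if "0 < k" "0 < f" "0 < l" for k f F l :: real
    using that by (simp add: field_simps)
  from this[of n "fact m" "real n + 1" "fact (2 * n)"] have "fact (2 * n) / (((real n + 1) * (real n * fact m)) * fact m) =
      fact (2 * n) / ((real n * fact m) * (real n * fact m)) * (real n / (real n + 1))"
    using Suc by simp
  moreover have "(fact (Suc n) :: real) = (real n + 1) * fact n" by (simp add: algebra_simps)
  ultimately have "real (2 * n choose Suc n) = real (2 * n choose n) * (real n / (real n + 1))"
    by (simp only: of_nat_add of_nat_1)
  moreover have "walk1 (2 * n) (2 * int (Suc n) - int (2 * n)) = real (2 * n choose Suc n) / 2 ^ (2 * n)"
    by (rule walk1_binomial)
  ultimately show ?thesis by (simp add: central_def power_mult)
qed simp

lemma central_Suc: "central (Suc n) = central n * ((2 * real n + 1) / (2 * real n + 2))"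
proof -
  have c: "real (2 * m choose m) = fact (2 * m) / (fact m * fact m)" for m
    using binomial_fact[of m "2 * m", where 'a = real] by (simp add: mult_2)
  define k where "k = real n + 1"
  have f: "(fact (2 * Suc n) :: real) = (2 * k) * ((2 * k - 1) * fact (2 * n))" "(fact (Suc n) :: real) = k * fact n"
    "2 * real n + 1 = 2 * k - 1" "2 * real n + 2 = 2 * k" "(4::real) ^ Suc n = 4 * 4 ^ n"
    by (simp_all add: k_def algebra_simps)
  have "((2 * k) * ((2 * k - 1) * F)) / ((k * g) * (k * g)) / (4 * p) = F / (g * g) / p * ((2 * k - 1) / (2 * k))"
    if "0 < g" "0 < p" "0 < k" for F g p :: real
    using that by (simp add: field_simps)
  note a = this[of "fact n" "4 ^ n" "fact (2 * n)"]
  show ?thesis unfolding central_def c f by (rule a) (simp_all add: k_def)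
qed

text \<open>The second factor is the reciprocal of the partial Wallis product; this is where pi
  enters.\<close>

lemma wallis_central: "(\<Prod>i=1..n. (4 * real i ^ 2) / (4 * real i ^ 2 - 1)) * ((2 * real n + 1) * (central n)\<^sup>2) = 1"
proof (induction n)
  case 0
  then show ?case by (simp add: central_def)
next
  case (Suc n)
  have e: "4 * real (Suc n) ^ 2 - 1 = (2 * real n + 1) * (2 * real n + 3)"
    by (simp add: power2_eq_square algebra_simps)
  have "(4 * real (Suc n) ^ 2) / (4 * real (Suc n) ^ 2 - 1) * ((2 * real (Suc n) + 1) * (central (Suc n))\<^sup>2) = (2 * real n + 1) * (central n)\<^sup>2"
    unfolding e central_Suc by (simp add: divide_simps power2_eq_square) (simp add: algebra_simps)
  moreover have "(\<Prod>i=1..Suc n. (4 * real i ^ 2) / (4 * real i ^ 2 - 1)) =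
      (\<Prod>i=1..n. (4 * real i ^ 2) / (4 * real i ^ 2 - 1)) * ((4 * real (Suc n) ^ 2) / (4 * real (Suc n) ^ 2 - 1))"
    by simp
  ultimately show ?case using Suc by (simp only: mult.assoc)
qed

lemma central_sq_le: "(central n)\<^sup>2 \<le> 1 / (2 * real n + 1)"
proof -
  have "1 \<le> (\<Prod>i=1..n. (4 * real i ^ 2) / (4 * real i ^ 2 - 1))"
  proof (intro prod_ge_1)
    fix i assume "i \<in> {1..n}"
    then have "1 \<le> real i ^ 2" by (simp add: one_le_power)
    then have "0 < 4 * real i ^ 2 - 1" by linarith
    then show "1 \<le> (4 * real i ^ 2) / (4 * real i ^ 2 - 1)" by (simp add: le_divide_eq)
  qed
  then have "1 * ((2 * real n + 1) * (central n)\<^sup>2) \<le>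
      (\<Prod>i=1..n. (4 * real i ^ 2) / (4 * real i ^ 2 - 1)) * ((2 * real n + 1) * (central n)\<^sup>2)"
    by (intro mult_right_mono) auto
  then have "(2 * real n + 1) * (central n)\<^sup>2 \<le> 1" by (simp only: wallis_central mult_1_left)
  then show ?thesis by (simp add: field_simps)
qed

lemma central_sq_limit: "(\<lambda>n. 4 * real n * (central n)\<^sup>2) \<longlonglongrightarrow> 4 / pi"
proof -
  have "(\<lambda>n. inverse (\<Prod>i=1..n. (4 * real i ^ 2) / (4 * real i ^ 2 - 1))) \<longlonglongrightarrow> inverse (pi / 2)"
    by (intro tendsto_inverse wallis) simp
  moreover have "inverse (\<Prod>i=1..n. (4 * real i ^ 2) / (4 * real i ^ 2 - 1)) = (2 * real n + 1) * (central n)\<^sup>2" for n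
    by (rule inverse_unique) (rule wallis_central)
  ultimately have a: "(\<lambda>n. (2 * real n + 1) * (central n)\<^sup>2) \<longlonglongrightarrow> 2 / pi" by simp
  have "(\<lambda>n. 2 * (real n / (2 * real n + 1))) \<longlonglongrightarrow> 1" by real_asymp
  from tendsto_mult[OF tendsto_const[of 2] tendsto_mult[OF this a]]
  have "(\<lambda>n. 2 * (2 * (real n / (2 * real n + 1)) * ((2 * real n + 1) * (central n)\<^sup>2))) \<longlonglongrightarrow> 4 / pi" by simp
  moreover have "2 * (2 * (real n / (2 * real n + 1)) * ((2 * real n + 1) * (central n)\<^sup>2)) = 4 * real n * (central n)\<^sup>2" for n
    by (simp add: field_simps)
  ultimately show ?thesis by (simp only:)
qed

text \<open>The partial sums telescope to \<open>4 * n * (central n)\<^sup>2\<close>. The terms are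
  return probability minus probability of being at (1, 1) at time 2n, so the sum is the potential
  kernel at (1, 1).\<close>

lemma central_sq_sums: "(\<lambda>n. (central n)\<^sup>2 / (real n + 1)) sums (4 / pi)"
proof -
  have e: "(\<Sum>i<n. (central i)\<^sup>2 / (real i + 1)) = 4 * real n * (central n)\<^sup>2" for n
  proof (induction n)
    case (Suc n)
    define k where "k = real n + 1"
    have k: "0 < k" "real n = k - 1" "2 * real n + 1 = 2 * k - 1" "2 * real n + 2 = 2 * k" "real (Suc n) = k"
      by (auto simp: k_def)
    have a: "4 * (k - 1) * c\<^sup>2 + c\<^sup>2 / k = 4 * k * (c * ((2 * k - 1) / (2 * k)))\<^sup>2" for c
      using k(1) by (simp add: power2_eq_square field_simps)
    have e: "real n + 1 = k" by (simp add: k_def)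
    show ?case unfolding sum.lessThan_Suc Suc central_Suc e k(3-5) unfolding k(2) by (rule a)
  qed simp
  show ?thesis unfolding sums_def e by (rule central_sq_limit)
qed

section \<open>The Green function of the killed simple random walk\<close>

locale killed_srw =
  fixes \<kappa> :: real
  assumes \<kappa>: "0 < \<kappa>" "\<kappa> \<le> 1"
begin

sublocale const_kernel "srw_killed \<kappa>" using srw_killed \<kappa> by blast

abbreviation "g \<equiv> cgreen (srw_killed \<kappa>)"

lemma g_sums: "(\<lambda>n. (1 - \<kappa>) ^ n * (walk1 n (fst x + snd x) * walk1 n (fst x - snd x))) sums g x"
  using summable_sums[OF pot_summable[OF sub bdd_unit_at, of 0 x]]
  unfolding srw_power by (simp add: cgreen_def green_def pot_def srw_power)

lemma sums_even:
  assumes "f sums (s :: real)" "\<And>n. odd n \<Longrightarrow> f n = 0"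
  shows "(\<lambda>n. f (2 * n)) sums s"
proof -
  have "(f \<circ> (\<lambda>n. 2 * n)) sums s \<longleftrightarrow> f sums s"
    unfolding o_def
  proof (rule sums_mono_reindex)
    show "strict_mono (\<lambda>n::nat. 2 * n)" by (simp add: strict_mono_def)
    show "f n = 0" if "n \<notin> range (\<lambda>n. 2 * n)" for n
      using that assms(2)[of n] by (cases "even n") auto
  qed
  then show ?thesis using assms(1) by (simp add: o_def)
qed

lemma g_0_sums: "(\<lambda>n. (1 - \<kappa>) ^ (2 * n) * (central n)\<^sup>2) sums g 0"
  using sums_even[OF g_sums[of 0]] by (simp add: walk1_0 walk1_odd power2_eq_square)

lemma g_diag_sums: "(\<lambda>n. (1 - \<kappa>) ^ (2 * n) * ((central n)\<^sup>2 * (real n / (real n + 1)))) sums g (1, 1)"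
proof -
  have "(\<lambda>n. (1 - \<kappa>) ^ (2 * n) * (walk1 (2 * n) 2 * walk1 (2 * n) 0)) sums g (1, 1)"
    using sums_even[OF g_sums[of "(1, 1)"]] by (simp add: walk1_odd)
  moreover have "walk1 (2 * n) 2 * walk1 (2 * n) 0 = (central n)\<^sup>2 * (real n / (real n + 1))" for n
    unfolding walk1_2 walk1_0 by (simp add: power2_eq_square)
  ultimately show ?thesis by (simp only:)
qed

lemma g_swap: "g (a, b) = g (b, a)" and g_minus: "g (a, b) = g (- a, b)" and g_minus2: "g (a, b) = g (a, - b)"
proof -
  have w: "walk1 n (- u) = walk1 n u" for n u
  proof (induction n arbitrary: u)
    case (Suc n)
    have e: "- u + 1 = - (u - 1)" "- u - 1 = - (u + 1)" by simp_all
    show ?case unfolding walk1.simps e Suc by (simp only: add.commute)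
  qed simp
  have "walk1 n (a - b) = walk1 n (b - a)" for n a b using w[of n "a - b"] by simp
  then show "g (a, b) = g (b, a)"
    using sums_unique2[OF g_sums[of "(a, b)"], of "g (b, a)"] g_sums[of "(b, a)"]
    by (simp add: add.commute)
  have m: "walk1 n (- a - b) = walk1 n (a + b)" "walk1 n (b - a) = walk1 n (a - b)" for n a b
    using w[of n "a + b"] w[of n "a - b"] by (simp_all add: algebra_simps)
  have "(\<lambda>n. (1 - \<kappa>) ^ n * (walk1 n (a + b) * walk1 n (a - b))) sums g (- a, b)"
    using g_sums[of "(- a, b)"] m(1)[of _ a b] m(2)[of _ a b] by (simp add: mult.commute add.commute[of b])
  then show "g (a, b) = g (- a, b)"
    using sums_unique2[OF g_sums[of "(a, b)"], of "g (- a, b)"] by simp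
  show "g (a, b) = g (a, - b)"
    using sums_unique2[OF g_sums[of "(a, b)"], of "g (a, - b)"] g_sums[of "(a, - b)"]
    by (simp add: mult.commute)
qed

text \<open>As \<open>(central n)\<^sup>2\<close> is at most \<open>1 / n\<close>, the logarithmic
  series dominates; the summand 1 is the term at time 0.\<close>

lemma g_0_le: "g 0 \<le> 1 + ln (1 / \<kappa>)"
proof -
  have "(\<lambda>n. - (- (- ((1 - \<kappa>) ^ n) / real n))) sums - (- ln \<kappa>)"
    using ln_series'[of "- (1 - \<kappa>)"] \<kappa> by simp
  then have "(\<lambda>n. (1 - \<kappa>) ^ n / real n) sums ln (1 / \<kappa>)"
    using sums_minus[of "\<lambda>n. - ((1 - \<kappa>) ^ n / real n)" "ln \<kappa>"] \<kappa> by (simp add: ln_div)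
  then have "(\<lambda>n. (if n = 0 then 1 else 0) + (1 - \<kappa>) ^ n / real n) sums (1 + ln (1 / \<kappa>))"
    by (intro sums_add sums_single)
  from g_0_sums this show ?thesis
  proof (rule sums_le[rotated])
    fix n
    show "(1 - \<kappa>) ^ (2 * n) * (central n)\<^sup>2 \<le> (if n = 0 then 1 else 0) + (1 - \<kappa>) ^ n / real n"
    proof (cases "n = 0")
      case False
      have "(1 - \<kappa>) ^ (2 * n) * (central n)\<^sup>2 \<le> (1 - \<kappa>) ^ n * (1 / n)"
        using \<kappa> False
        by (intro mult_mono power_decreasing order_trans[OF central_sq_le]) (auto simp: frac_le)
      then show ?thesis using False by simp
    qed (simp add: central_def)
  qed
qed

text \<open>The square root interpolates between the linear bound and 1. The linear bound alone
  would leave a harmonic series in \<open>g_0_minus_diag\<close>.\<close>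

lemma one_minus_power_le:
  assumes "0 \<le> a" "a \<le> 1"
  shows "1 - (1 - a) ^ m \<le> sqrt (m * a)"
proof (cases "m * a \<le> 1")
  case True
  have "1 - (1 - a) ^ m \<le> m * a"
    using Bernoulli_inequality[of "- a" m] assms by simp
  also have "\<dots> \<le> sqrt (m * a)"
    using True assms by (intro real_le_rsqrt) (simp add: power2_eq_square mult_left_le)
  finally show ?thesis .
next
  case False
  then have "1 \<le> sqrt (m * a)" by simp
  moreover have "0 \<le> (1 - a) ^ m" using assms by simp
  ultimately show ?thesis by linarith
qed

lemma inverse_sqrt_telescope:
  "1 / (sqrt (real n + 1) * (real n + 1)) \<le> 8 * (1 / sqrt (real n + 1) - 1 / sqrt (real (Suc n) + 1))"
proof -
  define a where "a = sqrt (real n + 1)"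
  define b where "b = sqrt (real n + 2)"
  have a: "1 \<le> a" "a * a = real n + 1" by (auto simp: a_def)
  have b: "a \<le> b" "b * b = a * a + 1" by (auto simp: a_def b_def)
  have "b * b \<le> (2 * a) * (2 * a)" using a b mult_mono[of 1 a 1 a] by simp
  then have "b\<^sup>2 \<le> (2 * a)\<^sup>2" by (simp only: power2_eq_square)
  then have ba: "b \<le> 2 * a" by (rule power2_le_imp_le) (use a in simp)
  have "b * (a + b) \<le> (2 * a) * (3 * a)" using a b ba by (intro mult_mono) auto
  then have "b * (a + b) \<le> 8 * (a * a)" using a by simp
  moreover have "1 = (b - a) * (a + b)" using b by (simp add: algebra_simps)
  ultimately have "b * (a + b) * 1 \<le> 8 * (a * a) * ((b - a) * (a + b))" by simp
  then have "(a + b) * b \<le> (a + b) * (8 * (a * a) * (b - a))" by (simp add: algebra_simps)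
  then have "b \<le> 8 * (a * a) * (b - a)" using a b by (simp add: mult_le_cancel_left)
  then have "1 / (a * (a * a)) \<le> 8 * (1 / a - 1 / b)"
    using a b by (simp add: divide_simps) (simp add: algebra_simps)
  then show ?thesis by (simp add: a_def b_def add.commute)
qed

text \<open>The terms of the defect to the series of 4 / pi are at most sqrt \<kappa> times (n +
  1)^(-3/2), up to a constant. At the rate \<open>srw_rate\<close> the total is
  O(\<epsilon>).\<close>

lemma g_0_minus_diag: "\<bar>g 0 - g (1, 1) - 4 / pi\<bar> \<le> 8 * sqrt \<kappa>"
proof -
  have "(\<lambda>n. (1 - \<kappa>) ^ (2 * n) * (central n)\<^sup>2 - (1 - \<kappa>) ^ (2 * n) * ((central n)\<^sup>2 * (real n / (real n + 1)))) sums (g 0 - g (1, 1))"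
    by (rule sums_diff[OF g_0_sums g_diag_sums])
  moreover have "(1 - \<kappa>) ^ (2 * n) * (central n)\<^sup>2 - (1 - \<kappa>) ^ (2 * n) * ((central n)\<^sup>2 * (real n / (real n + 1))) =
      (1 - \<kappa>) ^ (2 * n) * ((central n)\<^sup>2 / (real n + 1))" for n :: nat
    by (simp add: field_simps)
  ultimately have "(\<lambda>n. (1 - \<kappa>) ^ (2 * n) * ((central n)\<^sup>2 / (real n + 1))) sums (g 0 - g (1, 1))" by simp
  from sums_diff[OF central_sq_sums this]
  have s: "(\<lambda>n. (1 - (1 - \<kappa>) ^ (2 * n)) * ((central n)\<^sup>2 / (real n + 1))) sums (4 / pi - (g 0 - g (1, 1)))"
    by (simp only: left_diff_distrib mult_1_left)
  have "(\<lambda>n. 1 / sqrt (real n + 1)) \<longlonglongrightarrow> 0" by real_asymp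
  from telescope_sums'[OF this]
  have t: "(\<lambda>n. sqrt \<kappa> * (8 * (1 / sqrt (real n + 1) - 1 / sqrt (real (Suc n) + 1)))) sums (sqrt \<kappa> * (8 * (1 - 0)))"
    by (intro sums_mult) simp
  have p: "0 \<le> 1 - (1 - \<kappa>) ^ (2 * n)" for n using \<kappa> by (simp add: power_le_one)
  have c: "(1 - (1 - \<kappa>) ^ (2 * n)) * ((central n)\<^sup>2 / (real n + 1)) \<le>
      sqrt \<kappa> * (8 * (1 / sqrt (real n + 1) - 1 / sqrt (real (Suc n) + 1)))" for n
  proof -
    have "(1 - (1 - \<kappa>) ^ (2 * n)) * ((central n)\<^sup>2 / (real n + 1)) \<le> sqrt (real (2 * n) * \<kappa>) * ((1 / (2 * real n + 1)) / (real n + 1))"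
      using \<kappa> by (intro mult_mono one_minus_power_le divide_right_mono central_sq_le) auto
    also have "\<dots> \<le> (sqrt \<kappa> * sqrt (2 * real n + 1)) * ((1 / (2 * real n + 1)) / (real n + 1))"
      using \<kappa> unfolding real_sqrt_mult mult.commute[of "sqrt \<kappa>"] by (intro mult_right_mono) auto
    also have "\<dots> = sqrt \<kappa> * (1 / sqrt (2 * real n + 1) / (real n + 1))"
    proof -
      define s where "s = sqrt (2 * real n + 1)"
      have s: "s \<noteq> 0" "2 * real n + 1 = s * s" by (simp_all add: s_def)
      have "(c * s) * ((1 / (s * s)) / d) = c * (1 / s / d)" for c d :: real
        using s(1) by simp
      then show ?thesis unfolding s_def[symmetric] unfolding s(2) .
    qed
    also have "\<dots> \<le> sqrt \<kappa> * (1 / sqrt (real n + 1) / (real n + 1))"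
      using \<kappa> by (intro mult_left_mono divide_right_mono divide_left_mono) auto
    also have "\<dots> = sqrt \<kappa> * (1 / (sqrt (real n + 1) * (real n + 1)))" by simp
    also have "\<dots> \<le> sqrt \<kappa> * (8 * (1 / sqrt (real n + 1) - 1 / sqrt (real (Suc n) + 1)))"
      using \<kappa> by (intro mult_left_mono inverse_sqrt_telescope) auto
    finally show ?thesis .
  qed
  have "0 \<le> 4 / pi - (g 0 - g (1, 1))" using sums_le[OF _ sums_zero s] p by simp
  moreover have "4 / pi - (g 0 - g (1, 1)) \<le> sqrt \<kappa> * (8 * (1 - 0))" by (rule sums_le[OF c s t])
  ultimately show ?thesis by simp
qed

end

section \<open>Two independent copies of the environment\<close>

lemma space_Omega: "space Omega = environments"
  by (simp add: Omega_def space_restrict_space)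

lemma space_P_space: "space P_space = prob_vectors"
  by (simp add: P_space_def space_restrict_space)

text \<open>There are countably many sites with second countable fibres, so the Borel sets of the
  product topology are generated by the coordinates.\<close>

lemma measurable_into_Omega:
  assumes "\<And>x. (\<lambda>X. h X x) \<in> M \<rightarrow>\<^sub>M P_space"
  shows "h \<in> M \<rightarrow>\<^sub>M Omega"
  unfolding Omega_def
proof (rule measurable_restrict_space2)
  have "h X x \<in> prob_vectors" if "X \<in> space M" for X x
    using measurable_space[OF assms that] by (simp add: space_P_space)
  then show "h \<in> space M \<rightarrow> environments"
    unfolding environments_def by blast
  have "(\<lambda>X. h X x) \<in> borel_measurable M" for x
    using assms[of x] unfolding P_space_def measurable_restrict_space2_iff by simp
  then show "h \<in> borel_measurable M"
    by (rule measurable_coordinatewise_then_product)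
qed

lemma measurable_site: "(\<lambda>\<omega>. \<omega> x) \<in> Omega \<rightarrow>\<^sub>M P_space"
  using measurable_compose[OF measurable_restrict_env[of "{x}"] measurable_component_singleton[of x "{x}" "\<lambda>_. P_space"]]
  by simp

locale iid_env =
  fixes P :: "env measure"
  assumes iid: "iid_law P"
begin

definition site_law :: "(site \<Rightarrow> real) measure" where
  "site_law = distr P P_space (\<lambda>\<omega>. \<omega> 0)"

text \<open>The coordinates \<open>(x, True)\<close> form one environment, the coordinates \<open>(x, False)\<close> an
  independent one.\<close>

definition copies :: "(site \<times> bool \<Rightarrow> site \<Rightarrow> real) measure" where
  "copies = (\<Pi>\<^sub>M i\<in>UNIV. site_law)"

lemma prob_P: "prob_space P" and sets_P: "sets P = sets Omega"
  using iid by (auto simp: iid_law_def)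

lemma space_P: "space P = environments"
  using sets_eq_imp_space_eq[OF sets_P] by (simp add: space_Omega)

sublocale P: prob_space P by (rule prob_P)

lemma measurable_site_P: "(\<lambda>\<omega>. \<omega> x) \<in> P \<rightarrow>\<^sub>M P_space"
  using measurable_site by (simp add: measurable_cong_sets[OF sets_P refl])

lemma site_law_eq: "distr P P_space (\<lambda>\<omega>. \<omega> x) = site_law"
  using iid unfolding site_law_def iid_law_def by blast

lemma prob_site_law: "prob_space site_law"
  unfolding site_law_def by (rule P.prob_space_distr[OF measurable_site_P])

lemma sets_site_law [measurable_cong]: "sets site_law = sets P_space"
  by (simp add: site_law_def)

sublocale copies: prob_space copies
  unfolding copies_def by (rule prob_space_PiM) (rule prob_site_law)

text \<open>Independence with a common marginal says that \<open>P\<close> is a product measure; the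
  identity map transports it from the product sigma-algebra to \<open>Omega\<close>.\<close>

lemma distr_PiM_site_law: "distr (\<Pi>\<^sub>M x\<in>(UNIV :: site set). site_law) Omega (\<lambda>\<omega>. \<omega>) = P"
proof -
  have "distr P (\<Pi>\<^sub>M x\<in>UNIV. P_space) (\<lambda>\<omega>. \<lambda>x\<in>UNIV. \<omega> x) = (\<Pi>\<^sub>M x\<in>UNIV. distr P P_space (\<lambda>\<omega>. \<omega> x))"
    using iid P.indep_vars_iff_distr_eq_PiM[of UNIV "\<lambda>x \<omega>. \<omega> x" "\<lambda>_. P_space"] measurable_site_P
    by (auto simp: iid_law_def)
  then have e: "(\<Pi>\<^sub>M x\<in>(UNIV :: site set). site_law) = distr P (\<Pi>\<^sub>M x\<in>UNIV. P_space) (\<lambda>\<omega>. \<omega>)"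
    by (simp add: site_law_eq restrict_UNIV)
  have m: "(\<lambda>\<omega>. \<omega>) \<in> P \<rightarrow>\<^sub>M (\<Pi>\<^sub>M x\<in>UNIV. P_space)"
    using measurable_restrict[of UNIV "\<lambda>x \<omega>. \<omega> x" P "\<lambda>_. P_space"] measurable_site_P by (simp add: restrict_UNIV)
  have m': "(\<lambda>\<omega>. \<omega>) \<in> (\<Pi>\<^sub>M x\<in>UNIV. P_space) \<rightarrow>\<^sub>M Omega"
    by (rule measurable_into_Omega) (rule measurable_component_singleton, simp)
  have "distr (distr P (\<Pi>\<^sub>M x\<in>UNIV. P_space) (\<lambda>\<omega>. \<omega>)) Omega (\<lambda>\<omega>. \<omega>) = distr P Omega ((\<lambda>\<omega>. \<omega>) \<circ> (\<lambda>\<omega>. \<omega>))"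
    by (rule distr_distr[OF m' m])
  also have "\<dots> = P" by (simp add: o_def distr_id2 sets_P)
  finally show ?thesis unfolding e .
qed

lemma measurable_coord_copies: "(\<lambda>X. X i) \<in> copies \<rightarrow>\<^sub>M P_space"
  unfolding copies_def by (simp add: measurable_component_singleton[where M = "\<lambda>_. site_law", THEN measurable_cong_sets[OF refl sets_site_law, THEN equalityD1, THEN subsetD]])

text \<open>An injective \<open>f\<close> chooses one coordinate per site, so the result has law
  \<open>P\<close>; varying \<open>f\<close> couples several environments on one space.\<close>

definition pick :: "(site \<Rightarrow> site \<times> bool) \<Rightarrow> (site \<times> bool \<Rightarrow> site \<Rightarrow> real) \<Rightarrow> env" where
  "pick f X x = X (f x)"

lemma measurable_pick: "pick f \<in> copies \<rightarrow>\<^sub>M Omega"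
  by (rule measurable_into_Omega) (simp add: pick_def measurable_coord_copies)

lemma distr_pick:
  assumes "inj f"
  shows "distr copies Omega (pick f) = P"
proof -
  have r: "distr copies (\<Pi>\<^sub>M x\<in>UNIV. site_law) (\<lambda>X. \<lambda>x\<in>UNIV. X (f x)) = (\<Pi>\<^sub>M x\<in>(UNIV::site set). site_law)"
    unfolding copies_def using assms by (intro distr_PiM_reindex prob_site_law) auto
  have m: "(\<lambda>X. \<lambda>x\<in>UNIV. X (f x)) \<in> copies \<rightarrow>\<^sub>M (\<Pi>\<^sub>M x\<in>UNIV. site_law)"
    using measurable_coord_copies by (intro measurable_restrict) (simp add: measurable_cong_sets[OF refl sets_site_law])
  have m': "(\<lambda>\<omega>. \<omega>) \<in> (\<Pi>\<^sub>M x\<in>UNIV. site_law) \<rightarrow>\<^sub>M Omega"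
    by (rule measurable_into_Omega) (simp add: measurable_cong_sets[OF refl sets_site_law[symmetric]])
  have "distr (distr copies (\<Pi>\<^sub>M x\<in>UNIV. site_law) (\<lambda>X. \<lambda>x\<in>UNIV. X (f x))) Omega (\<lambda>\<omega>. \<omega>) =
      distr copies Omega ((\<lambda>\<omega>. \<omega>) \<circ> (\<lambda>X. \<lambda>x\<in>UNIV. X (f x)))"
    by (rule distr_distr[OF m' m])
  then show ?thesis
    unfolding r distr_PiM_site_law by (simp add: o_def restrict_UNIV pick_def[abs_def])
qed

lemma integral_pick:
  fixes h :: "env \<Rightarrow> real"
  assumes "inj f" "h \<in> borel_measurable Omega"
  shows "(LINT X|copies. h (pick f X)) = (LINT \<omega>|P. h \<omega>)"
  by (subst distr_pick[OF assms(1), symmetric], subst integral_distr[OF measurable_pick assms(2)]) simp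

lemma AE_pick:
  assumes "inj f" "AE \<omega> in P. Q \<omega>"
  shows "AE X in copies. Q (pick f X)"
proof -
  have "AE \<omega> in distr copies Omega (pick f). Q \<omega>"
    unfolding distr_pick[OF assms(1)] by (rule assms(2))
  then show ?thesis by (rule AE_distrD[OF measurable_pick])
qed

lemma space_copiesD: "X \<in> space copies \<Longrightarrow> pick f X \<in> environments"
  using measurable_space[OF measurable_pick] by (simp add: space_Omega)

lemma integral_reindex:
  fixes \<Phi> :: "_ \<Rightarrow> real"
  assumes "bij \<tau>" "\<Phi> \<in> borel_measurable copies"
  shows "(LINT X|copies. \<Phi> (X \<circ> \<tau>)) = (LINT X|copies. \<Phi> X)"
proof -
  have r: "distr copies copies (\<lambda>X. X \<circ> \<tau>) = copies"
    using distr_PiM_reindex[of UNIV "\<lambda>_. site_law" \<tau> UNIV] assms(1)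
    by (simp add: copies_def prob_site_law bij_is_inj restrict_UNIV o_def)
  have "(\<lambda>X. \<lambda>x\<in>UNIV. X (\<tau> x)) \<in> copies \<rightarrow>\<^sub>M (\<Pi>\<^sub>M x\<in>UNIV. site_law)"
    using measurable_coord_copies by (intro measurable_restrict) (simp add: measurable_cong_sets[OF refl sets_site_law])
  then have "(\<lambda>X. X \<circ> \<tau>) \<in> copies \<rightarrow>\<^sub>M copies" by (simp add: copies_def restrict_UNIV o_def)
  from integral_distr[OF this assms(2)] show ?thesis unfolding r by simp
qed

lemma integrable_bounded:
  fixes F :: "_ \<Rightarrow> real"
  assumes "F \<in> borel_measurable copies" "\<And>X. X \<in> space copies \<Longrightarrow> \<bar>F X\<bar> \<le> C"
  shows "integrable copies F"
  by (rule copies.integrable_const_bound[of _ C]) (simp_all add: assms AE_I2)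

text \<open>A function of the coordinates in \<open>S\<close> factors through
  \<open>restrict\<close> after the others are filled in from a fixed point \<open>X0\<close>;
  disjoint blocks of coordinates are independent.\<close>

lemma integral_indep:
  fixes F G :: "_ \<Rightarrow> real"
  assumes F: "F \<in> borel_measurable copies" "\<And>X. X \<in> space copies \<Longrightarrow> \<bar>F X\<bar> \<le> C"
    "\<And>X X'. X \<in> space copies \<Longrightarrow> X' \<in> space copies \<Longrightarrow> (\<And>i. i \<in> S \<Longrightarrow> X i = X' i) \<Longrightarrow> F X = F X'"
  assumes G: "G \<in> borel_measurable copies" "\<And>X. X \<in> space copies \<Longrightarrow> \<bar>G X\<bar> \<le> C'"
    "\<And>X X'. X \<in> space copies \<Longrightarrow> X' \<in> space copies \<Longrightarrow> (\<And>i. i \<notin> S \<Longrightarrow> X i = X' i) \<Longrightarrow> G X = G X'"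
  shows "(LINT X|copies. F X * G X) = (LINT X|copies. F X) * (LINT X|copies. G X)"
proof -
  obtain X0 where X0: "X0 \<in> space copies" using copies.not_empty by blast
  have "copies.indep_vars (\<lambda>_. site_law) (\<lambda>i X. X i) UNIV"
  proof (rule copies.indep_vars_iff_distr_eq_PiM[THEN iffD2])
    show "copies.random_variable site_law (\<lambda>X. X i)" for i
      using measurable_coord_copies by (simp add: measurable_cong_sets[OF refl sets_site_law])
    have "distr copies site_law (\<lambda>X. X i) = site_law" for i
      unfolding copies_def by (rule distr_PiM_component) (auto intro: prob_site_law)
    then show "distr copies (\<Pi>\<^sub>M i\<in>UNIV. site_law) (\<lambda>X. \<lambda>i\<in>UNIV. X i) = (\<Pi>\<^sub>M i\<in>UNIV. distr copies site_law (\<lambda>X. X i))"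
      by (simp add: restrict_UNIV copies_def)
  qed simp_all
  then have iv: "copies.indep_var (PiM S (\<lambda>_. site_law)) (\<lambda>X. restrict X S) (PiM (- S) (\<lambda>_. site_law)) (\<lambda>X. restrict X (- S))"
    by (rule copies.indep_var_restrict) auto
  define merge where "merge S' Y i = (if i \<in> S' then Y i else X0 i)" for S' Y i
  have merge: "merge S' \<in> PiM S' (\<lambda>_. site_law) \<rightarrow>\<^sub>M copies" for S'
  proof -
    have X0': "X0 i \<in> space site_law" for i using X0 by (auto simp: copies_def space_PiM)
    have "(\<lambda>Y. \<lambda>i\<in>UNIV. if i \<in> S' then Y i else X0 i) \<in> PiM S' (\<lambda>_. site_law) \<rightarrow>\<^sub>M copies"
      unfolding copies_def
    proof (rule measurable_restrict)
      show "(\<lambda>Y. if i \<in> S' then Y i else X0 i) \<in> PiM S' (\<lambda>_. site_law) \<rightarrow>\<^sub>M site_law" for i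
        using X0' by (cases "i \<in> S'") (auto intro: measurable_component_singleton)
    qed
    then show ?thesis by (simp add: merge_def[abs_def] restrict_UNIV)
  qed
  have res: "(\<lambda>X. restrict X S') \<in> copies \<rightarrow>\<^sub>M PiM S' (\<lambda>_. site_law)" for S'
    unfolding copies_def by (rule measurable_restrict_subset) simp
  have sp: "merge S' (restrict X S') \<in> space copies" if "X \<in> space copies" for X S'
    using measurable_space[OF merge measurable_space[OF res that]] .
  have "copies.indep_var borel ((F \<circ> merge S) \<circ> (\<lambda>X. restrict X S)) borel ((G \<circ> merge (- S)) \<circ> (\<lambda>X. restrict X (- S)))"
    by (rule copies.indep_var_compose[OF iv]) (intro measurable_comp[OF merge] F(1) G(1))+
  moreover have e: "((F \<circ> merge S) \<circ> (\<lambda>X. restrict X S)) X = F X" "((G \<circ> merge (- S)) \<circ> (\<lambda>X. restrict X (- S))) X = G X"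
    if "X \<in> space copies" for X
    using sp[OF that] that by (auto simp: merge_def intro!: F(3) G(3))
  moreover have "integrable copies F" "integrable copies G"
    by (rule integrable_bounded[OF F(1,2)] integrable_bounded[OF G(1,2)], assumption)+
  then have "integrable copies ((F \<circ> merge S) \<circ> (\<lambda>X. restrict X S))" "integrable copies ((G \<circ> merge (- S)) \<circ> (\<lambda>X. restrict X (- S)))"
    by (simp_all only: e cong: Bochner_Integration.integrable_cong)
  ultimately have "(LINT X|copies. ((F \<circ> merge S) \<circ> (\<lambda>X. restrict X S)) X * ((G \<circ> merge (- S)) \<circ> (\<lambda>X. restrict X (- S))) X) =
      (LINT X|copies. ((F \<circ> merge S) \<circ> (\<lambda>X. restrict X S)) X) * (LINT X|copies. ((G \<circ> merge (- S)) \<circ> (\<lambda>X. restrict X (- S))) X)"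
    by (intro copies.indep_var_lebesgue_integral)
  then show ?thesis by (simp only: e cong: Bochner_Integration.integral_cong)
qed

end

text \<open>A countable index set admits an exhausting sequence of finite sets, which replaces the
  net defining \<open>infsum\<close> by a sequential limit.\<close>

lemma borel_measurable_infsum:
  fixes f :: "'b::countable \<Rightarrow> 'a \<Rightarrow> real"
  assumes "\<And>x. f x \<in> borel_measurable M" "\<And>\<omega>. \<omega> \<in> space M \<Longrightarrow> (\<lambda>x. f x \<omega>) summable_on UNIV"
  shows "(\<lambda>\<omega>. \<Sum>\<^sub>\<infinity>x. f x \<omega>) \<in> borel_measurable M"
proof (rule borel_measurable_LIMSEQ_real)
  define F where "F n = {x :: 'b. to_nat x < n}" for n
  have fin: "finite (F n)" for n
    unfolding F_def by (rule finite_imageD[of to_nat]) (auto intro: finite_subset[of _ "{..<n}"])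
  have lim: "filterlim F (finite_subsets_at_top UNIV) sequentially"
    unfolding filterlim_finite_subsets_at_top
  proof (intro allI impI)
    fix X :: "'b set" assume X: "finite X \<and> X \<subseteq> UNIV"
    obtain N where "\<forall>x\<in>to_nat ` X. x < N" using X finite_nat_set_iff_bounded[of "to_nat ` X"] by auto
    then have "X \<subseteq> F n" if "N \<le> n" for n using that by (auto simp: F_def)
    then show "\<forall>\<^sub>F n in sequentially. finite (F n) \<and> X \<subseteq> F n \<and> F n \<subseteq> UNIV"
      using fin by (auto simp: eventually_sequentially)
  qed
  show "(\<lambda>\<omega>. \<Sum>x\<in>F n. f x \<omega>) \<in> borel_measurable M" for n
    using assms(1) by measurable
  show "(\<lambda>n. \<Sum>x\<in>F n. f x \<omega>) \<longlonglongrightarrow> (\<Sum>\<^sub>\<infinity>x. f x \<omega>)" if "\<omega> \<in> space M" for \<omega>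
    using filterlim_compose[OF infsum_tendsto[OF assms(2)[OF that]] lim] by simp
qed

lemma measurable_pot_damped: "(\<lambda>\<omega>. pot (damped \<delta> \<omega>) c y) \<in> borel_measurable Omega"
proof -
  have "(\<lambda>\<omega>. (step_op (damped \<delta> \<omega>) ^^ n) c y) \<in> borel_measurable Omega" for n
  proof (induction n arbitrary: y)
    case (Suc n)
    have "(\<lambda>\<omega>. step_op (damped \<delta> \<omega>) ((step_op (damped \<delta> \<omega>) ^^ n) c) y) =
        (\<lambda>\<omega>. \<Sum>e\<in>steps. \<delta> * \<omega> y e * (step_op (damped \<delta> \<omega>) ^^ n) c (y + e))"
      by (simp only: step_op_def[of _ "(step_op _ ^^ n) c"] damped_def)
    also have "\<dots> \<in> borel_measurable Omega"
      by (intro borel_measurable_sum borel_measurable_times borel_measurable_const measurable_coord Suc)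
    finally show ?case by simp
  qed simp
  then show ?thesis unfolding pot_def by (rule borel_measurable_suminf)
qed

lemma measurable_green_damped: "(\<lambda>\<omega>. green (damped \<delta> \<omega>) y x) \<in> borel_measurable Omega"
  unfolding green_def by (rule measurable_pot_damped)

lemma measurable_mass_damped: "0 \<le> \<delta> \<Longrightarrow> \<delta> < 1 \<Longrightarrow> (\<lambda>\<omega>. mass (damped \<delta> \<omega>) x) \<in> borel_measurable Omega"
  unfolding mass_def
  by (intro borel_measurable_infsum measurable_green_damped green_summable(1)[OF subkernel_damped]) (simp_all add: space_Omega)

section \<open>Expected masses under the environment law\<close>

lemma green_shift:
  assumes "\<omega> \<in> environments" "0 \<le> \<delta>" "\<delta> < 1"
  shows "green (damped \<delta> (env_shift y \<omega>)) a b = green (damped \<delta> \<omega>) (y + a) (y + b)"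
  unfolding green_def
proof (rule pot_unique[symmetric])
  have e: "env_shift y \<omega> \<in> environments" using assms(1) unfolding environments_def env_shift_def by blast
  show "subkernel \<delta> (damped \<delta> (env_shift y \<omega>))" by (rule subkernel_damped[OF e assms(2,3)])
  note s = subkernel_damped[OF assms]
  show "bdd (\<lambda>a. pot (damped \<delta> \<omega>) (unit_at (y + b)) (y + a))"
    by (rule bdd_shift) (rule bdd_pot[OF s bdd_unit_at])
  show "pot (damped \<delta> \<omega>) (unit_at (y + b)) (y + a) =
      unit_at b a + step_op (damped \<delta> (env_shift y \<omega>)) (\<lambda>a. pot (damped \<delta> \<omega>) (unit_at (y + b)) (y + a)) a" for a
    by (subst pot_eq[OF s bdd_unit_at]) (simp add: unit_at_def step_op_def damped_def env_shift_def add.assoc)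
qed simp

lemma mass_shift:
  assumes "\<omega> \<in> environments" "0 \<le> \<delta>" "\<delta> < 1"
  shows "mass (damped \<delta> (env_shift y \<omega>)) x = mass (damped \<delta> \<omega>) (y + x)"
  unfolding mass_def green_shift[OF assms]
  by (rule infsum_translate(4)[where f = "\<lambda>u. green (damped \<delta> \<omega>) u (y + x)"])

text \<open>The lower bound on \<open>\<delta>\<close> keeps the killing below the effect
  \<epsilon>^2 of the drift. The resulting bounds are uniform in this range, so that
  \<open>\<delta>\<close> can tend to 1.\<close>

locale low_disorder = iid_env P for P +
  fixes \<epsilon> \<delta> :: real
  assumes \<epsilon>: "0 < \<epsilon>" "\<epsilon> \<le> 1 / 1000" and LD: "LD srw \<epsilon> P"
    and \<delta>: "1 - \<epsilon>\<^sup>2 / 4 \<le> \<delta>" "\<delta> < 1"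
begin

lemma \<epsilon>2: "\<epsilon>\<^sup>2 \<le> \<epsilon> / 1000" "0 < \<epsilon>\<^sup>2" "\<epsilon>\<^sup>2 \<le> 1 / 1000000"
  using \<epsilon> mult_left_mono[of \<epsilon> "1 / 1000" \<epsilon>] mult_mono[of \<epsilon> "1 / 1000" \<epsilon> "1 / 1000"]
  by (auto simp: power2_eq_square)

lemma \<delta>0: "0 \<le> \<delta>" "9 / 10 \<le> \<delta>" using \<delta> \<epsilon>2 by linarith+

abbreviation "Near \<equiv> environments_near srw \<epsilon>"

lemma AE_near: "AE \<omega> in P. \<omega> \<in> Near"
proof -
  have m: "measure P Near = 1" using LD by (simp add: LD_def)
  then have "Near \<in> sets P" using measure_notin_sets by fastforce
  then show ?thesis using m P.prob_eq_1 by simp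
qed

text \<open>The second copy on \<open>S\<close> and the first elsewhere; in particular
  \<open>mix {}\<close> and \<open>mix UNIV\<close> are independent.\<close>

definition mix :: "site set \<Rightarrow> (site \<times> bool \<Rightarrow> site \<Rightarrow> real) \<Rightarrow> env" where
  "mix S = pick (\<lambda>x. (x, x \<notin> S))"

definition swap :: "site set \<Rightarrow> site \<times> bool \<Rightarrow> site \<times> bool" where
  "swap S = (\<lambda>(x, b). (x, if x \<in> S then \<not> b else b))"

lemma mix_apply: "mix S X x = X (x, x \<notin> S)"
  by (simp add: mix_def pick_def)

lemma bij_swap: "bij (swap S)"
  by (rule o_bij[where g = "swap S"]) (auto simp: swap_def fun_eq_iff)

lemma mix_swap: "mix T (X \<circ> swap S) = mix (T - S \<union> (S - T)) X"
  by (auto simp: mix_apply swap_def fun_eq_iff)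

lemma inj_mix: "inj (\<lambda>x. (x, x \<notin> S))"
  by (simp add: inj_on_def)

definition rv :: "(env \<Rightarrow> real) \<Rightarrow> bool" where
  "rv h \<longleftrightarrow> h \<in> borel_measurable Omega \<and> (\<exists>C. \<forall>\<omega>\<in>environments. \<bar>h \<omega>\<bar> \<le> C)"

definition crv :: "((site \<times> bool \<Rightarrow> site \<Rightarrow> real) \<Rightarrow> real) \<Rightarrow> bool" where
  "crv F \<longleftrightarrow> F \<in> borel_measurable copies \<and> (\<exists>C. \<forall>X\<in>space copies. \<bar>F X\<bar> \<le> C)"

lemma bounded_ops:
  assumes "\<exists>C. \<forall>x\<in>A. \<bar>f x :: real\<bar> \<le> C" "\<exists>C. \<forall>x\<in>A. \<bar>g x\<bar> \<le> C"
  shows "\<exists>C. \<forall>x\<in>A. \<bar>f x * g x\<bar> \<le> C" "\<exists>C. \<forall>x\<in>A. \<bar>f x + g x\<bar> \<le> C" "\<exists>C. \<forall>x\<in>A. \<bar>f x - g x\<bar> \<le> C"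
proof -
  obtain C D where C: "\<And>x. x \<in> A \<Longrightarrow> \<bar>f x\<bar> \<le> C" "\<And>x. x \<in> A \<Longrightarrow> \<bar>g x\<bar> \<le> D" using assms by blast
  have "\<bar>f x * g x\<bar> \<le> C * D" "\<bar>f x + g x\<bar> \<le> C + D" "\<bar>f x - g x\<bar> \<le> C + D" if "x \<in> A" for x
    using mult_mono[OF C(1)[OF that] C(2)[OF that] order_trans[OF abs_ge_zero C(1)[OF that]]] C[OF that]
    by (auto simp: abs_mult)
  then show "\<exists>C. \<forall>x\<in>A. \<bar>f x * g x\<bar> \<le> C" "\<exists>C. \<forall>x\<in>A. \<bar>f x + g x\<bar> \<le> C" "\<exists>C. \<forall>x\<in>A. \<bar>f x - g x\<bar> \<le> C"
    by blast+
qed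

lemma rv_ops:
  assumes "rv f" "rv g"
  shows "rv (\<lambda>\<omega>. f \<omega> * g \<omega>)" "rv (\<lambda>\<omega>. f \<omega> + g \<omega>)" "rv (\<lambda>\<omega>. f \<omega> - g \<omega>)"
  using assms bounded_ops[where f = f and g = g and A = environments] unfolding rv_def by auto

lemma rv_const: "rv (\<lambda>_. c)"
  unfolding rv_def by auto

lemma rv_coord: "rv (\<lambda>\<omega>. \<omega> x e)"
  unfolding rv_def
proof (intro conjI measurable_coord exI[of _ 1] ballI)
  fix \<omega> assume \<omega>: "\<omega> \<in> environments"
  show "\<bar>\<omega> x e\<bar> \<le> 1"
  proof (cases "e \<in> steps")
    case True
    then have "\<omega> x e \<le> (\<Sum>e\<in>steps. \<omega> x e)"
      using \<omega> by (intro member_le_sum) (auto simp: environmentsD finite_steps)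
    then show ?thesis using environmentsD[OF \<omega>] by simp
  qed (simp add: environmentsD[OF \<omega>])
qed

lemma crv_ops:
  assumes "crv f" "crv g"
  shows "crv (\<lambda>\<omega>. f \<omega> * g \<omega>)" "crv (\<lambda>\<omega>. f \<omega> + g \<omega>)" "crv (\<lambda>\<omega>. f \<omega> - g \<omega>)"
  using assms bounded_ops[where f = f and g = g and A = "space copies"] unfolding crv_def by auto

lemma crv_const: "crv (\<lambda>_. c)"
  unfolding crv_def by auto

lemma crv_mix:
  assumes "rv h"
  shows "crv (\<lambda>X. h (mix S X))"
proof -
  obtain C where C: "\<And>\<omega>. \<omega> \<in> environments \<Longrightarrow> \<bar>h \<omega>\<bar> \<le> C" using assms unfolding rv_def by blast
  have "(\<lambda>X. h (mix S X)) \<in> borel_measurable copies"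
    using assms measurable_compose[OF measurable_pick] unfolding rv_def mix_def by blast
  then show ?thesis unfolding crv_def mix_def using C space_copiesD by blast
qed

lemma crv_mix_coord: "crv (\<lambda>X. mix S X x e)"
  using crv_mix[OF rv_coord] .

lemma crv_integrable: "crv F \<Longrightarrow> integrable copies F"
  unfolding crv_def using integrable_bounded by blast

lemma rv_integrable: "rv h \<Longrightarrow> integrable P h"
  unfolding rv_def
  by (elim conjE exE, rule P.integrable_const_bound) (auto simp: measurable_cong_sets[OF sets_P refl] space_P intro!: AE_I2)

lemmas crv_intros = crv_ops crv_const crv_mix crv_mix_coord
lemmas rv_intros = rv_ops rv_const rv_coord

lemma integral_mix: "rv h \<Longrightarrow> (LINT X|copies. h (mix S X)) = (LINT \<omega>|P. h \<omega>)"
  unfolding mix_def rv_def by (intro integral_pick inj_mix) auto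

lemma integral_swap: "crv \<Phi> \<Longrightarrow> (LINT X|copies. \<Phi> (X \<circ> swap S)) = (LINT X|copies. \<Phi> X)"
  unfolding crv_def by (intro integral_reindex bij_swap) auto

lemma crv_swap:
  assumes "crv \<Phi>"
  shows "crv (\<lambda>X. \<Phi> (X \<circ> swap S))"
proof -
  have "(\<lambda>X. \<lambda>x\<in>UNIV. X (swap S x)) \<in> copies \<rightarrow>\<^sub>M (\<Pi>\<^sub>M x\<in>UNIV. site_law)"
    using measurable_coord_copies by (intro measurable_restrict) (simp add: measurable_cong_sets[OF refl sets_site_law])
  then have m: "(\<lambda>X. X \<circ> swap S) \<in> copies \<rightarrow>\<^sub>M copies" by (simp add: copies_def restrict_UNIV o_def)
  show ?thesis
    using assms measurable_compose[OF m] measurable_space[OF m] unfolding crv_def by blast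
qed

lemma near_mix:
  assumes "mix {} X \<in> Near" "mix UNIV X \<in> Near"
  shows "mix S X \<in> Near"
proof -
  have "mix S X x = (if x \<in> S then mix UNIV X x else mix {} X x)" for x by (simp add: mix_apply)
  then show ?thesis using assms unfolding environments_near_def environments_def by auto
qed

lemma AE_near_mix: "AE X in copies. \<forall>S. mix S X \<in> Near"
proof -
  have "AE X in copies. mix {} X \<in> Near" "AE X in copies. mix UNIV X \<in> Near"
    unfolding mix_def by (intro AE_pick inj_mix AE_near)+
  then show ?thesis by eventually_elim (auto intro: near_mix)
qed

lemma site_change_mix:
  assumes "\<forall>S. mix S X \<in> Near" "S - {x} = T - {x}"
  shows "site_change \<delta> \<epsilon> x (mix S X) (mix T X)"
proof unfold_locales
  fix y assume "y \<noteq> x"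
  then have "y \<in> S \<longleftrightarrow> y \<in> T" using assms(2) by blast
  then show "mix T X y = mix S X y" by (simp add: mix_apply)
qed (use assms \<delta> \<delta>0 \<epsilon> in auto)

lemma integral_abs_le:
  assumes "crv F" "crv Z" "AE X in copies. \<bar>F X\<bar> \<le> Z X"
  shows "\<bar>LINT X|copies. F X\<bar> \<le> (LINT X|copies. Z X)"
  by (rule order_trans[OF integral_abs_bound
        integral_mono_AE[OF integrable_abs[OF crv_integrable[OF assms(1)]] crv_integrable[OF assms(2)] assms(3)]])

lemma integral_le:
  assumes "crv F" "crv Z" "AE X in copies. F X \<le> Z X"
  shows "(LINT X|copies. F X) \<le> (LINT X|copies. Z X)"
  using assms by (intro integral_mono_AE crv_integrable)

text \<open>The difference of the copies at \<open>x\<close> changes sign under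
  \<open>swap {x}\<close>, while the measure is invariant. Hence \<open>Y\<close> may be replaced by
  half its oscillation, and the difference itself is at most 2\<epsilon>.\<close>

lemma resample:
  assumes "crv Y" "crv Z" "e \<in> steps"
    and le: "AE X in copies. \<bar>Y X - Y (X \<circ> swap {x})\<bar> \<le> Z X"
  shows "\<bar>LINT X|copies. Y X * (mix {} X x e - mix UNIV X x e)\<bar> \<le> \<epsilon> * (LINT X|copies. Z X)"
proof -
  define \<Delta> where "\<Delta> X = mix {} X x e - mix UNIV X x e" for X
  have \<Delta>: "crv \<Delta>" unfolding \<Delta>_def by (intro crv_intros)
  have sw: "\<Delta> (X \<circ> swap {x}) = - \<Delta> X" for X by (simp add: \<Delta>_def mix_swap) (simp add: mix_apply)
  have "(LINT X|copies. Y X * \<Delta> X) = (LINT X|copies. Y (X \<circ> swap {x}) * \<Delta> (X \<circ> swap {x}))"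
    using integral_swap[OF crv_ops(1)[OF assms(1) \<Delta>], of "{x}"] by simp
  also have "\<dots> = - (LINT X|copies. Y (X \<circ> swap {x}) * \<Delta> X)"
    by (simp add: sw)
  finally have "2 * (LINT X|copies. Y X * \<Delta> X) = (LINT X|copies. Y X * \<Delta> X) - (LINT X|copies. Y (X \<circ> swap {x}) * \<Delta> X)"
    by simp
  also have "\<dots> = (LINT X|copies. (Y X - Y (X \<circ> swap {x})) * \<Delta> X)"
    by (subst Bochner_Integration.integral_diff[symmetric])
       (auto intro!: crv_integrable crv_ops assms \<Delta> crv_swap simp: left_diff_distrib)
  also have "\<bar>\<dots>\<bar> \<le> (LINT X|copies. Z X * (2 * \<epsilon>))"
  proof (rule integral_abs_le)
    show "AE X in copies. \<bar>(Y X - Y (X \<circ> swap {x})) * \<Delta> X\<bar> \<le> Z X * (2 * \<epsilon>)"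
      using le AE_near_mix
    proof eventually_elim
      case (elim X)
      have "\<bar>\<Delta> X\<bar> \<le> 2 * \<epsilon>"
        using environments_nearD(2)[of "mix {} X" \<epsilon> e x] environments_nearD(2)[of "mix UNIV X" \<epsilon> e x] elim(2) assms(3)
        unfolding \<Delta>_def by (smt (verit))
      then show ?case unfolding abs_mult using elim(1) by (intro mult_mono) auto
    qed
  qed (intro crv_intros crv_swap assms \<Delta>)+
  also have "\<dots> = 2 * (\<epsilon> * (LINT X|copies. Z X))" by simp
  finally show ?thesis unfolding \<Delta>_def by (simp add: abs_mult)
qed

section \<open>Annealed jump probabilities and covariances\<close>

definition pbar :: "site \<Rightarrow> real" where
  "pbar e = (LINT \<omega>|P. \<omega> 0 e)"

lemma integral_shift:
  assumes "rv h"
  shows "(LINT \<omega>|P. h (env_shift y \<omega>)) = (LINT \<omega>|P. h \<omega>)"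
proof -
  have h: "h \<in> borel_measurable Omega" using assms by (simp add: rv_def)
  have "(LINT \<omega>|P. h (env_shift y \<omega>)) = (LINT X|copies. h (env_shift y (pick (\<lambda>x. (x, True)) X)))"
    by (rule integral_pick[symmetric]) (auto intro: inj_onI measurable_compose[OF measurable_env_shift h])
  also have "\<dots> = (LINT X|copies. h (pick (\<lambda>x. (y + x, True)) X))"
    by (simp add: env_shift_def pick_def[abs_def])
  also have "\<dots> = (LINT \<omega>|P. h \<omega>)"
    by (rule integral_pick[OF _ h]) (auto intro: inj_onI)
  finally show ?thesis .
qed

lemma pbar_eq: "(LINT \<omega>|P. \<omega> x e) = pbar e"
  using integral_shift[OF rv_coord[of 0 e], of x] by (simp add: pbar_def env_shift_def)

lemma indep_copies:
  assumes "rv g" "rv h"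
  shows "(LINT X|copies. g (mix {} X) * h (mix UNIV X)) = (LINT \<omega>|P. g \<omega>) * (LINT \<omega>|P. h \<omega>)"
proof -
  have c: "crv (\<lambda>X. g (mix {} X))" "crv (\<lambda>X. h (mix UNIV X))" by (intro crv_mix assms)+
  obtain C D where "\<And>X. X \<in> space copies \<Longrightarrow> \<bar>g (mix {} X)\<bar> \<le> C" "\<And>X. X \<in> space copies \<Longrightarrow> \<bar>h (mix UNIV X)\<bar> \<le> D"
    using c unfolding crv_def by blast
  then have "(LINT X|copies. g (mix {} X) * h (mix UNIV X)) = (LINT X|copies. g (mix {} X)) * (LINT X|copies. h (mix UNIV X))"
    using c by (intro integral_indep[where S = "UNIV \<times> {True}"])
      (auto simp: crv_def mix_def pick_def[abs_def] intro!: arg_cong[of _ _ g] arg_cong[of _ _ h])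
  then show ?thesis by (simp add: integral_mix assms)
qed

text \<open>The second copy of \<open>\<omega> x e\<close> has mean \<open>pbar e\<close> and is
  independent of \<open>W\<close>, so the covariance is an integral against the difference of the
  copies. The oscillation and the difference contribute one \<epsilon> each.\<close>

lemma covariance_le:
  assumes W: "rv W" and e: "e \<in> steps"
    and osc: "\<And>\<omega> \<omega>'. site_change \<delta> \<epsilon> x \<omega> \<omega>' \<Longrightarrow> \<bar>W \<omega> - W \<omega>'\<bar> \<le> c * \<epsilon> * W \<omega>"
  shows "\<bar>(LINT \<omega>|P. W \<omega> * \<omega> x e) - pbar e * (LINT \<omega>|P. W \<omega>)\<bar> \<le> c * \<epsilon>\<^sup>2 * (LINT \<omega>|P. W \<omega>)"
proof -
  have "(LINT X|copies. W (mix {} X) * (mix {} X x e - mix UNIV X x e)) =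
      (LINT X|copies. W (mix {} X) * mix {} X x e) - (LINT X|copies. W (mix {} X) * mix UNIV X x e)"
    by (subst Bochner_Integration.integral_diff[symmetric])
       (auto intro!: crv_integrable crv_intros rv_intros W simp: right_diff_distrib)
  also have "\<dots> = (LINT \<omega>|P. W \<omega> * \<omega> x e) - pbar e * (LINT \<omega>|P. W \<omega>)"
    using integral_mix[OF rv_ops(1)[OF W rv_coord], of "{}" x e] indep_copies[OF W rv_coord, of x e] by (simp add: pbar_eq)
  finally have "\<bar>(LINT \<omega>|P. W \<omega> * \<omega> x e) - pbar e * (LINT \<omega>|P. W \<omega>)\<bar> =
      \<bar>LINT X|copies. W (mix {} X) * (mix {} X x e - mix UNIV X x e)\<bar>" by simp
  also have "\<dots> \<le> \<epsilon> * (LINT X|copies. c * \<epsilon> * W (mix {} X))"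
  proof (rule resample[OF _ _ e])
    show "AE X in copies. \<bar>W (mix {} X) - W (mix {} (X \<circ> swap {x}))\<bar> \<le> c * \<epsilon> * W (mix {} X)"
      using AE_near_mix by eventually_elim (auto simp: mix_swap intro!: osc site_change_mix)
  qed (intro crv_intros W)+
  also have "\<dots> = c * \<epsilon>\<^sup>2 * (LINT \<omega>|P. W \<omega>)"
    by (simp add: integral_mix W power2_eq_square)
  finally show ?thesis .
qed

definition m :: "site \<Rightarrow> env \<Rightarrow> real" where
  "m x \<omega> = (1 - \<delta>) * mass (damped \<delta> \<omega>) x"

definition V :: "site \<Rightarrow> site \<Rightarrow> env \<Rightarrow> real" where
  "V z x \<omega> = (1 - \<delta>) * through \<delta> \<omega> z x"

definition g :: "site \<Rightarrow> site \<Rightarrow> env \<Rightarrow> real" where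
  "g z x \<omega> = green (damped \<delta> \<omega>) z x"

lemma sub: "\<omega> \<in> environments \<Longrightarrow> subkernel \<delta> (damped \<delta> \<omega>)"
  using \<delta> \<delta>0 by (intro subkernel_damped) auto

lemma m_nonneg: "\<omega> \<in> environments \<Longrightarrow> 0 \<le> m x \<omega>"
  using mass_nonneg[OF sub] \<delta> by (simp add: m_def)

lemma g_nonneg: "\<omega> \<in> environments \<Longrightarrow> 0 \<le> g z x \<omega>"
  using green_nonneg[OF sub] by (simp add: g_def)

lemma V_bounds:
  assumes "\<omega> \<in> environments"
  shows "0 \<le> V z x \<omega>" "x \<noteq> z \<Longrightarrow> V z x \<omega> \<le> m x \<omega>" "V z x \<omega> \<le> m z \<omega> * g z x \<omega>"
  using through_bounds[OF assms, of \<delta>] \<delta> \<delta>0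
  by (auto simp: V_def m_def g_def mult.assoc intro!: mult_left_mono)

text \<open>Diverges as \<open>\<delta>\<close> tends to 1; it serves for boundedness and
  summability only.\<close>

definition Cm :: real where
  "Cm = (1 - \<delta>) * (\<Sum>\<^sub>\<infinity>y. \<delta> ^ rad y / (1 - \<delta>))"

lemma m_le: "\<omega> \<in> environments \<Longrightarrow> \<bar>m x \<omega>\<bar> \<le> Cm"
  using m_nonneg[of \<omega> x] mass_le[OF sub] \<delta> by (simp add: m_def Cm_def mult_left_mono)

lemma g_le: "\<omega> \<in> environments \<Longrightarrow> \<bar>g z x \<omega>\<bar> \<le> \<delta> ^ rad (x - z) / (1 - \<delta>)"
  using g_nonneg[of \<omega> z x] green_decay[OF sub] by (simp add: g_def)

lemma rv_m: "rv (m x)"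
  unfolding rv_def
proof
  show "m x \<in> borel_measurable Omega"
    unfolding m_def[abs_def] by (intro borel_measurable_times borel_measurable_const measurable_mass_damped \<delta>0 \<delta>)
qed (use m_le in blast)

lemma rv_g: "rv (g z x)"
  unfolding rv_def using g_le measurable_green_damped unfolding g_def[abs_def] by blast

lemma rv_V: "rv (V z x)"
proof -
  have a: "rv (\<lambda>\<omega>. m z \<omega> * g z x \<omega>)" by (intro rv_ops rv_m rv_g)
  then obtain C where C: "\<And>\<omega>. \<omega> \<in> environments \<Longrightarrow> \<bar>m z \<omega> * g z x \<omega>\<bar> \<le> C" unfolding rv_def by blast
  have "V z x = (\<lambda>\<omega>. (m z \<omega> * g z x \<omega>) / g z z \<omega>)"
    by (simp add: V_def through_def m_def g_def fun_eq_iff)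
  then have "V z x \<in> borel_measurable Omega"
    using a rv_g[of z z] unfolding rv_def by auto
  moreover have "\<bar>V z x \<omega>\<bar> \<le> C" if "\<omega> \<in> environments" for \<omega>
    using V_bounds(1,3)[OF that, of z x] C[OF that] by linarith
  ultimately show ?thesis unfolding rv_def by blast
qed

lemma m_eq: "\<omega> \<in> environments \<Longrightarrow> m x \<omega> = (1 - \<delta>) + \<delta> * (\<Sum>e\<in>steps. m (x - e) \<omega> * \<omega> (x - e) e)"
  unfolding m_def by (subst mass_eq[OF sub]) (simp_all add: damped_def algebra_simps sum_distrib_left)

lemma m_shift: "\<omega> \<in> environments \<Longrightarrow> m x (env_shift y \<omega>) = m (y + x) \<omega>"
  unfolding m_def by (simp add: mass_shift \<delta>0 \<delta>)

text \<open>The mean jump probability under the weight \<open>m 0\<close>. Centring at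
  \<open>phat\<close> rather than \<open>pbar\<close> gives
  \<open>m x \<omega> * (\<omega> x e - phat e)\<close> mean exactly zero.\<close>

definition phat :: "site \<Rightarrow> real" where
  "phat e = (LINT \<omega>|P. m 0 \<omega> * \<omega> 0 e)"

lemma integral_cong_env: "(\<And>\<omega>. \<omega> \<in> environments \<Longrightarrow> f \<omega> = h \<omega>) \<Longrightarrow> (LINT \<omega>|P. f \<omega>) = (LINT \<omega>|P. h \<omega> :: real)"
  by (rule Bochner_Integration.integral_cong) (simp_all add: space_P)

lemma phat_eq: "(LINT \<omega>|P. m x \<omega> * \<omega> x e) = phat e"
proof -
  have "phat e = (LINT \<omega>|P. m 0 (env_shift x \<omega>) * env_shift x \<omega> 0 e)"
    unfolding phat_def by (rule integral_shift[symmetric]) (intro rv_ops rv_m rv_coord)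
  also have "\<dots> = (LINT \<omega>|P. m x \<omega> * \<omega> x e)"
    by (rule integral_cong_env) (simp only: m_shift, simp add: env_shift_def)
  finally show ?thesis ..
qed

text \<open>Averaging the mass equation and using shift invariance gives
  \<open>c = (1 - \<delta>) + \<delta> * c\<close>.\<close>

lemma m_mean: "(LINT \<omega>|P. m x \<omega>) = 1"
proof -
  define c where "c = (LINT \<omega>|P. m 0 \<omega>)"
  have c: "(LINT \<omega>|P. m x \<omega>) = c" for x
  proof -
    have "c = (LINT \<omega>|P. m 0 (env_shift x \<omega>))" unfolding c_def by (rule integral_shift[OF rv_m, symmetric])
    also have "\<dots> = (LINT \<omega>|P. m x \<omega>)" by (rule integral_cong_env) (simp add: m_shift)
    finally show ?thesis ..
  qed
  have i: "integrable P (\<lambda>\<omega>. m x \<omega> * \<omega> x e)" for x e by (intro rv_integrable rv_ops rv_m rv_coord)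
  have "c = (LINT \<omega>|P. (1 - \<delta>) + \<delta> * (\<Sum>e\<in>steps. m (0 - e) \<omega> * \<omega> (0 - e) e))"
    unfolding c_def by (rule integral_cong_env) (rule m_eq)
  also have "\<dots> = (1 - \<delta>) + \<delta> * (\<Sum>e\<in>steps. phat e)"
    using i by (simp add: P.prob_space phat_eq)
  also have "(\<Sum>e\<in>steps. phat e) = (LINT \<omega>|P. (\<Sum>e\<in>steps. m 0 \<omega> * \<omega> 0 e))"
    unfolding phat_def using i by simp
  also have "\<dots> = c"
    unfolding c_def by (rule integral_cong_env) (simp add: environmentsD flip: sum_distrib_left)
  finally have "(1 - \<delta>) * c = (1 - \<delta>)" by (simp add: algebra_simps)
  then show ?thesis using c \<delta> by simp
qed

lemma sum_phat: "(\<Sum>e\<in>steps. phat e) = 1"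
proof -
  have i: "integrable P (\<lambda>\<omega>. m x \<omega> * \<omega> x e)" for x e by (intro rv_integrable rv_ops rv_m rv_coord)
  have "(\<Sum>e\<in>steps. phat e) = (LINT \<omega>|P. (\<Sum>e\<in>steps. m 0 \<omega> * \<omega> 0 e))"
    unfolding phat_def using i by simp
  also have "\<dots> = (LINT \<omega>|P. m 0 \<omega>)"
    by (rule integral_cong_env) (simp add: environmentsD flip: sum_distrib_left)
  finally show ?thesis by (simp add: m_mean)
qed

lemma sum_pbar: "(\<Sum>e\<in>steps. pbar e) = 1"
proof -
  have "(\<Sum>e\<in>steps. pbar e) = (LINT \<omega>|P. (\<Sum>e\<in>steps. \<omega> 0 e))"
    unfolding pbar_def using rv_integrable[OF rv_coord] by simp
  also have "\<dots> = (LINT \<omega>|P. 1)"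
    by (rule integral_cong_env) (simp add: environmentsD)
  finally show ?thesis by (simp add: P.prob_space)
qed

lemma pbar_near: "e \<in> steps \<Longrightarrow> \<bar>pbar e - 1 / 4\<bar> \<le> \<epsilon>"
proof -
  assume e: "e \<in> steps"
  have "\<omega> 0 e \<le> 1 / 4 + \<epsilon> \<and> 1 / 4 - \<epsilon> \<le> \<omega> 0 e" if "\<omega> \<in> Near" for \<omega>
    using environments_nearD(2)[OF that e, of 0] by linarith
  then have "AE \<omega> in P. \<omega> 0 e \<le> 1 / 4 + \<epsilon>" "AE \<omega> in P. 1 / 4 - \<epsilon> \<le> \<omega> 0 e"
    using AE_near by (auto elim!: eventually_mono)
  then have "pbar e \<le> 1 / 4 + \<epsilon>" "1 / 4 - \<epsilon> \<le> pbar e"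
    using integral_mono_AE[of P "\<lambda>\<omega>. \<omega> 0 e" "\<lambda>_. 1 / 4 + \<epsilon>"] integral_mono_AE[of P "\<lambda>_. 1 / 4 - \<epsilon>" "\<lambda>\<omega>. \<omega> 0 e"]
      rv_integrable[OF rv_coord] rv_integrable[OF rv_const]
    by (auto simp: pbar_def P.prob_space)
  then show ?thesis by linarith
qed

lemma coord_pbar_le: "e \<in> steps \<Longrightarrow> \<omega> \<in> Near \<Longrightarrow> \<bar>\<omega> z e - pbar e\<bar> \<le> 2 * \<epsilon>"
  using environments_nearD(2)[of \<omega> \<epsilon> e z] pbar_near[of e] by linarith

lemma m_osc:
  assumes "site_change \<delta> \<epsilon> z \<omega> \<omega>'"
  shows "comparable ((1 + 10 * \<epsilon>)\<^sup>2) (m x \<omega>') (m x \<omega>)" "comparable (1 + 21 * \<epsilon>) (m x \<omega>') (m x \<omega>)"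
proof -
  interpret site_change \<delta> \<epsilon> z \<omega> \<omega>' by fact
  show c: "comparable ((1 + 10 * \<epsilon>)\<^sup>2) (m x \<omega>') (m x \<omega>)"
    unfolding m_def using \<delta> by (intro comparable_cmult mass_comparable) auto
  have "\<rho>\<^sup>2 \<le> 1 + 21 * \<epsilon>" using \<epsilon>2 \<epsilon> by (simp add: power2_eq_square algebra_simps)
  then show "comparable (1 + 21 * \<epsilon>) (m x \<omega>') (m x \<omega>)"
    by (rule comparable_weaken[OF c])
qed

lemma m_diff_le:
  assumes "site_change \<delta> \<epsilon> z \<omega> \<omega>'"
  shows "\<bar>m x \<omega> - m x \<omega>'\<bar> \<le> 21 * \<epsilon> * m x \<omega>"
  using comparable_abs_diff[OF m_osc(2)[OF assms]] \<epsilon> by (simp add: abs_minus_commute)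

lemma phat_pbar: "e \<in> steps \<Longrightarrow> \<bar>phat e - pbar e\<bar> \<le> 21 * \<epsilon>\<^sup>2"
  using covariance_le[where e = e and x = 0 and c = 21, OF rv_m[of 0]] m_diff_le by (simp add: phat_def m_mean)

lemma phat_near:
  assumes e: "e \<in> steps"
  shows "\<bar>phat e - 1 / 4\<bar> \<le> \<epsilon>"
proof -
  have "AE \<omega> in P. m 0 \<omega> * \<omega> 0 e \<le> m 0 \<omega> * (1 / 4 + \<epsilon>) \<and> m 0 \<omega> * (1 / 4 - \<epsilon>) \<le> m 0 \<omega> * \<omega> 0 e"
    using AE_near
  proof eventually_elim
    case (elim \<omega>)
    have "1 / 4 - \<epsilon> \<le> \<omega> 0 e \<and> \<omega> 0 e \<le> 1 / 4 + \<epsilon>"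
      using environments_nearD(2)[OF elim e, of 0] by linarith
    then show ?case using m_nonneg[OF environments_nearD(1)[OF elim], of 0] by (auto intro!: mult_left_mono)
  qed
  then have ae: "AE \<omega> in P. m 0 \<omega> * \<omega> 0 e \<le> m 0 \<omega> * (1 / 4 + \<epsilon>)" "AE \<omega> in P. m 0 \<omega> * (1 / 4 - \<epsilon>) \<le> m 0 \<omega> * \<omega> 0 e"
    by (eventually_elim, simp)+
  have i: "integrable P (\<lambda>\<omega>. m 0 \<omega> * \<omega> 0 e)" "integrable P (\<lambda>\<omega>. m 0 \<omega> * c)" for c
    by (intro rv_integrable rv_ops rv_m rv_coord rv_const)+
  have "phat e \<le> (LINT \<omega>|P. m 0 \<omega> * (1 / 4 + \<epsilon>))" "(LINT \<omega>|P. m 0 \<omega> * (1 / 4 - \<epsilon>)) \<le> phat e"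
    unfolding phat_def by (rule integral_mono_AE[OF i(1,2) ae(1)], rule integral_mono_AE[OF i(2,1) ae(2)])
  then show ?thesis by (simp add: m_mean abs_le_iff)
qed

lemma mg_osc:
  assumes "site_change \<delta> \<epsilon> u \<omega> \<omega>'"
  shows "\<bar>m z \<omega> * g z x \<omega> - m z \<omega>' * g z x \<omega>'\<bar> \<le> 70 * \<epsilon> * (m z \<omega> * g z x \<omega>)"
proof -
  interpret site_change \<delta> \<epsilon> u \<omega> \<omega>' by fact
  have "comparable (\<rho>\<^sup>2 * \<rho>\<^sup>2) (m z \<omega>' * g z x \<omega>') (m z \<omega> * g z x \<omega>)"
    unfolding g_def using m_osc(1)[OF assms] green_comparable by (intro comparable_mult) auto
  from comparable_abs_diff[OF comparable_weaken[OF this \<rho>_pow(1)]] show ?thesis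
    using \<epsilon> by (simp add: abs_minus_commute)
qed

lemma V_osc:
  assumes "site_change \<delta> \<epsilon> u \<omega> \<omega>'"
  shows "V z x \<omega>' \<le> 11 / 10 * V z x \<omega>" "V z x \<omega> \<le> 11 / 10 * V z x \<omega>'"
proof -
  interpret site_change \<delta> \<epsilon> u \<omega> \<omega>' by fact
  have "comparable (1 + 70 * \<epsilon>) (V z x \<omega>') (V z x \<omega>)"
    unfolding V_def using \<delta> by (intro comparable_cmult through_comparable) auto
  from comparable_weaken[OF this, of "11 / 10"] \<epsilon>
  show "V z x \<omega>' \<le> 11 / 10 * V z x \<omega>" "V z x \<omega> \<le> 11 / 10 * V z x \<omega>'"
    by (auto simp: comparable_def)
qed

lemma pbar_drift: "\<epsilon> \<le> pbar (1, 0) - pbar (- 1, 0)"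
proof -
  have "(LINT \<omega>|P. local_drift 0 \<omega>) = (\<Sum>e\<in>steps. pbar e *\<^sub>R to_plane e)"
    unfolding local_drift_def pbar_def
    using rv_integrable[OF rv_coord] by (subst Bochner_Integration.integral_sum) auto
  then show ?thesis using LD by (simp add: LD_def sum_steps to_plane_def inner_prod_def)
qed

definition k :: "site \<Rightarrow> real" where
  "k e = \<delta> * phat e"

text \<open>The drift of \<open>phat\<close> differs from that of \<open>pbar\<close> by at most 42
  * \<epsilon>^2, little against \<epsilon>.\<close>

lemma drift_kernel: "drift_kernel k \<epsilon>"
proof unfold_locales
  have "0 \<le> phat e" for e
    unfolding phat_def by (rule integral_nonneg_AE) (auto simp: space_P environmentsD m_nonneg intro!: AE_I2)
  then show "0 \<le> k e" for e using \<delta>0 by (simp add: k_def)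
  have mk: "cmass k = \<delta>" by (simp add: cmass_def k_def sum_phat flip: sum_distrib_left)
  show "cmass k < 1" "1 - \<epsilon>\<^sup>2 / 4 \<le> cmass k" using mk \<delta> by auto
  show "\<bar>k e - 1 / 4\<bar> \<le> 11 / 10 * \<epsilon>" if e: "e \<in> steps" for e
  proof -
    have "phat e \<le> 1" using phat_near[OF e] \<epsilon> by linarith
    then have "0 \<le> (1 - \<delta>) * phat e" "(1 - \<delta>) * phat e \<le> (\<epsilon>\<^sup>2 / 4) * 1"
      using \<delta> \<open>0 \<le> phat e\<close> by (intro mult_mono mult_nonneg_nonneg; simp)+
    moreover have "k e = phat e - (1 - \<delta>) * phat e" by (simp add: k_def algebra_simps)
    ultimately show ?thesis using phat_near[OF e] \<epsilon>2 \<epsilon> by linarith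
  qed
  have e: "(1, 0) \<in> steps" "(- 1, 0) \<in> steps" "(0, 1) \<in> steps" "(0, - 1) \<in> steps" by (auto simp: steps_eq)
  show "9 / 10 * \<epsilon> \<le> k (1, 0) - k (- 1, 0)"
  proof -
    have "9 / 10 * ((102 / 100) * \<epsilon>) \<le> phat (1, 0) - phat (- 1, 0)"
      using phat_pbar[OF e(1)] phat_pbar[OF e(2)] pbar_drift \<epsilon>2 by linarith
    then have "99 / 100 * (9 / 10 * ((102 / 100) * \<epsilon>)) \<le> \<delta> * (phat (1, 0) - phat (- 1, 0))"
      using \<delta> \<epsilon>2 \<epsilon> by (intro mult_mono) auto
    then show ?thesis using \<epsilon> by (simp add: k_def algebra_simps)
  qed
  have up: "\<bar>k a - k b\<bar> \<le> 2 * \<epsilon>" if "a \<in> steps" "b \<in> steps" for a b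
  proof -
    have "\<delta> * \<bar>phat a - phat b\<bar> \<le> 1 * (2 * \<epsilon>)"
      using phat_near[OF that(1)] phat_near[OF that(2)] \<delta> \<delta>0 by (intro mult_mono) auto
    then show ?thesis using \<delta>0 by (simp add: k_def abs_mult flip: right_diff_distrib)
  qed
  show "k (1, 0) - k (- 1, 0) \<le> 2 * \<epsilon>" using up[OF e(1,2)] by linarith
  show "\<bar>k (0, 1) - k (0, - 1)\<bar> \<le> 2 * \<epsilon>" by (rule up[OF e(3,4)])
qed (use \<epsilon> in auto)

end

context low_disorder
begin

subsection \<open>Backtracking\<close>

text \<open>The weight \<open>m z\<close> comes from the bound on \<open>V\<close>; it has mean 1,
  so the occupation equation has a unit source.\<close>

definition U :: "site \<Rightarrow> site \<Rightarrow> real" where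
  "U z x = (LINT \<omega>|P. m z \<omega> * g z x \<omega>)"

lemma U_nonneg: "0 \<le> U z x"
  unfolding U_def by (rule integral_nonneg_AE) (auto simp: space_P m_nonneg g_nonneg intro!: AE_I2)

lemma U_summable: "U z summable_on UNIV"
proof -
  have q: "0 \<le> \<delta>" "\<delta> < 1" using \<delta>0 \<delta> by auto
  define h where "h x = Cm / (1 - \<delta>) * \<delta> ^ rad x" for x
  have "h summable_on UNIV"
    unfolding h_def by (intro summable_on_cmult_right summable_on_geometric_rad q)
  then have s: "(\<lambda>x. h (x - z)) summable_on UNIV" by (simp only: summable_on_translate(2))
  show ?thesis
  proof (rule summable_on_comparison_test[OF s _ U_nonneg])
    fix x
    have i: "integrable P (\<lambda>\<omega>. m z \<omega> * g z x \<omega>)" by (intro rv_integrable rv_ops rv_m rv_g)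
    have "U z x \<le> (LINT \<omega>|P. h (x - z))"
      unfolding U_def
    proof (rule integral_mono_AE[OF i], simp, rule AE_I2)
      fix \<omega> assume "\<omega> \<in> space P"
      then have \<omega>: "\<omega> \<in> environments" by (simp add: space_P)
      have "m z \<omega> * g z x \<omega> \<le> Cm * (\<delta> ^ rad (x - z) / (1 - \<delta>))"
        using m_le[OF \<omega>, of z] g_le[OF \<omega>, of z x] m_nonneg[OF \<omega>, of z] g_nonneg[OF \<omega>, of z x]
        by (intro mult_mono) auto
      then show "m z \<omega> * g z x \<omega> \<le> h (x - z)" by (simp add: h_def)
    qed
    then show "U z x \<le> h (x - z)" by (simp add: P.prob_space)
  qed
qed

definition Ue :: "site \<Rightarrow> site \<Rightarrow> site \<Rightarrow> real" where
  "Ue z x e = (LINT \<omega>|P. m z \<omega> * g z x \<omega> * \<omega> x e)"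

lemma Ue_nonneg: "0 \<le> Ue z x e"
  unfolding Ue_def by (rule integral_nonneg_AE) (auto simp: space_P m_nonneg g_nonneg environmentsD intro!: AE_I2)

lemma integrable_Ue: "integrable P (\<lambda>\<omega>. m z \<omega> * g z x \<omega> * \<omega> x e)"
  by (intro rv_integrable rv_ops rv_m rv_g rv_coord)

lemma sum_Ue: "(\<Sum>e\<in>steps. Ue z x e) = U z x"
proof -
  have "(\<Sum>e\<in>steps. Ue z x e) = (LINT \<omega>|P. (\<Sum>e\<in>steps. m z \<omega> * g z x \<omega> * \<omega> x e))"
    unfolding Ue_def using integrable_Ue by simp
  also have "\<dots> = U z x"
    unfolding U_def by (rule integral_cong_env) (simp add: environmentsD flip: sum_distrib_left)
  finally show ?thesis .
qed

text \<open>Resampling \<open>x\<close> shows that the jump out of \<open>x\<close> is nearly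
  independent of the occupation there. The relative error O(\<epsilon>^2) is dominated by the
  drift.\<close>

lemma Ue_le: "e \<in> steps \<Longrightarrow> \<bar>Ue z x e - pbar e * U z x\<bar> \<le> 70 * \<epsilon>\<^sup>2 * U z x"
  unfolding Ue_def U_def
  by (rule covariance_le[OF rv_ops(1)[OF rv_m rv_g]]) (auto intro: mg_osc)

lemma U_eq: "U z x = of_bool (x = z) + \<delta> * (\<Sum>e\<in>steps. Ue z (x - e) e)"
proof -
  have "U z x = (LINT \<omega>|P. of_bool (x = z) * m z \<omega> + \<delta> * (\<Sum>e\<in>steps. m z \<omega> * g z (x - e) \<omega> * \<omega> (x - e) e))"
    unfolding U_def
  proof (rule integral_cong_env)
    fix \<omega> assume "\<omega> \<in> environments"
    then have "g z x \<omega> = of_bool (z = x) + (\<Sum>e\<in>steps. g z (x - e) \<omega> * (\<delta> * \<omega> (x - e) e))"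
      unfolding g_def by (subst green_last_step[OF sub]) (simp_all add: damped_def)
    then show "m z \<omega> * g z x \<omega> = of_bool (x = z) * m z \<omega> + \<delta> * (\<Sum>e\<in>steps. m z \<omega> * g z (x - e) \<omega> * \<omega> (x - e) e)"
      by (simp add: algebra_simps sum_distrib_left)
  qed
  also have "\<dots> = of_bool (x = z) * (LINT \<omega>|P. m z \<omega>) + \<delta> * (\<Sum>e\<in>steps. Ue z (x - e) e)"
    unfolding Ue_def using integrable_Ue rv_integrable[OF rv_m]
    by (subst Bochner_Integration.integral_add) auto
  finally show ?thesis by (simp add: m_mean)
qed

text \<open>An exponential supermartingale, capped at level \<open>- K\<close> to keep it bounded.\<close>

definition \<psi> :: "int \<Rightarrow> site \<Rightarrow> real" where
  "\<psi> K x = exp (- (\<epsilon> / 5 * real_of_int (max (fst x) (- K))))"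

text \<open>Above the cap the gain is at least \<epsilon> / 5 times
  \<open>\<epsilon> - 140 * \<epsilon>\<^sup>2\<close>, with 140 = 2 * 70 from \<open>Ue_le\<close>,
  against a second-order loss of 11/10 times \<epsilon>^2 / 25. At or below the cap a step cannot
  increase \<open>\<psi>\<close>.\<close>

lemma \<psi>_step:
  assumes "0 \<le> K"
  shows "(\<Sum>e\<in>steps. \<psi> K (x + e) * Ue z x e) \<le> \<psi> K x * U z x - (if - K < fst x then \<epsilon>\<^sup>2 / 10 * (\<psi> K x * U z x) else 0)"
proof (cases "- K < fst x")
  case False
  have "(\<Sum>e\<in>steps. \<psi> K (x + e) * Ue z x e) \<le> (\<Sum>e\<in>steps. \<psi> K x * Ue z x e)"
  proof (intro sum_mono mult_right_mono Ue_nonneg)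
    fix e
    have "\<epsilon> / 5 * real_of_int (max (fst x) (- K)) \<le> \<epsilon> / 5 * real_of_int (max (fst (x + e)) (- K))"
      using False \<epsilon> by (intro mult_left_mono) auto
    then show "\<psi> K (x + e) \<le> \<psi> K x" by (simp add: \<psi>_def)
  qed
  then show ?thesis using False by (simp add: sum_Ue flip: sum_distrib_left)
next
  case True
  define t where "t = \<epsilon> / 5"
  have t: "\<bar>t\<bar> \<le> 1 / 100" "\<bar>- t\<bar> \<le> 1 / 100" "0 < t" "t\<^sup>2 = \<epsilon>\<^sup>2 / 25" using \<epsilon> by (auto simp: t_def power_divide)
  have e: "(1, 0) \<in> steps" "(- 1, 0) \<in> steps" by (auto simp: steps_eq)
  have \<psi>: "\<psi> K (x + (1, 0)) = \<psi> K x * exp (- t)" "\<psi> K (x + (- 1, 0)) = \<psi> K x * exp (- (- t))"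
    "\<psi> K (x + (0, 1)) = \<psi> K x" "\<psi> K (x + (0, - 1)) = \<psi> K x"
  proof -
    have "\<psi> K (x + e) = \<psi> K x * exp (- (t * real_of_int (fst e)))" if "- 1 \<le> fst e" for e
    proof -
      have "max (fst (x + e)) (- K) = fst x + fst e" "max (fst x) (- K) = fst x" using True that by auto
      then show ?thesis by (simp add: \<psi>_def t_def algebra_simps flip: exp_add)
    qed
    from this[of "(1, 0)"] this[of "(- 1, 0)"] this[of "(0, 1)"] this[of "(0, - 1)"]
    show "\<psi> K (x + (1, 0)) = \<psi> K x * exp (- t)" "\<psi> K (x + (- 1, 0)) = \<psi> K x * exp (- (- t))"
      "\<psi> K (x + (0, 1)) = \<psi> K x" "\<psi> K (x + (0, - 1)) = \<psi> K x" by simp_all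
  qed
  define a where "a = Ue z x (1, 0)"
  define b where "b = Ue z x (- 1, 0)"
  have U: "U z x = a + b + Ue z x (0, 1) + Ue z x (0, - 1)"
    using sum_Ue[of z x] by (simp add: sum_steps a_def b_def)
  have ab: "0 \<le> a" "0 \<le> b" by (auto simp: a_def b_def Ue_nonneg)
  have dr: "(\<epsilon> - 140 * \<epsilon>\<^sup>2) * U z x \<le> a - b"
  proof -
    have "\<epsilon> * U z x \<le> (pbar (1, 0) - pbar (- 1, 0)) * U z x"
      by (intro mult_right_mono pbar_drift U_nonneg)
    then show ?thesis using Ue_le[OF e(1), of z x] Ue_le[OF e(2), of z x]
      unfolding a_def b_def by (simp add: algebra_simps abs_le_iff)
  qed
  have s: "a + b \<le> U z x" using U Ue_nonneg[of z x "(0, 1)"] Ue_nonneg[of z x "(0, - 1)"] by linarith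
  have "(exp (- t) - 1) * a + (exp (- (- t)) - 1) * b \<le> (- t + 11 / 10 * t\<^sup>2) * a + (- (- t) + 11 / 10 * (- t)\<^sup>2) * b"
    using exp_minus_bounds(2)[OF t(1)] exp_minus_bounds(2)[OF t(2)] ab
    by (intro add_mono mult_right_mono) auto
  also have "\<dots> = - t * (a - b) + 11 / 10 * t\<^sup>2 * (a + b)" by (simp add: algebra_simps)
  also have "\<dots> \<le> - t * ((\<epsilon> - 140 * \<epsilon>\<^sup>2) * U z x) + 11 / 10 * t\<^sup>2 * U z x"
    using dr s t by (intro add_mono mult_left_mono mult_left_mono_neg) auto
  also have "\<dots> \<le> - (\<epsilon>\<^sup>2 / 10) * U z x"
  proof -
    define Q where "Q = t * (\<epsilon> - 140 * \<epsilon>\<^sup>2)"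
    have "Q \<ge> 86 / 500 * \<epsilon>\<^sup>2"
      unfolding Q_def using mult_left_mono[of "86 / 100 * \<epsilon>" "\<epsilon> - 140 * \<epsilon>\<^sup>2" t] t \<epsilon>2 \<epsilon> by (simp add: t_def power2_eq_square)
    then have "- Q + 11 / 10 * t\<^sup>2 \<le> - (\<epsilon>\<^sup>2 / 10)" using t(4) \<epsilon>2 by linarith
    from mult_right_mono[OF this U_nonneg[of z x]] show ?thesis by (simp add: Q_def algebra_simps)
  qed
  finally have "\<psi> K x * ((exp (- t) - 1) * a + (exp (- (- t)) - 1) * b) \<le> \<psi> K x * (- (\<epsilon>\<^sup>2 / 10) * U z x)"
    by (intro mult_left_mono) (simp_all add: \<psi>_def)
  moreover have "(\<Sum>e\<in>steps. \<psi> K (x + e) * Ue z x e) = \<psi> K x * U z x + \<psi> K x * ((exp (- t) - 1) * a + (exp (- (- t)) - 1) * b)"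
    unfolding sum_steps \<psi> U a_def[symmetric] b_def[symmetric] by (simp add: algebra_simps)
  ultimately show ?thesis using True by (simp add: algebra_simps)
qed

text \<open>Sum the occupation equation against \<open>\<psi> K\<close>. The total \<open>T\<close>
  is finite by the cap and the killing and can be cancelled; the accumulated decrease is then at
  most 1, and 10 / 0.9 is below 12.\<close>

lemma U_upstream_capped:
  assumes "0 \<le> K" "fst z = 0"
  shows "(\<Sum>\<^sub>\<infinity>x. if - K < fst x then \<psi> K x * U z x else 0) \<le> 12 / \<epsilon>\<^sup>2"
    "(\<lambda>x. if - K < fst x then \<psi> K x * U z x else 0) summable_on UNIV"
proof -
  have "\<psi> K x \<le> exp (\<epsilon> / 5 * K)" for x
  proof -
    have "\<epsilon> / 5 * real_of_int (- K) \<le> \<epsilon> / 5 * real_of_int (max (fst x) (- K))" using \<epsilon> by (intro mult_left_mono) auto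
    then show ?thesis by (simp add: \<psi>_def)
  qed
  then have b\<psi>: "bdd (\<psi> K)" by (intro bddI[where C = "exp (\<epsilon> / 5 * K)"]) (simp add: \<psi>_def)
  have s: "(\<lambda>x. \<psi> K x * U z x) summable_on UNIV"
    using summable_on_bdd_mult[OF U_summable b\<psi>] by (simp add: mult.commute)
  define c where "c x = (if - K < fst x then \<psi> K x * U z x else 0)" for x
  show cs: "(\<lambda>x. if - K < fst x then \<psi> K x * U z x else 0) summable_on UNIV"
    by (rule summable_on_comparison_test[OF s]) (auto simp: \<psi>_def U_nonneg)
  then have cs': "c summable_on UNIV" unfolding c_def .
  have Ues: "(\<lambda>x. Ue z x e) summable_on UNIV" if "e \<in> steps" for e
  proof (rule summable_on_comparison_test[OF U_summable])
    show "Ue z x e \<le> U z x" for x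
      unfolding sum_Ue[symmetric] using that by (intro member_le_sum Ue_nonneg) (auto simp: finite_steps)
  qed (rule Ue_nonneg)
  have ts: "(\<lambda>x. \<psi> K (x + e) * Ue z x e) summable_on UNIV" if "e \<in> steps" for e
    using summable_on_bdd_mult[OF Ues[OF that] bdd_shift[OF b\<psi>, of "\<lambda>x. x + e"]] by (simp add: mult.commute)
  have ts': "(\<lambda>x. \<psi> K x * Ue z (x - e) e) summable_on UNIV" if "e \<in> steps" for e
    using summable_on_translate(2)[of "\<lambda>y. \<psi> K (y + e) * Ue z y e" e] ts[OF that] by simp
  have td: "(\<Sum>\<^sub>\<infinity>x. \<psi> K x * Ue z (x - e) e) = (\<Sum>\<^sub>\<infinity>x. \<psi> K (x + e) * Ue z x e)" for e
    using infsum_translate(2)[of "\<lambda>y. \<psi> K (y + e) * Ue z y e" e] by simp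
  define T where "T = (\<Sum>\<^sub>\<infinity>x. \<psi> K x * U z x)"
  have T0: "0 \<le> T" unfolding T_def by (intro infsum_nonneg) (simp add: \<psi>_def U_nonneg)
  have "T = (\<Sum>\<^sub>\<infinity>x. of_bool (x = z) * \<psi> K x + \<delta> * (\<Sum>e\<in>steps. \<psi> K x * Ue z (x - e) e))"
    unfolding T_def by (intro infsum_cong, subst U_eq) (simp add: algebra_simps sum_distrib_left)
  also have "\<dots> = (\<Sum>\<^sub>\<infinity>x. of_bool (x = z) * \<psi> K x) + (\<Sum>\<^sub>\<infinity>x. \<delta> * (\<Sum>e\<in>steps. \<psi> K x * Ue z (x - e) e))"
    by (intro infsum_add infsum_unit_at summable_on_cmult_right summable_on_sum ts')
  also have "(\<Sum>\<^sub>\<infinity>x. of_bool (x = z) * \<psi> K x) = 1" 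
    using assms by (simp add: infsum_unit_at \<psi>_def)
  also have "(\<Sum>\<^sub>\<infinity>x. \<delta> * (\<Sum>e\<in>steps. \<psi> K x * Ue z (x - e) e)) = \<delta> * (\<Sum>\<^sub>\<infinity>x. \<Sum>e\<in>steps. \<psi> K (x + e) * Ue z x e)"
    by (subst infsum_cmult_right', subst infsum_sum, erule ts', subst infsum_sum, erule ts, simp only: td)
  also have "(\<Sum>\<^sub>\<infinity>x. \<Sum>e\<in>steps. \<psi> K (x + e) * Ue z x e) \<le> (\<Sum>\<^sub>\<infinity>x. \<psi> K x * U z x + (- (\<epsilon>\<^sup>2 / 10)) * c x)"
  proof (intro infsum_mono summable_on_sum ts summable_on_add s summable_on_cmult_right cs')
    show "(\<Sum>e\<in>steps. \<psi> K (x + e) * Ue z x e) \<le> \<psi> K x * U z x + - (\<epsilon>\<^sup>2 / 10) * c x" for x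
      using \<psi>_step[OF assms(1), of x z] by (cases "- K < fst x") (simp_all add: c_def)
  qed
  also have "\<dots> = T + (- (\<epsilon>\<^sup>2 / 10)) * infsum c UNIV"
    unfolding T_def infsum_cmult_right'[symmetric] by (intro infsum_add s summable_on_cmult_right cs')
  finally have "T \<le> 1 + \<delta> * (T + (- (\<epsilon>\<^sup>2 / 10)) * infsum c UNIV)"
    using \<delta>0 by (simp add: mult_left_mono)
  moreover have "\<delta> * T \<le> 1 * T" using \<delta> T0 by (intro mult_right_mono) auto
  ultimately have "\<delta> * (\<epsilon>\<^sup>2 / 10 * infsum c UNIV) \<le> 1" by (simp add: algebra_simps)
  moreover have "9 / 10 * (\<epsilon>\<^sup>2 / 10 * infsum c UNIV) \<le> \<delta> * (\<epsilon>\<^sup>2 / 10 * infsum c UNIV)"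
    using \<delta>0 by (intro mult_right_mono mult_nonneg_nonneg infsum_nonneg) (auto simp: c_def \<psi>_def U_nonneg)
  ultimately have "infsum c UNIV \<le> 12 / \<epsilon>\<^sup>2" using \<epsilon>2 by (simp add: field_simps)
  then show "(\<Sum>\<^sub>\<infinity>x. if - K < fst x then \<psi> K x * U z x else 0) \<le> 12 / \<epsilon>\<^sup>2" unfolding c_def .
qed

lemma U_upstream:
  assumes "fst z = 0"
  shows "(\<Sum>\<^sub>\<infinity>x. if fst x \<le> 0 then U z x else 0) \<le> 12 / \<epsilon>\<^sup>2"
    "(\<lambda>x. if fst x \<le> 0 then U z x else 0) summable_on UNIV"
proof -
  show s: "(\<lambda>x. if fst x \<le> 0 then U z x else 0) summable_on UNIV"
    by (rule summable_on_comparison_test[OF U_summable[of z]]) (auto simp: U_nonneg)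
  show "(\<Sum>\<^sub>\<infinity>x. if fst x \<le> 0 then U z x else 0) \<le> 12 / \<epsilon>\<^sup>2"
  proof (rule infsum_le_finite_sums[OF s])
    fix F :: "site set" assume F: "finite F"
    \<comment> \<open>The cap lies below the finite set \<open>F\<close>, and
      \<open>\<psi> K\<close> is at least 1 at the points of \<open>F\<close> with
      \<open>fst x \<le> 0\<close>; the bound is independent of the cap.\<close>
    define K where "K = 1 + Max ((\<lambda>x. \<bar>fst x\<bar>) ` insert 0 F)"
    have "\<bar>fst x\<bar> < K" if "x \<in> insert 0 F" for x
      unfolding K_def using F that by (intro zle_add1_eq_le[THEN iffD2, simplified add.commute] Max_ge) auto
    then have K: "- K < fst x" "0 \<le> K" if "x \<in> F" for x using that by fastforce+
    show "(\<Sum>x\<in>F. if fst x \<le> 0 then U z x else 0) \<le> 12 / \<epsilon>\<^sup>2"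
    proof (cases "F = {}")
      case False
      then have K0: "0 \<le> K" using K by blast
      have "(\<Sum>x\<in>F. if fst x \<le> 0 then U z x else 0) \<le> (\<Sum>x\<in>F. if - K < fst x then \<psi> K x * U z x else 0)"
      proof (intro sum_mono)
        fix x assume x: "x \<in> F"
        have "1 * U z x \<le> \<psi> K x * U z x" if "fst x \<le> 0"
          using that \<epsilon> K(1)[OF x] by (intro mult_right_mono U_nonneg) (auto simp: \<psi>_def mult_nonneg_nonpos)
        then show "(if fst x \<le> 0 then U z x else 0) \<le> (if - K < fst x then \<psi> K x * U z x else 0)"
          using K(1)[OF x] by (auto simp: \<psi>_def U_nonneg)
      qed
      also have "\<dots> \<le> 12 / \<epsilon>\<^sup>2"
        using U_upstream_capped[OF K0 assms] F
        by (intro order_trans[OF finite_sum_le_infsum[OF U_upstream_capped(2)[OF K0 assms] F]]) (auto simp: \<psi>_def U_nonneg)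
      finally show ?thesis .
    qed (use \<epsilon> in simp)
  qed
qed

end

section \<open>The expansion of the expected mass\<close>

text \<open>The constants \<open>1\<close>, \<open>4 / pi\<close> and \<open>4 - 8 / pi\<close> are the values of the potential kernel of the
  simple random walk at \<open>(0, 1)\<close>, \<open>(1, 1)\<close> and \<open>(0, 2)\<close>.\<close>

lemma (in killed_srw) potential_kernel_values:
  assumes "\<kappa> \<le> 1 / 2"
  shows "\<bar>g 0 - g (0, 1) - 1\<bar> \<le> 2 * \<kappa> * g 0"
    "\<bar>g 0 - g (0, 2) - (4 - 8 / pi)\<bar> \<le> 24 * \<kappa> * g 0 + 16 * sqrt \<kappa>"
proof -
  define a where "a = g (0, 1)"
  have s: "g (1, 0) = a" "g (- 1, 0) = a" "g (0, - 1) = a" "g (- 1, 1) = g (1, 1)" "g (0, 0) = g 0"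
    using g_swap[of 1 0] g_minus[of 1 0] g_minus2[of 0 1] g_minus[of 1 1] by (auto simp: a_def zero_prod_def)
  have 0: "g 0 = 1 + (1 - \<kappa>) * a"
    by (subst eq) (simp add: sum_steps srw_killed_def s a_def[symmetric])
  \<comment> \<open>The equation at (0, 1), whose neighbours are the origin, (0, 2) and two diagonal
    sites, converts the diagonal constant 4 / pi into the value at (0, 2).\<close>
  have "a = (1 - \<kappa>) / 4 * (g 0 + g (0, 2) + 2 * g (1, 1))"
  proof -
    have "((0, 1) :: site) \<noteq> 0" by (simp add: zero_prod_def)
    with eq[of "(0, 1)"] have "a = (1 - \<kappa>) / 4 * g (1, 1) + (1 - \<kappa>) / 4 * g (1, 1) + (1 - \<kappa>) / 4 * g (0, 2) + (1 - \<kappa>) / 4 * g 0"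
      by (simp add: sum_steps srw_killed_def s a_def[symmetric])
    then show ?thesis by (simp add: field_simps)
  qed
  then have 1: "4 * (a / (1 - \<kappa>)) = g 0 + g (0, 2) + 2 * g (1, 1)" using assms by (simp add: field_simps)
  have a0: "0 \<le> a" unfolding a_def by (rule cgreen_nonneg)
  have "1 / 2 * a \<le> (1 - \<kappa>) * a" using assms a0 by (intro mult_right_mono) auto
  then have a2: "a \<le> 2 * g 0" using 0 by linarith
  then have \<kappa>a: "0 \<le> \<kappa> * a" "\<kappa> * a \<le> 2 * \<kappa> * g 0" using \<kappa> a0 mult_left_mono[OF a2, of \<kappa>] by auto
  have d: "g 0 - a - 1 = - (\<kappa> * a)" using 0 by (simp add: algebra_simps)
  show "\<bar>g 0 - g (0, 1) - 1\<bar> \<le> 2 * \<kappa> * g 0" using d \<kappa>a unfolding a_def by linarith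
  have "a / (1 - \<kappa>) - a = \<kappa> * a / (1 - \<kappa>)" using assms by (simp add: field_simps)
  moreover have "\<kappa> * a / (1 - \<kappa>) \<le> (2 * \<kappa> * g 0) / (1 / 2)" using \<kappa>a assms by (intro frac_le) auto
  moreover have "0 \<le> \<kappa> * a / (1 - \<kappa>)" using \<kappa>a assms by simp
  ultimately have e: "0 \<le> a / (1 - \<kappa>) - a" "a / (1 - \<kappa>) - a \<le> 4 * \<kappa> * g 0" by simp_all
  show "\<bar>g 0 - g (0, 2) - (4 - 8 / pi)\<bar> \<le> 24 * \<kappa> * g 0 + 16 * sqrt \<kappa>"
    using 1 d \<kappa>a e g_0_minus_diag by linarith
qed

text \<open>Agrees with the potential kernel of simple random walk at the neighbours of the two
  observed sites; only these values are used.\<close>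

definition pkernel :: "site \<Rightarrow> real" where
  "pkernel x = (if x = 0 then 0 else if rad x = 1 then 1 else if fst x = 0 then 4 - 8 / pi else 4 / pi)"

context drift_kernel
begin

sublocale s: killed_srw \<kappa>
  using \<kappa> by unfold_locales auto

lemma sqrt_\<kappa>: "sqrt \<kappa> = \<epsilon> / 5"
  using \<epsilon> by (simp add: srw_rate_def real_sqrt_divide)

text \<open>The path from the origin through \<open>z\<close> to \<open>z + e\<close> has at most
  two steps, each controlled by \<open>increment_le\<close>; what remains is the effect of killing
  on the potential kernel.\<close>

lemma increment_pkernel:
  assumes z: "z \<in> {(0, 0), (0, 1)}" and e: "e \<in> steps"
  shows "\<bar>cgreen k (z + e) - cgreen k 0 + pkernel (z + e)\<bar> \<le> 33000 * \<epsilon> * cgreen k0 0"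
proof -
  define G where "G = cgreen k0 0"
  have G: "1 \<le> G" unfolding G_def by (rule k0.cgreen_0_ge)
  have \<epsilon>G: "\<epsilon> \<le> \<epsilon> * G" "\<epsilon>\<^sup>2 * G \<le> \<epsilon> * G" "0 \<le> \<epsilon>\<^sup>2 * G"
  proof -
    have "\<epsilon> * 1 \<le> \<epsilon> * G" by (intro mult_left_mono G) (use \<epsilon> in simp)
    then show "\<epsilon> \<le> \<epsilon> * G" by (simp only: mult_1_right)
    have "\<epsilon>\<^sup>2 \<le> \<epsilon>" using \<epsilon> \<epsilon>2 by linarith
    then show "\<epsilon>\<^sup>2 * G \<le> \<epsilon> * G" using G by (intro mult_right_mono) auto
    show "0 \<le> \<epsilon>\<^sup>2 * G" using G by simp
  qed
  have st: "(0, 1) \<in> steps" by (simp add: steps_eq)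
  have "\<bar>(cgreen k z - cgreen k0 z) - (cgreen k 0 - cgreen k0 0)\<bar> \<le> 16000 * \<epsilon> * G"
  proof (cases "z = 0")
    case False
    then have "z = 0 + (0, 1)" using z by (auto simp: zero_prod_def)
    then show ?thesis using increment_le[OF st, of 0] unfolding G_def by (simp only:)
  qed (use \<epsilon> G in simp)
  then have i: "\<bar>(cgreen k (z + e) - cgreen k0 (z + e)) - (cgreen k 0 - G)\<bar> \<le> 32000 * \<epsilon> * G"
    using increment_le[OF e, of z] unfolding G_def[symmetric] by linarith
  have v: "\<bar>G - cgreen k0 (0, 1) - 1\<bar> \<le> \<epsilon> * G" "\<bar>G - cgreen k0 (0, 2) - (4 - 8 / pi)\<bar> \<le> 5 * \<epsilon> * G"
    "\<bar>G - cgreen k0 (1, 1) - 4 / pi\<bar> \<le> 2 * \<epsilon> * G"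
  proof -
    have \<kappa>G: "\<kappa> * G = \<epsilon>\<^sup>2 * G / 25" by (simp add: srw_rate_def)
    have "\<kappa> \<le> 1 / 2" using \<kappa>(2) by simp
    note pv = s.potential_kernel_values[OF this, folded G_def, unfolded sqrt_\<kappa> mult.assoc \<kappa>G]
    show "\<bar>G - cgreen k0 (0, 1) - 1\<bar> \<le> \<epsilon> * G" using pv(1) \<epsilon>G by linarith
    show "\<bar>G - cgreen k0 (0, 2) - (4 - 8 / pi)\<bar> \<le> 5 * \<epsilon> * G" using pv(2) \<epsilon>G by linarith
    show "\<bar>G - cgreen k0 (1, 1) - 4 / pi\<bar> \<le> 2 * \<epsilon> * G"
      using s.g_0_minus_diag[folded G_def, unfolded sqrt_\<kappa>] \<epsilon>G by linarith
  qed
  have sy: "cgreen k0 (1, 0) = cgreen k0 (0, 1)" "cgreen k0 (- 1, 0) = cgreen k0 (0, 1)" "cgreen k0 (0, - 1) = cgreen k0 (0, 1)"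
    "cgreen k0 (- 1, 1) = cgreen k0 (1, 1)"
    using s.g_swap[of 1 0] s.g_minus[of 1 0] s.g_minus2[of 0 1] s.g_minus[of 1 1] by auto
  have G0: "cgreen k0 (0, 0) = G" by (simp add: G_def zero_prod_def)
  have "\<bar>cgreen k0 (z + e) - G + pkernel (z + e)\<bar> \<le> 5 * \<epsilon> * G"
    using z e v \<epsilon> G by (auto simp: steps_eq pkernel_def sy G0 rad_def zero_prod_def abs_le_iff)
  then show ?thesis using i \<epsilon> G unfolding G_def[symmetric] by linarith
qed

lemma sqrt_cgreen_le: "sqrt (cgreen k 0) \<le> 159 * cgreen k0 0"
proof (rule real_le_lsqrt)
  have G: "1 \<le> cgreen k0 0" by (rule k0.cgreen_0_ge)
  have "cgreen k 0 \<le> 25002 * (1 * cgreen k0 0)" using cgreen_0_le by simp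
  also have "\<dots> \<le> 25281 * (cgreen k0 0 * cgreen k0 0)"
    using G by (intro mult_mono) auto
  finally show "cgreen k 0 \<le> (159 * cgreen k0 0)\<^sup>2" by (simp add: power2_eq_square)
  show "0 \<le> 159 * cgreen k0 0" using G by simp
qed

lemma k0_diag_le: "cgreen k0 0 \<le> 1 + ln (25 / \<epsilon>\<^sup>2)"
  using s.g_0_le by (simp add: srw_rate_def)

end

abbreviation sites2 :: "site set" where
  "sites2 \<equiv> {(0, 0), (0, 1)}"

text \<open>Errors are kept proportional to \<open>Ef\<close> rather than to a supremum of
  \<open>f\<close>; this is what later becomes a pointwise bound on the density.\<close>

locale weighted = low_disorder +
  fixes f :: "env \<Rightarrow> real"
  assumes rv_f: "rv f" and f_nonneg: "\<And>\<omega>. 0 \<le> f \<omega>"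
    and f_dep: "\<And>\<omega> \<omega>'. \<omega> (0, 0) = \<omega>' (0, 0) \<Longrightarrow> \<omega> (0, 1) = \<omega>' (0, 1) \<Longrightarrow> f \<omega> = f \<omega>'"
begin

abbreviation "Ef \<equiv> (LINT \<omega>|P. f \<omega>)"

lemma Ef_nonneg: "0 \<le> Ef"
  by (rule integral_nonneg_AE) (simp add: f_nonneg)

text \<open>\<open>mix sites2\<close> carries the second copy at both observed sites, so it is
  independent of what \<open>F\<close> sees. Exchanging the copies there reduces to two independent
  environments.\<close>

lemma integral_decouple:
  assumes F: "rv F" and h: "rv h" and dep: "\<And>\<omega> \<omega>'. \<omega> (0, 0) = \<omega>' (0, 0) \<Longrightarrow> \<omega> (0, 1) = \<omega>' (0, 1) \<Longrightarrow> F \<omega> = F \<omega>'"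
  shows "(LINT X|copies. F (mix {} X) * h (mix sites2 X)) = (LINT \<omega>|P. F \<omega>) * (LINT \<omega>|P. h \<omega>)"
proof -
  have "(LINT X|copies. F (mix {} X) * h (mix sites2 X)) =
      (LINT X|copies. F (mix {} (X \<circ> swap sites2)) * h (mix sites2 (X \<circ> swap sites2)))"
    by (rule integral_swap[symmetric]) (intro crv_intros F h)
  also have "\<dots> = (LINT X|copies. h (mix {} X) * F (mix UNIV X))"
  proof (rule Bochner_Integration.integral_cong[OF refl])
    fix X
    have "F (mix sites2 X) = F (mix UNIV X)" by (rule dep) (simp_all add: mix_apply)
    then show "F (mix {} (X \<circ> swap sites2)) * h (mix sites2 (X \<circ> swap sites2)) = h (mix {} X) * F (mix UNIV X)"
      by (simp add: mix_swap mult.commute)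
  qed
  also have "\<dots> = (LINT \<omega>|P. F \<omega>) * (LINT \<omega>|P. h \<omega>)" by (simp add: indep_copies F h)
  finally show ?thesis .
qed

text \<open>Replacing the two sites by the other copy, one after the other, costs 1.1 twice and
  decouples \<open>f\<close> from \<open>h\<close>; 1.21 is below 5/4.\<close>

lemma weighted_le:
  assumes h: "rv h" and le: "\<And>\<omega> \<omega>' z. site_change \<delta> \<epsilon> z \<omega> \<omega>' \<Longrightarrow> h \<omega> \<le> 11 / 10 * h \<omega>'"
  shows "(LINT \<omega>|P. f \<omega> * h \<omega>) \<le> 5 / 4 * (Ef * (LINT \<omega>|P. h \<omega>))" "AE X in copies. 0 \<le> h (mix {} X)"
proof -
  have ae: "AE X in copies. h (mix {} X) \<le> 121 / 100 * h (mix sites2 X) \<and> 0 \<le> h (mix {} X) \<and> 0 \<le> h (mix sites2 X)"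
    using AE_near_mix
  proof eventually_elim
    case (elim X)
    have "h (mix {} X) \<le> 11 / 10 * h (mix {(0, 0)} X)" "h (mix {(0, 0)} X) \<le> 11 / 10 * h (mix sites2 X)"
      by (rule le[OF site_change_mix[OF elim]], blast)+
    \<comment> \<open>The trivial change gives \<open>h \<le> 11 / 10 * h\<close>, which forces
      nonnegativity.\<close>
    moreover have "0 \<le> h (mix S X)" for S using le[OF site_change_mix[OF elim, of S undefined S]] by simp
    ultimately show ?case by auto
  qed
  then show "AE X in copies. 0 \<le> h (mix {} X)" by eventually_elim simp
  have "(LINT \<omega>|P. f \<omega> * h \<omega>) = (LINT X|copies. f (mix {} X) * h (mix {} X))"
    by (rule integral_mix[OF rv_ops(1)[OF rv_f h], symmetric])
  also have "\<dots> \<le> (LINT X|copies. 121 / 100 * (f (mix {} X) * h (mix sites2 X)))"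
  proof (rule integral_le)
    show "AE X in copies. f (mix {} X) * h (mix {} X) \<le> 121 / 100 * (f (mix {} X) * h (mix sites2 X))"
      using ae
    proof eventually_elim
      case (elim X)
      then have "f (mix {} X) * h (mix {} X) \<le> f (mix {} X) * (121 / 100 * h (mix sites2 X))"
        by (intro mult_left_mono f_nonneg) auto
      then show ?case by simp
    qed
  qed (intro crv_ops crv_const crv_mix rv_f h)+
  also have "\<dots> = 121 / 100 * (Ef * (LINT \<omega>|P. h \<omega>))"
    by (simp add: integral_decouple[OF rv_f h f_dep])
  also have "\<dots> \<le> 5 / 4 * (Ef * (LINT \<omega>|P. h \<omega>))"
  proof (rule mult_right_mono)
    have "0 \<le> (LINT X|copies. h (mix sites2 X))"
      using ae by (intro integral_nonneg_AE) (auto elim: eventually_mono)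
    then show "0 \<le> Ef * (LINT \<omega>|P. h \<omega>)" using Ef_nonneg by (simp add: integral_mix h)
  qed simp
  finally show "(LINT \<omega>|P. f \<omega> * h \<omega>) \<le> 5 / 4 * (Ef * (LINT \<omega>|P. h \<omega>))" .
qed

definition D :: "site \<Rightarrow> site \<Rightarrow> real" where
  "D x e = (LINT \<omega>|P. f \<omega> * (m x \<omega> * (\<omega> x e - phat e)))"

definition EV :: "site \<Rightarrow> real" where
  "EV x = (LINT \<omega>|P. V (0, 0) x \<omega> + V (0, 1) x \<omega>)"

lemma m_diff_V:
  assumes "site_change \<delta> \<epsilon> z \<omega> \<omega>'" "x \<noteq> z"
  shows "\<bar>m x \<omega>' - m x \<omega>\<bar> \<le> 21 * \<epsilon> * V z x \<omega>"
proof -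
  interpret site_change \<delta> \<epsilon> z \<omega> \<omega>' by fact
  have "\<bar>m x \<omega>' - m x \<omega>\<bar> = (1 - \<delta>) * \<bar>mass W' x - mass W x\<bar>"
    using \<delta> by (simp add: m_def abs_mult flip: right_diff_distrib)
  also have "\<dots> \<le> (1 - \<delta>) * (21 * \<epsilon> * through \<delta> \<omega> z x)"
    using \<delta> by (intro mult_left_mono mass_diff_le assms) auto
  finally show ?thesis by (simp add: V_def mult_ac)
qed

lemma m_mixed_diff_V:
  assumes "site_change \<delta> \<epsilon> z \<omega> \<omega>'" "site_change \<delta> \<epsilon> x \<omega> \<sigma>" "x \<noteq> z"
  shows "\<bar>(m x (\<omega>'(x := \<sigma> x)) - m x \<sigma>) - (m x \<omega>' - m x \<omega>)\<bar> \<le> 1500 * \<epsilon>\<^sup>2 * V z x \<omega>"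
proof -
  have "\<bar>(m x (\<omega>'(x := \<sigma> x)) - m x \<sigma>) - (m x \<omega>' - m x \<omega>)\<bar> = (1 - \<delta>) *
      \<bar>(mass (damped \<delta> (\<omega>'(x := \<sigma> x))) x - mass (damped \<delta> \<sigma>) x) - (mass (damped \<delta> \<omega>') x - mass (damped \<delta> \<omega>) x)\<bar>"
    using \<delta> by (simp add: m_def abs_mult flip: right_diff_distrib)
  also have "\<dots> \<le> (1 - \<delta>) * (1500 * \<epsilon>\<^sup>2 * through \<delta> \<omega> z x)"
    using \<delta> by (intro mult_left_mono mass_mixed_diff_le assms) auto
  finally show ?thesis by (simp add: V_def mult_ac)
qed

text \<open>Off the two sites, \<open>D x\<close> is the covariance of \<open>\<omega> x\<close> with the influence of the two sites on
  \<open>m x\<close>; the influence is of order \<open>\<epsilon>\<close>, its oscillation in \<open>\<omega> x\<close> of order \<open>\<epsilon>\<^sup>2\<close>.\<close>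

lemma D_off_le:
  assumes x: "x \<notin> sites2" and e: "e \<in> steps"
  shows "\<bar>D x e\<bar> \<le> 2700 * \<epsilon> ^ 3 * (Ef * EV x)"
proof -
  define L where "L X = m x (mix {} X) - m x (mix sites2 X)" for X
  define H where "H \<omega> = V (0, 0) x \<omega> + V (0, 1) x \<omega>" for \<omega>
  define S where "S = (LINT \<omega>|P. f \<omega> * H \<omega>)"
  have rH: "rv H" unfolding H_def by (intro rv_ops rv_V)
  have cL: "crv L" unfolding L_def by (intro crv_intros rv_m)
  have cY: "crv (\<lambda>X. f (mix {} X) * L X)" by (intro crv_ops cL crv_mix rv_f)
  have fH: "(LINT X|copies. f (mix {} X) * H (mix {} X)) = S"
    unfolding S_def by (rule integral_mix[OF rv_ops(1)[OF rv_f rH]])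
  have SH: "S \<le> 5 / 4 * (Ef * EV x)"
    unfolding S_def EV_def H_def[symmetric]
    by (rule weighted_le(1)[OF rH]) (use V_osc(2) in \<open>simp add: H_def add_mono distrib_left\<close>)
  have x0: "x \<noteq> (0, 0)" "x \<noteq> (0, 1)" using x by auto
  have VV: "V (0, 1) x (mix {(0, 0)} X) \<le> 11 / 10 * V (0, 1) x (mix {} X)" "0 \<le> V z x (mix S X)"
    if "\<forall>S. mix S X \<in> Near" for X z S
    using V_osc(1)[OF site_change_mix[OF that, of "{}" "(0, 0)" "{(0, 0)}"], of "(0, 1)" x]
      V_bounds(1)[OF environments_nearD(1), of "mix S X" \<epsilon> z x] that by simp_all
  \<comment> \<open>The sites are exchanged one after the other; the factor 1.1 brings the second
    \<open>V\<close> back to \<open>mix {} X\<close>, and 21 * 1.1 is below 24.\<close>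
  have Lle: "\<bar>L X\<bar> \<le> 24 * \<epsilon> * H (mix {} X)" if n: "\<forall>S. mix S X \<in> Near" for X
  proof -
    have "\<bar>m x (mix {(0, 0)} X) - m x (mix {} X)\<bar> \<le> 21 * \<epsilon> * V (0, 0) x (mix {} X)"
      by (rule m_diff_V[OF site_change_mix[OF n] x0(1)]) blast
    moreover have "\<bar>m x (mix sites2 X) - m x (mix {(0, 0)} X)\<bar> \<le> 21 * \<epsilon> * V (0, 1) x (mix {(0, 0)} X)"
      by (rule m_diff_V[OF site_change_mix[OF n] x0(2)]) blast
    moreover have "21 * \<epsilon> * V (0, 1) x (mix {(0, 0)} X) \<le> 21 * \<epsilon> * (11 / 10 * V (0, 1) x (mix {} X))"
      using VV[OF n] \<epsilon> by (intro mult_left_mono) auto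
    moreover have "0 \<le> \<epsilon> * V z x (mix {} X)" for z using VV(2)[OF n, of z "{}"] \<epsilon> by simp
    from this[of "(0, 0)"] this[of "(0, 1)"] calculation show ?thesis
      unfolding L_def H_def by (simp add: algebra_simps abs_le_iff)
  qed
  have upd: "(mix S X)(x := mix {x} X x) = mix (insert x S) X" "(mix S X)(x := mix (insert x T) X x) = mix (insert x S) X" for S T X
    by (auto simp: mix_apply fun_eq_iff)
  \<comment> \<open>Each of the two exchanges, taken with and without an exchange at
    \<open>x\<close>, gives a mixed second difference; 1650 is 1500 * 1.1.\<close>
  have Mle: "\<bar>L X - L (X \<circ> swap {x})\<bar> \<le> 1650 * \<epsilon>\<^sup>2 * H (mix {} X)" if n: "\<forall>S. mix S X \<in> Near" for X
  proof -
    have "\<bar>(m x (mix {x, (0, 0)} X) - m x (mix {x} X)) - (m x (mix {(0, 0)} X) - m x (mix {} X))\<bar>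
        \<le> 1500 * \<epsilon>\<^sup>2 * V (0, 0) x (mix {} X)"
      unfolding upd(1)[of "{(0, 0)}", symmetric]
      by (rule m_mixed_diff_V[OF site_change_mix[OF n] site_change_mix[OF n] x0(1)]) blast+
    moreover have "\<bar>(m x (mix (insert x sites2) X) - m x (mix {x, (0, 0)} X)) - (m x (mix sites2 X) - m x (mix {(0, 0)} X))\<bar>
        \<le> 1500 * \<epsilon>\<^sup>2 * V (0, 1) x (mix {(0, 0)} X)"
      unfolding upd(2)[of sites2 X "{(0, 0)}", symmetric]
      by (rule m_mixed_diff_V[OF site_change_mix[OF n] site_change_mix[OF n] x0(2)]) blast+
    moreover have "1500 * \<epsilon>\<^sup>2 * V (0, 1) x (mix {(0, 0)} X) \<le> 1500 * \<epsilon>\<^sup>2 * (11 / 10 * V (0, 1) x (mix {} X))"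
      using VV[OF n] by (intro mult_left_mono) auto
    moreover have "0 \<le> \<epsilon>\<^sup>2 * V z x (mix {} X)" for z using VV(2)[OF n, of z "{}"] by simp
    moreover have "L (X \<circ> swap {x}) = m x (mix {x} X) - m x (mix (insert x sites2) X)"
    proof -
      have "sites2 - {x} \<union> ({x} - sites2) = insert x sites2" using x by auto
      then show ?thesis unfolding L_def mix_swap by simp
    qed
    moreover have "L X = m x (mix {} X) - m x (mix sites2 X)" by (simp add: L_def)
    moreover have "\<bar>(a - b) - (c - d)\<bar> \<le> 1650 * E * (v + w)"
      if "\<bar>(p - c) - (q - a)\<bar> \<le> 1500 * E * v" "\<bar>(d - p) - (b - q)\<bar> \<le> 1500 * E * w'" "1500 * E * w' \<le> 1500 * E * (11 / 10 * w)"
        "0 \<le> E * v" for a b c d p q v w w' E :: real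
    proof -
      have "1500 * E * v = 1500 * (E * v)" "1500 * E * (11 / 10 * w) = 1650 * (E * w)" "1650 * E * (v + w) = 1650 * (E * v) + 1650 * (E * w)"
        by (simp_all add: algebra_simps)
      then show ?thesis using that by linarith
    qed
    ultimately show ?thesis unfolding H_def by (simp only:)
  qed
  \<comment> \<open>Once the two sites are decoupled from \<open>f\<close> the integral factorises
    and the centring at \<open>phat\<close> annihilates it. Subtracting it brings in the influence
    \<open>L\<close>.\<close>
  have z: "(LINT X|copies. f (mix {} X) * (m x (mix sites2 X) * (mix sites2 X x e - phat e))) = 0"
  proof -
    have i: "integrable P (\<lambda>\<omega>. m x \<omega> * \<omega> x e)" "integrable P (\<lambda>\<omega>. m x \<omega> * phat e)"
      by (intro rv_integrable rv_ops rv_m rv_coord rv_const)+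
    have z: "(LINT \<omega>|P. m x \<omega> * (\<omega> x e - phat e)) = 0"
      unfolding right_diff_distrib Bochner_Integration.integral_diff[OF i] by (simp add: phat_eq m_mean)
    have r: "rv (\<lambda>\<omega>. m x \<omega> * (\<omega> x e - phat e))" by (intro rv_ops rv_m rv_coord rv_const)
    show ?thesis
      using integral_decouple[where F = f and h = "\<lambda>\<omega>. m x \<omega> * (\<omega> x e - phat e)", OF rv_f r f_dep]
      unfolding z mult_zero_right .
  qed
  have D1: "D x e = (LINT X|copies. f (mix {} X) * L X * (mix {} X x e - phat e))"
  proof -
    have "D x e = (LINT X|copies. f (mix {} X) * (m x (mix {} X) * (mix {} X x e - phat e)))"
      unfolding D_def by (rule integral_mix[symmetric]) (intro rv_ops rv_f rv_m rv_coord rv_const)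
    also have "\<dots> = (LINT X|copies. f (mix {} X) * (m x (mix {} X) * (mix {} X x e - phat e)) -
        f (mix {} X) * (m x (mix sites2 X) * (mix sites2 X x e - phat e)))"
      by (subst Bochner_Integration.integral_diff)
         (auto intro!: crv_integrable crv_ops crv_const crv_mix crv_mix_coord rv_f rv_m rv_ops rv_coord rv_const simp: z)
    also have "\<dots> = (LINT X|copies. f (mix {} X) * L X * (mix {} X x e - phat e))"
      using x by (intro Bochner_Integration.integral_cong refl) (simp add: L_def mix_apply algebra_simps)
    finally show ?thesis .
  qed
  have ind: "(LINT X|copies. (f (mix {} X) * L X) * (mix UNIV X x e - pbar e)) = 0"
  proof -
    have cG: "crv (\<lambda>X. mix UNIV X x e - pbar e)" by (intro crv_ops crv_const crv_mix_coord)
    obtain C C' where C: "\<And>X. X \<in> space copies \<Longrightarrow> \<bar>f (mix {} X) * L X\<bar> \<le> C"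
      "\<And>X. X \<in> space copies \<Longrightarrow> \<bar>mix UNIV X x e - pbar e\<bar> \<le> C'"
      using cY cG unfolding crv_def by blast
    have "(LINT X|copies. (f (mix {} X) * L X) * (mix UNIV X x e - pbar e)) =
        (LINT X|copies. f (mix {} X) * L X) * (LINT X|copies. mix UNIV X x e - pbar e)"
    proof (rule integral_indep[where S = "- {(x, False)}"])
      fix X X' :: "site \<times> bool \<Rightarrow> site \<Rightarrow> real"
      assume a: "\<And>i. i \<in> - {(x, False)} \<Longrightarrow> X i = X' i"
      have "mix {} X = mix {} X'" "mix sites2 X = mix sites2 X'"
        using x by (auto simp: mix_apply fun_eq_iff a)
      then show "f (mix {} X) * L X = f (mix {} X') * L X'" by (simp add: L_def)
    qed (use C cY cG in \<open>auto simp: crv_def mix_apply\<close>)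
    moreover have "(LINT X|copies. mix UNIV X x e - pbar e) = 0"
      using integral_mix[OF rv_ops(3)[OF rv_coord rv_const], of UNIV x e "pbar e"] rv_integrable[OF rv_coord]
      by (simp add: pbar_eq P.prob_space)
    ultimately show ?thesis by simp
  qed
  \<comment> \<open>\<open>\<omega> x e - phat e\<close> is split into the difference of the copies,
    the centred second copy, and \<open>pbar e - phat e\<close>. The middle part vanishes by
    \<open>ind\<close>, the last is O(\<epsilon>^2).\<close>
  have D2: "D x e = (LINT X|copies. (f (mix {} X) * L X) * (mix {} X x e - mix UNIV X x e)) +
      (pbar e - phat e) * (LINT X|copies. f (mix {} X) * L X)"
  proof -
    have c: "crv (\<lambda>X. (f (mix {} X) * L X) * (mix {} X x e - mix UNIV X x e))"
      "crv (\<lambda>X. (f (mix {} X) * L X) * (mix UNIV X x e - pbar e))" "crv (\<lambda>X. (f (mix {} X) * L X) * (pbar e - phat e))"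
      by (intro crv_ops cY crv_mix_coord crv_const)+
    have "D x e = (LINT X|copies. (f (mix {} X) * L X) * (mix {} X x e - mix UNIV X x e) +
        ((f (mix {} X) * L X) * (mix UNIV X x e - pbar e) + (f (mix {} X) * L X) * (pbar e - phat e)))"
      unfolding D1 by (intro Bochner_Integration.integral_cong refl) (simp add: algebra_simps)
    also have "\<dots> = (LINT X|copies. (f (mix {} X) * L X) * (mix {} X x e - mix UNIV X x e)) +
        (0 + (LINT X|copies. (f (mix {} X) * L X) * (pbar e - phat e)))"
      unfolding ind[symmetric]
      by (subst Bochner_Integration.integral_add, (intro crv_integrable crv_ops c)+)+ simp
    finally show ?thesis by simp
  qed
  have b1: "\<bar>LINT X|copies. (f (mix {} X) * L X) * (mix {} X x e - mix UNIV X x e)\<bar> \<le>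
      \<epsilon> * (LINT X|copies. 1650 * \<epsilon>\<^sup>2 * (f (mix {} X) * H (mix {} X)))"
  proof (rule resample[OF cY _ e])
    show "AE X in copies. \<bar>f (mix {} X) * L X - f (mix {} (X \<circ> swap {x})) * L (X \<circ> swap {x})\<bar>
        \<le> 1650 * \<epsilon>\<^sup>2 * (f (mix {} X) * H (mix {} X))"
      using AE_near_mix
    proof eventually_elim
      case (elim X)
      have "f (mix {} (X \<circ> swap {x})) = f (mix {} X)"
        unfolding mix_swap using x0 by (intro f_dep) (auto simp: mix_apply)
      then have "\<bar>f (mix {} X) * L X - f (mix {} (X \<circ> swap {x})) * L (X \<circ> swap {x})\<bar> = f (mix {} X) * \<bar>L X - L (X \<circ> swap {x})\<bar>"
        using f_nonneg by (simp add: abs_mult flip: right_diff_distrib)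
      also have "\<dots> \<le> f (mix {} X) * (1650 * \<epsilon>\<^sup>2 * H (mix {} X))" by (intro mult_left_mono Mle[OF elim] f_nonneg)
      finally show ?case by (simp add: mult_ac)
    qed
  qed (intro crv_ops crv_const crv_mix rv_f rH)
  have b2: "\<bar>LINT X|copies. f (mix {} X) * L X\<bar> \<le> (LINT X|copies. 24 * \<epsilon> * (f (mix {} X) * H (mix {} X)))"
  proof (rule integral_abs_le[OF cY])
    show "AE X in copies. \<bar>f (mix {} X) * L X\<bar> \<le> 24 * \<epsilon> * (f (mix {} X) * H (mix {} X))"
      using AE_near_mix
    proof eventually_elim
      case (elim X)
      have "f (mix {} X) * \<bar>L X\<bar> \<le> f (mix {} X) * (24 * \<epsilon> * H (mix {} X))" by (intro mult_left_mono Lle[OF elim] f_nonneg)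
      then show ?case using f_nonneg by (simp add: abs_mult mult_ac)
    qed
  qed (intro crv_ops crv_const crv_mix rv_f rH)
  have "\<bar>(pbar e - phat e) * (LINT X|copies. f (mix {} X) * L X)\<bar> \<le> (21 * \<epsilon>\<^sup>2) * (24 * \<epsilon> * S)"
    unfolding abs_mult using phat_pbar[OF e] b2 by (intro mult_mono) (auto simp: fH abs_minus_commute)
  then have "\<bar>D x e\<bar> \<le> \<epsilon> * (1650 * \<epsilon>\<^sup>2 * S) + (21 * \<epsilon>\<^sup>2) * (24 * \<epsilon> * S)"
  proof -
    have "\<bar>a + b\<bar> \<le> A + B" if "\<bar>a\<bar> \<le> A" "\<bar>b\<bar> \<le> B" for a b A B :: real using that by linarith
    from this[OF b1 \<open>\<bar>(pbar e - phat e) * _\<bar> \<le> _\<close>] show ?thesis unfolding D2 by (simp add: fH)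
  qed
  also have "\<dots> = 2154 * \<epsilon> ^ 3 * S" by (simp add: power2_eq_square power3_eq_cube algebra_simps)
  also have "\<dots> \<le> 2154 * \<epsilon> ^ 3 * (5 / 4 * (Ef * EV x))" using \<epsilon> SH by (intro mult_left_mono) auto
  also have "\<dots> \<le> 2700 * \<epsilon> ^ 3 * (Ef * EV x)"
  proof -
    have "0 \<le> EV x" unfolding EV_def using V_bounds(1) by (intro integral_nonneg_AE AE_I2) (auto simp: space_P)
    then have "0 \<le> \<epsilon> ^ 3 * (Ef * EV x)" using \<epsilon> Ef_nonneg by simp
    then have "2154 * (5 / 4) * (\<epsilon> ^ 3 * (Ef * EV x)) \<le> 2700 * (\<epsilon> ^ 3 * (Ef * EV x))"
      by (intro mult_right_mono) auto
    then show ?thesis by (simp only: mult_ac)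
  qed
  finally show ?thesis .
qed

end

context weighted
begin

sublocale drift_kernel k \<epsilon> by (rule drift_kernel)

lemma m_weighted_le: "(LINT \<omega>|P. f \<omega> * m x \<omega>) \<le> 5 / 4 * Ef"
proof -
  have "m x \<omega> \<le> 11 / 10 * m x \<omega>'" if "site_change \<delta> \<epsilon> z \<omega> \<omega>'" for \<omega> \<omega>' z
    using comparable_weaken[OF m_osc(2)[OF that], of "11 / 10" x] low_disorder_axioms \<epsilon>
    by (simp add: comparable_def)
  from weighted_le(1)[OF rv_m this] show ?thesis by (simp add: m_mean)
qed

lemma integrable_fm: "integrable P (\<lambda>\<omega>. f \<omega> * m x \<omega>)" "integrable P (\<lambda>\<omega>. f \<omega> * (m x \<omega> * \<omega> y e))"
  by (intro rv_integrable rv_ops rv_f rv_m rv_coord)+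

lemma D_eq: "D x e = (LINT \<omega>|P. f \<omega> * (m x \<omega> * \<omega> x e)) - phat e * (LINT \<omega>|P. f \<omega> * m x \<omega>)"
proof -
  have "D x e = (LINT \<omega>|P. f \<omega> * (m x \<omega> * \<omega> x e) - (f \<omega> * m x \<omega>) * phat e)"
    unfolding D_def by (intro Bochner_Integration.integral_cong refl) (simp add: algebra_simps)
  also have "\<dots> = (LINT \<omega>|P. f \<omega> * (m x \<omega> * \<omega> x e)) - (LINT \<omega>|P. (f \<omega> * m x \<omega>) * phat e)"
    by (intro Bochner_Integration.integral_diff integrable_fm integrable_mult_left)
  finally show ?thesis by simp
qed

lemma fm_nonneg: "0 \<le> (LINT \<omega>|P. f \<omega> * m x \<omega>)"
  by (intro integral_nonneg_AE AE_I2 mult_nonneg_nonneg f_nonneg m_nonneg) (simp add: space_P)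

lemma sum_fm: "(\<Sum>e\<in>steps. LINT \<omega>|P. f \<omega> * (m x \<omega> * \<omega> x e)) = (LINT \<omega>|P. f \<omega> * m x \<omega>)"
proof -
  have "(\<Sum>e\<in>steps. LINT \<omega>|P. f \<omega> * (m x \<omega> * \<omega> x e)) = (LINT \<omega>|P. (\<Sum>e\<in>steps. f \<omega> * (m x \<omega> * \<omega> x e)))"
    using integrable_fm(2) by simp
  also have "\<dots> = (LINT \<omega>|P. f \<omega> * m x \<omega>)"
    by (rule integral_cong_env) (simp add: environmentsD flip: sum_distrib_left)
  finally show ?thesis .
qed

lemma sum_D: "(\<Sum>e\<in>steps. D x e) = 0"
  unfolding D_eq sum_subtractf sum_fm by (simp add: sum_phat flip: sum_distrib_right)

lemma phat_bounds: "e \<in> steps \<Longrightarrow> 0 \<le> phat e" "e \<in> steps \<Longrightarrow> phat e \<le> 1"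
  using phat_near[of e] \<epsilon> by (auto simp: abs_le_iff)

lemma D_bound: "e \<in> steps \<Longrightarrow> \<bar>D x e\<bar> \<le> 5 / 4 * Ef"
proof -
  assume e: "e \<in> steps"
  have n: "0 \<le> (LINT \<omega>|P. f \<omega> * (m x \<omega> * \<omega> x e'))" for e'
    by (intro integral_nonneg_AE AE_I2 mult_nonneg_nonneg f_nonneg m_nonneg environmentsD) (simp_all add: space_P)
  have "(LINT \<omega>|P. f \<omega> * (m x \<omega> * \<omega> x e)) \<le> (LINT \<omega>|P. f \<omega> * m x \<omega>)"
    unfolding sum_fm[symmetric] using e n by (intro member_le_sum) (auto simp: finite_steps)
  moreover have "0 \<le> phat e * (LINT \<omega>|P. f \<omega> * m x \<omega>)" "phat e * (LINT \<omega>|P. f \<omega> * m x \<omega>) \<le> 1 * (LINT \<omega>|P. f \<omega> * m x \<omega>)"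
    by (rule mult_nonneg_nonneg[OF phat_bounds(1)[OF e] fm_nonneg])
      (rule mult_right_mono[OF phat_bounds(2)[OF e] fm_nonneg])
  ultimately show ?thesis unfolding D_eq using n[of e] m_weighted_le[of x] by linarith
qed

text \<open>What \<open>D z e\<close> becomes when \<open>m z\<close> is replaced by its mean 1 and
  \<open>phat\<close> by \<open>pbar\<close>.\<close>

definition d :: "site \<Rightarrow> site \<Rightarrow> real" where
  "d z e = (LINT \<omega>|P. f \<omega> * (\<omega> z e - pbar e))"

lemma d_le: "e \<in> steps \<Longrightarrow> \<bar>d z e\<bar> \<le> 2 * \<epsilon> * Ef"
proof -
  assume e: "e \<in> steps"
  have c: "crv (\<lambda>X. f (mix {} X) * (mix {} X z e - pbar e))" by (intro crv_ops crv_const crv_mix rv_f crv_mix_coord)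
  have "d z e = (LINT X|copies. f (mix {} X) * (mix {} X z e - pbar e))"
    unfolding d_def by (rule integral_mix[symmetric]) (intro rv_ops rv_f rv_coord rv_const)
  also have "\<bar>\<dots>\<bar> \<le> (LINT X|copies. 2 * \<epsilon> * f (mix {} X))"
  proof (rule integral_abs_le[OF c])
    show "AE X in copies. \<bar>f (mix {} X) * (mix {} X z e - pbar e)\<bar> \<le> 2 * \<epsilon> * f (mix {} X)"
      using AE_near_mix
    proof eventually_elim
      case (elim X)
      have "f (mix {} X) * \<bar>mix {} X z e - pbar e\<bar> \<le> f (mix {} X) * (2 * \<epsilon>)"
        using elim by (intro mult_left_mono coord_pbar_le e f_nonneg) auto
      then show ?case by (simp add: abs_mult f_nonneg mult.commute)
    qed
  qed (intro crv_ops crv_const crv_mix rv_f)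
  finally show ?thesis by (simp add: integral_mix rv_f)
qed

text \<open>\<open>\<omega> z e - pbar e\<close> is of order \<epsilon> already, so decoupling
  \<open>m z\<close> from the two sites costs another \<epsilon>. The constants are 86 * 5/4 + 21 *
  5/4 < 140.\<close>

lemma D_on_le:
  assumes z: "z \<in> sites2" and e: "e \<in> steps"
  shows "\<bar>D z e - d z e\<bar> \<le> 140 * \<epsilon>\<^sup>2 * Ef"
proof -
  define F where "F \<omega> = f \<omega> * (\<omega> z e - pbar e)" for \<omega>
  have rF: "rv F" unfolding F_def by (intro rv_ops rv_f rv_coord rv_const)
  have F_dep: "F \<omega> = F \<omega>'" if "\<omega> (0, 0) = \<omega>' (0, 0)" "\<omega> (0, 1) = \<omega>' (0, 1)" for \<omega> \<omega>'
    using f_dep[OF that] that z by (auto simp: F_def)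
  have "(LINT X|copies. F (mix {} X) * m z (mix sites2 X)) = (LINT \<omega>|P. F \<omega>) * (LINT \<omega>|P. m z \<omega>)"
    by (rule integral_decouple[OF rF rv_m]) (rule F_dep)
  then have dec: "(LINT X|copies. F (mix {} X) * m z (mix sites2 X)) = d z e"
    unfolding m_mean mult_1_right by (simp only: d_def F_def[abs_def])
  have cA: "crv (\<lambda>X. F (mix {} X) * m z (mix S X))" for S by (intro crv_ops crv_mix rF rv_m)
  have "(LINT \<omega>|P. F \<omega> * m z \<omega>) - d z e = (LINT X|copies. F (mix {} X) * m z (mix {} X)) - (LINT X|copies. F (mix {} X) * m z (mix sites2 X))"
    using integral_mix[OF rv_ops(1)[OF rF rv_m], of "{}" z] dec by simp
  also have "\<dots> = (LINT X|copies. F (mix {} X) * m z (mix {} X) - F (mix {} X) * m z (mix sites2 X))"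
    by (rule Bochner_Integration.integral_diff[symmetric]) (rule crv_integrable[OF cA])+
  also have "\<bar>\<dots>\<bar> \<le> (LINT X|copies. 86 * \<epsilon>\<^sup>2 * (f (mix {} X) * m z (mix {} X)))"
  proof (rule integral_abs_le[OF crv_ops(3)[OF cA cA]])
    show "AE X in copies. \<bar>F (mix {} X) * m z (mix {} X) - F (mix {} X) * m z (mix sites2 X)\<bar>
        \<le> 86 * \<epsilon>\<^sup>2 * (f (mix {} X) * m z (mix {} X))"
      using AE_near_mix
    proof eventually_elim
      case (elim X)
      have sc: "site_change \<delta> \<epsilon> (0, 0) (mix {} X) (mix {(0, 0)} X)" "site_change \<delta> \<epsilon> (0, 1) (mix {(0, 0)} X) (mix sites2 X)"
        by (rule site_change_mix[OF elim], blast)+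
      have m0: "0 \<le> m z (mix {} X)" using elim environments_nearD(1) by (intro m_nonneg) blast
      have "m z (mix {(0, 0)} X) \<le> (1 + 21 * \<epsilon>) * m z (mix {} X)"
        using m_osc(2)[OF sc(1), of z] by (simp add: comparable_def)
      also have "\<dots> \<le> 22 / 21 * m z (mix {} X)" using \<epsilon> m0 by (intro mult_right_mono) auto
      finally have "21 * \<epsilon> * m z (mix {(0, 0)} X) \<le> 21 * \<epsilon> * (22 / 21 * m z (mix {} X))"
        using \<epsilon> by (intro mult_left_mono) auto
      then have mm: "\<bar>m z (mix {} X) - m z (mix sites2 X)\<bar> \<le> 43 * \<epsilon> * m z (mix {} X)"
        using m_diff_le[OF sc(1), of z] m_diff_le[OF sc(2), of z] by linarith
      have "\<bar>F (mix {} X) * m z (mix {} X) - F (mix {} X) * m z (mix sites2 X)\<bar> =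
          f (mix {} X) * (\<bar>mix {} X z e - pbar e\<bar> * \<bar>m z (mix {} X) - m z (mix sites2 X)\<bar>)"
        by (simp add: F_def abs_mult f_nonneg mult.assoc flip: right_diff_distrib)
      also have "\<dots> \<le> f (mix {} X) * ((2 * \<epsilon>) * (43 * \<epsilon> * m z (mix {} X)))"
        using elim \<epsilon> by (intro mult_left_mono mult_mono mm coord_pbar_le e f_nonneg) auto
      finally show ?case by (simp add: power2_eq_square mult_ac)
    qed
  qed (intro crv_ops crv_const crv_mix rv_f rv_m)
  also have "\<dots> = 86 * \<epsilon>\<^sup>2 * (LINT \<omega>|P. f \<omega> * m z \<omega>)"
    using integral_mix[OF rv_ops(1)[OF rv_f rv_m], of "{}" z] by simp
  also have "\<dots> \<le> 86 * \<epsilon>\<^sup>2 * (5 / 4 * Ef)" by (intro mult_left_mono m_weighted_le) simp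
  finally have a: "\<bar>(LINT \<omega>|P. F \<omega> * m z \<omega>) - d z e\<bar> \<le> 86 * \<epsilon>\<^sup>2 * (5 / 4 * Ef)" .
  have "(LINT \<omega>|P. F \<omega> * m z \<omega>) = (LINT \<omega>|P. f \<omega> * (m z \<omega> * \<omega> z e) - (f \<omega> * m z \<omega>) * pbar e)"
    by (intro Bochner_Integration.integral_cong refl) (simp add: F_def algebra_simps)
  also have "\<dots> = (LINT \<omega>|P. f \<omega> * (m z \<omega> * \<omega> z e)) - (LINT \<omega>|P. (f \<omega> * m z \<omega>) * pbar e)"
    by (intro Bochner_Integration.integral_diff integrable_fm integrable_mult_left)
  finally have D: "D z e - (LINT \<omega>|P. F \<omega> * m z \<omega>) = (pbar e - phat e) * (LINT \<omega>|P. f \<omega> * m z \<omega>)"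
    unfolding D_eq left_diff_distrib integral_mult_left_zero by (simp add: mult.commute)
  have b: "\<bar>D z e - (LINT \<omega>|P. F \<omega> * m z \<omega>)\<bar> \<le> (21 * \<epsilon>\<^sup>2) * (5 / 4 * Ef)"
    unfolding D abs_mult using phat_pbar[OF e] m_weighted_le[of z] fm_nonneg[of z]
    by (intro mult_mono) (auto simp: abs_minus_commute)
  have "0 \<le> \<epsilon>\<^sup>2 * Ef" using Ef_nonneg by simp
  then show ?thesis using a b by linarith
qed

section \<open>The Poisson equation for the expected mass\<close>

definition u :: "site \<Rightarrow> real" where
  "u x = (LINT \<omega>|P. f \<omega> * m x \<omega>) - Ef"

lemma u_eq: "u x = (\<Sum>e\<in>steps. k e * u (x - e)) + \<delta> * (\<Sum>e\<in>steps. D (x - e) e)"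
proof -
  have i: "integrable P (\<lambda>\<omega>. f \<omega> * (1 - \<delta>))" "integrable P (\<lambda>\<omega>. \<delta> * (\<Sum>e\<in>steps. f \<omega> * (m (x - e) \<omega> * \<omega> (x - e) e)))"
    using rv_integrable[OF rv_f] integrable_fm(2) by auto
  have "(LINT \<omega>|P. f \<omega> * m x \<omega>) = (LINT \<omega>|P. f \<omega> * (1 - \<delta>) + \<delta> * (\<Sum>e\<in>steps. f \<omega> * (m (x - e) \<omega> * \<omega> (x - e) e)))"
    by (rule integral_cong_env) (subst m_eq, assumption, simp add: algebra_simps sum_distrib_left)
  also have "\<dots> = Ef * (1 - \<delta>) + \<delta> * (\<Sum>e\<in>steps. LINT \<omega>|P. f \<omega> * (m (x - e) \<omega> * \<omega> (x - e) e))"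
    unfolding Bochner_Integration.integral_add[OF i] using integrable_fm(2) by simp
  also have "(\<Sum>e\<in>steps. LINT \<omega>|P. f \<omega> * (m (x - e) \<omega> * \<omega> (x - e) e)) = (\<Sum>e\<in>steps. D (x - e) e + phat e * (u (x - e) + Ef))"
    by (intro sum.cong refl) (simp add: D_eq u_def)
  also have "\<dots> = (\<Sum>e\<in>steps. D (x - e) e) + (\<Sum>e\<in>steps. phat e * u (x - e)) + Ef"
    by (simp add: sum.distrib distrib_left sum_phat flip: sum_distrib_right)
  finally show ?thesis by (simp add: u_def[of x] k_def sum_distrib_left algebra_simps)
qed

lemma bdd_D: "e \<in> steps \<Longrightarrow> bdd (\<lambda>x. D x e)"
  by (rule bddI[where C = "5 / 4 * Ef"]) (rule D_bound)

text \<open>Potentials step forward while \<open>u_eq\<close> looks back to \<open>x - e\<close>,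
  hence the reflection \<open>y\<close> to \<open>- y\<close>. Translating each summand by
  \<open>e\<close> is a summation by parts onto the Green function, and \<open>sum_D\<close> allows
  its value at \<open>x\<close> to be subtracted.\<close>

lemma u_0: "u 0 = \<delta> * (\<Sum>\<^sub>\<infinity>x. \<Sum>e\<in>steps. D x e * (cgreen k (x + e) - cgreen k x))"
proof -
  define c where "c y = \<delta> * (\<Sum>e\<in>steps. D (- y - e) e)" for y
  have bc: "bdd c"
  proof (rule bddI)
    fix y
    have "\<bar>\<Sum>e\<in>steps. D (- y - e) e\<bar> \<le> (\<Sum>e\<in>steps. 5 / 4 * Ef)"
      by (rule order_trans[OF sum_abs sum_mono]) (rule D_bound)
    then have "\<delta> * \<bar>\<Sum>e\<in>steps. D (- y - e) e\<bar> \<le> 1 * (\<Sum>e\<in>steps. 5 / 4 * Ef)"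
      using \<delta> \<delta>0 by (intro mult_mono) auto
    then show "\<bar>c y\<bar> \<le> 1 * (\<Sum>e\<in>steps. 5 / 4 * Ef)" unfolding c_def abs_mult using \<delta>0 by simp
  qed
  have "\<bar>u x\<bar> \<le> 3 * Ef" for x
    unfolding u_def using m_weighted_le[of x] fm_nonneg[of x] Ef_nonneg by linarith
  then have bu: "bdd (\<lambda>y. u (- y))" by (intro bddI[where C = "3 * Ef"])
  have bs: "bdd (\<lambda>x. D (x - e) e)" if "e \<in> steps" for e
    by (rule bddI[where C = "5 / 4 * Ef"]) (rule D_bound[OF that])
  have "u (- 0) = pot (\<lambda>_. k) c 0"
  proof (rule pot_unique[OF const_kernel.sub bc bu])
    show "u (- y) = c y + step_op (\<lambda>_. k) (\<lambda>y. u (- y)) y" for y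
      by (subst u_eq) (simp add: c_def step_op_def minus_add_distrib)
  qed unfold_locales
  also have "\<dots> = (\<Sum>\<^sub>\<infinity>x. cgreen k (0 - x) * c x)"
    unfolding pot_eq_infsum[OF const_kernel.sub[OF const_kernel_axioms] bc] green_translate ..
  also have "\<dots> = (\<Sum>\<^sub>\<infinity>x. cgreen k x * c (- x))"
    using infsum_translate(1)[of "\<lambda>x. cgreen k x * c (- x)" 0] by simp
  also have "\<dots> = \<delta> * (\<Sum>\<^sub>\<infinity>x. \<Sum>e\<in>steps. cgreen k x * D (x - e) e)"
    unfolding infsum_cmult_right'[symmetric] c_def
    by (intro infsum_cong) (simp add: sum_distrib_left mult_ac)
  also have "(\<Sum>\<^sub>\<infinity>x. \<Sum>e\<in>steps. cgreen k x * D (x - e) e) = (\<Sum>e\<in>steps. \<Sum>\<^sub>\<infinity>x. cgreen k x * D (x - e) e)"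
    by (intro infsum_sum summable_on_bdd_mult cgreen_summable bs)
  also have "\<dots> = (\<Sum>e\<in>steps. \<Sum>\<^sub>\<infinity>x. cgreen k (x + e) * D x e)"
  proof (intro sum.cong refl)
    fix e
    show "(\<Sum>\<^sub>\<infinity>x. cgreen k x * D (x - e) e) = (\<Sum>\<^sub>\<infinity>x. cgreen k (x + e) * D x e)"
      using infsum_translate(3)[of "\<lambda>x. cgreen k x * D (x - e) e" e] by simp
  qed
  also have "\<dots> = (\<Sum>\<^sub>\<infinity>x. \<Sum>e\<in>steps. cgreen k (x + e) * D x e)"
    by (intro infsum_sum[symmetric] summable_on_bdd_mult shift_summable bdd_D)
  also have "\<dots> = (\<Sum>\<^sub>\<infinity>x. \<Sum>e\<in>steps. D x e * (cgreen k (x + e) - cgreen k x))"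
  proof (intro infsum_cong)
    fix x
    have "(\<Sum>e\<in>steps. D x e * (cgreen k (x + e) - cgreen k x)) = (\<Sum>e\<in>steps. cgreen k (x + e) * D x e) - (\<Sum>e\<in>steps. D x e) * cgreen k x"
      unfolding sum_distrib_right right_diff_distrib sum_subtractf by (simp only: mult.commute)
    then show "(\<Sum>e\<in>steps. cgreen k (x + e) * D x e) = (\<Sum>e\<in>steps. D x e * (cgreen k (x + e) - cgreen k x))"
      by (simp add: sum_D)
  qed
  finally show ?thesis by simp
qed

lemma EV_bounds:
  assumes "x \<notin> sites2"
  shows "0 \<le> EV x" "EV x \<le> 2" "EV x \<le> U (0, 0) x + U (0, 1) x"
proof -
  have V: "integrable P (V z x)" for z by (rule rv_integrable[OF rv_V])
  have e: "EV x = (LINT \<omega>|P. V (0, 0) x \<omega>) + (LINT \<omega>|P. V (0, 1) x \<omega>)"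
    unfolding EV_def by (rule Bochner_Integration.integral_add[OF V V])
  have n: "0 \<le> (LINT \<omega>|P. V z x \<omega>)" for z
    by (intro integral_nonneg_AE AE_I2 V_bounds) (simp add: space_P)
  have m: "(LINT \<omega>|P. V z x \<omega>) \<le> 1" if "x \<noteq> z" for z
    unfolding m_mean[of x, symmetric] using that
    by (intro integral_mono_AE V rv_integrable[OF rv_m] AE_I2 V_bounds(2)) (simp_all add: space_P)
  have U: "(LINT \<omega>|P. V z x \<omega>) \<le> U z x" for z
    unfolding U_def
    by (intro integral_mono_AE V rv_integrable rv_ops rv_m rv_g AE_I2 V_bounds(3)) (simp add: space_P)
  show "0 \<le> EV x" unfolding e using n[of "(0, 0)"] n[of "(0, 1)"] by linarith
  show "EV x \<le> 2" unfolding e using m[of "(0, 0)"] m[of "(0, 1)"] assms by auto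
  show "EV x \<le> U (0, 0) x + U (0, 1) x" unfolding e using U[of "(0, 0)"] U[of "(0, 1)"] by linarith
qed

text \<open>Upstream, \<open>EV x \<le> 2\<close> turns the square sum into the occupation bounded
  by \<open>U_upstream\<close>, so \<open>\<alpha>\<close> is \<open>7 * c / \<epsilon>\<close>;
  downstream \<open>\<beta>\<close> is \<open>2 * c\<close>. With \<open>c\<close> of order
  \<epsilon>^3 both parts of \<open>grad_pairing\<close> are of order \<epsilon>^2 times the
  diagonal.\<close>

lemma D_off_pairing:
  assumes e: "e \<in> steps"
  defines "T \<equiv> \<lambda>x. if x \<in> sites2 then 0 else \<bar>D x e\<bar>"
  shows "(\<lambda>x. T x * \<bar>cgreen k (x + e) - cgreen k x\<bar>) summable_on UNIV"
    "(\<Sum>\<^sub>\<infinity>x. T x * \<bar>cgreen k (x + e) - cgreen k x\<bar>) \<le> 2 * 10 ^ 8 * (\<epsilon>\<^sup>2 * cgreen k0 0 * Ef)"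
proof -
  define c where "c = 2700 * \<epsilon> ^ 3 * Ef"
  have c0: "0 \<le> c" using \<epsilon> Ef_nonneg by (simp add: c_def)
  have T: "0 \<le> T x" "T x \<le> c * (if x \<in> sites2 then 0 else EV x)" for x
    using D_off_le[OF _ e, of x] by (auto simp: T_def c_def mult.assoc)
  have T2: "T x \<le> 2 * c" for x
  proof (cases "x \<in> sites2")
    case False
    then have "c * EV x \<le> c * 2" using EV_bounds(2) c0 by (intro mult_left_mono) auto
    then show ?thesis using T(2)[of x] False by simp
  qed (use c0 in \<open>simp add: T_def\<close>)
  have sq: "(if fst x \<le> 0 then T x else 0)\<^sup>2 \<le> 2 * c\<^sup>2 * ((if fst x \<le> 0 then U (0, 0) x else 0) + (if fst x \<le> 0 then U (0, 1) x else 0))" for x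
  proof (cases "fst x \<le> 0 \<and> x \<notin> sites2")
    case True
    then have b: "0 \<le> EV x" "EV x \<le> 2" "EV x \<le> U (0, 0) x + U (0, 1) x" using EV_bounds[of x] by auto
    have "(T x)\<^sup>2 \<le> (c * EV x)\<^sup>2" using T[of x] True by (intro power_mono) auto
    also have "\<dots> = c\<^sup>2 * (EV x * EV x)" by (simp add: power2_eq_square mult_ac)
    also have "\<dots> \<le> c\<^sup>2 * (2 * (U (0, 0) x + U (0, 1) x))" using b by (intro mult_left_mono mult_mono) auto
    finally show ?thesis using True by (simp add: algebra_simps)
  qed (auto simp: T_def U_nonneg)
  have s0: "(\<lambda>x. 2 * c\<^sup>2 * ((if fst x \<le> 0 then U (0, 0) x else 0) + (if fst x \<le> 0 then U (0, 1) x else 0))) summable_on UNIV"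
    by (intro summable_on_cmult_right summable_on_add U_upstream) simp_all
  have s: "(\<lambda>x. (if fst x \<le> 0 then T x else 0)\<^sup>2) summable_on UNIV"
    by (rule summable_on_comparison_test[OF s0 sq]) simp
  have "(\<Sum>\<^sub>\<infinity>x. (if fst x \<le> 0 then T x else 0)\<^sup>2) \<le> (\<Sum>\<^sub>\<infinity>x. 2 * c\<^sup>2 * ((if fst x \<le> 0 then U (0, 0) x else 0) + (if fst x \<le> 0 then U (0, 1) x else 0)))"
    by (rule infsum_mono[OF s s0 sq])
  also have "\<dots> = 2 * c\<^sup>2 * ((\<Sum>\<^sub>\<infinity>x. if fst x \<le> 0 then U (0, 0) x else 0) + (\<Sum>\<^sub>\<infinity>x. if fst x \<le> 0 then U (0, 1) x else 0))"
    unfolding infsum_cmult_right' by (subst infsum_add) (auto intro!: U_upstream)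
  also have "\<dots> \<le> 2 * c\<^sup>2 * (12 / \<epsilon>\<^sup>2 + 12 / \<epsilon>\<^sup>2)"
    by (intro mult_left_mono add_mono U_upstream) auto
  also have "\<dots> \<le> (7 * c / \<epsilon>)\<^sup>2" using \<epsilon> by (simp add: power_divide power_mult_distrib divide_simps)
  finally have a: "(\<Sum>\<^sub>\<infinity>x. (if fst x \<le> 0 then T x else 0)\<^sup>2) \<le> (7 * c / \<epsilon>)\<^sup>2" .
  have nn: "0 \<le> 2 * c" "0 \<le> 7 * c / \<epsilon>" using c0 \<epsilon> by auto
  note gp = grad_pairing[OF e T(1) T2 nn(1) s a nn(2)]
  show "(\<lambda>x. T x * \<bar>cgreen k (x + e) - cgreen k x\<bar>) summable_on UNIV" by (rule gp(1))
  have "(\<Sum>\<^sub>\<infinity>x. T x * \<bar>cgreen k (x + e) - cgreen k x\<bar>) \<le> (3 * (7 * c / \<epsilon>) + 200 * (2 * c) / \<epsilon>) * sqrt (cgreen k 0)"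
    by (rule gp(2))
  also have "\<dots> \<le> (3 * (7 * c / \<epsilon>) + 200 * (2 * c) / \<epsilon>) * (159 * cgreen k0 0)"
    using nn \<epsilon> c0 by (intro mult_left_mono sqrt_cgreen_le) auto
  also have "3 * (7 * c / \<epsilon>) + 200 * (2 * c) / \<epsilon> = 421 * 2700 * (\<epsilon>\<^sup>2 * Ef)"
    using \<epsilon> by (simp add: c_def power2_eq_square power3_eq_cube field_simps)
  also have "421 * 2700 * (\<epsilon>\<^sup>2 * Ef) * (159 * cgreen k0 0) = 180735300 * (\<epsilon>\<^sup>2 * cgreen k0 0 * Ef)" by simp
  also have "\<dots> \<le> 2 * 10 ^ 8 * (\<epsilon>\<^sup>2 * cgreen k0 0 * Ef)"
    using Ef_nonneg k0.cgreen_nonneg[of 0] by (intro mult_right_mono) auto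
  finally show "(\<Sum>\<^sub>\<infinity>x. T x * \<bar>cgreen k (x + e) - cgreen k x\<bar>) \<le> 2 * 10 ^ 8 * (\<epsilon>\<^sup>2 * cgreen k0 0 * Ef)" .
qed

definition main :: real where
  "main = - (4 / pi) * (d (0, 1) (1, 0) + d (0, 1) (- 1, 0)) + (8 / pi - 4) * d (0, 1) (0, 1)"

lemma sum_d: "(\<Sum>e\<in>steps. d z e) = 0"
proof -
  have i: "integrable P (\<lambda>\<omega>. f \<omega> * (\<omega> z e - pbar e))" for e by (intro rv_integrable rv_ops rv_f rv_coord rv_const)
  have "(\<Sum>e\<in>steps. d z e) = (LINT \<omega>|P. (\<Sum>e\<in>steps. f \<omega> * (\<omega> z e - pbar e)))"
    unfolding d_def using i by simp
  also have "\<dots> = (LINT \<omega>|P. 0)"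
    by (rule integral_cong_env) (simp add: environmentsD sum_subtractf sum_pbar flip: sum_distrib_left)
  finally show ?thesis by simp
qed

text \<open>As \<open>D z\<close> sums to zero over the steps, \<open>cgreen k z\<close> may be
  replaced by \<open>cgreen k 0\<close>; both sites are then measured against the potential kernel
  centred at the origin, where \<open>u\<close> is evaluated.\<close>

lemma D_on_sum:
  assumes z: "z \<in> sites2"
  shows "\<bar>(\<Sum>e\<in>steps. D z e * (cgreen k (z + e) - cgreen k z)) + (\<Sum>e\<in>steps. d z e * pkernel (z + e))\<bar>
    \<le> 10 ^ 6 * (\<epsilon>\<^sup>2 * cgreen k0 0 * Ef)"
proof -
  define G where "G = cgreen k0 0"
  have G: "1 \<le> G" unfolding G_def by (rule k0.cgreen_0_ge)
  have s: "(\<Sum>e\<in>steps. D z e * (cgreen k (z + e) - cgreen k z)) = (\<Sum>e\<in>steps. D z e * (cgreen k (z + e) - cgreen k 0))"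
    using sum_D[of z] by (simp add: right_diff_distrib sum_subtractf flip: sum_distrib_right)
  have "\<bar>D z e * (cgreen k (z + e) - cgreen k 0) + d z e * pkernel (z + e)\<bar> \<le> 200000 * (\<epsilon>\<^sup>2 * G * Ef)" if e: "e \<in> steps" for e
  proof -
    define r where "r = cgreen k (z + e) - cgreen k 0 + pkernel (z + e)"
    have r: "\<bar>r\<bar> \<le> 33000 * \<epsilon> * G" unfolding r_def G_def by (rule increment_pkernel[OF z e])
    have p: "\<bar>pkernel (z + e)\<bar> \<le> 4"
    proof -
      have "4 / pi \<le> 4" "0 \<le> 4 / pi" "8 / pi \<le> 4" "0 \<le> 8 / pi" using pi_gt3 by (auto simp: divide_le_eq)
      then show ?thesis by (auto simp: pkernel_def abs_le_iff)
    qed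
    have eq: "D z e * (cgreen k (z + e) - cgreen k 0) + d z e * pkernel (z + e) = D z e * r - (D z e - d z e) * pkernel (z + e)"
      by (simp add: r_def algebra_simps)
    have "\<bar>D z e\<bar> \<le> 2 * \<epsilon> * Ef + 140 * \<epsilon>\<^sup>2 * Ef" using D_on_le[OF z e] d_le[OF e, of z] by linarith
    also have "\<dots> \<le> 3 * \<epsilon> * Ef" using \<epsilon>2 \<epsilon> Ef_nonneg by (simp add: mult_right_mono flip: distrib_right)
    finally have "\<bar>D z e\<bar> * \<bar>r\<bar> \<le> (3 * \<epsilon> * Ef) * (33000 * \<epsilon> * G)" using r \<epsilon> Ef_nonneg by (intro mult_mono) auto
    moreover have "\<bar>D z e - d z e\<bar> * \<bar>pkernel (z + e)\<bar> \<le> (140 * \<epsilon>\<^sup>2 * Ef) * 4"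
      using p Ef_nonneg by (intro mult_mono D_on_le z e) auto
    moreover have "(140 * \<epsilon>\<^sup>2 * Ef) * 4 \<le> (140 * \<epsilon>\<^sup>2 * Ef) * (4 * G)" using G Ef_nonneg by (intro mult_left_mono) auto
    ultimately have "\<bar>D z e * r\<bar> + \<bar>(D z e - d z e) * pkernel (z + e)\<bar> \<le> 99560 * (\<epsilon>\<^sup>2 * G * Ef)"
      by (simp add: abs_mult power2_eq_square mult_ac)
    moreover have "0 \<le> \<epsilon>\<^sup>2 * G * Ef" using G Ef_nonneg by simp
    ultimately show ?thesis unfolding eq by linarith
  qed
  then have "(\<Sum>e\<in>steps. \<bar>D z e * (cgreen k (z + e) - cgreen k 0) + d z e * pkernel (z + e)\<bar>) \<le> (\<Sum>e\<in>steps. 200000 * (\<epsilon>\<^sup>2 * G * Ef))"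
    by (rule sum_mono)
  moreover have "0 \<le> \<epsilon>\<^sup>2 * G * Ef" using G Ef_nonneg by simp
  ultimately show ?thesis
    unfolding s sum.distrib[symmetric] G_def[symmetric]
    by (intro order_trans[OF sum_abs]) simp
qed

text \<open>Around the origin all kernel values are 1 and \<open>sum_d\<close> cancels the
  contribution. Around (0, 1) they are 0, twice 4 / pi, and 4 - 8 / pi: up to sign the coefficients
  of the expansion.\<close>

lemma main_eq: "(\<Sum>e\<in>steps. d (0, 0) e * pkernel ((0, 0) + e)) + (\<Sum>e\<in>steps. d (0, 1) e * pkernel ((0, 1) + e)) = - main"
proof -
  have "(\<Sum>e\<in>steps. d (0, 0) e * pkernel ((0, 0) + e)) = (\<Sum>e\<in>steps. d (0, 0) e)"
    by (simp add: sum_steps pkernel_def rad_def zero_prod_def)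
  moreover have "(\<Sum>e\<in>steps. d (0, 1) e * pkernel ((0, 1) + e)) = - main"
    by (simp add: sum_steps pkernel_def rad_def zero_prod_def main_def algebra_simps)
  ultimately show ?thesis by (simp add: sum_d)
qed

theorem expected_mass_expansion:
  "\<bar>(LINT \<omega>|P. f \<omega> * m 0 \<omega>) - (Ef + main)\<bar> \<le> 10 ^ 9 * (\<epsilon>\<^sup>2 * (1 + ln (25 / \<epsilon>\<^sup>2)) * Ef)"
proof -
  define G where "G = cgreen k0 0"
  have G: "1 \<le> G" "G \<le> 1 + ln (25 / \<epsilon>\<^sup>2)" unfolding G_def by (rule k0.cgreen_0_ge, rule k0_diag_le)
  define Y where "Y = \<epsilon>\<^sup>2 * G * Ef"
  have Y0: "0 \<le> Y" using G Ef_nonneg by (simp add: Y_def)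
  let ?g = "\<lambda>x e. cgreen k (x + e) - cgreen k x"
  define t where "t x = (\<Sum>e\<in>steps. D x e * ?g x e)" for x
  have ts: "t summable_on UNIV"
  proof -
    have "(\<lambda>x. ?g x e * D x e) summable_on UNIV" if "e \<in> steps" for e
      using that by (intro summable_on_bdd_mult grad_summable bdd_D)
    then show ?thesis unfolding t_def by (intro summable_on_sum) (simp add: mult.commute)
  qed
  define t' where "t' x = (if x \<in> sites2 then 0 else t x)" for x
  have t's: "t' summable_on UNIV"
  proof -
    have "(\<lambda>x. t x * (if x \<in> sites2 then 0 else 1)) summable_on UNIV"
      by (rule summable_on_bdd_mult[OF ts]) (rule bddI[where C = 1], simp)
    also have "(\<lambda>x. t x * (if x \<in> sites2 then 0 else 1)) = t'" by (rule ext) (simp add: t'_def)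
    finally show ?thesis .
  qed
  have split: "infsum t UNIV = t (0, 0) + t (0, 1) + infsum t' UNIV"
  proof -
    have "infsum t UNIV = (\<Sum>\<^sub>\<infinity>x. (of_bool (x = (0, 0)) * t x + of_bool (x = (0, 1)) * t x) + t' x)"
      by (intro infsum_cong) (auto simp: t'_def)
    also have "\<dots> = (\<Sum>\<^sub>\<infinity>x. of_bool (x = (0, 0)) * t x + of_bool (x = (0, 1)) * t x) + infsum t' UNIV"
      by (intro infsum_add summable_on_add infsum_unit_at t's)
    also have "(\<Sum>\<^sub>\<infinity>x. of_bool (x = (0, 0)) * t x + of_bool (x = (0, 1)) * t x) = (\<Sum>\<^sub>\<infinity>x. of_bool (x = (0, 0)) * t x) + (\<Sum>\<^sub>\<infinity>x. of_bool (x = (0, 1)) * t x)"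
      by (intro infsum_add infsum_unit_at)
    finally show ?thesis unfolding infsum_unit_at by simp
  qed
  define T where "T e x = (if x \<in> sites2 then 0 else \<bar>D x e\<bar>)" for e x
  have Ts: "(\<lambda>x. T e x * \<bar>?g x e\<bar>) summable_on UNIV" "(\<Sum>\<^sub>\<infinity>x. T e x * \<bar>?g x e\<bar>) \<le> 2 * 10 ^ 8 * Y" if "e \<in> steps" for e
    using D_off_pairing[OF that] unfolding T_def Y_def G_def by blast+
  have "\<bar>infsum t' UNIV\<bar> \<le> (\<Sum>\<^sub>\<infinity>x. \<Sum>e\<in>steps. T e x * \<bar>?g x e\<bar>)"
  proof -
    have "norm (infsum t' UNIV) \<le> (\<Sum>\<^sub>\<infinity>x. \<Sum>e\<in>steps. T e x * \<bar>?g x e\<bar>)"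
    proof (rule norm_infsum_le[OF has_sum_infsum[OF t's] has_sum_infsum])
      show "(\<lambda>x. \<Sum>e\<in>steps. T e x * \<bar>?g x e\<bar>) summable_on UNIV" by (intro summable_on_sum Ts)
      show "norm (t' x) \<le> (\<Sum>e\<in>steps. T e x * \<bar>?g x e\<bar>)" for x
        using sum_abs[of "\<lambda>e. D x e * ?g x e" steps] by (auto simp: t'_def t_def T_def abs_mult)
    qed
    then show ?thesis by simp
  qed
  also have "\<dots> = (\<Sum>e\<in>steps. \<Sum>\<^sub>\<infinity>x. T e x * \<bar>?g x e\<bar>)" by (intro infsum_sum Ts)
  also have "\<dots> \<le> (\<Sum>e\<in>steps. 2 * 10 ^ 8 * Y)" by (intro sum_mono Ts)
  finally have off: "\<bar>infsum t' UNIV\<bar> \<le> 8 * 10 ^ 8 * Y" by simp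
  have on: "\<bar>t (0, 0) + (\<Sum>e\<in>steps. d (0, 0) e * pkernel ((0, 0) + e))\<bar> \<le> 10 ^ 6 * Y"
    "\<bar>t (0, 1) + (\<Sum>e\<in>steps. d (0, 1) e * pkernel ((0, 1) + e))\<bar> \<le> 10 ^ 6 * Y"
    unfolding t_def Y_def G_def by (rule D_on_sum; simp)+
  have I: "\<bar>infsum t UNIV - main\<bar> \<le> 802 * 10 ^ 6 * Y"
  proof -
    have "\<bar>i - r\<bar> \<le> 802 * 10 ^ 6 * Y"
      if "i = a + b + j" "\<bar>j\<bar> \<le> 8 * 10 ^ 8 * Y" "\<bar>a + p\<bar> \<le> 10 ^ 6 * Y" "\<bar>b + q\<bar> \<le> 10 ^ 6 * Y" "p + q = - r"
      for i r a b j p q :: real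
      using that by (simp add: abs_le_iff)
    from this[OF split off on main_eq] show ?thesis .
  qed
  \<comment> \<open>Needed to replace the factor \<open>\<delta>\<close> in \<open>u_0\<close> by 1:
    \<open>(1 - \<delta>) * main\<close> is absorbed into the error.\<close>
  have mainb: "\<bar>main\<bar> \<le> 100 * (\<epsilon> * Ef)"
  proof -
    have st: "(1, 0) \<in> steps" "(- 1, 0) \<in> steps" "(0, 1) \<in> steps" by (auto simp: steps_eq)
    have pi: "\<bar>- (4 / pi)\<bar> \<le> 4" "\<bar>8 / pi - 4\<bar> \<le> 4" using pi_gt3 by (auto simp: divide_le_eq abs_le_iff)
    have "\<bar>main\<bar> \<le> \<bar>- (4 / pi)\<bar> * \<bar>d (0, 1) (1, 0) + d (0, 1) (- 1, 0)\<bar> + \<bar>8 / pi - 4\<bar> * \<bar>d (0, 1) (0, 1)\<bar>"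
      unfolding main_def abs_mult[symmetric] by (rule abs_triangle_ineq)
    also have "\<dots> \<le> 4 * (2 * \<epsilon> * Ef + 2 * \<epsilon> * Ef) + 4 * (2 * \<epsilon> * Ef)"
      using pi d_le[OF st(1), of "(0, 1)"] d_le[OF st(2), of "(0, 1)"] d_le[OF st(3), of "(0, 1)"]
      by (intro add_mono mult_mono) (auto intro: order_trans[OF abs_triangle_ineq])
    also have "\<dots> \<le> 100 * (\<epsilon> * Ef)" using \<epsilon> Ef_nonneg by simp
    finally show ?thesis .
  qed
  have "\<epsilon> * Ef \<le> 1 * (G * Ef)" using \<epsilon> mult_right_mono[OF G(1) Ef_nonneg] Ef_nonneg by (intro mult_mono) auto
  then have "\<bar>(1 - \<delta>) * main\<bar> \<le> (\<epsilon>\<^sup>2 / 4) * (100 * (G * Ef))"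
    unfolding abs_mult using \<delta> mainb by (intro mult_mono) auto
  then have e: "\<bar>(1 - \<delta>) * main\<bar> \<le> 25 * Y" by (simp add: Y_def mult_ac)
  have "\<delta> * \<bar>infsum t UNIV - main\<bar> \<le> 1 * (802 * 10 ^ 6 * Y)"
    using \<delta> \<delta>0 by (intro mult_mono I) auto
  then have e': "\<bar>\<delta> * infsum t UNIV - \<delta> * main\<bar> \<le> 802 * 10 ^ 6 * Y"
    using \<delta>0 by (simp add: abs_mult flip: right_diff_distrib)
  have "u 0 = \<delta> * infsum t UNIV" unfolding u_0 t_def ..
  then have "\<bar>(LINT \<omega>|P. f \<omega> * m 0 \<omega>) - (Ef + main)\<bar> \<le> 10 ^ 9 * Y"
    using e e' Y0 unfolding u_def by (simp add: left_diff_distrib)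
  also have "\<dots> \<le> 10 ^ 9 * (\<epsilon>\<^sup>2 * (1 + ln (25 / \<epsilon>\<^sup>2)) * Ef)"
    unfolding Y_def using G Ef_nonneg by (intro mult_left_mono mult_right_mono) auto
  finally show ?thesis .
qed

end

section \<open>The environmental process\<close>

lemma nn_integral_env_process_law:
  assumes P: "prob_space P" "sets P = sets Omega" and h: "h \<in> borel_measurable Omega"
  shows "(\<integral>\<^sup>+\<omega>. h \<omega> \<partial>env_process_law P n) =
    (\<integral>\<^sup>+\<omega>. \<integral>\<^sup>+X. h (env_shift (X n) \<omega>) \<partial>quenched_law \<omega> 0 \<partial>P)"
proof -
  have sp: "space P = environments"
    using sets_eq_imp_space_eq[OF P(2)] by (simp add: space_Omega)
  have Pair: "Pair \<omega> \<in> quenched_law \<omega> 0 \<rightarrow>\<^sub>M Omega \<Otimes>\<^sub>M paths" if "\<omega> \<in> environments" for \<omega>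
    using that by (simp add: measurable_cong_sets[OF sets_quenched_law refl] space_Omega)
  have K: "(\<lambda>\<omega>. distr (quenched_law \<omega> 0) (Omega \<Otimes>\<^sub>M paths) (Pair \<omega>))
      \<in> P \<rightarrow>\<^sub>M subprob_algebra (Omega \<Otimes>\<^sub>M paths)"
    unfolding measurable_cong_sets[OF P(2) refl]
    by (rule measurable_distr2[where M = paths])
       (simp_all add: measurable_quenched_law[THEN measurable_prob_algebraD])
  have S: "sets (averaged_law P 0) = sets (Omega \<Otimes>\<^sub>M paths)"
    unfolding averaged_law_def
    by (rule sets_bind) (simp_all add: sp P(1) prob_space.not_empty flip: sp)
  have hm: "(\<lambda>z. h (env_process n z)) \<in> borel_measurable (Omega \<Otimes>\<^sub>M paths)"
    by (rule measurable_compose[OF measurable_env_process h])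
  have "(\<integral>\<^sup>+\<omega>. h \<omega> \<partial>env_process_law P n) = (\<integral>\<^sup>+z. h (env_process n z) \<partial>averaged_law P 0)"
    unfolding env_process_law_def
    by (rule nn_integral_distr) (simp_all add: measurable_cong_sets[OF S refl] measurable_env_process h)
  also have "\<dots> = (\<integral>\<^sup>+\<omega>. \<integral>\<^sup>+z. h (env_process n z) \<partial>distr (quenched_law \<omega> 0) (Omega \<Otimes>\<^sub>M paths) (Pair \<omega>) \<partial>P)"
    unfolding averaged_law_def by (rule nn_integral_bind[OF hm K])
  also have "\<dots> = (\<integral>\<^sup>+\<omega>. \<integral>\<^sup>+X. h (env_shift (X n) \<omega>) \<partial>quenched_law \<omega> 0 \<partial>P)"
  proof (rule nn_integral_cong)
    fix \<omega> assume "\<omega> \<in> space P"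
    then have \<omega>: "\<omega> \<in> environments" by (simp add: sp)
    show "(\<integral>\<^sup>+z. h (env_process n z) \<partial>distr (quenched_law \<omega> 0) (Omega \<Otimes>\<^sub>M paths) (Pair \<omega>)) =
        (\<integral>\<^sup>+X. h (env_shift (X n) \<omega>) \<partial>quenched_law \<omega> 0)"
      by (subst nn_integral_distr[OF Pair[OF \<omega>]]) (simp_all add: hm, simp add: env_process_def)
  qed
  finally show ?thesis .
qed

text \<open>The Markov property, read off from the cylinder probabilities: the event that
  \<open>X n = z\<close> is a countable disjoint union over the first \<open>n\<close> positions,
  and fixing one more position multiplies each cylinder by one jump probability.\<close>

lemma
  assumes \<omega>: "\<omega> \<in> environments"
  shows nn_integral_position: "(\<integral>\<^sup>+X. h (X i) \<partial>quenched_law \<omega> x) =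
      (\<integral>\<^sup>+y. h y * emeasure (quenched_law \<omega> x) {X. X i = y} \<partial>count_space UNIV)"
    and sets_position: "{X. X i = y} \<in> sets (quenched_law \<omega> x)"
    and emeasure_position_Suc: "emeasure (quenched_law \<omega> x) {X. X (Suc n) = y} =
      (\<integral>\<^sup>+z. ennreal (\<omega> z (y - z)) * emeasure (quenched_law \<omega> x) {X. X n = z} \<partial>count_space UNIV)"
    and quenched_step: "(\<integral>\<^sup>+X. h (X (Suc n)) \<partial>quenched_law \<omega> x) =
      (\<integral>\<^sup>+X. (\<Sum>e\<in>steps. ennreal (\<omega> (X n) e) * h (X n + e)) \<partial>quenched_law \<omega> x)"
proof -
  define Q where "Q = quenched_law \<omega> x"
  have sQ: "sets Q = sets paths" unfolding Q_def by (rule sets_quenched_law[OF \<omega>])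
  have spQ: "space Q = UNIV" using sets_eq_imp_space_eq[OF sQ] by simp
  have cyl: "{X. \<forall>i<k. X i = s i} \<in> sets Q" for k s unfolding sQ by (rule cylinder_sets)
  have mX: "(\<lambda>X. X i) \<in> Q \<rightarrow>\<^sub>M count_space UNIV" for i
    unfolding measurable_cong_sets[OF sQ refl] paths_def by (rule measurable_component_singleton) simp
  have pos: "{X. X i = y} \<in> sets Q" for i y
    using measurable_sets[OF mX, of "{y}" i] by (simp add: vimage_def spQ)
  then show "{X. X i = y} \<in> sets (quenched_law \<omega> x)" by (simp add: Q_def)
  have ind: "indicator {X. X i = y} \<in> borel_measurable Q" for i y
    by (rule borel_measurable_indicator[OF pos])
  have E: "(\<integral>\<^sup>+X. g (X i) \<partial>Q) = (\<integral>\<^sup>+y. g y * emeasure Q {X. X i = y} \<partial>count_space UNIV)" for g :: "site \<Rightarrow> ennreal" and i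
  proof -
    have "g (X i) = (\<integral>\<^sup>+y. g y * indicator {X. X i = y} X \<partial>count_space UNIV)" for X
      by (subst nn_integral_count_space'[where A = "{X i}"]) auto
    then have "(\<integral>\<^sup>+X. g (X i) \<partial>Q) = (\<integral>\<^sup>+X. \<integral>\<^sup>+y. g y * indicator {X. X i = y} X \<partial>count_space UNIV \<partial>Q)" by (simp only:)
    also have "\<dots> = (\<integral>\<^sup>+y. \<integral>\<^sup>+X. g y * indicator {X. X i = y} X \<partial>Q \<partial>count_space UNIV)"
      by (rule nn_integral_count_space_nn_integral) (simp, rule borel_measurable_times_ennreal, simp, rule ind)
    also have "\<dots> = (\<integral>\<^sup>+y. g y * emeasure Q {X. X i = y} \<partial>count_space UNIV)"
      by (intro nn_integral_cong nn_integral_cmult_indicator pos)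
    finally show ?thesis .
  qed
  then show "(\<integral>\<^sup>+X. h (X i) \<partial>quenched_law \<omega> x) =
      (\<integral>\<^sup>+y. h y * emeasure (quenched_law \<omega> x) {X. X i = y} \<partial>count_space UNIV)" by (simp add: Q_def)
  have joint: "emeasure Q {X. X n = z \<and> X (Suc n) = y} = ennreal (\<omega> z (y - z)) * emeasure Q {X. X n = z}" for z y
  proof -
    define s where "s l i = (if i < n then l ! i else if i = n then z else y)" for l :: "site list" and i
    define C where "C l = {X. \<forall>i<Suc n. X i = s l i}" for l
    define C' where "C' l = {X. \<forall>i<Suc (Suc n). X i = s l i}" for l
    define I where "I = {l :: site list. length l = n}"
    have step: "emeasure Q (C' l) = ennreal (\<omega> z (y - z)) * emeasure Q (C l)" for l
      unfolding C_def C'_def Q_def quenched_law_cylinder[OF \<omega>]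
      by (simp add: s_def mult.commute)
    have cI: "countable I" by (rule countable_subset[OF subset_UNIV countableI_type])
    have Cs: "C l \<in> sets Q" "C' l \<in> sets Q" for l unfolding C_def C'_def by (rule cyl)+
    have nth: "X i = l ! i" if "X \<in> C l" "i < n" for X l i
    proof -
      have "X i = s l i" using that unfolding C_def by (simp add: less_Suc_eq)
      then show ?thesis using that by (simp add: s_def)
    qed
    have eq: "l = l'" if "X \<in> C l" "X \<in> C l'" "l \<in> I" "l' \<in> I" for X l l'
      using that nth[OF that(1)] nth[OF that(2)] by (intro nth_equalityI) (auto simp: I_def)
    have C'C: "C' l \<subseteq> C l" for l unfolding C_def C'_def by (auto simp: less_Suc_eq)
    have disj: "disjoint_family_on C I" "disjoint_family_on C' I"
      using eq C'C unfolding disjoint_family_on_def by blast+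
    have "{X. X n = z} = \<Union> (C ` I)"
    proof (intro set_eqI iffI)
      fix X assume "X \<in> {X. X n = z}"
      then have "X \<in> C (map X [0..<n])" by (auto simp: C_def s_def less_Suc_eq)
      then show "X \<in> \<Union> (C ` I)" by (rule UN_I[rotated]) (simp add: I_def)
    next
      fix X assume "X \<in> \<Union> (C ` I)"
      then obtain l where "X \<in> C l" by blast
      then have "X n = s l n" unfolding C_def by blast
      then show "X \<in> {X. X n = z}" by (simp add: s_def)
    qed
    moreover have "{X. X n = z \<and> X (Suc n) = y} = \<Union> (C' ` I)"
    proof (intro set_eqI iffI)
      fix X assume "X \<in> {X. X n = z \<and> X (Suc n) = y}"
      then have "X \<in> C' (map X [0..<n])" by (auto simp: C'_def s_def less_Suc_eq)
      then show "X \<in> \<Union> (C' ` I)" by (rule UN_I[rotated]) (simp add: I_def)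
    next
      fix X assume "X \<in> \<Union> (C' ` I)"
      then obtain l where "X \<in> C' l" by blast
      then have "X n = s l n" "X (Suc n) = s l (Suc n)" unfolding C'_def by simp_all
      then show "X \<in> {X. X n = z \<and> X (Suc n) = y}" by (simp add: s_def)
    qed
    ultimately show ?thesis
      using emeasure_UN_countable[OF Cs(1) cI disj(1)] emeasure_UN_countable[OF Cs(2) cI disj(2)]
      by (simp add: step nn_integral_cmult)
  qed
  have R: "emeasure Q {X. X (Suc n) = y} = (\<integral>\<^sup>+z. ennreal (\<omega> z (y - z)) * emeasure Q {X. X n = z} \<partial>count_space UNIV)" for y
  proof -
    have s: "{X. X n = z \<and> X (Suc n) = y} \<in> sets Q" for z
      using sets.Int[OF pos[of n z] pos[of "Suc n" y]] by (simp add: Int_def)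
    have "{X. X (Suc n) = y} = (\<Union>z. {X. X n = z \<and> X (Suc n) = y})" by blast
    then have "emeasure Q {X. X (Suc n) = y} = (\<integral>\<^sup>+z. emeasure Q {X. X n = z \<and> X (Suc n) = y} \<partial>count_space UNIV)"
      using emeasure_UN_countable[of UNIV "\<lambda>z. {X. X n = z \<and> X (Suc n) = y}" Q] s
      by (simp add: disjoint_family_on_def disjoint_iff)
    then show ?thesis by (simp only: joint)
  qed
  then show "emeasure (quenched_law \<omega> x) {X. X (Suc n) = y} =
      (\<integral>\<^sup>+z. ennreal (\<omega> z (y - z)) * emeasure (quenched_law \<omega> x) {X. X n = z} \<partial>count_space UNIV)" by (simp add: Q_def)
  define \<rho> where "\<rho> z = emeasure Q {X. X n = z}" for z
  have "(\<integral>\<^sup>+X. h (X (Suc n)) \<partial>Q) = (\<integral>\<^sup>+y. h y * (\<integral>\<^sup>+z. ennreal (\<omega> z (y - z)) * \<rho> z \<partial>count_space UNIV) \<partial>count_space UNIV)"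
    unfolding E R \<rho>_def ..
  also have "\<dots> = (\<integral>\<^sup>+y. \<integral>\<^sup>+z. h y * (ennreal (\<omega> z (y - z)) * \<rho> z) \<partial>count_space UNIV \<partial>count_space UNIV)"
    by (intro nn_integral_cong nn_integral_cmult[symmetric]) simp
  also have "\<dots> = (\<integral>\<^sup>+z. \<integral>\<^sup>+y. h y * (ennreal (\<omega> z (y - z)) * \<rho> z) \<partial>count_space UNIV \<partial>count_space UNIV)"
    by (rule nn_integral_count_space_nn_integral) auto
  also have "\<dots> = (\<integral>\<^sup>+z. (\<Sum>e\<in>steps. ennreal (\<omega> z e) * h (z + e)) * \<rho> z \<partial>count_space UNIV)"
  proof (rule nn_integral_cong)
    fix z
    have z: "\<omega> z (y - z) = 0" if "y \<notin> (\<lambda>e. z + e) ` steps" for y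
    proof (rule environmentsD(2)[OF \<omega>])
      show "y - z \<notin> steps"
      proof
        assume "y - z \<in> steps"
        then have "z + (y - z) \<in> (\<lambda>e. z + e) ` steps" by (rule imageI)
        then show False using that by simp
      qed
    qed
    have "(\<integral>\<^sup>+y. h y * (ennreal (\<omega> z (y - z)) * \<rho> z) \<partial>count_space UNIV) =
        (\<Sum>y\<in>(\<lambda>e. z + e) ` steps. h y * (ennreal (\<omega> z (y - z)) * \<rho> z))"
      by (rule nn_integral_count_space') (simp_all add: finite_steps z)
    also have "\<dots> = (\<Sum>e\<in>steps. ennreal (\<omega> z e) * h (z + e)) * \<rho> z"
      by (subst sum.reindex) (simp_all add: inj_on_def sum_distrib_left mult_ac)
    finally show "(\<integral>\<^sup>+y. h y * (ennreal (\<omega> z (y - z)) * \<rho> z) \<partial>count_space UNIV) =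
      (\<Sum>e\<in>steps. ennreal (\<omega> z e) * h (z + e)) * \<rho> z" .
  qed
  also have "\<dots> = (\<integral>\<^sup>+X. (\<Sum>e\<in>steps. ennreal (\<omega> (X n) e) * h (X n + e)) \<partial>Q)"
    unfolding \<rho>_def by (rule E[of "\<lambda>z. \<Sum>e\<in>steps. ennreal (\<omega> z e) * h (z + e)" n, symmetric])
  finally show "(\<integral>\<^sup>+X. h (X (Suc n)) \<partial>quenched_law \<omega> x) =
      (\<integral>\<^sup>+X. (\<Sum>e\<in>steps. ennreal (\<omega> (X n) e) * h (X n + e)) \<partial>quenched_law \<omega> x)" by (simp only: Q_def)
qed

lemma nn_integral_position_0:
  assumes \<omega>: "\<omega> \<in> environments"
  shows "(\<integral>\<^sup>+X. h (X 0) \<partial>quenched_law \<omega> x) = h x"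
proof -
  have "emeasure (quenched_law \<omega> x) {X. X 0 = y} = (if y = x then 1 else 0)" for y
    using quenched_law_cylinder[OF \<omega>, of x 0 "\<lambda>_. y"] by simp
  then show ?thesis
    unfolding nn_integral_position[OF \<omega>]
    by (simp, subst nn_integral_count_space'[where A = "{x}"]) auto
qed

text \<open>The transition operator of the environment viewed from the walker.\<close>

definition env_op :: "(env \<Rightarrow> real) \<Rightarrow> env \<Rightarrow> real" where
  "env_op f \<omega> = (\<Sum>e\<in>steps. \<omega> 0 e * f (env_shift e \<omega>))"

lemma env_shift_environments: "\<omega> \<in> environments \<Longrightarrow> env_shift x \<omega> \<in> environments"
  unfolding environments_def env_shift_def by blast

lemma env_shift_env_shift: "env_shift e (env_shift y \<omega>) = env_shift (y + e) \<omega>"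
  by (rule ext) (simp add: env_shift_def add.assoc)

lemma env_shift_0 [simp]: "env_shift 0 \<omega> = \<omega>"
  by (rule ext) (simp add: env_shift_def)

context low_disorder
begin

lemma rv_shift: "rv f \<Longrightarrow> rv (\<lambda>\<omega>. f (env_shift x \<omega>))"
  unfolding rv_def using measurable_compose[OF measurable_env_shift] env_shift_environments by blast

lemma rv_env_op: "rv f \<Longrightarrow> rv (env_op f)"
  unfolding env_op_def[abs_def] sum_steps by (intro rv_ops rv_coord rv_shift)

lemma rv_env_op_funpow: "rv f \<Longrightarrow> rv ((env_op ^^ n) f)"
  by (induction n) (simp_all add: rv_env_op)

lemma env_op_funpow_le:
  assumes f: "\<And>\<omega>. \<omega> \<in> environments \<Longrightarrow> \<bar>f \<omega>\<bar> \<le> C" and \<omega>: "\<omega> \<in> environments"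
  shows "\<bar>(env_op ^^ n) f \<omega>\<bar> \<le> C"
  using \<omega>
proof (induction n arbitrary: \<omega>)
  case (Suc n)
  have "\<bar>(env_op ^^ Suc n) f \<omega>\<bar> \<le> (\<Sum>e\<in>steps. \<bar>\<omega> 0 e * (env_op ^^ n) f (env_shift e \<omega>)\<bar>)"
    by (simp add: env_op_def[of "(env_op ^^ n) f"] sum_abs)
  also have "\<dots> \<le> (\<Sum>e\<in>steps. \<omega> 0 e * C)"
    unfolding abs_mult
    by (intro sum_mono mult_mono Suc.IH env_shift_environments Suc.prems)
      (simp_all add: environmentsD(1)[OF Suc.prems])
  also have "\<dots> = C" by (simp add: environmentsD(3)[OF Suc.prems] flip: sum_distrib_right)
  finally show ?case .
qed (simp add: f)

text \<open>Integrating \<open>f\<close> after \<open>n + 1\<close> steps is integrating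
  \<open>env_op f\<close> after \<open>n\<close> steps; the last step is peeled off, so the
  induction runs over all \<open>f\<close>.\<close>

lemma nn_integral_env_process_law_eq:
  assumes "rv f" "\<And>\<omega>. \<omega> \<in> environments \<Longrightarrow> 0 \<le> f \<omega>"
  shows "(\<integral>\<^sup>+\<omega>. ennreal (f \<omega>) \<partial>env_process_law P n) = (\<integral>\<^sup>+\<omega>. ennreal ((env_op ^^ n) f \<omega>) \<partial>P)"
  using assms
proof (induction n arbitrary: f)
  case 0
  have "(\<lambda>\<omega>. ennreal (f \<omega>)) \<in> borel_measurable Omega" 
    by (rule measurable_compose[OF conjunct1[OF 0(1)[unfolded rv_def]] measurable_ennreal])
  note nn_integral_env_process_law[OF prob_P sets_P this, of 0]
  also have "(\<integral>\<^sup>+\<omega>. \<integral>\<^sup>+X. ennreal (f (env_shift (X 0) \<omega>)) \<partial>quenched_law \<omega> 0 \<partial>P) = (\<integral>\<^sup>+\<omega>. ennreal (f \<omega>) \<partial>P)"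
    by (intro nn_integral_cong)
      (simp add: space_P nn_integral_position_0[where h = "\<lambda>y. ennreal (f (env_shift y _))"])
  finally show ?case by simp
next
  case (Suc n)
  have m: "(\<lambda>\<omega>. ennreal (h \<omega>)) \<in> borel_measurable Omega" if "rv h" for h
    by (rule measurable_compose[OF conjunct1[OF that[unfolded rv_def]] measurable_ennreal])
  have pos: "0 \<le> env_op f \<omega>" if "\<omega> \<in> environments" for \<omega>
    unfolding env_op_def
    by (intro sum_nonneg mult_nonneg_nonneg environmentsD(1)[OF that] Suc.prems(2) env_shift_environments that)
  have "(\<integral>\<^sup>+\<omega>. ennreal (f \<omega>) \<partial>env_process_law P (Suc n)) =
      (\<integral>\<^sup>+\<omega>. \<integral>\<^sup>+X. ennreal (f (env_shift (X (Suc n)) \<omega>)) \<partial>quenched_law \<omega> 0 \<partial>P)"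
    by (rule nn_integral_env_process_law[OF prob_P sets_P m[OF Suc.prems(1)]])
  also have "\<dots> = (\<integral>\<^sup>+\<omega>. \<integral>\<^sup>+X. ennreal (env_op f (env_shift (X n) \<omega>)) \<partial>quenched_law \<omega> 0 \<partial>P)"
  proof (rule nn_integral_cong)
    fix \<omega> assume "\<omega> \<in> space P"
    then have \<omega>: "\<omega> \<in> environments" by (simp add: space_P)
    have "(\<Sum>e\<in>steps. ennreal (\<omega> y e) * ennreal (f (env_shift (y + e) \<omega>))) = ennreal (env_op f (env_shift y \<omega>))" for y
    proof -
      have "(\<Sum>e\<in>steps. ennreal (\<omega> y e) * ennreal (f (env_shift (y + e) \<omega>))) = (\<Sum>e\<in>steps. ennreal (\<omega> y e * f (env_shift (y + e) \<omega>)))"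
        by (intro sum.cong refl ennreal_mult[symmetric] environmentsD(1)[OF \<omega>] Suc.prems(2) env_shift_environments \<omega>)
      also have "\<dots> = ennreal (\<Sum>e\<in>steps. \<omega> y e * f (env_shift (y + e) \<omega>))"
        by (intro sum_ennreal mult_nonneg_nonneg environmentsD(1)[OF \<omega>] Suc.prems(2) env_shift_environments \<omega>)
      finally show ?thesis unfolding env_op_def env_shift_env_shift by (simp add: env_shift_def[of y \<omega>])
    qed
    then show "(\<integral>\<^sup>+X. ennreal (f (env_shift (X (Suc n)) \<omega>)) \<partial>quenched_law \<omega> 0) =
        (\<integral>\<^sup>+X. ennreal (env_op f (env_shift (X n) \<omega>)) \<partial>quenched_law \<omega> 0)"
      by (simp only: quenched_step[OF \<omega>, where h = "\<lambda>y. ennreal (f (env_shift y \<omega>))"])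
  qed
  also have "\<dots> = (\<integral>\<^sup>+\<omega>. ennreal (env_op f \<omega>) \<partial>env_process_law P n)"
    by (rule nn_integral_env_process_law[OF prob_P sets_P m[OF rv_env_op[OF Suc.prems(1)]], symmetric])
  also have "\<dots> = (\<integral>\<^sup>+\<omega>. ennreal ((env_op ^^ n) (env_op f) \<omega>) \<partial>P)"
    by (rule Suc.IH[OF rv_env_op[OF Suc.prems(1)] pos])
  finally show ?case by (simp only: funpow_Suc_right comp_apply)
qed

lemma integral_env_process_law:
  assumes f: "rv f" "\<And>\<omega>. \<omega> \<in> environments \<Longrightarrow> 0 \<le> f \<omega>"
  shows "(LINT \<omega>|env_process_law P n. f \<omega>) = (LINT \<omega>|P. (env_op ^^ n) f \<omega>)"
proof -
  have s: "sets (env_process_law P n) = sets Omega" by (simp add: env_process_law_def)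
  have sp: "space (env_process_law P n) = environments" using sets_eq_imp_space_eq[OF s] by (simp add: space_Omega)
  have pos: "0 \<le> (env_op ^^ n) f \<omega>" if "\<omega> \<in> environments" for \<omega>
    using that
    by (induction n arbitrary: \<omega>) (simp_all add: f(2) env_op_def[of "(env_op ^^ _) f"] sum_nonneg environmentsD(1) env_shift_environments)
  have "(LINT \<omega>|env_process_law P n. f \<omega>) = enn2real (\<integral>\<^sup>+\<omega>. ennreal (f \<omega>) \<partial>env_process_law P n)"
    using f by (intro integral_eq_nn_integral AE_I2) (simp_all add: rv_def measurable_cong_sets[OF s refl] sp)
  also have "\<dots> = enn2real (\<integral>\<^sup>+\<omega>. ennreal ((env_op ^^ n) f \<omega>) \<partial>P)"
    by (simp only: nn_integral_env_process_law_eq[OF f])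
  also have "\<dots> = (LINT \<omega>|P. (env_op ^^ n) f \<omega>)"
    using rv_env_op_funpow[OF f(1), of n] pos
    by (intro integral_eq_nn_integral[symmetric] AE_I2) (simp_all add: rv_def measurable_cong_sets[OF sets_P refl] space_P)
  finally show ?thesis .
qed

text \<open>The mass equation expresses \<open>m 0\<close> by the neighbours of the origin; shift
  invariance of \<open>P\<close> moves each of them to the origin and puts the shift on
  \<open>f\<close>, which produces \<open>env_op\<close>.\<close>

lemma weighted_step:
  assumes f: "rv f"
  shows "(LINT \<omega>|P. f \<omega> * m 0 \<omega>) = (1 - \<delta>) * (LINT \<omega>|P. f \<omega>) + \<delta> * (LINT \<omega>|P. env_op f \<omega> * m 0 \<omega>)"
proof -
  have r: "rv (\<lambda>\<omega>. f \<omega> * (m (- e) \<omega> * \<omega> (- e) e))" for e by (intro rv_ops f rv_m rv_coord)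
  have r': "rv (\<lambda>\<omega>. \<omega> 0 e * f (env_shift e \<omega>) * m 0 \<omega>)" for e by (intro rv_ops rv_shift f rv_m rv_coord)
  have sh: "(LINT \<omega>|P. f \<omega> * (m (- e) \<omega> * \<omega> (- e) e)) = (LINT \<omega>|P. \<omega> 0 e * f (env_shift e \<omega>) * m 0 \<omega>)" for e
    unfolding integral_shift[OF r[of e], of e, symmetric]
  proof (rule integral_cong_env)
    fix \<omega> assume "\<omega> \<in> environments"
    from m_shift[OF this, of "- e" e]
    show "f (env_shift e \<omega>) * (m (- e) (env_shift e \<omega>) * env_shift e \<omega> (- e) e) = \<omega> 0 e * f (env_shift e \<omega>) * m 0 \<omega>"
      by (simp add: env_shift_def[of e \<omega>, THEN fun_cong, of "- e"])
  qed
  have "(LINT \<omega>|P. f \<omega> * m 0 \<omega>) = (LINT \<omega>|P. (1 - \<delta>) * f \<omega> + \<delta> * (\<Sum>e\<in>steps. f \<omega> * (m (- e) \<omega> * \<omega> (- e) e)))"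
    by (rule integral_cong_env) (subst m_eq, assumption, simp add: algebra_simps sum_distrib_left)
  also have "\<dots> = (1 - \<delta>) * (LINT \<omega>|P. f \<omega>) + \<delta> * (\<Sum>e\<in>steps. LINT \<omega>|P. f \<omega> * (m (- e) \<omega> * \<omega> (- e) e))"
    using rv_integrable[OF f] rv_integrable[OF r] by simp
  also have "(\<Sum>e\<in>steps. LINT \<omega>|P. f \<omega> * (m (- e) \<omega> * \<omega> (- e) e)) = (LINT \<omega>|P. (\<Sum>e\<in>steps. \<omega> 0 e * f (env_shift e \<omega>) * m 0 \<omega>))"
    unfolding sh using rv_integrable[OF r'] by simp
  finally show ?thesis by (simp only: env_op_def sum_distrib_right)
qed

lemma weighted_iterate:
  assumes f: "rv f"
  shows "(LINT \<omega>|P. f \<omega> * m 0 \<omega>) = (1 - \<delta>) * (\<Sum>n<N. \<delta> ^ n * (LINT \<omega>|P. (env_op ^^ n) f \<omega>)) +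
    \<delta> ^ N * (LINT \<omega>|P. (env_op ^^ N) f \<omega> * m 0 \<omega>)"
proof (induction N)
  case (Suc N)
  show ?case unfolding Suc weighted_step[OF rv_env_op_funpow[OF f], of N] by (simp add: algebra_simps)
qed simp

text \<open>Iteration of \<open>weighted_step\<close>; as \<open>m 0\<close> is nonnegative with
  mean 1, the remainder after \<open>N\<close> steps is at most \<open>\<delta> ^ N\<close> times a
  bound of \<open>f\<close>.\<close>

lemma weighted_sums:
  assumes f: "rv f"
  shows "(\<lambda>n. \<delta> ^ n * (LINT \<omega>|P. (env_op ^^ n) f \<omega>)) sums ((LINT \<omega>|P. f \<omega> * m 0 \<omega>) / (1 - \<delta>))"
proof -
  obtain C where C: "\<And>\<omega>. \<omega> \<in> environments \<Longrightarrow> \<bar>f \<omega>\<bar> \<le> C" using f unfolding rv_def by blast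
  define b where "b N = (LINT \<omega>|P. (env_op ^^ N) f \<omega> * m 0 \<omega>)" for N
  have b: "\<bar>b N\<bar> \<le> C" for N
  proof -
    have i: "integrable P (\<lambda>\<omega>. (env_op ^^ N) f \<omega> * m 0 \<omega>)" by (intro rv_integrable rv_ops rv_env_op_funpow f rv_m)
    have "\<bar>b N\<bar> \<le> (LINT \<omega>|P. \<bar>(env_op ^^ N) f \<omega> * m 0 \<omega>\<bar>)" unfolding b_def by (rule integral_abs_bound)
    also have "\<dots> \<le> (LINT \<omega>|P. C * m 0 \<omega>)"
    proof (rule integral_mono_AE[OF integrable_abs[OF i] rv_integrable[OF rv_ops(1)[OF rv_const rv_m]]], rule AE_I2)
      fix \<omega> assume "\<omega> \<in> space P"
      then have \<omega>: "\<omega> \<in> environments" by (simp add: space_P)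
      show "\<bar>(env_op ^^ N) f \<omega> * m 0 \<omega>\<bar> \<le> C * m 0 \<omega>"
        unfolding abs_mult abs_of_nonneg[OF m_nonneg[OF \<omega>]]
        by (rule mult_right_mono[OF env_op_funpow_le[OF C \<omega>] m_nonneg[OF \<omega>]])
    qed
    also have "\<dots> = C" by (simp add: m_mean)
    finally show ?thesis .
  qed
  have "(\<lambda>N. \<delta> ^ N * b N) \<longlonglongrightarrow> 0"
  proof (rule tendsto_rabs_zero_cancel, rule tendsto_sandwich[OF _ _ tendsto_const])
    show "\<forall>\<^sub>F N in sequentially. 0 \<le> \<bar>\<delta> ^ N * b N\<bar>" by simp
    show "\<forall>\<^sub>F N in sequentially. \<bar>\<delta> ^ N * b N\<bar> \<le> \<delta> ^ N * C"
      using \<delta>0 b by (intro always_eventually allI) (simp add: abs_mult mult_left_mono)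
    show "(\<lambda>N. \<delta> ^ N * C) \<longlonglongrightarrow> 0"
      using \<delta>0 \<delta> by (intro tendsto_mult_left_zero LIMSEQ_power_zero) simp
  qed
  then have "(\<lambda>N. ((LINT \<omega>|P. f \<omega> * m 0 \<omega>) - \<delta> ^ N * b N) / (1 - \<delta>)) \<longlonglongrightarrow> ((LINT \<omega>|P. f \<omega> * m 0 \<omega>) - 0) / (1 - \<delta>)"
    using \<delta> by (intro tendsto_intros) auto
  moreover have "((LINT \<omega>|P. f \<omega> * m 0 \<omega>) - \<delta> ^ N * b N) / (1 - \<delta>) = (\<Sum>n<N. \<delta> ^ n * (LINT \<omega>|P. (env_op ^^ n) f \<omega>))" for N
    unfolding weighted_iterate[OF f, of N] b_def using \<delta> by simp
  ultimately show ?thesis unfolding sums_def by simp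
qed

end

text \<open>Abel means of a convergent sequence tend to its limit, so a bound on
  \<open>s \<delta>\<close>, the normalised Abel sum, for all \<delta> near 1 passes to
  \<open>L\<close>.\<close>

lemma abel_limit_le:
  fixes A :: "nat \<Rightarrow> real"
  assumes A: "A \<longlonglongrightarrow> L" and \<delta>0: "0 \<le> \<delta>0" "\<delta>0 < 1"
    and s: "\<And>\<delta>. \<delta>0 \<le> \<delta> \<Longrightarrow> \<delta> < 1 \<Longrightarrow> (\<lambda>n. \<delta> ^ n * A n) sums (s \<delta> / (1 - \<delta>))"
    and le: "\<And>\<delta>. \<delta>0 \<le> \<delta> \<Longrightarrow> \<delta> < 1 \<Longrightarrow> \<bar>s \<delta> - K\<bar> \<le> E"
  shows "\<bar>L - K\<bar> \<le> E"
proof (rule field_le_epsilon)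
  fix \<eta> :: real assume \<eta>: "0 < \<eta>"
  have "0 < \<eta> / 2" using \<eta> by simp
  then obtain N where N0: "\<forall>n\<ge>N. norm (A n - L) < \<eta> / 2" using LIMSEQ_D[OF A] by blast
  have N: "\<bar>A n - L\<bar> \<le> \<eta> / 2" if "N \<le> n" for n
    using N0[rule_format, OF that] unfolding real_norm_def by linarith
  have "(\<lambda>n. A n - L) \<longlonglongrightarrow> L - L" by (intro tendsto_diff A tendsto_const)
  then have "Bseq (\<lambda>n. A n - L)" by (rule convergent_imp_Bseq[OF convergentI])
  then obtain C where C: "0 < C" "\<And>n. \<bar>A n - L\<bar> \<le> C" unfolding Bseq_def by auto
  \<comment> \<open>So close to 1 that the first \<open>N\<close> terms, each at most
    \<open>C\<close>, contribute at most \<open>\<eta> / 2\<close> after multiplication by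
    \<open>1 - \<delta>\<close>; the tail gives the other half.\<close>
  define \<delta> where "\<delta> = max \<delta>0 (1 - \<eta> / (2 * (real N + 1) * C))"
  have q: "0 < \<eta> / (2 * (real N + 1) * C)" using \<eta> C by simp
  have \<delta>: "\<delta>0 \<le> \<delta>" "\<delta> < 1" "0 \<le> \<delta>" using \<delta>0 q by (auto simp: \<delta>_def)
  have "1 - \<delta> \<le> \<eta> / (2 * (real N + 1) * C)" by (simp add: \<delta>_def)
  then have "(1 - \<delta>) * (real N * C) \<le> \<eta> / (2 * (real N + 1) * C) * ((real N + 1) * C)"
    using C \<delta> q by (intro mult_mono) auto
  also have "\<dots> = \<eta> / 2" using C by (simp add: divide_simps)
  finally have small: "(1 - \<delta>) * (real N * C) \<le> \<eta> / 2" .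
  define b where "b n = (if n \<in> {..<N} then C else 0) + \<eta> / 2 * \<delta> ^ n" for n
  have b: "b sums (real N * C + \<eta> / 2 * (1 / (1 - \<delta>)))"
    unfolding b_def using sums_If_finite_set[of "{..<N}" "\<lambda>_. C"] \<delta>
    by (intro sums_add sums_mult geometric_sums) auto
  have g: "(\<lambda>n. \<delta> ^ n * L) sums (1 / (1 - \<delta>) * L)" using \<delta> by (intro sums_mult2 geometric_sums) auto
  have a: "(\<lambda>n. \<delta> ^ n * (A n - L)) sums (s \<delta> / (1 - \<delta>) - 1 / (1 - \<delta>) * L)"
    using sums_diff[OF s[OF \<delta>(1,2)] g] by (simp add: right_diff_distrib)
  have "\<bar>\<delta> ^ n * (A n - L)\<bar> \<le> b n" for n
  proof (cases "n < N")
    case True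
    have "\<delta> ^ n * \<bar>A n - L\<bar> \<le> 1 * C" using \<delta> C by (intro mult_mono power_le_one) auto
    moreover have "0 \<le> \<eta> / 2 * \<delta> ^ n" using \<delta> \<eta> by simp
    ultimately show ?thesis using True \<delta> by (simp add: b_def abs_mult)
  next
    case False
    then have "\<delta> ^ n * \<bar>A n - L\<bar> \<le> \<delta> ^ n * (\<eta> / 2)" using \<delta> N by (intro mult_left_mono) auto
    then show ?thesis using False \<delta> by (simp add: b_def abs_mult mult.commute)
  qed
  then have "norm (suminf (\<lambda>n. \<delta> ^ n * (A n - L))) \<le> suminf b"
    using sums_summable[OF b] by (intro norm_suminf_le) auto
  then have "\<bar>s \<delta> / (1 - \<delta>) - 1 / (1 - \<delta>) * L\<bar> \<le> real N * C + \<eta> / 2 * (1 / (1 - \<delta>))"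
    using sums_unique[OF a] sums_unique[OF b] by simp
  then have "(1 - \<delta>) * \<bar>s \<delta> / (1 - \<delta>) - 1 / (1 - \<delta>) * L\<bar> \<le> (1 - \<delta>) * (real N * C + \<eta> / 2 * (1 / (1 - \<delta>)))"
    using \<delta> by (intro mult_left_mono) auto
  moreover have "(1 - \<delta>) * \<bar>s \<delta> / (1 - \<delta>) - 1 / (1 - \<delta>) * L\<bar> = \<bar>s \<delta> - L\<bar>"
    using \<delta> by (simp add: diff_divide_distrib[symmetric] abs_divide)
  moreover have "(1 - \<delta>) * (real N * C + \<eta> / 2 * (1 / (1 - \<delta>))) = (1 - \<delta>) * (real N * C) + \<eta> / 2"
  proof -
    have R: "r * (x + y / 2 * (1 / r)) = r * x + y / 2" if "r \<noteq> 0" for r x y :: real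
      using that by (simp add: field_simps)
    show ?thesis by (rule R) (use \<delta> in simp)
  qed
  ultimately have "\<bar>s \<delta> - L\<bar> \<le> \<eta>" using small by linarith
  then show "\<bar>L - K\<bar> \<le> E + \<eta>" using le[OF \<delta>(1,2)] by linarith
qed

section \<open>Comparison of measures\<close>

text \<open>Indicators of compact sets are limits of continuous cut-offs of the distance, and finite
  Borel measures on a Polish space are inner regular.\<close>

lemma emeasure_le_of_continuous:
  fixes \<mu> \<nu> :: "'a::{second_countable_topology, complete_space} measure"
  assumes s: "sets \<mu> = sets borel" "sets \<nu> = sets borel"
    and fin: "finite_measure \<mu>" "finite_measure \<nu>"
    and le: "\<And>f. continuous_on UNIV f \<Longrightarrow> (\<And>x. 0 \<le> f x \<and> f x \<le> 1) \<Longrightarrow> (LINT x|\<mu>. f x) \<le> (LINT x|\<nu>. f x :: real)"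
    and A: "A \<in> sets borel"
  shows "emeasure \<mu> A \<le> emeasure \<nu> A"
proof -
  interpret \<mu>: finite_measure \<mu> by (rule fin)
  interpret \<nu>: finite_measure \<nu> by (rule fin)
  have K: "emeasure \<mu> K \<le> emeasure \<nu> K" if K: "compact K" for K
  proof (cases "K = {}")
    case False
    have cl: "closed K" by (rule compact_imp_closed[OF K])
    define f where "f n x = max 0 (1 - real n * infdist x K)" for n x
    have cont: "continuous_on UNIV (f n)" for n
      unfolding f_def by (intro continuous_intros)
    have f01: "0 \<le> f n x" "f n x \<le> 1" for n x by (simp_all add: f_def infdist_nonneg)
    have lim: "(\<lambda>n. f n x) \<longlonglongrightarrow> indicator K x" for x
    proof (cases "x \<in> K")
      case True
      then have "infdist x K = 0" by simp
      then show ?thesis using True by (simp add: f_def)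
    next
      case x: False
      have p: "0 < infdist x K" by (rule infdist_pos_not_in_closed[OF cl False x])
      obtain N where N: "1 / infdist x K < real N" using reals_Archimedean2 by blast
      have "f n x = 0" if "N \<le> n" for n
      proof -
        have "1 / infdist x K \<le> real n" using N that by linarith
        then have "1 \<le> real n * infdist x K" using p by (simp add: pos_divide_le_eq)
        then show ?thesis by (simp add: f_def)
      qed
      then have "\<forall>\<^sub>F n in sequentially. f n x = 0" unfolding eventually_sequentially by blast
      then show ?thesis using x by (simp add: tendsto_eventually)
    qed
    have L: "(\<lambda>n. LINT x|M. f n x) \<longlonglongrightarrow> measure M K" if sM: "sets M = sets borel" and "finite_measure M" for M
    proof -
      interpret M: finite_measure M by fact
      have Ks: "K \<in> sets M" unfolding sM using cl by simp
      have "(\<lambda>n. LINT x|M. f n x) \<longlonglongrightarrow> (LINT x|M. indicator K x)"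
      proof (rule integral_dominated_convergence[where w = "\<lambda>_. 1"])
        show "indicator K \<in> borel_measurable M" using Ks by simp
        show "f n \<in> borel_measurable M" for n
          unfolding measurable_cong_sets[OF sM refl] by (rule borel_measurable_continuous_onI[OF cont])
      qed (use lim f01 in auto)
      then show ?thesis using Ks by simp
    qed
    have "measure \<mu> K \<le> measure \<nu> K"
      by (rule LIMSEQ_le[OF L[OF s(1) fin(1)] L[OF s(2) fin(2)]]) (use le[OF cont] f01 in blast)
    then show ?thesis by (simp add: \<mu>.emeasure_eq_measure \<nu>.emeasure_eq_measure)
  qed simp
  have "emeasure \<mu> A = (SUP K \<in> {K. K \<subseteq> A \<and> compact K}. emeasure \<mu> K)"
    by (rule inner_regular[OF s(1) _ A]) simp
  also have "\<dots> \<le> emeasure \<nu> A"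
  proof (rule SUP_least)
    fix K assume "K \<in> {K. K \<subseteq> A \<and> compact K}"
    then have "compact K" "K \<subseteq> A" by auto
    then have "emeasure \<mu> K \<le> emeasure \<nu> K" "emeasure \<nu> K \<le> emeasure \<nu> A"
      using K A s(2) by (auto intro!: emeasure_mono)
    then show "emeasure \<mu> K \<le> emeasure \<nu> A" by (rule order_trans)
  qed
  finally show ?thesis .
qed

text \<open>On the set where \<open>f\<close> exceeds \<open>g\<close> the difference is nonnegative
  and has integral at most 0.\<close>

lemma AE_le_of_nn_integral:
  assumes f: "f \<in> borel_measurable M" and g: "g \<in> borel_measurable M"
    and fin: "(\<integral>\<^sup>+x. g x \<partial>M) \<noteq> \<infinity>"
    and le: "\<And>A. A \<in> sets M \<Longrightarrow> (\<integral>\<^sup>+x. f x * indicator A x \<partial>M) \<le> (\<integral>\<^sup>+x. g x * indicator A x \<partial>M)"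
  shows "AE x in M. f x \<le> (g x :: ennreal)"
proof -
  define A where "A = {x \<in> space M. g x < f x}"
  have A: "A \<in> sets M" unfolding A_def using f g by measurable
  define F where "F x = f x * indicator A x" for x
  define G where "G x = g x * indicator A x" for x
  have m: "F \<in> borel_measurable M" "G \<in> borel_measurable M"
    unfolding F_def G_def using f g A by measurable
  have "integral\<^sup>N M G \<le> (\<integral>\<^sup>+x. g x \<partial>M)"
    unfolding G_def by (intro nn_integral_mono) (auto split: split_indicator)
  then have finG: "integral\<^sup>N M G \<noteq> \<infinity>" using fin by (auto simp: top_unique)
  have "AE x in M. G x \<le> F x"
    by (intro AE_I2) (auto simp: F_def G_def A_def less_imp_le split: split_indicator)
  from nn_integral_diff[OF m finG this]
  have "(\<integral>\<^sup>+x. F x - G x \<partial>M) = integral\<^sup>N M F - integral\<^sup>N M G" .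
  also have "\<dots> = 0" using le[OF A] finG unfolding F_def[symmetric] G_def[symmetric]
    by (intro diff_eq_0_ennreal) (auto simp: less_top intro: le_less_trans)
  finally have "AE x in M. F x - G x = 0"
    using nn_integral_0_iff_AE[of "\<lambda>x. F x - G x" M] m by simp
  then show ?thesis
    using AE_space
  proof eventually_elim
    case (elim x)
    show ?case
    proof (rule ccontr)
      assume "\<not> f x \<le> g x"
      then have lt: "g x < f x" by simp
      then have "x \<in> A" using elim by (simp add: A_def)
      then have "f x - g x = 0" using elim by (simp add: F_def G_def)
      then show False using lt by (auto simp: diff_eq_0_iff_ennreal dest: leD)
    qed
  qed
qed

text \<open>The upper bound forces absolute continuity; the density then obeys both bounds on every
  set, hence almost everywhere. Negative values of \<open>l\<close> are truncated by
  \<open>ennreal\<close>.\<close>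

lemma RN_deriv_between:
  fixes l u :: "'a \<Rightarrow> real"
  assumes M: "finite_measure M" and N: "finite_measure N" and s: "sets N = sets M"
    and l: "l \<in> borel_measurable M" and u: "u \<in> borel_measurable M"
    and u0: "AE x in M. 0 \<le> u x" and fin: "(\<integral>\<^sup>+x. ennreal (u x) \<partial>M) \<noteq> \<infinity>"
    and lo: "\<And>A. A \<in> sets M \<Longrightarrow> (\<integral>\<^sup>+x. ennreal (l x) * indicator A x \<partial>M) \<le> emeasure N A"
    and hi: "\<And>A. A \<in> sets M \<Longrightarrow> emeasure N A \<le> (\<integral>\<^sup>+x. ennreal (u x) * indicator A x \<partial>M)"
  shows "absolutely_continuous M N"
    and "AE x in M. l x \<le> enn2real (RN_deriv M N x) \<and> enn2real (RN_deriv M N x) \<le> u x"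
proof -
  interpret M: finite_measure M by (rule M)
  interpret N: finite_measure N by (rule N)
  show ac: "absolutely_continuous M N"
    unfolding absolutely_continuous_def
  proof
    fix A assume A: "A \<in> null_sets M"
    have "emeasure N A \<le> (\<integral>\<^sup>+x. ennreal (u x) * indicator A x \<partial>M)" using A by (intro hi) auto
    also have "\<dots> = 0" using nn_integral_null_set[OF A] .
    finally show "A \<in> null_sets N" using A s by (intro null_setsI) auto
  qed
  define r where "r = RN_deriv M N"
  have r: "r \<in> borel_measurable M" unfolding r_def by simp
  have e: "emeasure N A = (\<integral>\<^sup>+x. r x * indicator A x \<partial>M)" if A: "A \<in> sets M" for A
  proof -
    have "emeasure N A = emeasure (density M r) A" unfolding r_def by (simp only: M.density_RN_deriv[OF ac s])
    then show ?thesis using emeasure_density[OF r A] by simp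
  qed
  have sp: "space M = space N" using sets_eq_imp_space_eq[OF s] by simp
  have "(\<integral>\<^sup>+x. r x \<partial>M) = (\<integral>\<^sup>+x. r x * indicator (space M) x \<partial>M)"
    by (intro nn_integral_cong) simp
  also have "\<dots> = emeasure N (space N)" using e[OF sets.top] by (simp only: sp)
  finally have finr: "(\<integral>\<^sup>+x. r x \<partial>M) \<noteq> \<infinity>" by simp
  have "AE x in M. ennreal (l x) \<le> r x"
    using l r finr lo e by (intro AE_le_of_nn_integral) auto
  moreover have "AE x in M. r x \<le> ennreal (u x)"
    using u r fin hi e by (intro AE_le_of_nn_integral) auto
  ultimately show "AE x in M. l x \<le> enn2real (RN_deriv M N x) \<and> enn2real (RN_deriv M N x) \<le> u x"
    using u0
  proof eventually_elim
    case (elim x)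
    have t: "r x < top" using elim(2) ennreal_less_top le_less_trans by blast
    have "l x \<le> enn2real (r x)"
    proof (cases "0 \<le> l x")
      case True
      have "enn2real (ennreal (l x)) \<le> enn2real (r x)" by (rule enn2real_mono[OF elim(1) t])
      then show ?thesis using True by simp
    next
      case False
      then show ?thesis using enn2real_nonneg[of "r x"] by linarith
    qed
    moreover have "enn2real (r x) \<le> enn2real (ennreal (u x))" by (rule enn2real_mono[OF elim(2)]) simp
    ultimately show ?case using elim(3) by (simp add: r_def)
  qed
qed

section \<open>The limiting invariant measure\<close>

text \<open>Freezes the other sites at simple random walk. It is continuous and preserves
  \<open>environments\<close>, so continuous functions of \<open>proj \<omega>\<close> are
  admissible test functions seeing the two sites only, and the measures are compared on one Polish
  space.\<close>

definition proj :: "env \<Rightarrow> env" where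
  "proj \<omega> x = (if x = (0, 0) \<or> x = (0, 1) then \<omega> x else srw)"

lemma continuous_proj: "continuous_on UNIV proj"
proof (rule continuous_on_coordinatewise_then_product)
  show "continuous_on UNIV (\<lambda>\<omega>. proj \<omega> x)" for x
    by (cases "x = (0, 0) \<or> x = (0, 1)")
      (simp_all add: proj_def continuous_on_product_coordinates)
qed

lemma measurable_proj: "proj \<in> Omega \<rightarrow>\<^sub>M borel"
  unfolding Omega_def by (intro measurable_restrict_space1 borel_measurable_continuous_onI continuous_proj)

lemma proj_environments: "\<omega> \<in> environments \<Longrightarrow> proj \<omega> \<in> environments"
  by (auto simp: environments_def proj_def prob_vectors_def srw_def sum_steps steps_eq)

context low_disorder
begin

definition phi :: "env \<Rightarrow> real" where
  "phi \<omega> = 1 - 4 / pi * ((\<omega> (0, 1) (1, 0) - pbar (1, 0)) + (\<omega> (0, 1) (- 1, 0) - pbar (- 1, 0))) +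
     (8 / pi - 4) * (\<omega> (0, 1) (0, 1) - pbar (0, 1))"

definition err :: real where
  "err = 10 ^ 9 * (\<epsilon>\<^sup>2 * (1 + ln (25 / \<epsilon>\<^sup>2)))"

lemma rv_phi: "rv phi"
  unfolding phi_def[abs_def] by (intro rv_ops rv_const rv_coord)

text \<open>The margin 1/4, with \<open>err \<le> 1 / 4\<close>, makes \<open>phi - err\<close> and
  \<open>phi + err\<close> nonnegative, so that both can serve as densities.\<close>

lemma phi_near:
  assumes "\<omega> \<in> Near"
  shows "\<bar>phi \<omega> - 1\<bar> \<le> 1 / 4"
proof -
  have st: "(1, 0) \<in> steps" "(- 1, 0) \<in> steps" "(0, 1) \<in> steps" by (auto simp: steps_eq)
  define a b c where "a = \<omega> (0, 1) (1, 0) - pbar (1, 0)" and "b = \<omega> (0, 1) (- 1, 0) - pbar (- 1, 0)"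
    and "c = \<omega> (0, 1) (0, 1) - pbar (0, 1)"
  have abc: "\<bar>a\<bar> \<le> 2 / 1000" "\<bar>b\<bar> \<le> 2 / 1000" "\<bar>c\<bar> \<le> 2 / 1000"
    using coord_pbar_le[OF st(1) assms, of "(0, 1)"] coord_pbar_le[OF st(2) assms, of "(0, 1)"]
      coord_pbar_le[OF st(3) assms, of "(0, 1)"] \<epsilon> unfolding a_def b_def c_def by linarith+
  have pi: "\<bar>4 / pi\<bar> \<le> 4" "\<bar>8 / pi - 4\<bar> \<le> 4" using pi_gt3 by (auto simp: divide_le_eq abs_le_iff)
  have ab: "\<bar>a + b\<bar> \<le> 4 / 1000" using abc by linarith
  have "\<bar>4 / pi * (a + b)\<bar> \<le> 4 * (4 / 1000)" "\<bar>(8 / pi - 4) * c\<bar> \<le> 4 * (2 / 1000)"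
    unfolding abs_mult by (rule mult_mono[OF pi(1) ab] mult_mono[OF pi(2) abc(3)]; simp)+
  then show ?thesis unfolding phi_def a_def[symmetric] b_def[symmetric] c_def[symmetric] by linarith
qed

text \<open>\<open>phi\<close> and \<open>err\<close> do not involve the killing, so the expansion
  holds for all \<delta> up to 1 and \<open>abel_limit_le\<close> transfers it to
  \<open>Q\<close>.\<close>

lemma integral_limit:
  assumes lim: "limiting_invariant_measure P Q"
    and f: "continuous_on environments f" "rv f" "\<And>\<omega>. 0 \<le> f \<omega>"
      "\<And>\<omega> \<omega>'. \<omega> (0, 0) = \<omega>' (0, 0) \<Longrightarrow> \<omega> (0, 1) = \<omega>' (0, 1) \<Longrightarrow> f \<omega> = f \<omega>'"
  shows "\<bar>(LINT \<omega>|Q. f \<omega>) - (LINT \<omega>|P. f \<omega> * phi \<omega>)\<bar> \<le> err * (LINT \<omega>|P. f \<omega>)"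
proof (rule abel_limit_le)
  define \<delta>0 where "\<delta>0 = 1 - \<epsilon>\<^sup>2 / 4"
  have "bounded (f ` environments)" using f(2) by (auto simp: rv_def bounded_iff)
  then have "(\<lambda>n. LINT \<omega>|env_process_law P n. f \<omega>) \<longlonglongrightarrow> (LINT \<omega>|Q. f \<omega>)"
    using lim f(1) unfolding limiting_invariant_measure_def converges_in_distribution_def by blast
  then show "(\<lambda>n. LINT \<omega>|P. (env_op ^^ n) f \<omega>) \<longlonglongrightarrow> (LINT \<omega>|Q. f \<omega>)"
    by (simp only: integral_env_process_law[OF f(2,3)])
  show "0 \<le> \<delta>0" "\<delta>0 < 1" using \<epsilon>2 by (auto simp: \<delta>0_def)
  fix \<delta>' assume \<delta>': "\<delta>0 \<le> \<delta>'" "\<delta>' < 1"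
  have lo: "1 - \<epsilon>\<^sup>2 / 4 \<le> \<delta>'" using \<delta>'(1) by (simp add: \<delta>0_def)
  interpret W: weighted P \<epsilon> \<delta>' f
    by unfold_locales (fact \<epsilon> LD lo \<delta>'(2) f(2) f(3) f(4))+
  show "(\<lambda>n. \<delta>' ^ n * (LINT \<omega>|P. (env_op ^^ n) f \<omega>)) sums ((LINT \<omega>|P. f \<omega> * W.m 0 \<omega>) / (1 - \<delta>'))"
    by (rule W.weighted_sums[OF f(2)])
  have i: "integrable P f" "integrable P (\<lambda>\<omega>. f \<omega> * (\<omega> z e - pbar e))" for z e
    by (intro rv_integrable rv_ops f(2) rv_coord rv_const)+
  have "(LINT \<omega>|P. f \<omega> * phi \<omega>) = (LINT \<omega>|P. f \<omega> - 4 / pi * (f \<omega> * (\<omega> (0, 1) (1, 0) - pbar (1, 0)) + f \<omega> * (\<omega> (0, 1) (- 1, 0) - pbar (- 1, 0))) +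
     (8 / pi - 4) * (f \<omega> * (\<omega> (0, 1) (0, 1) - pbar (0, 1))))"
    by (rule arg_cong[where f = "integral\<^sup>L P"], rule ext) (simp add: phi_def algebra_simps)
  also have "\<dots> = (LINT \<omega>|P. f \<omega>) - 4 / pi * (W.d (0, 1) (1, 0) + W.d (0, 1) (- 1, 0)) + (8 / pi - 4) * W.d (0, 1) (0, 1)"
    unfolding W.d_def using i by simp
  also have "\<dots> = (LINT \<omega>|P. f \<omega>) + W.main" unfolding W.main_def by simp
  finally have "(LINT \<omega>|P. f \<omega> * phi \<omega>) = (LINT \<omega>|P. f \<omega>) + W.main" .
  then show "\<bar>(LINT \<omega>|P. f \<omega> * W.m 0 \<omega>) - (LINT \<omega>|P. f \<omega> * phi \<omega>)\<bar> \<le> err * (LINT \<omega>|P. f \<omega>)"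
    using W.expected_mass_expansion by (simp add: err_def mult.assoc)
qed

text \<open>The error in \<open>integral_limit\<close> is proportional to the integral of
  \<open>f\<close> and can be absorbed into the density. The two-sided bound for continuous
  functions of the two sites then extends to all events they determine.\<close>

lemma limit_between:
  assumes lim: "limiting_invariant_measure P Q" and err: "0 \<le> err" "err \<le> 1 / 4"
    and A: "A \<in> sets Omega" and inv: "\<And>\<omega>. \<omega> \<in> environments \<Longrightarrow> proj \<omega> \<in> A \<longleftrightarrow> \<omega> \<in> A"
  shows "(\<integral>\<^sup>+\<omega>. ennreal (phi \<omega> + - err) * indicator A \<omega> \<partial>P) \<le> emeasure Q A"
    and "emeasure Q A \<le> (\<integral>\<^sup>+\<omega>. ennreal (phi \<omega> + err) * indicator A \<omega> \<partial>P)"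
proof -
  have Q: "prob_space Q" "sets Q = sets Omega"
    using lim by (auto simp: limiting_invariant_measure_def invariant_measure_def)
  interpret Q: prob_space Q by (rule Q)
  have spQ: "space Q = environments" using sets_eq_imp_space_eq[OF Q(2)] by (simp add: space_Omega)
  have projQ: "proj \<in> Q \<rightarrow>\<^sub>M borel" and projP: "proj \<in> P \<rightarrow>\<^sub>M borel"
    using measurable_proj by (simp_all add: measurable_cong_sets[OF Q(2) refl] measurable_cong_sets[OF sets_P refl])
  define \<nu> where "\<nu> c = density P (\<lambda>\<omega>. ennreal (phi \<omega> + c))" for c
  have proj\<nu>: "proj \<in> \<nu> c \<rightarrow>\<^sub>M borel" for c using projP by (simp add: \<nu>_def)
  have rvc: "rv (\<lambda>\<omega>. phi \<omega> + c)" for c by (intro rv_ops rv_phi rv_const)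
  have mc: "(\<lambda>\<omega>. phi \<omega> + c) \<in> borel_measurable P" for c using rvc by (simp add: rv_def measurable_cong_sets[OF sets_P refl])
  have pos: "AE \<omega> in P. 0 \<le> phi \<omega> + c" if "\<bar>c\<bar> \<le> 1 / 4" for c
    using AE_near
  proof eventually_elim
    case (elim \<omega>)
    then show ?case using phi_near[OF elim] that by linarith
  qed
  have fin\<nu>: "finite_measure (\<nu> c)" if "\<bar>c\<bar> \<le> 1 / 4" for c
  proof (rule finite_measureI)
    have "emeasure (\<nu> c) (space (\<nu> c)) = (\<integral>\<^sup>+\<omega>. ennreal (phi \<omega> + c) * indicator (space P) \<omega> \<partial>P)"
      unfolding \<nu>_def by (subst emeasure_density) (use mc in simp_all)
    also have "\<dots> = (\<integral>\<^sup>+\<omega>. ennreal (phi \<omega> + c) \<partial>P)" by (intro nn_integral_cong) simp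
    also have "\<dots> = ennreal (LINT \<omega>|P. phi \<omega> + c)"
      by (rule nn_integral_eq_integral[OF rv_integrable[OF rvc] pos[OF that]])
    finally show "emeasure (\<nu> c) (space (\<nu> c)) \<noteq> \<infinity>" by simp
  qed
  have key: "(LINT \<omega>|distr (\<nu> (- err)) borel proj. g \<omega>) \<le> (LINT \<omega>|distr Q borel proj. g \<omega>) \<and>
      (LINT \<omega>|distr Q borel proj. g \<omega>) \<le> (LINT \<omega>|distr (\<nu> err) borel proj. g \<omega>)"
    if g: "continuous_on UNIV g" "\<And>\<omega>. 0 \<le> g \<omega> \<and> g \<omega> \<le> 1" for g :: "env \<Rightarrow> real"
  proof -
    define f where "f \<omega> = g (proj \<omega>)" for \<omega>
    have gm: "g \<in> borel_measurable borel" by (rule borel_measurable_continuous_onI[OF g(1)])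
    have "continuous_on UNIV f" unfolding f_def
      using continuous_on_compose2[OF g(1) continuous_proj] by simp
    then have cf: "continuous_on environments f" by (rule continuous_on_subset) simp
    have rf: "rv f" unfolding rv_def
      using measurable_compose[OF measurable_proj gm] g(2) by (auto simp: f_def[abs_def] intro!: exI[of _ 1])
    have dep: "f \<omega> = f \<omega>'" if "\<omega> (0, 0) = \<omega>' (0, 0)" "\<omega> (0, 1) = \<omega>' (0, 1)" for \<omega> \<omega>'
    proof -
      have "proj \<omega> = proj \<omega>'" using that by (auto simp: proj_def fun_eq_iff simp del: split_paired_All)
      then show ?thesis by (simp add: f_def)
    qed
    have lim': "\<bar>(LINT \<omega>|Q. f \<omega>) - (LINT \<omega>|P. f \<omega> * phi \<omega>)\<bar> \<le> err * (LINT \<omega>|P. f \<omega>)"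
      by (rule integral_limit[OF lim cf rf _ dep]) (simp_all add: f_def g(2))
    have q: "(LINT \<omega>|distr Q borel proj. g \<omega>) = (LINT \<omega>|Q. f \<omega>)"
      unfolding f_def by (rule integral_distr[OF projQ gm])
    have n: "(LINT \<omega>|distr (\<nu> c) borel proj. g \<omega>) = (LINT \<omega>|P. f \<omega> * phi \<omega>) + c * (LINT \<omega>|P. f \<omega>)"
      if c: "\<bar>c\<bar> \<le> 1 / 4" for c
    proof -
      have fm: "f \<in> borel_measurable P" using rf by (simp add: rv_def measurable_cong_sets[OF sets_P refl])
      have "(LINT \<omega>|distr (\<nu> c) borel proj. g \<omega>) = (LINT \<omega>|\<nu> c. f \<omega>)"
        unfolding f_def by (rule integral_distr[OF proj\<nu> gm])
      also have "\<dots> = (LINT \<omega>|P. (phi \<omega> + c) *\<^sub>R f \<omega>)"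
        unfolding \<nu>_def by (rule integral_density[OF fm mc pos[OF c]])
      also have "\<dots> = (LINT \<omega>|P. f \<omega> * phi \<omega> + c * f \<omega>)"
        by (rule arg_cong[where f = "integral\<^sup>L P"], rule ext) (simp add: algebra_simps)
      also have "\<dots> = (LINT \<omega>|P. f \<omega> * phi \<omega>) + c * (LINT \<omega>|P. f \<omega>)"
        using rv_integrable[OF rf] rv_integrable[OF rv_ops(1)[OF rf rv_phi]] by simp
      finally show ?thesis .
    qed
    show ?thesis using lim' n[of err] n[of "- err"] err unfolding q by (simp add: abs_le_iff)
  qed
  obtain D where D: "D \<in> sets borel" "A = environments \<inter> D"
    using A unfolding Omega_def by (auto simp: sets_restrict_space)
  have pre: "proj -` D \<inter> environments = A"
    using inv proj_environments D(2) by blast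
  have fQ: "finite_measure (distr Q borel proj)" by (rule Q.finite_measure_distr[OF projQ])
  have f\<nu>: "finite_measure (distr (\<nu> c) borel proj)" if "\<bar>c\<bar> \<le> 1 / 4" for c
    by (rule finite_measure.finite_measure_distr[OF fin\<nu>[OF that] proj\<nu>])
  have eQ: "emeasure (distr Q borel proj) D = emeasure Q A"
    using emeasure_distr[OF projQ D(1)] by (simp add: spQ pre)
  have e\<nu>: "emeasure (distr (\<nu> c) borel proj) D = (\<integral>\<^sup>+\<omega>. ennreal (phi \<omega> + c) * indicator A \<omega> \<partial>P)" for c
  proof -
    have "space (\<nu> c) = environments" by (simp add: \<nu>_def space_P)
    then have "emeasure (distr (\<nu> c) borel proj) D = emeasure (\<nu> c) A"
      using emeasure_distr[OF proj\<nu> D(1)] by (simp add: pre)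
    also have "\<dots> = (\<integral>\<^sup>+\<omega>. ennreal (phi \<omega> + c) * indicator A \<omega> \<partial>P)"
      unfolding \<nu>_def using mc A by (intro emeasure_density) (simp_all add: sets_P)
    finally show ?thesis .
  qed
  have c: "\<bar>err\<bar> \<le> 1 / 4" "\<bar>- err\<bar> \<le> 1 / 4" using err by auto
  have "emeasure (distr (\<nu> (- err)) borel proj) D \<le> emeasure (distr Q borel proj) D"
    by (rule emeasure_le_of_continuous[OF _ _ f\<nu>[OF c(2)] fQ _ D(1)]) (simp, simp, rule key[THEN conjunct1], assumption, blast)
  then show "(\<integral>\<^sup>+\<omega>. ennreal (phi \<omega> + - err) * indicator A \<omega> \<partial>P) \<le> emeasure Q A"
    unfolding eQ e\<nu> .
  have "emeasure (distr Q borel proj) D \<le> emeasure (distr (\<nu> err) borel proj) D"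
    by (rule emeasure_le_of_continuous[OF _ _ fQ f\<nu>[OF c(1)] _ D(1)]) (simp, simp, rule key[THEN conjunct2], assumption, blast)
  then show "emeasure Q A \<le> (\<integral>\<^sup>+\<omega>. ennreal (phi \<omega> + err) * indicator A \<omega> \<partial>P)"
    unfolding eQ e\<nu> .
qed

text \<open>Exchanging the copies at (0, 1) alone turns the product into one over two independent
  environments.\<close>

lemma integral_indep:
  assumes F: "rv F" and h: "rv h"
    and dF: "\<And>\<omega> \<omega>'. \<omega> \<in> environments \<Longrightarrow> \<omega>' \<in> environments \<Longrightarrow> \<omega> (0, 0) = \<omega>' (0, 0) \<Longrightarrow> F \<omega> = F \<omega>'"
    and dh: "\<And>\<omega> \<omega>'. \<omega> \<in> environments \<Longrightarrow> \<omega>' \<in> environments \<Longrightarrow> \<omega> (0, 1) = \<omega>' (0, 1) \<Longrightarrow> h \<omega> = h \<omega>'"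
  shows "(LINT \<omega>|P. F \<omega> * h \<omega>) = (LINT \<omega>|P. F \<omega>) * (LINT \<omega>|P. h \<omega>)"
proof -
  have "(LINT \<omega>|P. F \<omega> * h \<omega>) = (LINT X|copies. F (mix {} X) * h (mix {} X))"
    by (rule integral_mix[OF rv_ops(1)[OF F h], symmetric])
  also have "\<dots> = (LINT X|copies. F (mix {} (X \<circ> swap {(0, 1)})) * h (mix {} (X \<circ> swap {(0, 1)})))"
    by (rule integral_swap[symmetric]) (intro crv_intros F h)
  also have "\<dots> = (LINT X|copies. F (mix {} X) * h (mix UNIV X))"
  proof (rule Bochner_Integration.integral_cong[OF refl])
    fix X assume X: "X \<in> space copies"
    have env: "mix S X \<in> environments" for S
      using measurable_space[OF measurable_pick X] by (simp add: mix_def space_Omega)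
    have "F (mix {(0, 1)} X) = F (mix {} X)" "h (mix {(0, 1)} X) = h (mix UNIV X)"
      by (rule dF dh; simp add: env mix_apply)+
    then show "F (mix {} (X \<circ> swap {(0, 1)})) * h (mix {} (X \<circ> swap {(0, 1)})) = F (mix {} X) * h (mix UNIV X)"
      by (simp add: mix_swap)
  qed
  also have "\<dots> = (LINT \<omega>|P. F \<omega>) * (LINT \<omega>|P. h \<omega>)" by (rule indep_copies[OF F h])
  finally show ?thesis .
qed

text \<open>\<open>phi - 1\<close> is a centred function of the environment at (0, 1), hence
  orthogonal to events determined at the origin.\<close>

lemma nn_integral_phi_origin:
  assumes A: "A \<in> sets Omega"
    and dep: "\<And>\<omega> \<omega>'. \<omega> \<in> environments \<Longrightarrow> \<omega>' \<in> environments \<Longrightarrow> \<omega> (0, 0) = \<omega>' (0, 0) \<Longrightarrow> \<omega> \<in> A \<longleftrightarrow> \<omega>' \<in> A"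
    and c: "\<bar>c\<bar> \<le> 1 / 4"
  shows "(\<integral>\<^sup>+\<omega>. ennreal (phi \<omega> + c) * indicator A \<omega> \<partial>P) = (\<integral>\<^sup>+\<omega>. ennreal (1 + c) * indicator A \<omega> \<partial>P)"
proof -
  define F :: "env \<Rightarrow> real" where "F = indicator A"
  have F: "rv F" unfolding rv_def F_def using A by (auto intro!: exI[of _ 1] split: split_indicator)
  have dF: "F \<omega> = F \<omega>'" if "\<omega> \<in> environments" "\<omega>' \<in> environments" "\<omega> (0, 0) = \<omega>' (0, 0)" for \<omega> \<omega>'
    using dep[OF that] by (simp add: F_def indicator_def)
  have coord: "(LINT \<omega>|P. F \<omega> * (\<omega> (0, 1) e - pbar e)) = 0" for e
  proof -
    have r: "rv (\<lambda>\<omega>. \<omega> (0, 1) e - pbar e)" by (intro rv_ops rv_coord rv_const)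
    have "(LINT \<omega>|P. \<omega> (0, 1) e - pbar e) = 0"
      using rv_integrable[OF rv_coord[of "(0, 1)" e]] by (simp add: pbar_eq P.prob_space)
    then show ?thesis by (subst integral_indep[OF F r dF]) auto
  qed
  have i: "integrable P F" "integrable P (\<lambda>\<omega>. F \<omega> * (\<omega> (0, 1) e - pbar e))" for e
    by (intro rv_integrable rv_ops F rv_coord rv_const)+
  have "(LINT \<omega>|P. (phi \<omega> + c) * F \<omega>) = (LINT \<omega>|P. (1 + c) * F \<omega> - 4 / pi * (F \<omega> * (\<omega> (0, 1) (1, 0) - pbar (1, 0)) + F \<omega> * (\<omega> (0, 1) (- 1, 0) - pbar (- 1, 0))) +
     (8 / pi - 4) * (F \<omega> * (\<omega> (0, 1) (0, 1) - pbar (0, 1))))"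
    by (rule arg_cong[where f = "integral\<^sup>L P"], rule ext) (simp add: phi_def algebra_simps)
  also have "\<dots> = (LINT \<omega>|P. (1 + c) * F \<omega>)"
    using i by (simp add: coord)
  finally have eq: "(LINT \<omega>|P. (phi \<omega> + c) * F \<omega>) = (LINT \<omega>|P. (1 + c) * F \<omega>)" .
  have ind: "ennreal x * indicator A \<omega> = ennreal (x * F \<omega>)" for x \<omega>
    by (simp add: F_def split: split_indicator)
  have "AE \<omega> in P. 0 \<le> (phi \<omega> + c) * F \<omega>"
    using AE_near
  proof eventually_elim
    case (elim \<omega>)
    have "0 \<le> phi \<omega> + c" using phi_near[OF elim] c by linarith
    then show ?case by (simp add: F_def)
  qed
  moreover have "integrable P (\<lambda>\<omega>. (phi \<omega> + c) * F \<omega>)" by (intro rv_integrable rv_ops rv_phi rv_const F)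
  moreover have "AE \<omega> in P. 0 \<le> (1 + c) * F \<omega>" using c by (intro AE_I2) (simp add: F_def)
  moreover have "integrable P (\<lambda>\<omega>. (1 + c) * F \<omega>)" using i(1) by simp
  ultimately show ?thesis unfolding ind by (simp add: nn_integral_eq_integral eq)
qed

text \<open>The candidate \<open>dns\<close> is \<open>phi\<close> when (0, 1) belongs to
  \<open>B\<close> and the constant 1 for the origin alone; the last assumption says that
  \<open>phi\<close> averages to \<open>dns\<close> over the environment outside
  \<open>B\<close>.\<close>

lemma marginal_density_near:
  assumes lim: "limiting_invariant_measure P Q" and err: "0 \<le> err" "err \<le> 1 / 4"
    and B: "B \<subseteq> {(0, 0), (0, 1)}"
    and dns: "dns \<in> borel_measurable (\<Pi>\<^sub>M x\<in>B. P_space)" "AE \<omega> in P. \<bar>dns (restrict \<omega> B) - 1\<bar> \<le> 1 / 4"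
    and eq: "\<And>A c. A \<in> sets Omega \<Longrightarrow> \<bar>c\<bar> \<le> 1 / 4 \<Longrightarrow>
      (\<And>\<omega> \<omega>'. \<omega> \<in> environments \<Longrightarrow> \<omega>' \<in> environments \<Longrightarrow> restrict \<omega> B = restrict \<omega>' B \<Longrightarrow> \<omega> \<in> A \<longleftrightarrow> \<omega>' \<in> A) \<Longrightarrow>
      (\<integral>\<^sup>+\<omega>. ennreal (phi \<omega> + c) * indicator A \<omega> \<partial>P) = (\<integral>\<^sup>+\<omega>. ennreal (dns (restrict \<omega> B) + c) * indicator A \<omega> \<partial>P)"
  shows "absolutely_continuous (marginal B P) (marginal B Q)"
    and "AE \<omega> in P. \<bar>marginal_density B P Q \<omega> - dns (restrict \<omega> B)\<bar> \<le> err"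
proof -
  have Q: "prob_space Q" "sets Q = sets Omega"
    using lim by (auto simp: limiting_invariant_measure_def invariant_measure_def)
  interpret Q: prob_space Q by (rule Q)
  have spQ: "space Q = environments" using sets_eq_imp_space_eq[OF Q(2)] by (simp add: space_Omega)
  let ?S = "\<Pi>\<^sub>M x\<in>B. P_space"
  have rP: "(\<lambda>\<omega>. restrict \<omega> B) \<in> P \<rightarrow>\<^sub>M ?S" and rQ: "(\<lambda>\<omega>. restrict \<omega> B) \<in> Q \<rightarrow>\<^sub>M ?S"
    using measurable_restrict_env by (simp_all add: measurable_cong_sets[OF Q(2) refl] measurable_cong_sets[OF sets_P refl])
  have sM: "sets (marginal B P) = sets ?S" "sets (marginal B Q) = sets ?S" by (simp_all add: marginal_def)
  have nn: "(\<integral>\<^sup>+r. k r \<partial>marginal B P) = (\<integral>\<^sup>+\<omega>. k (restrict \<omega> B) \<partial>P)" if "k \<in> borel_measurable ?S" for k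
    unfolding marginal_def by (rule nn_integral_distr[OF rP]) (use that in simp)
  have m: "(\<lambda>r. dns r + c) \<in> borel_measurable ?S" for c using dns(1) by simp
  have both: "(\<integral>\<^sup>+r. ennreal (dns r + - err) * indicator A r \<partial>marginal B P) \<le> emeasure (marginal B Q) A \<and>
      emeasure (marginal B Q) A \<le> (\<integral>\<^sup>+r. ennreal (dns r + err) * indicator A r \<partial>marginal B P)"
    if A: "A \<in> sets ?S" for A
  proof -
    define A' where "A' = (\<lambda>\<omega>. restrict \<omega> B) -` A \<inter> environments"
    have A': "A' \<in> sets Omega"
      using measurable_sets[OF measurable_restrict_env A] by (simp add: A'_def space_Omega)
    have dep: "\<omega> \<in> A' \<longleftrightarrow> \<omega>' \<in> A'" if "\<omega> \<in> environments" "\<omega>' \<in> environments" "restrict \<omega> B = restrict \<omega>' B" for \<omega> \<omega>'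
      using that by (simp add: A'_def)
    have "restrict (proj \<omega>) B = restrict \<omega> B" for \<omega>
      using B by (auto simp: proj_def restrict_def fun_eq_iff simp del: split_paired_All)
    then have inv: "proj \<omega> \<in> A' \<longleftrightarrow> \<omega> \<in> A'" if "\<omega> \<in> environments" for \<omega>
      using that proj_environments[OF that] by (intro dep)
    have q: "emeasure (marginal B Q) A = emeasure Q A'"
      unfolding marginal_def using emeasure_distr[OF rQ A] by (simp add: spQ A'_def)
    have n: "(\<integral>\<^sup>+r. ennreal (dns r + c) * indicator A r \<partial>marginal B P) = (\<integral>\<^sup>+\<omega>. ennreal (phi \<omega> + c) * indicator A' \<omega> \<partial>P)"
      if c: "\<bar>c\<bar> \<le> 1 / 4" for c
    proof -
      have "(\<integral>\<^sup>+r. ennreal (dns r + c) * indicator A r \<partial>marginal B P) = (\<integral>\<^sup>+\<omega>. ennreal (dns (restrict \<omega> B) + c) * indicator A (restrict \<omega> B) \<partial>P)"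
        using m[of c] A by (intro nn) simp
      also have "\<dots> = (\<integral>\<^sup>+\<omega>. ennreal (dns (restrict \<omega> B) + c) * indicator A' \<omega> \<partial>P)"
        by (intro nn_integral_cong) (simp add: space_P A'_def indicator_def)
      also have "\<dots> = (\<integral>\<^sup>+\<omega>. ennreal (phi \<omega> + c) * indicator A' \<omega> \<partial>P)"
        by (rule eq[OF A' c dep, symmetric])
      finally show ?thesis .
    qed
    have c: "\<bar>err\<bar> \<le> 1 / 4" "\<bar>- err\<bar> \<le> 1 / 4" using err by auto
    show ?thesis
      unfolding q n[OF c(1)] n[OF c(2)] by (intro conjI limit_between[OF lim err A' inv])
  qed
  have fM: "finite_measure (marginal B P)" "finite_measure (marginal B Q)"
    unfolding marginal_def by (rule P.finite_measure_distr[OF rP], rule Q.finite_measure_distr[OF rQ])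
  have "AE \<omega> in P. 0 \<le> dns (restrict \<omega> B) + err \<and> dns (restrict \<omega> B) + err \<le> 2"
    using dns(2) by eventually_elim (use err in linarith)
  then have AE2: "AE \<omega> in P. 0 \<le> dns (restrict \<omega> B) + err" "AE \<omega> in P. dns (restrict \<omega> B) + err \<le> 2" by auto
  have p: "{r \<in> space ?S. 0 \<le> dns r + err} \<in> sets ?S" using m[of err] by measurable
  have u0: "AE r in marginal B P. 0 \<le> dns r + err"
    unfolding marginal_def by (subst AE_distr_iff[OF rP p]) (rule AE2)
  have "(\<integral>\<^sup>+r. ennreal (dns r + err) \<partial>marginal B P) = (\<integral>\<^sup>+\<omega>. ennreal (dns (restrict \<omega> B) + err) \<partial>P)"
    using m[of err] by (intro nn) simp
  also have "\<dots> \<le> (\<integral>\<^sup>+\<omega>. ennreal 2 \<partial>P)"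
    by (rule nn_integral_mono_AE) (use AE2(2) in eventually_elim, rule ennreal_leI)
  also have "\<dots> < \<infinity>" by (simp add: P.emeasure_space_1)
  finally have fin: "(\<integral>\<^sup>+r. ennreal (dns r + err) \<partial>marginal B P) \<noteq> \<infinity>" by simp
  have mm: "(\<lambda>r. dns r + c) \<in> borel_measurable (marginal B P)" for c
    using m by (simp add: measurable_cong_sets[OF sM(1) refl])
  have ss: "sets (marginal B Q) = sets (marginal B P)" by (simp add: sM)
  note R = RN_deriv_between[OF fM ss mm[of "- err"] mm[of err] u0 fin]
  show "absolutely_continuous (marginal B P) (marginal B Q)" by (rule R(1)) (use both sM in auto)
  have "AE r in marginal B P. dns r + - err \<le> enn2real (RN_deriv (marginal B P) (marginal B Q) r) \<and>
      enn2real (RN_deriv (marginal B P) (marginal B Q) r) \<le> dns r + err"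
    by (rule R(2)) (use both sM in auto)
  then have "AE r in distr P ?S (\<lambda>\<omega>. restrict \<omega> B). dns r + - err \<le> enn2real (RN_deriv (marginal B P) (marginal B Q) r) \<and>
      enn2real (RN_deriv (marginal B P) (marginal B Q) r) \<le> dns r + err"
    by (simp only: marginal_def[of B P, symmetric])
  from AE_distrD[OF rP this]
  show "AE \<omega> in P. \<bar>marginal_density B P Q \<omega> - dns (restrict \<omega> B)\<bar> \<le> err"
    unfolding marginal_density_def by eventually_elim linarith
qed

lemma phi_restrict: "(0, 1) \<in> B \<Longrightarrow> phi (restrict \<omega> B) = phi \<omega>"
  by (simp add: phi_def)

lemma measurable_phi_marginal:
  assumes "(0, 1) \<in> B"
  shows "phi \<in> borel_measurable (\<Pi>\<^sub>M x\<in>B. P_space)"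
proof -
  have "(\<lambda>p. p e) \<in> borel_measurable P_space" for e
    unfolding P_space_def
    by (intro measurable_restrict_space1 borel_measurable_continuous_onI continuous_on_product_coordinates)
  then have "(\<lambda>r. r (0, 1) e) \<in> borel_measurable (\<Pi>\<^sub>M x\<in>B. P_space)" for e
    by (rule measurable_compose[OF measurable_component_singleton[OF assms]])
  then show ?thesis unfolding phi_def[abs_def] by simp
qed

theorem marginal_expansion:
  assumes lim: "limiting_invariant_measure P Q" and err: "0 \<le> err" "err \<le> 1 / 4"
  shows "B = {(0, 0), (0, 1)} \<or> B = {(0, 1)} \<Longrightarrow> absolutely_continuous (marginal B P) (marginal B Q) \<and>
      (AE \<omega> in P. \<bar>marginal_density B P Q \<omega> - phi \<omega>\<bar> \<le> err)"
    and "absolutely_continuous (marginal {(0, 0)} P) (marginal {(0, 0)} Q) \<and>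
      (AE \<omega> in P. \<bar>marginal_density {(0, 0)} P Q \<omega> - 1\<bar> \<le> err)"
proof -
  assume B: "B = {(0, 0), (0, 1)} \<or> B = {(0, 1)}"
  then have B': "(0, 1) \<in> B" "B \<subseteq> {(0, 0), (0, 1)}" by auto
  have "AE \<omega> in P. \<bar>phi (restrict \<omega> B) - 1\<bar> \<le> 1 / 4"
    unfolding phi_restrict[OF B'(1)] using AE_near by eventually_elim (rule phi_near)
  note R = marginal_density_near[OF lim err B'(2) measurable_phi_marginal[OF B'(1)] this, unfolded phi_restrict[OF B'(1)]]
  show "absolutely_continuous (marginal B P) (marginal B Q) \<and>
      (AE \<omega> in P. \<bar>marginal_density B P Q \<omega> - phi \<omega>\<bar> \<le> err)"
    by (intro conjI R refl)
next
  have "absolutely_continuous (marginal {(0, 0)} P) (marginal {(0, 0)} Q)"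
    "AE \<omega> in P. \<bar>marginal_density {(0, 0)} P Q \<omega> - 1\<bar> \<le> err"
  proof (rule_tac [!] marginal_density_near[OF lim err, where dns = "\<lambda>_. 1"])
    fix A c
    assume A: "A \<in> sets Omega" and c: "\<bar>c\<bar> \<le> 1 / (4 :: real)"
      and dep: "\<And>\<omega> \<omega>'. \<omega> \<in> environments \<Longrightarrow> \<omega>' \<in> environments \<Longrightarrow> restrict \<omega> {(0, 0)} = restrict \<omega>' {(0, 0)} \<Longrightarrow> \<omega> \<in> A \<longleftrightarrow> \<omega>' \<in> A"
    have r: "restrict \<omega> {(0, 0)} = restrict \<omega>' {(0, 0)}" if "\<omega> (0, 0) = \<omega>' (0, 0)" for \<omega> \<omega>' :: env
      using that by (auto simp: restrict_def fun_eq_iff)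
    show "(\<integral>\<^sup>+\<omega>. ennreal (phi \<omega> + c) * indicator A \<omega> \<partial>P) = (\<integral>\<^sup>+\<omega>. ennreal (1 + c) * indicator A \<omega> \<partial>P)"
      by (rule nn_integral_phi_origin[OF A dep[OF _ _ r] c])
    then show "(\<integral>\<^sup>+\<omega>. ennreal (phi \<omega> + c) * indicator A \<omega> \<partial>P) = (\<integral>\<^sup>+\<omega>. ennreal (1 + c) * indicator A \<omega> \<partial>P)" .
  qed auto
  then show "absolutely_continuous (marginal {(0, 0)} P) (marginal {(0, 0)} Q) \<and>
      (AE \<omega> in P. \<bar>marginal_density {(0, 0)} P Q \<omega> - 1\<bar> \<le> err)" by blast
qed

section \<open>The density in terms of the normalised fluctuations\<close>

lemma xi_bar_eq: "xi_bar srw \<epsilon> P \<omega> z e * \<epsilon> = \<omega> z e - pbar e"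
proof -
  have "(LINT \<omega>'|P. xi srw \<epsilon> \<omega>' z e) = (pbar e - srw e) / \<epsilon>"
    unfolding xi_def using rv_integrable[OF rv_coord[of z e]] by (simp add: pbar_eq P.prob_space)
  then show ?thesis unfolding xi_bar_def by (simp only:) (use \<epsilon> in \<open>simp add: xi_def field_simps\<close>)
qed

lemma phi_eq: "phi \<omega> = 1 - 4 / pi * (xi_bar srw \<epsilon> P \<omega> (0, 1) e\<^sub>1 + xi_bar srw \<epsilon> P \<omega> (0, 1) (- e\<^sub>1)) * \<epsilon>
    + (8 / pi - 4) * xi_bar srw \<epsilon> P \<omega> (0, 1) e\<^sub>2 * \<epsilon>"
  unfolding phi_def by (simp add: distrib_right mult.assoc xi_bar_eq)

end

text \<open>A power absorbs the logarithm:
  \<open>ln (1 / \<epsilon>) \<le> \<epsilon> powr (- a) / a\<close>. The 25 is 1 plus the crude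
  bound \<open>ln 25 \<le> 24\<close>.\<close>

lemma square_log_le:
  fixes a \<epsilon> :: real
  assumes a: "0 < a" "a \<le> 1" and \<epsilon>: "0 < \<epsilon>" "\<epsilon> \<le> 1"
  shows "\<epsilon>\<^sup>2 * (1 + ln (25 / \<epsilon>\<^sup>2)) \<le> (25 + 2 / a) * \<epsilon> powr (2 - a)"
proof -
  define t where "t = \<epsilon> powr (- a)"
  have t: "1 \<le> t" using \<epsilon> a powr_mono'[of "- a" 0 \<epsilon>] by (simp add: t_def)
  have "ln (1 / \<epsilon>) \<le> (1 / \<epsilon>) powr a / a" using \<epsilon> a by (intro ln_powr_bound) auto
  also have "(1 / \<epsilon>) powr a = t" using \<epsilon> by (simp add: t_def powr_divide powr_minus_divide)
  finally have l: "ln (1 / \<epsilon>) \<le> t / a" .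
  have "ln (25 :: real) \<le> 24" using ln_le_minus_one[of "25 :: real"] by simp
  moreover have "ln (25 / \<epsilon>\<^sup>2) = ln 25 + 2 * ln (1 / \<epsilon>)"
    using \<epsilon> by (simp add: ln_div ln_realpow)
  ultimately have "1 + ln (25 / \<epsilon>\<^sup>2) \<le> 25 * t + 2 * (t / a)" using l t by linarith
  also have "\<dots> = (25 + 2 / a) * t" by (simp add: algebra_simps)
  finally have "\<epsilon>\<^sup>2 * (1 + ln (25 / \<epsilon>\<^sup>2)) \<le> \<epsilon>\<^sup>2 * ((25 + 2 / a) * t)" by (rule mult_left_mono) simp
  also have "\<dots> = (25 + 2 / a) * (\<epsilon> powr 2 * \<epsilon> powr (- a))" using \<epsilon> by (simp add: t_def powr_numeral)
  also have "\<epsilon> powr 2 * \<epsilon> powr (- a) = \<epsilon> powr (2 - a)" unfolding powr_add[symmetric] by simp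
  finally show ?thesis .
qed

theorem corollary3:
  fixes \<eta> :: real and z\<^sub>0 z\<^sub>1 :: site
  assumes "\<eta> > 0" and "z\<^sub>0 = (0, 0)" and "z\<^sub>1 = (0, 1)"
  shows "\<exists>\<epsilon>\<^sub>0 > 0. \<exists>c\<^sub>2 :: real. \<forall>\<epsilon> P Q.
    0 < \<epsilon> \<and> \<epsilon> \<le> \<epsilon>\<^sub>0 \<and> iid_law P \<and> LD srw \<epsilon> P \<and> limiting_invariant_measure P Q \<longrightarrow>
      (\<forall>B \<in> {{z\<^sub>0, z\<^sub>1}, {z\<^sub>0}, {z\<^sub>1}}. absolutely_continuous (marginal B P) (marginal B Q)) \<and>
      (AE \<omega> in P. \<bar>marginal_density {z\<^sub>0, z\<^sub>1} P Q \<omega> -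
         (1 - 4 / pi * (xi_bar srw \<epsilon> P \<omega> z\<^sub>1 e\<^sub>1 + xi_bar srw \<epsilon> P \<omega> z\<^sub>1 (- e\<^sub>1)) * \<epsilon>
            + (8 / pi - 4) * xi_bar srw \<epsilon> P \<omega> z\<^sub>1 e\<^sub>2 * \<epsilon>)\<bar> \<le> c\<^sub>2 * \<epsilon> powr (2 - \<eta>)) \<and>
      (AE \<omega> in P. \<bar>marginal_density {z\<^sub>0} P Q \<omega> - 1\<bar> \<le> c\<^sub>2 * \<epsilon> powr (2 - \<eta>)) \<and>
      (AE \<omega> in P. \<bar>marginal_density {z\<^sub>1} P Q \<omega> -
         (1 - 4 / pi * (xi_bar srw \<epsilon> P \<omega> z\<^sub>1 e\<^sub>1 + xi_bar srw \<epsilon> P \<omega> z\<^sub>1 (- e\<^sub>1)) * \<epsilon>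
            + (8 / pi - 4) * xi_bar srw \<epsilon> P \<omega> z\<^sub>1 e\<^sub>2 * \<epsilon>)\<bar> \<le> c\<^sub>2 * \<epsilon> powr (2 - \<eta>))"
proof -
  \<comment> \<open>Capping the exponent at 1 ensures
    \<open>\<epsilon> powr (2 - a) \<le> \<epsilon>\<close>, so the error is small with \<epsilon>
    even if \<open>\<eta>\<close> exceeds 1.\<close>
  define a where "a = min \<eta> 1"
  have a: "0 < a" "a \<le> 1" "a \<le> \<eta>" using assms(1) by (auto simp: a_def)
  define C where "C = 10 ^ 9 * (25 + 2 / a)"
  have C: "1 \<le> C" using a by (simp add: C_def)
  \<comment> \<open>1/1000 is the range of all estimates; the second term makes
    \<open>err \<le> 1 / 4\<close>, as the sandwich between two densities requires.\<close>
  define \<epsilon>\<^sub>0 where "\<epsilon>\<^sub>0 = min (1 / 1000) (1 / (4 * C))"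
  show ?thesis
  proof (rule exI[of _ \<epsilon>\<^sub>0], rule conjI, goal_cases)
    case 1
    show ?case using C by (simp add: \<epsilon>\<^sub>0_def)
  next
    case 2
    show ?case
    proof (rule exI[of _ C], intro allI impI conjI)
    fix \<epsilon> P Q
    assume H: "0 < \<epsilon> \<and> \<epsilon> \<le> \<epsilon>\<^sub>0 \<and> iid_law P \<and> LD srw \<epsilon> P \<and> limiting_invariant_measure P Q"
    then have eps: "0 < \<epsilon>" "\<epsilon> \<le> 1 / 1000" "\<epsilon> \<le> 1 / (4 * C)" and lim: "limiting_invariant_measure P Q"
      by (auto simp: \<epsilon>\<^sub>0_def)
    interpret low_disorder P \<epsilon> "1 - \<epsilon>\<^sup>2 / 4"
      by unfold_locales (use H eps in auto)
    have "err \<le> C * \<epsilon> powr (2 - a)"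
      unfolding err_def C_def mult.assoc
      by (rule mult_left_mono[OF square_log_le[OF a(1,2)]]) (use eps in auto)
    also have b: "C * \<epsilon> powr (2 - a) \<le> C * \<epsilon> powr (2 - \<eta>)" "C * \<epsilon> powr (2 - a) \<le> C * \<epsilon> powr 1"
      using C a eps by (intro mult_left_mono powr_mono'; simp)+
    note b(1)
    finally have le: "err \<le> C * \<epsilon> powr (2 - \<eta>)" .
    have "C * \<epsilon> \<le> C * (1 / (4 * C))" using C eps(3) by (intro mult_left_mono) auto
    moreover have "C * (1 / (4 * C)) = 1 / 4" "C * \<epsilon> powr 1 = C * \<epsilon>" using C eps(1) by simp_all
    ultimately have small: "err \<le> 1 / 4" using \<open>err \<le> C * \<epsilon> powr (2 - a)\<close> b(2) by linarith
    have "\<epsilon>\<^sup>2 \<le> 1" using \<epsilon>2(3) by linarith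
    then have "0 \<le> ln (25 / \<epsilon>\<^sup>2)" using eps by (intro ln_ge_zero) (simp add: pos_le_divide_eq)
    then have nonneg: "0 \<le> err" by (simp add: err_def)
    note R = marginal_expansion[OF lim nonneg small]
    have sub: "AE \<omega> in P. h \<omega> \<le> C * \<epsilon> powr (2 - \<eta>)" if "AE \<omega> in P. h \<omega> \<le> err" for h
      using that by eventually_elim (use le in linarith)
    show "\<forall>B \<in> {{z\<^sub>0, z\<^sub>1}, {z\<^sub>0}, {z\<^sub>1}}. absolutely_continuous (marginal B P) (marginal B Q)"
      using R(1)[of "{(0, 0), (0, 1)}"] R(1)[of "{(0, 1)}"] R(2) unfolding assms(2,3) by blast
    show "AE \<omega> in P. \<bar>marginal_density {z\<^sub>0, z\<^sub>1} P Q \<omega> -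
         (1 - 4 / pi * (xi_bar srw \<epsilon> P \<omega> z\<^sub>1 e\<^sub>1 + xi_bar srw \<epsilon> P \<omega> z\<^sub>1 (- e\<^sub>1)) * \<epsilon>
            + (8 / pi - 4) * xi_bar srw \<epsilon> P \<omega> z\<^sub>1 e\<^sub>2 * \<epsilon>)\<bar> \<le> C * \<epsilon> powr (2 - \<eta>)"
      unfolding assms(2,3) phi_eq[symmetric] by (rule sub) (use R(1) in blast)
    show "AE \<omega> in P. \<bar>marginal_density {z\<^sub>0} P Q \<omega> - 1\<bar> \<le> C * \<epsilon> powr (2 - \<eta>)"
      unfolding assms(2,3) by (rule sub) (use R(2) in blast)
    show "AE \<omega> in P. \<bar>marginal_density {z\<^sub>1} P Q \<omega> -
         (1 - 4 / pi * (xi_bar srw \<epsilon> P \<omega> z\<^sub>1 e\<^sub>1 + xi_bar srw \<epsilon> P \<omega> z\<^sub>1 (- e\<^sub>1)) * \<epsilon>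
            + (8 / pi - 4) * xi_bar srw \<epsilon> P \<omega> z\<^sub>1 e\<^sub>2 * \<epsilon>)\<bar> \<le> C * \<epsilon> powr (2 - \<eta>)"
      unfolding assms(2,3) phi_eq[symmetric] by (rule sub) (use R(1) in blast)
    qed
  qed
qed

end
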